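(* Let $X\subset\mathcal A^{\mathbb N}$ be a subshift satisfying weak specification, set $K=R(X)$, and let $\gamma=\dim_{\mathrm H}K$. Then $$\dim_{\mathrm H}K=\dim_{\mathrm B}K\quad\Longleftrightarrow\quad 0<\mathcal H^\gamma(K)<\infty,$$ $$\dim_{\mathrm H}K<\dim_{\mathrm B}K\quad\Longleftrightarrow\quad \mathcal H^\gamma(K)=\infty.$$ In the second case (that is, when $\dim_{\mathrm H}K<\dim_{\mathrm B}K$), $\mathcal H^\gamma$ is not $\sigma$-finite on $K$.
   Context: Let $\Lambda=\operatorname{diag}(m_1,\ldots,m_d)$ with integers $m_1\ge\cdots\ge m_d\ge2$ taking at least two distinct values, and let $\mathcal A=\prod_{r=1}^d\{0,1,\ldots,m_r-1\}\subset\mathbb Z^d$. Here $\mathbb N=\{1,2,\ldots\}$. A subshift $X\subset\mathcal A^{\mathbb N}$ is a nonempty closed set (product topology) with $\sigma(X)\subseteq X$, where $\sigma(x_1x_2x_3\cdots)=x_2x_3\cdots$. $\mathcal L(X)$ is the set of finite words occurring in sequences of $X$, together with the empty word; $|W|$ is the length of a word $W$, and $IJ$ denotes concatenation. $X$ has weak specification if there is an integer $p\ge0$ such that for every $I,J\in\mathcal L(X)$ there is $W\in\mathcal L(X)$ with $|W|\le p$ and $IWJ\in\mathcal L(X)$. The coding map is $R(x)=\sum_{k=1}^\infty\Lambda^{-k}x_k\in[0,1]^d$ for $x=(x_k)_{k\ge1}$, $x_k\in\mathcal A$. $\mathcal H^t$ is $t$-dimensional Hausdorff measure, $\dim_{\mathrm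 H}$ Hausdorff dimension, $\dim_{\mathrm B}$ box dimension (the common value of lower and upper box dimensions; it is known to exist for $K=R(X)$ when $X$ has weak specification). "$\mathcal H^\gamma$ is not $\sigma$-finite on $K$" means that $K$ is not a countable union of $\mathcal H^\gamma$-measurable sets of finite $\mathcal H^\gamma$-measure. *)

theory Defs
  imports "HOL-Analysis.Analysis"
begin

section \<open>Subshifts\<close>

text \<open>Sequences are indexed from 0, so \<^term>\<open>x k\<close> stands for the symbol $x_{k+1}$.\<close>

definition digits :: "('n::finite \<Rightarrow> int) \<Rightarrow> (int ^ 'n) set" where
  "digits m = {a. \<forall>r. a $ r \<in> {0..m r - 1}}"

definition shift :: "(nat \<Rightarrow> 'a) \<Rightarrow> nat \<Rightarrow> 'a" where
  "shift x = (\<lambda>k. x (Suc k))"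

definition subshift :: "'a set \<Rightarrow> (nat \<Rightarrow> 'a) set \<Rightarrow> bool" where
  "subshift A X \<longleftrightarrow>
     X \<noteq> {} \<and>
     closedin (product_topology (\<lambda>_. discrete_topology A) (UNIV :: nat set)) X \<and>
     shift ` X \<subseteq> X"

definition language :: "(nat \<Rightarrow> 'a) set \<Rightarrow> 'a list set" where
  "language X = insert [] {map x [i..<j] | x i j. x \<in> X}"

definition weak_specification :: "(nat \<Rightarrow> 'a) set \<Rightarrow> bool" where
  "weak_specification X \<longleftrightarrow>
     (\<exists>p::nat. \<forall>I \<in> language X. \<forall>J \<in> language X.
        \<exists>W \<in> language X. length W \<le> p \<and> I @ W @ J \<in> language X)"


section \<open>The coding map\<close>

definition Lambda :: "('n::finite \<Rightarrow> int) \<Rightarrow> real ^ 'n ^ 'n" where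
  "Lambda m = (\<chi> i j. if i = j then of_int (m i) else 0)"

text \<open>The $k$-th term is $\Lambda^{-(k+1)}$ applied to the symbol $x_{k+1}$; the negative power is
  the iterate of multiplication by $\Lambda^{-1}$ (the library has no power operation for the
  matrix product).\<close>

definition coding_map :: "('n::finite \<Rightarrow> int) \<Rightarrow> (nat \<Rightarrow> int ^ 'n) \<Rightarrow> real ^ 'n" where
  "coding_map m x =
     (\<Sum>k. ((\<lambda>v. matrix_inv (Lambda m) *v v) ^^ Suc k) (\<chi> r. of_int (x k $ r)))"


section \<open>Hausdorff measure and Hausdorff dimension\<close>

text \<open>$|U|^t$ with $|\emptyset|^t = 0$ and $0^0 = 1$, so that the 0-dimensional measure is counting
  measure; note that \<^term>\<open>0 powr 0 = (0::real)\<close>.\<close>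

definition diam_pow :: "real \<Rightarrow> 'a::metric_space set \<Rightarrow> ennreal" where
  "diam_pow t U =
     (if U = {} then 0 else if t = 0 then 1 else ennreal (diameter U powr t))"

text \<open>Boundedness is required explicitly because \<^const>\<open>diameter\<close> is a real number and carries no
  information for unbounded sets. Countable covers are sequences; the empty set may be repeated.\<close>

definition hausdorff_premeasure :: "real \<Rightarrow> real \<Rightarrow> 'a::metric_space set \<Rightarrow> ennreal" where
  "hausdorff_premeasure \<delta> t E =
     Inf {(\<Sum>i. diam_pow t (U i)) | U :: nat \<Rightarrow> 'a set.
            (\<forall>i. bounded (U i) \<and> diameter (U i) \<le> \<delta>) \<and> E \<subseteq> (\<Union>i. U i)}"

definition hausdorff_measure :: "real \<Rightarrow> 'a::metric_space set \<Rightarrow> ennreal" where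
  "hausdorff_measure t E = (SUP \<delta>\<in>{0<..}. hausdorff_premeasure \<delta> t E)"

text \<open>In a Euclidean space the set below is nonempty: it contains every $t$ above the dimension of
  the space.\<close>

definition hausdorff_dim :: "'a::euclidean_space set \<Rightarrow> real" where
  "hausdorff_dim E = Inf {t. 0 \<le> t \<and> hausdorff_measure t E = 0}"

text \<open>Measurability is in the sense of Caratheodory, for the outer measure
  \<^term>\<open>hausdorff_measure t\<close> on all subsets of the space.\<close>

definition hausdorff_sigma_finite_on :: "real \<Rightarrow> 'a::metric_space set \<Rightarrow> bool" where
  "hausdorff_sigma_finite_on t E \<longleftrightarrow>
     (\<exists>S :: nat \<Rightarrow> 'a set.
        (\<forall>i. S i \<in> lambda_system UNIV UNIV (hausdorff_measure t) \<and> hausdorff_measure t (S i) < \<infinity>) \<and>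
        E = (\<Union>i. S i))"


section \<open>Box dimension\<close>

definition covering_number :: "real \<Rightarrow> 'a::metric_space set \<Rightarrow> nat" where
  "covering_number \<delta> E =
     (LEAST n. \<exists>C. finite C \<and> card C = n \<and>
        (\<forall>U\<in>C. bounded U \<and> diameter U \<le> \<delta>) \<and> E \<subseteq> \<Union>C)"

definition lower_box_dim :: "'a::metric_space set \<Rightarrow> ereal" where
  "lower_box_dim E =
     Liminf (at_right 0) (\<lambda>\<delta>. ereal (ln (real (covering_number \<delta> E)) / - ln \<delta>))"

definition upper_box_dim :: "'a::metric_space set \<Rightarrow> ereal" where
  "upper_box_dim E =
     Limsup (at_right 0) (\<lambda>\<delta>. ereal (ln (real (covering_number \<delta> E)) / - ln \<delta>))"

text \<open>The common value of the two; meaningful only for nonempty sets for which they agree and are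
  finite.\<close>

definition box_dim :: "'a::metric_space set \<Rightarrow> real" where
  "box_dim E = (THE s. lower_box_dim E = ereal s \<and> upper_box_dim E = ereal s)"

end

theory Submission
  imports Defs "HOL-Probability.Probability" "HOL-Real_Asymp.Real_Asymp"
begin

text \<open>Let $N_0 > \dots > N_{s-1}$ be the distinct values of $m$, $\lambda_j = \log N_{s-1} / \log N_j$ and
  $w_j = \lambda_j - \lambda_{j-1}$. For a weight vector $v$, let $P(v)$ be the growth rate of the maximum of
  $\sum_j v_j H_j$ over distributions on words, where $H_j$ is the entropy of the projection to the coordinates with
  $m_r \le N_j$. Then $\dim_{\mathrm H} K \le P(w) / \log N_{s-1}$, whereas the box dimension is
  $\sum_j w_j P(e_j) / \log N_{s-1}$ for the unit vectors $e_j$, and the Hausdorff measure in the latter dimension is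
  finite. Choose entropy rates $h_j$ that are attained simultaneously with $\sum_j w_j h_j = P(w)$, and consider the
  perturbed weights $\lambda_j^\alpha - \lambda_{j-1}^\alpha$ for $s$ exponents $\alpha \in (2/3, 1]$.

  If the pressure of each of them equals $\sum_j (\lambda_j^\alpha - \lambda_{j-1}^\alpha) h_j$, then $P$ is linear on the open cone
  that they span. This rigidity forces uniform bounds for the numbers of words with a given projection; hence both
  dimensions agree and the Hausdorff measure is positive.

  Otherwise some $\alpha < 1$ admits a strict gain. Concatenate independent random words in slots ending at about
  $k^{1/\alpha}$, each with entropies exceeding the rates $h_j$ by the gain. At scale $T$ the gains add up to a multiple of
  $T^\alpha$, which outweighs both the fluctuations and the loss from connecting words. Thus approximate cubes of
  scale $T$ have outer probability at most $e^{-T^\alpha}$ times the power of their diameter, and almost no sequence is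
  coded into a countable union of sets of finite measure.\<close>

text \<open>Where some \<alpha> gains, nothing is won in the exponent: the dimension stays
  \<open>P(w) / log N\<close>, and only a factor subexponential in the scale can be gained. Each
  connecting word has an unknown length and costs a bounded amount of entropy, so every slot must
  win more than it loses. This is possible at a weight \<open>v\<close> where the rates
  \<open>h_j\<close> fall short of \<open>P(v)\<close>: one word of a long but fixed length, drawn
  from a near-maximiser for \<open>v\<close> and placed once in every slot, changes the entropies by
  constants \<open>e_j\<close> for which the sum of \<open>v_j e_j\<close> is as large as desired.
  Single \<open>e_j\<close> may be negative, so the numbers of slots seen at the different levels
  have to be proportional to \<open>v\<close>. Slots of constant length would give
  \<open>v = w\<close>, where the rates already attain the pressure; growing slots move the
  proportions away from \<open>w\<close>. If no exponent gains, each level is tested by scaling the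
  weights below it against its own weight. This needs linearity of \<open>P\<close> in an open set
  of directions, hence as many independent weights as there are levels.\<close>

section \<open>Entropy of finitely supported distributions\<close>

definition ent :: "'a pmf \<Rightarrow> real" where
  "ent p = (\<integral>x. - ln (pmf p x) \<partial>measure_pmf p)"

lemma ent_nonneg: "0 \<le> ent p"
  unfolding ent_def
  by (intro integral_nonneg_AE) (simp add: AE_measure_pmf_iff pmf_le_1 pmf_positive ln_le_zero_iff)

lemma integral_pmf_mono:
  fixes f g :: "'a \<Rightarrow> real"
  assumes "finite (set_pmf p)" "\<And>x. x \<in> set_pmf p \<Longrightarrow> f x \<le> g x"
  shows "(\<integral>x. f x \<partial>measure_pmf p) \<le> (\<integral>x. g x \<partial>measure_pmf p)"
  using assms by (intro integral_mono_AE integrable_measure_pmf_finite) (auto simp: AE_measure_pmf_iff)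

lemma integral_pmf_sum:
  fixes f :: "'a \<Rightarrow> real"
  assumes "finite S" "set_pmf p \<subseteq> S"
  shows "(\<integral>x. f x \<partial>measure_pmf p) = (\<Sum>x\<in>S. pmf p x * f x)"
  using integral_measure_pmf[of S p f] assms by auto

text \<open>From \<open>ln x \<le> x - 1\<close>. The comparison weight \<open>g\<close> is not
  normalised, so the logarithm of its total mass appears; this form yields entropy bounds as well as
  the variational formula for pressures.\<close>

lemma gibbs_ineq:
  assumes S: "finite S" "set_pmf p \<subseteq> S"
    and g: "\<And>x. x \<in> S \<Longrightarrow> 0 \<le> g x" "\<And>x. x \<in> set_pmf p \<Longrightarrow> 0 < g x"
  shows "ent p \<le> (\<integral>x. - ln (g x) \<partial>measure_pmf p) + ln (\<Sum>x\<in>S. g x)"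
proof -
  define G where "G = (\<Sum>x\<in>S. g x)"
  have fp: "finite (set_pmf p)" using S finite_subset by blast
  obtain x0 where "x0 \<in> set_pmf p" using set_pmf_not_empty by fast
  then have "0 < g x0" "g x0 \<le> G" using g S unfolding G_def by (auto intro!: member_le_sum)
  then have G: "G > 0" by linarith
  note I = integrable_measure_pmf_finite[OF fp]
  have "ent p - (\<integral>x. - ln (g x) \<partial>measure_pmf p) - ln G = (\<integral>x. - ln (pmf p x) + ln (g x) - ln G \<partial>measure_pmf p)"
    unfolding ent_def by (simp add: I)
  also have "\<dots> \<le> (\<integral>x. g x / (pmf p x * G) - 1 \<partial>measure_pmf p)"
  proof (rule integral_pmf_mono[OF fp])
    fix x assume x: "x \<in> set_pmf p"
    then have pos: "0 < pmf p x" "0 < g x" using g by (auto simp: pmf_positive)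
    have "- ln (pmf p x) + ln (g x) - ln G = ln (g x / (pmf p x * G))"
      using pos G by (simp add: ln_div ln_mult)
    also have "\<dots> \<le> g x / (pmf p x * G) - 1"
      using pos G by (intro ln_le_minus_one) simp
    finally show "- ln (pmf p x) + ln (g x) - ln G \<le> g x / (pmf p x * G) - 1" .
  qed
  also have "\<dots> = (\<Sum>x\<in>set_pmf p. pmf p x * (g x / (pmf p x * G))) - 1"
    by (subst Bochner_Integration.integral_diff)
       (simp_all only: I integral_pmf_sum[OF fp order_refl] sum_pmf_eq_1[OF fp order_refl] mult_1_right)
  also have "(\<Sum>x\<in>set_pmf p. pmf p x * (g x / (pmf p x * G))) = (\<Sum>x\<in>set_pmf p. g x) / G"
    unfolding sum_divide_distrib by (intro sum.cong) (auto simp: set_pmf_iff)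
  also have "\<dots> \<le> 1"
    using G S g(1) sum_mono2[of S "set_pmf p" g] unfolding G_def by auto
  finally show ?thesis unfolding G_def by simp
qed

lemma ent_le_ln_card:
  assumes "finite S" "set_pmf p \<subseteq> S"
  shows "ent p \<le> ln (real (card S))"
  using gibbs_ineq[of S p "\<lambda>_. 1"] assms by simp

lemma ent_map: "ent (map_pmf f p) = (\<integral>x. - ln (pmf (map_pmf f p) (f x)) \<partial>measure_pmf p)"
  unfolding ent_def by simp

lemma pmf_le_pmf_map: "pmf p x \<le> pmf (map_pmf f p) (f x)"
  unfolding pmf_map by (simp add: measure_pmf.finite_measure_mono flip: measure_pmf_single)

lemma ent_map_le:
  assumes "finite (set_pmf p)"
  shows "ent (map_pmf f p) \<le> ent p"
  unfolding ent_map unfolding ent_def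
  by (intro integral_pmf_mono assms) (simp add: pmf_le_pmf_map pmf_positive less_le_trans[OF pmf_positive])

lemma ent_map_mono:
  assumes "finite (set_pmf p)" "\<And>x. x \<in> set_pmf p \<Longrightarrow> f x = h (g x)"
  shows "ent (map_pmf f p) \<le> ent (map_pmf g p)"
proof -
  have "map_pmf f p = map_pmf h (map_pmf g p)"
    unfolding map_pmf_comp using assms by (intro map_pmf_cong) auto
  then show ?thesis using ent_map_le[of "map_pmf g p" h] assms by simp
qed

lemma ent_pair_pmf:
  assumes "finite (set_pmf p)" "finite (set_pmf q)"
  shows "ent (pair_pmf p q) = ent p + ent q"
proof -
  note I = integrable_measure_pmf_finite[of "pair_pmf p q"]
  have "ent (pair_pmf p q) = (\<integral>x. - ln (pmf p (fst x)) + - ln (pmf q (snd x)) \<partial>measure_pmf (pair_pmf p q))"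
    unfolding ent_def
    by (intro integral_cong_AE) (auto simp: AE_measure_pmf_iff pmf_pair ln_mult pmf_positive set_pmf_iff)
  also have "\<dots> = (\<integral>x. - ln (pmf p (fst x)) \<partial>measure_pmf (pair_pmf p q)) + (\<integral>x. - ln (pmf q (snd x)) \<partial>measure_pmf (pair_pmf p q))"
    using assms by (intro Bochner_Integration.integral_add I) auto
  also have "\<dots> = ent p + ent q"
    unfolding ent_def using assms
    by (simp add: expectation_pair_pmf_fst[where f="\<lambda>x. - ln (pmf p x)", simplified] expectation_pair_pmf_snd[where f="\<lambda>x. - ln (pmf q x)", simplified])
  finally show ?thesis .
qed

text \<open>Gibbs' inequality against the product of the marginals, which has total mass 1.\<close>

lemma ent_Pair_le:
  assumes fin: "finite (set_pmf p)"
  shows "ent (map_pmf (\<lambda>x. (f x, g x)) p) \<le> ent (map_pmf f p) + ent (map_pmf g p)"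
proof -
  let ?q = "map_pmf (\<lambda>x. (f x, g x)) p"
  let ?h = "\<lambda>y. pmf (map_pmf f p) (fst y) * pmf (map_pmf g p) (snd y)"
  let ?S = "set_pmf (map_pmf f p) \<times> set_pmf (map_pmf g p)"
  note I = integrable_measure_pmf_finite[OF fin]
  have 1: "sum ?h ?S = 1"
  proof -
    have "sum ?h ?S = (\<Sum>x\<in>set_pmf (map_pmf f p). pmf (map_pmf f p) x) * (\<Sum>x\<in>set_pmf (map_pmf g p). pmf (map_pmf g p) x)"
      by (simp add: sum_product sum.cartesian_product case_prod_beta)
    also have "\<dots> = 1" using fin by (simp add: sum_pmf_eq_1)
    finally show ?thesis .
  qed
  have "ent ?q \<le> (\<integral>y. - ln (?h y) \<partial>measure_pmf ?q) + ln (sum ?h ?S)"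
    using fin by (intro gibbs_ineq) (auto simp: pmf_positive_iff intro!: mult_nonneg_nonneg mult_pos_pos)
  also have "\<dots> = (\<integral>x. - ln (?h (f x, g x)) \<partial>measure_pmf p)" unfolding 1 by simp
  also have "\<dots> = (\<integral>x. - ln (pmf (map_pmf f p) (f x)) + - ln (pmf (map_pmf g p) (g x)) \<partial>measure_pmf p)"
  proof (intro integral_cong_AE, simp, simp, unfold AE_measure_pmf_iff, intro ballI)
    fix x assume "x \<in> set_pmf p"
    then show "- ln (?h (f x, g x)) = - ln (pmf (map_pmf f p) (f x)) + - ln (pmf (map_pmf g p) (g x))"
      using ln_mult_pos[of "pmf (map_pmf f p) (f x)" "pmf (map_pmf g p) (g x)"]
      by (simp add: pmf_positive)
  qed
  also have "\<dots> = ent (map_pmf f p) + ent (map_pmf g p)"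
    unfolding ent_map by (intro Bochner_Integration.integral_add I)
  finally show ?thesis .
qed

lemma integral_bind_pmf_finite:
  fixes f :: "'b \<Rightarrow> real"
  assumes "finite (set_pmf p)" "\<And>y. y \<in> set_pmf p \<Longrightarrow> finite (set_pmf (k y))"
  shows "(\<integral>x. f x \<partial>measure_pmf (bind_pmf p k)) = (\<integral>y. (\<integral>x. f x \<partial>measure_pmf (k y)) \<partial>measure_pmf p)"
proof -
  let ?S = "\<Union>y\<in>set_pmf p. set_pmf (k y)"
  have S: "finite ?S" using assms by auto
  have "(\<integral>x. f x \<partial>measure_pmf (bind_pmf p k)) = (\<Sum>x\<in>?S. (\<Sum>y\<in>set_pmf p. pmf p y * pmf (k y) x) * f x)"
    by (subst integral_pmf_sum[OF S]) (auto simp: pmf_bind integral_pmf_sum[OF assms(1) order_refl])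
  also have "\<dots> = (\<Sum>y\<in>set_pmf p. \<Sum>x\<in>?S. pmf p y * pmf (k y) x * f x)"
    unfolding sum_distrib_right by (rule sum.swap)
  also have "\<dots> = (\<Sum>y\<in>set_pmf p. pmf p y * (\<integral>x. f x \<partial>measure_pmf (k y)))"
    by (intro sum.cong refl) (subst integral_pmf_sum[OF S], auto simp: sum_distrib_left mult.assoc)
  also have "\<dots> = (\<integral>y. (\<integral>x. f x \<partial>measure_pmf (k y)) \<partial>measure_pmf p)"
    by (simp add: integral_pmf_sum[OF assms(1) order_refl])
  finally show ?thesis .
qed

lemma pmf_bind_ge:
  assumes "finite (set_pmf p)" "y \<in> set_pmf p"
  shows "pmf p y * pmf (k y) x \<le> pmf (bind_pmf p k) x"
  unfolding pmf_bind using assms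
  by (subst integral_pmf_sum[OF assms(1) order_refl])
     (rule member_le_sum[where f="\<lambda>y. pmf p y * pmf (k y) x"], auto)

text \<open>Concavity of entropy: Gibbs' inequality compares every \<open>k y\<close> with the
  mixture.\<close>

lemma ent_bind_ge:
  assumes fin: "finite (set_pmf p)" "\<And>y. y \<in> set_pmf p \<Longrightarrow> finite (set_pmf (k y))"
  shows "(\<integral>y. ent (k y) \<partial>measure_pmf p) \<le> ent (bind_pmf p k)"
proof -
  let ?b = "bind_pmf p k"
  have fb: "finite (set_pmf ?b)" using fin by auto
  have "(\<integral>y. ent (k y) \<partial>measure_pmf p) \<le> (\<integral>y. (\<integral>x. - ln (pmf ?b x) \<partial>measure_pmf (k y)) \<partial>measure_pmf p)"
  proof (rule integral_pmf_mono[OF fin(1)])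
    fix y assume y: "y \<in> set_pmf p"
    have "ent (k y) \<le> (\<integral>x. - ln (pmf ?b x) \<partial>measure_pmf (k y)) + ln (\<Sum>x\<in>set_pmf ?b. pmf ?b x)"
      using y fb by (intro gibbs_ineq) (auto simp: pmf_positive_iff)
    then show "ent (k y) \<le> (\<integral>x. - ln (pmf ?b x) \<partial>measure_pmf (k y))"
      using fb by (simp add: sum_pmf_eq_1)
  qed
  also have "\<dots> = ent ?b" unfolding ent_def using fin by (subst integral_bind_pmf_finite) auto
  finally show ?thesis .
qed

text \<open>The mixture has mass at least \<open>pmf p y * pmf (k y) x\<close> at \<open>x\<close>,
  so the information of \<open>x\<close> is at most that of \<open>y\<close> plus that of
  \<open>x\<close> under \<open>k y\<close>.\<close>

lemma ent_bind_le:
  assumes fin: "finite (set_pmf p)" "\<And>y. y \<in> set_pmf p \<Longrightarrow> finite (set_pmf (k y))"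
  shows "ent (bind_pmf p k) \<le> ent p + (\<integral>y. ent (k y) \<partial>measure_pmf p)"
proof -
  let ?b = "bind_pmf p k"
  note I = integrable_measure_pmf_finite
  have "ent ?b = (\<integral>y. (\<integral>x. - ln (pmf ?b x) \<partial>measure_pmf (k y)) \<partial>measure_pmf p)"
    unfolding ent_def using fin by (subst integral_bind_pmf_finite) auto
  also have "\<dots> \<le> (\<integral>y. - ln (pmf p y) + ent (k y) \<partial>measure_pmf p)"
  proof (rule integral_pmf_mono[OF fin(1)])
    fix y assume y: "y \<in> set_pmf p"
    have "(\<integral>x. - ln (pmf ?b x) \<partial>measure_pmf (k y)) \<le> (\<integral>x. - ln (pmf p y) + - ln (pmf (k y) x) \<partial>measure_pmf (k y))"
    proof (rule integral_pmf_mono[OF fin(2)[OF y]])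
      fix x assume x: "x \<in> set_pmf (k y)"
      have "0 < pmf p y * pmf (k y) x" using x y by (simp add: pmf_positive)
      then have "ln (pmf p y * pmf (k y) x) \<le> ln (pmf ?b x)"
        using pmf_bind_ge[OF fin(1) y, of k x] by (intro ln_mono) auto
      then show "- ln (pmf ?b x) \<le> - ln (pmf p y) + - ln (pmf (k y) x)"
        using ln_mult_pos[of "pmf p y" "pmf (k y) x"] x y by (simp add: pmf_positive)
    qed
    also have "\<dots> = - ln (pmf p y) + ent (k y)"
      unfolding ent_def using fin(2)[OF y] by (simp add: I)
    finally show "(\<integral>x. - ln (pmf ?b x) \<partial>measure_pmf (k y)) \<le> - ln (pmf p y) + ent (k y)" .
  qed
  also have "\<dots> = ent p + (\<integral>y. ent (k y) \<partial>measure_pmf p)"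
    unfolding ent_def[of p] using fin by (intro Bochner_Integration.integral_add I)
  finally show ?thesis .
qed

text \<open>The chain rule: because \<open>h\<close> recovers \<open>y\<close> from
  \<open>x\<close>, a single summand of the mixture survives at \<open>x\<close>.\<close>

lemma ent_bind_eq:
  assumes fin: "finite (set_pmf p)" "\<And>y. y \<in> set_pmf p \<Longrightarrow> finite (set_pmf (k y))"
    and h: "\<And>x y. y \<in> set_pmf p \<Longrightarrow> x \<in> set_pmf (k y) \<Longrightarrow> h x = y"
  shows "ent (bind_pmf p k) = ent p + (\<integral>y. ent (k y) \<partial>measure_pmf p)"
proof -
  let ?b = "bind_pmf p k"
  note I = integrable_measure_pmf_finite
  have pb: "pmf ?b x = pmf p y * pmf (k y) x" if y: "y \<in> set_pmf p" and x: "x \<in> set_pmf (k y)" for x y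
  proof -
    have "pmf ?b x = (\<Sum>z\<in>set_pmf p. pmf p z * pmf (k z) x)"
      by (simp add: pmf_bind integral_pmf_sum[OF fin(1) order_refl])
    also have "\<dots> = (\<Sum>z\<in>{y}. pmf p z * pmf (k z) x)"
      using y x h fin(1) by (intro sum.mono_neutral_right) (auto simp: pmf_eq_0_set_pmf)
    finally show ?thesis by simp
  qed
  have "ent ?b = (\<integral>y. (\<integral>x. - ln (pmf ?b x) \<partial>measure_pmf (k y)) \<partial>measure_pmf p)"
    unfolding ent_def using fin by (subst integral_bind_pmf_finite) auto
  also have "\<dots> = (\<integral>y. - ln (pmf p y) + ent (k y) \<partial>measure_pmf p)"
  proof (intro integral_cong_AE, simp, simp, unfold AE_measure_pmf_iff, intro ballI)
    fix y assume y: "y \<in> set_pmf p"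
    have "(\<integral>x. - ln (pmf ?b x) \<partial>measure_pmf (k y)) = (\<integral>x. - ln (pmf p y) + - ln (pmf (k y) x) \<partial>measure_pmf (k y))"
      using y by (intro integral_cong_AE) (auto simp: AE_measure_pmf_iff pb ln_mult pmf_positive set_pmf_iff)
    also have "\<dots> = - ln (pmf p y) + ent (k y)"
      unfolding ent_def using fin(2)[OF y] by (simp add: I)
    finally show "(\<integral>x. - ln (pmf ?b x) \<partial>measure_pmf (k y)) = - ln (pmf p y) + ent (k y)" .
  qed
  also have "\<dots> = ent p + (\<integral>y. ent (k y) \<partial>measure_pmf p)"
    unfolding ent_def[of p] using fin by (intro Bochner_Integration.integral_add I)
  finally show ?thesis .
qed

text \<open>Disintegration over the values of \<open>f\<close>; combined with the chain rule it
  produces conditional entropies.\<close>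

lemma bind_cond_fibre:
  "bind_pmf (map_pmf f p) (\<lambda>y. cond_pmf p (f -` {y})) = p"
proof -
  have "bind_pmf (map_pmf f p) (\<lambda>y. cond_pmf p {x. y = f x}) = p"
  proof (rule bind_cond_pmf_cancel)
    fix y assume "y \<in> set_pmf (map_pmf f p)"
    then show "set_pmf p \<inter> {x. y = f x} \<noteq> {}" by auto
  next
    fix x assume "x \<in> set_pmf p"
    then show "set_pmf (map_pmf f p) \<inter> {y. y = f x} \<noteq> {}" by auto
  next
    fix x y assume "y = f x"
    moreover have "f -` {y. y = f x} = {z. f x = f z}" by auto
    ultimately show "measure_pmf.prob p {z. y = f z} = measure_pmf.prob (map_pmf f p) {y. y = f x}"
      by (simp only: measure_map_pmf)
  qed
  moreover have "{x. y = f x} = f -` {y}" for y by auto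
  ultimately show ?thesis by simp
qed

lemma ent_return [simp]: "ent (return_pmf x) = 0"
  by (simp add: ent_def)

section \<open>Entropies and pressures of languages with specification\<close>

text \<open>The maps \<open>pr j\<close> forget more and more of a letter as \<open>j\<close> grows; \<open>s\<close> is the number of levels \<open>j\<close> in use.\<close>

locale spec_lang =
  fixes A :: "'a set" and L :: "'a list set" and p s :: nat and pr :: "nat \<Rightarrow> 'a \<Rightarrow> 'a"
  assumes finite_A: "finite A"
    and L_lists: "L \<subseteq> lists A"
    and Nil_in_L: "[] \<in> L"
    and L_append: "u @ v \<in> L \<Longrightarrow> u \<in> L \<and> v \<in> L"
    and L_ext: "u \<in> L \<Longrightarrow> \<exists>a. u @ [a] \<in> L"
    and L_link: "u \<in> L \<Longrightarrow> v \<in> L \<Longrightarrow> \<exists>z. length z \<le> p \<and> u @ z @ v \<in> L"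
    and p_pos: "0 < p"
    and s_pos: "0 < s"
    and pr_0: "pr 0 a = a"
    and pr_pr: "i \<le> j \<Longrightarrow> pr j (pr i a) = pr j a"
begin

definition words :: "nat \<Rightarrow> 'a list set" where
  "words b = {u \<in> L. length u = b}"

definition prw :: "nat \<Rightarrow> 'a list \<Rightarrow> 'a list" where
  "prw j = map (pr j)"

definition Hl :: "nat \<Rightarrow> 'a list pmf \<Rightarrow> real" where
  "Hl j q = ent (map_pmf (prw j) q)"

definition dists :: "nat \<Rightarrow> 'a list pmf set" where
  "dists b = {q. set_pmf q \<subseteq> words b}"

definition Dw :: "(nat \<Rightarrow> real) \<Rightarrow> 'a list pmf \<Rightarrow> real" where
  "Dw w q = (\<Sum>j<s. w j * Hl j q)"

text \<open>A supremum, so that near-maximisers take the place of a compactness argument on the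
  simplex of distributions.\<close>

definition Zl :: "(nat \<Rightarrow> real) \<Rightarrow> nat \<Rightarrow> real" where
  "Zl w b = Sup (Dw w ` dists b)"

lemma finite_words [simp]: "finite (words b)"
  by (rule finite_subset[OF _ finite_lists_length_eq[OF finite_A, of b]])
     (use L_lists in \<open>auto simp: words_def lists_eq_set\<close>)

lemma L_ext_len: "u \<in> L \<Longrightarrow> \<exists>v. length v = n \<and> u @ v \<in> L"
proof (induction n)
  case (Suc n)
  then obtain v where "length v = n" "u @ v \<in> L" by blast
  moreover obtain a where "(u @ v) @ [a] \<in> L" using L_ext calculation by blast
  ultimately show ?case by (intro exI[of _ "v @ [a]"]) simp
qed simp

lemma words_nonempty [simp]: "words b \<noteq> {}"
  using L_ext_len[OF Nil_in_L, of b] by (auto simp: words_def)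

lemma A_nonempty: "A \<noteq> {}"
  using words_nonempty[of 1] L_lists by (auto simp: words_def lists_eq_set length_Suc_conv)

definition lnA :: real where "lnA = ln (real (card A))"

lemma card_A_pos: "0 < card A"
  using A_nonempty finite_A by (simp add: card_gt_0_iff)

lemma lnA_nonneg: "0 \<le> lnA"
  using card_A_pos unfolding lnA_def by simp

lemma card_words_le: "card (words b) \<le> card A ^ b"
  using card_mono[OF finite_lists_length_eq[OF finite_A, of b], of "words b"] L_lists
  by (auto simp: words_def lists_eq_set card_lists_length_eq[OF finite_A])

lemma take_words: "u \<in> words (a + b) \<Longrightarrow> take a u \<in> words a"
  and drop_words: "u \<in> words (a + b) \<Longrightarrow> drop a u \<in> words b"
  using L_append[of "take a u" "drop a u"] by (auto simp: words_def)

lemma mid_words: "u \<in> L \<Longrightarrow> i + b \<le> length u \<Longrightarrow> take b (drop i u) \<in> words b"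
  using drop_words[of u i "length u - i"] take_words[of "drop i u" b "length u - i - b"]
  by (auto simp: words_def)

lemma distsD: "q \<in> dists b \<Longrightarrow> x \<in> set_pmf q \<Longrightarrow> x \<in> words b"
  by (auto simp: dists_def)

lemma finite_dists: "q \<in> dists b \<Longrightarrow> finite (set_pmf q)"
  using finite_subset[OF _ finite_words] by (auto simp: dists_def)

lemma dists_nonempty: "dists b \<noteq> {}"
proof -
  obtain u where "u \<in> words b" using words_nonempty by blast
  then have "return_pmf u \<in> dists b" by (simp add: dists_def)
  then show ?thesis by blast
qed

lemma Hl_nonneg: "0 \<le> Hl j q"
  by (simp add: Hl_def ent_nonneg)

lemma Hl_le_ln_card: "q \<in> dists b \<Longrightarrow> Hl j q \<le> ln (real (card (prw j ` words b)))"
  unfolding Hl_def by (intro ent_le_ln_card) (auto simp: dists_def)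

lemma ln_card_prw_le: "ln (real (card (prw j ` words b))) \<le> real b * lnA"
proof -
  have "card (prw j ` words b) \<le> card A ^ b"
    using card_image_le[OF finite_words, of "prw j" b] card_words_le[of b] by linarith
  moreover have "0 < card (prw j ` words b)" by (simp add: card_gt_0_iff)
  ultimately have "ln (real (card (prw j ` words b))) \<le> ln (real (card A) ^ b)"
    by (intro ln_mono) (simp_all add: card_A_pos flip: of_nat_power)
  then show ?thesis using card_A_pos by (simp add: ln_realpow lnA_def)
qed

lemma Hl_le: "q \<in> dists b \<Longrightarrow> Hl j q \<le> real b * lnA"
  using Hl_le_ln_card ln_card_prw_le order_trans by blast

lemma Dw_nonneg: "(\<And>j. 0 \<le> w j) \<Longrightarrow> 0 \<le> Dw w q"
  unfolding Dw_def by (intro sum_nonneg mult_nonneg_nonneg Hl_nonneg)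

lemma Dw_le:
  assumes "\<And>j. 0 \<le> w j" "q \<in> dists b"
  shows "Dw w q \<le> (\<Sum>j<s. w j) * (real b * lnA)"
  unfolding Dw_def sum_distrib_right using assms by (intro sum_mono mult_left_mono Hl_le) auto

lemma bdd_Dw: "(\<And>j. 0 \<le> w j) \<Longrightarrow> bdd_above (Dw w ` dists b)"
  using Dw_le[of w _ b] by (intro bdd_aboveI2[where M="(\<Sum>j<s. w j) * (real b * lnA)"]) auto

lemma Dw_le_Zl: "(\<And>j. 0 \<le> w j) \<Longrightarrow> q \<in> dists b \<Longrightarrow> Dw w q \<le> Zl w b"
  unfolding Zl_def by (intro cSup_upper bdd_Dw) auto

lemma Zl_le: "(\<And>q. q \<in> dists b \<Longrightarrow> Dw w q \<le> c) \<Longrightarrow> Zl w b \<le> c"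
  unfolding Zl_def using dists_nonempty by (intro cSup_least) auto

lemma Zl_near_max:
  assumes "\<And>j. 0 \<le> w j" "0 < (e::real)"
  obtains q where "q \<in> dists b" "Zl w b - e < Dw w q"
  using less_cSupD[of "Dw w ` dists b" "Zl w b - e"] assms dists_nonempty[of b]
  unfolding Zl_def by auto

lemma Zl_nonneg: "(\<And>j. 0 \<le> w j) \<Longrightarrow> 0 \<le> Zl w b"
  using dists_nonempty[of b] Dw_nonneg[of w] Dw_le_Zl[of w] by (meson all_not_in_conv order_trans)

lemma Hl_split:
  assumes q: "q \<in> dists (a + b)"
  shows "Hl j q \<le> Hl j (map_pmf (take a) q) + Hl j (map_pmf (drop a) q)"
proof -
  have fin: "finite (set_pmf q)" using q finite_dists by blast
  have "Hl j q \<le> ent (map_pmf (\<lambda>u. (prw j (take a u), prw j (drop a u))) q)"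
    unfolding Hl_def
    by (rule ent_map_mono[OF fin, where h="\<lambda>(x, y). x @ y"]) (auto simp: prw_def map_append[symmetric])
  also have "\<dots> \<le> ent (map_pmf (\<lambda>u. prw j (take a u)) q) + ent (map_pmf (\<lambda>u. prw j (drop a u)) q)"
    by (rule ent_Pair_le[OF fin])
  finally show ?thesis by (simp add: Hl_def map_pmf_comp)
qed

lemma map_take_dists: "q \<in> dists (a + b) \<Longrightarrow> map_pmf (take a) q \<in> dists a"
  and map_drop_dists: "q \<in> dists (a + b) \<Longrightarrow> map_pmf (drop a) q \<in> dists b"
  using take_words drop_words by (auto simp: dists_def)

lemma Zl_subadd:
  assumes w: "\<And>j. 0 \<le> w j"
  shows "Zl w (a + b) \<le> Zl w a + Zl w b"
proof (rule Zl_le)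
  fix q assume q: "q \<in> dists (a + b)"
  have "Dw w q \<le> Dw w (map_pmf (take a) q) + Dw w (map_pmf (drop a) q)"
    unfolding Dw_def sum.distrib[symmetric] distrib_left[symmetric]
    using w Hl_split[OF q] by (intro sum_mono mult_left_mono)
  also have "\<dots> \<le> Zl w a + Zl w b"
    using q w by (intro add_mono Dw_le_Zl map_take_dists map_drop_dists)
  finally show "Dw w q \<le> Zl w a + Zl w b" .
qed

text \<open>The connecting word has a variable length, so a glued word is extended to a fixed total length.\<close>

definition lk :: "'a list \<Rightarrow> 'a list \<Rightarrow> 'a list" where
  "lk u v = (SOME z. length z \<le> p \<and> u @ z @ v \<in> L)"

definition xt :: "nat \<Rightarrow> 'a list \<Rightarrow> 'a list" where
  "xt n u = (SOME v. length v = n \<and> u @ v \<in> L)"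

definition glue :: "'a list \<Rightarrow> 'a list \<Rightarrow> 'a list" where
  "glue u v = u @ lk u v @ v @ xt (p - length (lk u v)) (u @ lk u v @ v)"

lemma lk: "u \<in> L \<Longrightarrow> v \<in> L \<Longrightarrow> length (lk u v) \<le> p \<and> u @ lk u v @ v \<in> L"
  unfolding lk_def by (rule someI_ex) (rule L_link)

lemma xt: "u \<in> L \<Longrightarrow> length (xt n u) = n \<and> u @ xt n u \<in> L"
  unfolding xt_def by (rule someI_ex) (rule L_ext_len)

lemma glue_words: "u \<in> words a \<Longrightarrow> v \<in> words b \<Longrightarrow> glue u v \<in> words (a + b + p)"
  using lk[of u v] xt[of "u @ lk u v @ v" "p - length (lk u v)"]
  by (auto simp: words_def glue_def)

lemma glue_dists:
  assumes "q \<in> dists a" "r \<in> dists b"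
  shows "map_pmf (\<lambda>(u, v). glue u v) (pair_pmf q r) \<in> dists (a + b + p)"
  using assms glue_words by (fastforce simp: dists_def)

text \<open>Once the length of the connecting word is known, both factors can be read off from the
  glued word. That length takes at most \<open>p + 1\<close> values, which is the loss
  \<open>ln (real p + 1)\<close>.\<close>

lemma Hl_glue:
  assumes q: "q \<in> dists a" and r: "r \<in> dists b"
  shows "Hl j q + Hl j r \<le> Hl j (map_pmf (\<lambda>(u, v). glue u v) (pair_pmf q r)) + ln (real p + 1)"
proof -
  let ?P = "pair_pmf q r"
  let ?l = "\<lambda>x. length (lk (fst x) (snd x))"
  let ?g = "\<lambda>x. prw j (glue (fst x) (snd x))"
  have fin: "finite (set_pmf ?P)" using q r by (simp add: finite_dists)
  have "Hl j q + Hl j r = ent (pair_pmf (map_pmf (prw j) q) (map_pmf (prw j) r))"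
    unfolding Hl_def using q r by (subst ent_pair_pmf) (auto simp: finite_dists)
  also have "\<dots> = ent (map_pmf (\<lambda>x. (prw j (fst x), prw j (snd x))) ?P)"
    by (simp add: map_pair[symmetric] case_prod_unfold)
  also have "\<dots> \<le> ent (map_pmf (\<lambda>x. (?l x, ?g x)) ?P)"
  proof (rule ent_map_mono[OF fin, where h="\<lambda>(l, z). (take a z, take b (drop (a + l) z))"])
    fix x assume "x \<in> set_pmf ?P"
    then have "length (fst x) = a" "length (snd x) = b"
      using distsD[OF q] distsD[OF r] by (auto simp: words_def)
    then show "(prw j (fst x), prw j (snd x)) = (case (?l x, ?g x) of (l, z) \<Rightarrow> (take a z, take b (drop (a + l) z)))"
      by (simp add: glue_def prw_def)
  qed
  also have "\<dots> \<le> ent (map_pmf ?l ?P) + ent (map_pmf ?g ?P)"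
    by (rule ent_Pair_le[OF fin])
  also have "ent (map_pmf ?l ?P) \<le> ln (real (card {..p}))"
    using distsD[OF q] distsD[OF r] lk by (intro ent_le_ln_card) (auto simp: words_def)
  also have "ent (map_pmf ?g ?P) = Hl j (map_pmf (\<lambda>(u, v). glue u v) ?P)"
    by (simp add: Hl_def map_pmf_comp case_prod_beta)
  finally show ?thesis by (simp add: add.commute)
qed

section \<open>Almost superadditivity and the pressure\<close>

definition Cw :: "(nat \<Rightarrow> real) \<Rightarrow> real" where
  "Cw w = Zl w p + (\<Sum>j<s. w j) * ln (real p + 1)"

lemma Cw_nonneg: "(\<And>j. 0 \<le> w j) \<Longrightarrow> 0 \<le> Cw w"
  unfolding Cw_def by (intro add_nonneg_nonneg Zl_nonneg mult_nonneg_nonneg sum_nonneg) auto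

text \<open>Near-maximisers for both lengths are glued independently, and the \<open>p\<close>
  surplus letters are split off again by subadditivity. \<open>Cw\<close> adds up these two
  losses.\<close>

lemma Zl_superadd:
  assumes w: "\<And>j. 0 \<le> w j"
  shows "Zl w a + Zl w b \<le> Zl w (a + b) + Cw w"
proof -
  have "Zl w a + Zl w b \<le> Zl w (a + b) + Cw w + e" if e: "0 < e" for e
  proof -
    obtain q where q: "q \<in> dists a" "Zl w a - e/2 < Dw w q"
      using Zl_near_max[where w=w and b=a and e="e/2"] w e by auto
    obtain r where r: "r \<in> dists b" "Zl w b - e/2 < Dw w r"
      using Zl_near_max[where w=w and b=b and e="e/2"] w e by auto
    let ?t = "map_pmf (\<lambda>(u, v). glue u v) (pair_pmf q r)"
    have "Dw w q + Dw w r \<le> Dw w ?t + (\<Sum>j<s. w j) * ln (real p + 1)"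
      unfolding Dw_def sum.distrib[symmetric] distrib_left[symmetric] sum_distrib_right
      using w Hl_glue[OF q(1) r(1)] by (intro sum_mono mult_left_mono)
    moreover have "Dw w ?t \<le> Zl w (a + b + p)"
      using w glue_dists[OF q(1) r(1)] by (intro Dw_le_Zl)
    moreover have "Zl w (a + b + p) \<le> Zl w (a + b) + Zl w p" using w by (rule Zl_subadd)
    ultimately show ?thesis using q(2) r(2) unfolding Cw_def by linarith
  qed
  then show ?thesis by (rule field_le_epsilon)
qed

lemma Zl_mult_le:
  assumes w: "\<And>j. 0 \<le> w j" "0 < n"
  shows "Zl w (n * b) \<le> real n * Zl w b"
  using assms(2)
proof (induction n rule: nat_induct_non_zero)
  case (Suc n)
  then show ?case using Zl_subadd[of w b "n * b"] w by (simp add: algebra_simps)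
qed simp

lemma Zl_mult_ge:
  assumes w: "\<And>j. 0 \<le> w j" "0 < n"
  shows "real n * (Zl w b - Cw w) \<le> Zl w (n * b) - Cw w"
  using assms(2)
proof (induction n rule: nat_induct_non_zero)
  case (Suc n)
  then show ?case using Zl_superadd[of w b "n * b"] w by (simp add: algebra_simps)
qed simp

text \<open>The limit of \<open>Zl w b / b\<close>. Since \<open>Zl w\<close> is subadditive and
  \<open>Zl w - Cw w\<close> superadditive, it is approached at a bounded distance:
  \<open>real b * Pr w \<le> Zl w b \<le> real b * Pr w + Cw w\<close> at every length.\<close>

definition Pr :: "(nat \<Rightarrow> real) \<Rightarrow> real" where
  "Pr w = (SUP b\<in>{0<..}. (Zl w b - Cw w) / real b)"

lemma Zl_le_Pr_aux:
  assumes w: "\<And>j. 0 \<le> w j" and "0 < a" "0 < (b::nat)"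
  shows "(Zl w b - Cw w) / real b \<le> Zl w a / real a"
proof -
  have "real a * (Zl w b - Cw w) \<le> Zl w (a * b) - Cw w" using assms by (intro Zl_mult_ge) auto
  also have "\<dots> \<le> Zl w (b * a)" using Cw_nonneg[of w, OF w] by (simp add: mult.commute)
  also have "\<dots> \<le> real b * Zl w a" using assms by (intro Zl_mult_le) auto
  finally show ?thesis using assms by (simp add: field_simps)
qed

lemma Zl_le_Pr:
  assumes w: "\<And>j. 0 \<le> w j"
  shows "Zl w b \<le> real b * Pr w + Cw w"
proof (cases "b = 0")
  case True
  then show ?thesis using Zl_superadd[where w=w and a=0 and b=0] w by simp
next
  case False
  have "(Zl w b - Cw w) / real b \<le> Pr w"
    unfolding Pr_def using False w
    by (intro cSUP_upper bdd_aboveI2[where M="Zl w 1 / real 1"] Zl_le_Pr_aux) auto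
  then show ?thesis using False by (simp add: field_simps)
qed

lemma Pr_le_Zl:
  assumes w: "\<And>j. 0 \<le> w j"
  shows "real b * Pr w \<le> Zl w b"
proof (cases "b = 0")
  case True
  then show ?thesis using Zl_nonneg w by simp
next
  case False
  have "Pr w \<le> Zl w b / real b"
    unfolding Pr_def using False w by (intro cSUP_least Zl_le_Pr_aux) auto
  then show ?thesis using False by (simp add: field_simps)
qed

lemma Pr_leI:
  assumes w: "\<And>j. 0 \<le> w j" and "\<And>b. 0 < b \<Longrightarrow> Zl w b \<le> real b * x + c"
  shows "Pr w \<le> x"
proof (rule field_le_epsilon)
  fix e :: real assume e: "0 < e"
  obtain b :: nat where b: "\<bar>c\<bar> / e < real b" using reals_Archimedean2 by blast
  then have b0: "0 < b" using e by (cases b) (auto simp: field_simps)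
  have "real b * Pr w \<le> real b * x + \<bar>c\<bar>" using Pr_le_Zl[of w b, OF w] assms(2)[OF b0] by linarith
  also have "\<bar>c\<bar> \<le> real b * e" using b e by (simp add: field_simps)
  finally have "real b * Pr w \<le> real b * (x + e)" by (simp add: algebra_simps)
  then show "Pr w \<le> x + e" using b0 by simp
qed

lemma Pr_geI:
  assumes w: "\<And>j. 0 \<le> w j" and "\<And>b. 0 < b \<Longrightarrow> real b * x - c \<le> Zl w b"
  shows "x \<le> Pr w"
proof (rule field_le_epsilon)
  fix e :: real assume e: "0 < e"
  obtain b :: nat where b: "(\<bar>c\<bar> + Cw w) / e < real b" using reals_Archimedean2 by blast
  have b0: "0 < b"
  proof (rule ccontr)
    assume "\<not> 0 < b"
    then have "(\<bar>c\<bar> + Cw w) / e < 0" using b by simp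
    moreover have "0 \<le> (\<bar>c\<bar> + Cw w) / e" using e Cw_nonneg[of w, OF w] by simp
    ultimately show False by linarith
  qed
  have "real b * x \<le> real b * Pr w + (\<bar>c\<bar> + Cw w)" using Zl_le_Pr[of w b, OF w] assms(2)[OF b0] by linarith
  also have "\<bar>c\<bar> + Cw w \<le> real b * e" using b e by (simp add: field_simps)
  finally have "real b * x \<le> real b * (Pr w + e)" by (simp add: algebra_simps)
  then show "x \<le> Pr w + e" using b0 by simp
qed

lemma Zl_add_le:
  assumes "\<And>j. 0 \<le> w j" "\<And>j. 0 \<le> w' j"
  shows "Zl (\<lambda>j. w j + w' j) b \<le> Zl w b + Zl w' b"
proof (rule Zl_le)
  fix q assume "q \<in> dists b"
  then have "Dw w q \<le> Zl w b" "Dw w' q \<le> Zl w' b" using assms by (auto intro: Dw_le_Zl)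
  then show "Dw (\<lambda>j. w j + w' j) q \<le> Zl w b + Zl w' b"
    by (simp add: Dw_def distrib_right sum.distrib)
qed

lemma Pr_add_le:
  assumes "\<And>j. 0 \<le> w j" "\<And>j. 0 \<le> w' j"
  shows "Pr (\<lambda>j. w j + w' j) \<le> Pr w + Pr w'"
proof (rule Pr_leI)
  show "Zl (\<lambda>j. w j + w' j) b \<le> real b * (Pr w + Pr w') + (Cw w + Cw w')" for b
    using Zl_add_le[of w w' b, OF assms] Zl_le_Pr[of w b] Zl_le_Pr[of w' b] assms by (simp add: algebra_simps)
qed (use assms in simp)

lemma Pr_scale_le:
  assumes "\<And>j. 0 \<le> w j" "0 \<le> c"
  shows "Pr (\<lambda>j. c * w j) \<le> c * Pr w"
proof (rule Pr_leI)
  fix b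
  have "Zl (\<lambda>j. c * w j) b \<le> c * Zl w b"
  proof (rule Zl_le)
    fix q assume "q \<in> dists b"
    then have "c * Dw w q \<le> c * Zl w b" using assms by (auto intro!: Dw_le_Zl mult_left_mono)
    then show "Dw (\<lambda>j. c * w j) q \<le> c * Zl w b" by (simp add: Dw_def sum_distrib_left mult.assoc)
  qed
  also have "\<dots> \<le> c * (real b * Pr w + Cw w)" using assms Zl_le_Pr[of w b] by (intro mult_left_mono) auto
  finally show "Zl (\<lambda>j. c * w j) b \<le> real b * (c * Pr w) + c * Cw w" by (simp add: algebra_simps)
qed (use assms in simp)

lemma Pr_sum_le:
  assumes "finite I" "\<And>i. i \<in> I \<Longrightarrow> 0 \<le> d i" "\<And>i j. i \<in> I \<Longrightarrow> 0 \<le> v i j"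
  shows "Pr (\<lambda>j. \<Sum>i\<in>I. d i * v i j) \<le> (\<Sum>i\<in>I. d i * Pr (v i))"
  using assms
proof (induction I rule: finite_induct)
  case empty
  show ?case by (rule Pr_leI[where c=0]) (auto intro: Zl_le simp: Dw_def)
next
  case (insert x F)
  have "Pr (\<lambda>j. \<Sum>i\<in>insert x F. d i * v i j) = Pr (\<lambda>j. d x * v x j + (\<Sum>i\<in>F. d i * v i j))"
    using insert by simp
  also have "\<dots> \<le> Pr (\<lambda>j. d x * v x j) + Pr (\<lambda>j. \<Sum>i\<in>F. d i * v i j)"
    using insert by (intro Pr_add_le) (auto intro!: sum_nonneg)
  also have "\<dots> \<le> d x * Pr (v x) + (\<Sum>i\<in>F. d i * Pr (v i))"
    using insert by (intro add_mono Pr_scale_le insert.IH) auto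
  finally show ?case using insert by simp
qed

end

section \<open>Entropy rates attained at every length\<close>

lemma convergent_subseq_finite:
  fixes g :: "nat \<Rightarrow> nat \<Rightarrow> real"
  assumes "\<And>j i. j < s \<Longrightarrow> \<bar>g j i\<bar> \<le> C"
  shows "\<exists>r::nat \<Rightarrow> nat. strict_mono r \<and> (\<forall>j<s. convergent (\<lambda>i. g j (r i)))"
  using assms
proof (induction s)
  case 0
  show ?case by (intro exI[of _ id]) (simp add: strict_mono_def)
next
  case (Suc s)
  then obtain r where r: "strict_mono r" "\<And>j. j < s \<Longrightarrow> convergent (\<lambda>i. g j (r i))"
    by (metis less_Suc_eq)
  have "bounded (range (\<lambda>i. g s (r i)))"
    using Suc.prems by (intro boundedI[where B=C]) auto
  then obtain l r' where r': "strict_mono r'" "((\<lambda>i. g s (r i)) \<circ> r') \<longlonglongrightarrow> l"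
    using bounded_imp_convergent_subsequence by blast
  show ?case
  proof (intro exI[of _ "r \<circ> r'"] conjI allI impI)
    show "strict_mono (r \<circ> r')" using r r' by (simp add: strict_mono_o)
    fix j assume "j < Suc s"
    then consider "j < s" | "j = s" by linarith
    then show "convergent (\<lambda>i. g j ((r \<circ> r') i))"
    proof cases
      case 1
      then show ?thesis
        using convergent_subseq_convergent[OF r(2)[OF 1] r'(1)] by (simp add: o_def)
    next
      case 2
      then show ?thesis using r'(2) by (auto simp: o_def convergent_def)
    qed
  qed
qed

context spec_lang
begin

lemma block_marginals:
  assumes "q \<in> dists (m * b)"
  shows "Hl j q \<le> (\<Sum>i<m. Hl j (map_pmf (\<lambda>u. take b (drop (i * b) u)) q))"
  using assms
proof (induction m arbitrary: q)
  case 0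
  then have "set_pmf q \<subseteq> {[]}" by (auto simp: dists_def words_def)
  then have "q = return_pmf []" by (simp add: set_pmf_subset_singleton)
  then show ?case by (simp add: Hl_def)
next
  case (Suc m)
  have q: "q \<in> dists (m * b + b)" using Suc.prems by (simp add: add.commute)
  let ?q1 = "map_pmf (take (m * b)) q"
  have "Hl j q \<le> Hl j ?q1 + Hl j (map_pmf (drop (m * b)) q)" by (rule Hl_split[OF q])
  also have "Hl j ?q1 \<le> (\<Sum>i<m. Hl j (map_pmf (\<lambda>u. take b (drop (i * b) u)) ?q1))"
    by (rule Suc.IH) (rule map_take_dists[OF q])
  also have "\<dots> = (\<Sum>i<m. Hl j (map_pmf (\<lambda>u. take b (drop (i * b) u)) q))"
  proof (intro sum.cong refl)
    fix i assume "i \<in> {..<m}"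
    then have "Suc i * b \<le> m * b" by (intro mult_le_mono) auto
    then have "b \<le> m * b - i * b" by simp
    then have "take b (drop (i * b) (take (m * b) u)) = take b (drop (i * b) u)" for u :: "'a list"
      by (simp add: drop_take min_absorb1)
    then show "Hl j (map_pmf (\<lambda>u. take b (drop (i * b) u)) ?q1) = Hl j (map_pmf (\<lambda>u. take b (drop (i * b) u)) q)"
      by (simp add: map_pmf_comp)
  qed
  also have "map_pmf (drop (m * b)) q = map_pmf (\<lambda>u. take b (drop (m * b) u)) q"
    using distsD[OF q] by (intro map_pmf_cong refl) (auto simp: words_def)
  finally show ?case by simp
qed

text \<open>A block chosen uniformly at random among the \<open>m\<close> blocks has, by concavity,
  at least the average block entropy. One distribution does this for all levels \<open>j\<close> at
  once.\<close>

lemma averaged_marginal: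
  assumes q: "q \<in> dists (m * b)" and m: "0 < m"
  obtains r where "r \<in> dists b" "\<And>j. Hl j q \<le> real m * Hl j r"
proof
  define k where "k i = map_pmf (\<lambda>u. take b (drop (i * b) u)) q" for i
  define r where "r = bind_pmf (pmf_of_set {..<m}) k"
  have k: "k i \<in> dists b" if "i < m" for i
  proof -
    have "Suc i * b \<le> m * b" using that by (intro mult_le_mono) auto
    then have "take b (drop (i * b) u) \<in> words b" if "u \<in> set_pmf q" for u
      using distsD[OF q that] by (intro mid_words) (auto simp: words_def)
    then show ?thesis by (auto simp: k_def dists_def)
  qed
  have S: "set_pmf (pmf_of_set {..<m}) = {..<m}" using m by (intro set_pmf_of_set) auto
  show "r \<in> dists b" using k S by (auto simp: r_def dists_def)
  fix j
  have "Hl j q \<le> (\<Sum>i<m. Hl j (k i))" using block_marginals[OF q] by (simp add: k_def)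
  also have "\<dots> = real m * (\<integral>i. ent (map_pmf (prw j) (k i)) \<partial>measure_pmf (pmf_of_set {..<m}))"
    using m by (subst integral_pmf_of_set) (auto simp: Hl_def)
  also have "\<dots> \<le> real m * Hl j r"
    unfolding Hl_def r_def map_bind_pmf using k finite_dists S
    by (intro mult_left_mono ent_bind_ge) auto
  finally show "Hl j q \<le> real m * Hl j r" .
qed

text \<open>Vectors of entropies per letter that are attained, up to a constant, at every length. They bound the
  pressure from below by a linear functional, and \<open>gain\<close> says that wherever this bound is strict, all entropies can be
  raised by an arbitrarily large amount in the direction of the weight.\<close>

definition base :: "(nat \<Rightarrow> real) \<Rightarrow> bool" where
  "base h \<longleftrightarrow> (\<forall>b. \<exists>q\<in>dists b. \<forall>j<s. real b * h j - 1 \<le> Hl j q)"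

text \<open>The rates are subsequential limits of the entropies per letter of near-maximisers;
  averaging over blocks carries them from long words to words of any given length.\<close>

lemma base_exists:
  assumes w: "\<And>j. 0 \<le> w j"
  obtains h where "base h" "(\<Sum>j<s. w j * h j) = Pr w"
proof -
  \<comment> \<open>Factorials, so that every length \<open>b\<close> eventually divides the length
    of the near-maximiser and blocks of length \<open>b\<close> tile it exactly.\<close>
  have "\<exists>q\<in>dists (fact i). Zl w (fact i) - 1 < Dw w q" for i :: nat
    by (rule Zl_near_max[where w=w and e=1 and b="fact i"]) (use w in auto)
  then obtain q where q: "\<And>i. q i \<in> dists (fact i)" "\<And>i. Zl w (fact i) - 1 < Dw w (q i)"
    by metis
  define g where "g j i = Hl j (q i) / fact i" for j i
  have g: "\<bar>g j i\<bar> \<le> lnA" for j i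
    using Hl_le[OF q(1)[of i], of j] Hl_nonneg[of j "q i"] by (simp add: g_def field_simps)
  obtain r where r: "strict_mono r" "\<And>j. j < s \<Longrightarrow> convergent (\<lambda>i. g j (r i))"
    using convergent_subseq_finite[of s g lnA] g by blast
  define h where "h j = lim (\<lambda>i. g j (r i))" for j
  have lim: "(\<lambda>i. g j (r i)) \<longlonglongrightarrow> h j" if "j < s" for j
    using r(2)[OF that] by (simp add: h_def convergent_LIMSEQ_iff)
  have "base h"
    unfolding base_def
  proof
    fix b
    show "\<exists>q\<in>dists b. \<forall>j<s. real b * h j - 1 \<le> Hl j q"
    proof (cases "b = 0")
      case True
      obtain t where "t \<in> dists b" using dists_nonempty[of b] by blast
      then show ?thesis using True by (intro bexI[of _ t]) (auto intro: order_trans[OF _ Hl_nonneg])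
    next
      case False
      have "\<forall>\<^sub>F i in sequentially. \<forall>j\<in>{..<s}. dist (g j (r i)) (h j) < 1 / real b"
        using lim False by (intro eventually_ball_finite ballI tendstoD) auto
      then have "\<forall>\<^sub>F i in sequentially. b \<le> i \<and> (\<forall>j\<in>{..<s}. dist (g j (r i)) (h j) < 1 / real b)"
        using eventually_ge_at_top by (rule eventually_conj[rotated])
      then have "\<exists>i. b \<le> i \<and> (\<forall>j\<in>{..<s}. dist (g j (r i)) (h j) < 1 / real b)"
        by (rule eventually_happens'[OF sequentially_bot])
      then obtain i where i: "b \<le> i" "\<And>j. j < s \<Longrightarrow> dist (g j (r i)) (h j) < 1 / real b"
        by auto
      have "b \<le> r i" using i(1) seq_suble[OF r(1), of i] by linarith
      then have "b dvd fact (r i)" using False by (intro dvd_fact) auto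
      then obtain m where "fact (r i) = b * m" by (rule dvdE)
      then have m: "fact (r i) = m * b" by (simp add: mult.commute)
      have m0: "0 < m"
      proof (rule ccontr)
        assume "\<not> 0 < m"
        then have "fact (r i) = (0 :: nat)" using m by simp
        then show False by simp
      qed
      have "q (r i) \<in> dists (m * b)" using q(1)[of "r i"] m by simp
      then obtain t where t: "t \<in> dists b" "\<And>j. Hl j (q (r i)) \<le> real m * Hl j t"
        using averaged_marginal m0 by blast
      have "real b * h j - 1 \<le> Hl j t" if j: "j < s" for j
      proof -
        have "real b * h j - 1 \<le> real b * g j (r i)"
          using i(2)[OF j] False by (simp add: dist_real_def abs_less_iff field_simps)
        also have "(fact (r i) :: real) = real m * real b"
          using m by (metis of_nat_fact of_nat_mult)
        then have "real b * g j (r i) = Hl j (q (r i)) / real m"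
          using False by (simp add: g_def)
        also have "\<dots> \<le> Hl j t" using t(2)[of j] m0 by (simp add: field_simps)
        finally show ?thesis .
      qed
      then show ?thesis using t by blast
    qed
  qed
  moreover have "(\<Sum>j<s. w j * h j) = Pr w"
  proof (rule LIMSEQ_unique)
    have "(\<lambda>i. \<Sum>j<s. w j * g j (r i)) \<longlonglongrightarrow> (\<Sum>j<s. w j * h j)"
      using lim by (intro tendsto_intros) auto
    then show "(\<lambda>i. Dw w (q (r i)) / fact (r i)) \<longlonglongrightarrow> (\<Sum>j<s. w j * h j)"
      by (simp add: Dw_def g_def sum_divide_distrib)
    show "(\<lambda>i. Dw w (q (r i)) / fact (r i)) \<longlonglongrightarrow> Pr w"
    proof (rule tendsto_sandwich)
      have "filterlim (\<lambda>i. fact (r i) :: nat) sequentially sequentially"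
        using order_trans[OF seq_suble[OF r(1)] fact_ge_self]
        by (intro filterlim_at_top_mono[OF filterlim_ident] always_eventually allI) blast
      then have "(\<lambda>i. c / real (fact (r i))) \<longlonglongrightarrow> 0" for c
        by (rule filterlim_compose[OF lim_const_over_n])
      then have inv: "(\<lambda>i. Pr w + c / real (fact (r i))) \<longlonglongrightarrow> Pr w + 0" for c
        by (intro tendsto_add tendsto_const)
      show "(\<lambda>i. Pr w + (- 1) / real (fact (r i))) \<longlonglongrightarrow> Pr w" using inv[of "-1"] by simp
      show "(\<lambda>i. Pr w + Cw w / real (fact (r i))) \<longlonglongrightarrow> Pr w" using inv[of "Cw w"] by simp
      show "\<forall>\<^sub>F i in sequentially. Pr w + (- 1) / real (fact (r i)) \<le> Dw w (q (r i)) / fact (r i)"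
      proof (rule always_eventually, rule allI)
        fix i
        have "real (fact (r i)) * Pr w \<le> Dw w (q (r i)) + 1"
          using q(2)[of "r i"] Pr_le_Zl[of w "fact (r i)", OF w] by linarith
        then show "Pr w + (- 1) / real (fact (r i)) \<le> Dw w (q (r i)) / fact (r i)"
          using divide_right_mono[of "fact (r i) * Pr w - 1" "Dw w (q (r i))" "fact (r i)"]
          by (simp add: diff_divide_distrib)
      qed
      show "\<forall>\<^sub>F i in sequentially. Dw w (q (r i)) / fact (r i) \<le> Pr w + Cw w / real (fact (r i))"
      proof (rule always_eventually, rule allI)
        fix i
        have "Dw w (q (r i)) \<le> real (fact (r i)) * Pr w + Cw w"
          using Dw_le_Zl[of w "q (r i)" "fact (r i)", OF w q(1)] Zl_le_Pr[of w "fact (r i)", OF w] by linarith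
        then show "Dw w (q (r i)) / fact (r i) \<le> Pr w + Cw w / real (fact (r i))"
          by (simp add: field_simps)
      qed
    qed
  qed
  ultimately show ?thesis using that by blast
qed

lemma base_lower:
  assumes "base h" "\<And>j. 0 \<le> w j"
  shows "real b * (\<Sum>j<s. w j * h j) - (\<Sum>j<s. w j) \<le> Zl w b"
proof -
  obtain q where q: "q \<in> dists b" "\<And>j. j < s \<Longrightarrow> real b * h j - 1 \<le> Hl j q"
    using assms(1) unfolding base_def by blast
  have "real b * (\<Sum>j<s. w j * h j) - (\<Sum>j<s. w j) = (\<Sum>j<s. w j * (real b * h j - 1))"
    by (simp add: sum_distrib_left sum_subtractf algebra_simps)
  also have "\<dots> \<le> Dw w q" unfolding Dw_def using q(2) assms(2) by (intro sum_mono mult_left_mono) auto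
  also have "\<dots> \<le> Zl w b" using assms(2) q(1) by (intro Dw_le_Zl)
  finally show ?thesis .
qed

lemma base_le_Pr:
  assumes "base h" "\<And>j. 0 \<le> w j"
  shows "(\<Sum>j<s. w j * h j) \<le> Pr w"
  using base_lower[OF assms] assms(2) by (intro Pr_geI[where c="\<Sum>j<s. w j"])

lemma gain:
  assumes h: "base h" and w: "\<And>j. 0 \<le> w j" and lt: "(\<Sum>j<s. w j * h j) < Pr w"
  obtains e B where "R \<le> (\<Sum>j<s. w j * e j)"
    "\<And>b. B \<le> b \<Longrightarrow> \<exists>q\<in>dists b. \<forall>j<s. real b * h j + e j \<le> Hl j q"
proof -
  define l where "l = (\<Sum>j<s. w j * h j)"
  define W where "W = (\<Sum>j<s. w j)"
  define c where "c = 1 + ln (real p + 1)"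
  \<comment> \<open>So long that the surplus \<open>B * (Pr w - l)\<close> over the linear rate pays
    for \<open>R\<close>, for the \<open>p\<close> connecting letters, and for the loss
    \<open>c\<close> at every level. In \<open>c\<close>, the 1 is the defect allowed by
    \<open>base\<close>, the logarithm the cost of gluing.\<close>
  obtain B :: nat where B: "(R + 1 + real p * l + c * W) / (Pr w - l) < real B" using reals_Archimedean2 by blast
  then have B: "R + 1 + real p * l + c * W < real B * (Pr w - l)" using lt by (simp add: l_def field_simps)
  obtain r where r: "r \<in> dists B" "Zl w B - 1 < Dw w r" using Zl_near_max[where w=w and b=B and e=1] w by auto
  \<comment> \<open>Together with its connecting letters, the inserted word displaces
    \<open>B + p\<close> letters that would have had rate \<open>h j\<close>.\<close>
  define e where "e j = Hl j r - real (B + p) * h j - c" for j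
  have "(\<Sum>j<s. w j * e j) = Dw w r - real (B + p) * l - c * W"
    by (simp add: e_def Dw_def l_def W_def sum_subtractf sum.distrib sum_distrib_left algebra_simps)
  also have "\<dots> \<ge> R" using r(2) B Pr_le_Zl[of w B, OF w] by (simp add: algebra_simps)
  finally have "R \<le> (\<Sum>j<s. w j * e j)" .
  moreover have "\<exists>q\<in>dists b. \<forall>j<s. real b * h j + e j \<le> Hl j q" if b: "B + p \<le> b" for b
  proof -
    obtain a where a: "b = a + B + p" using b by (metis add.assoc add.commute le_Suc_ex)
    obtain q where q: "q \<in> dists a" "\<And>j. j < s \<Longrightarrow> real a * h j - 1 \<le> Hl j q"
      using h unfolding base_def by blast
    show ?thesis
    proof (intro bexI allI impI)
      fix j assume "j < s"
      then show "real b * h j + e j \<le> Hl j (map_pmf (\<lambda>(u, v). glue u v) (pair_pmf q r))"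
        using q(2)[of j] Hl_glue[OF q(1) r(1), of j] by (simp add: a e_def c_def algebra_simps)
    qed (use glue_dists[OF q(1) r(1)] in \<open>simp add: a\<close>)
  qed
  ultimately show ?thesis using that by blast
qed

text \<open>Mixing in the uniform distribution with weight \<open>1 / b\<close> costs a bounded amount of entropy and bounds the
  information of every single word.\<close>

lemma smooth:
  assumes q: "q \<in> dists b" and b: "0 < b"
  obtains q' where "q' \<in> dists b" "\<And>j. Hl j q - lnA \<le> Hl j q'"
    "\<And>j u. u \<in> words b \<Longrightarrow> exp (- real b * (lnA + 1)) \<le> pmf (map_pmf (prw j) q') (prw j u)"
proof
  define k where "k c = (if c then pmf_of_set (words b) else q)" for c
  define q' where "q' = bind_pmf (bernoulli_pmf (1 / real b)) k"
  have b1: "0 < 1 / real b" "1 / real b \<le> 1" using b by auto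
  have Su: "set_pmf (pmf_of_set (words b)) = words b" by (intro set_pmf_of_set) auto
  have k: "k c \<in> dists b" for c using q by (auto simp: k_def dists_def Su)
  show "q' \<in> dists b" using k by (auto simp: q'_def dists_def)
  have fin: "finite (set_pmf (bernoulli_pmf (1 / real b)))" by (rule finite_subset[of _ UNIV]) auto
  show "Hl j q - lnA \<le> Hl j q'" for j
  proof -
    have "Hl j q - lnA \<le> (1 - 1 / real b) * Hl j q"
      using Hl_le[OF q, of j] b by (simp add: field_simps)
    also have "\<dots> \<le> (\<integral>c. Hl j (k c) \<partial>measure_pmf (bernoulli_pmf (1 / real b)))"
      using b1 Hl_nonneg by (subst integral_bernoulli_pmf) (auto simp: k_def)
    also have "\<dots> \<le> Hl j q'"
      unfolding Hl_def q'_def map_bind_pmf using k finite_dists by (intro ent_bind_ge fin) auto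
    finally show ?thesis .
  qed
  fix j u assume u: "u \<in> words b"
  have "real (card A) ^ b = exp (real b * lnA)"
    using card_A_pos by (simp add: lnA_def exp_of_nat_mult)
  then have "exp (- real b * (lnA + 1)) = exp (- real b) * (1 / real (card A) ^ b)"
    by (simp add: exp_diff[symmetric] algebra_simps)
  also have "\<dots> \<le> (1 / real b) * (1 / real (card (words b)))"
  proof (intro mult_mono divide_left_mono)
    show "exp (- real b) \<le> 1 / real b" using b less_imp_le[OF less_le_trans[OF less_add_one exp_ge_add_one_self[of "real b", unfolded add.commute[of 1]]]]
      by (simp add: exp_minus field_simps)
    show "real (card (words b)) \<le> real (card A) ^ b" using card_words_le by (metis of_nat_le_iff of_nat_power)
    show "0 < real (card A) ^ b * real (card (words b))"
      using card_A_pos by (intro mult_pos_pos zero_less_power) (simp_all add: card_gt_0_iff)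
  qed auto
  also have "\<dots> \<le> pmf q' u"
  proof -
    have "pmf (bernoulli_pmf (1 / real b)) True * pmf (k True) u \<le> pmf q' u"
      unfolding q'_def using b1 by (intro pmf_bind_ge fin) (auto simp: set_pmf_iff)
    then show ?thesis using b1 u by (simp add: k_def pmf_of_set)
  qed
  also have "\<dots> \<le> pmf (map_pmf (prw j) q') (prw j u)" by (rule pmf_le_pmf_map)
  finally show "exp (- real b * (lnA + 1)) \<le> pmf (map_pmf (prw j) q') (prw j u)" .
qed

end

section \<open>Comparison of quasi-multiplicative weights\<close>

lemma sum_Un_le_add:
  fixes f :: "'b \<Rightarrow> real"
  assumes "finite A" "finite B" "\<And>x. x \<in> A \<inter> B \<Longrightarrow> 0 \<le> f x"
  shows "sum f (A \<union> B) \<le> sum f A + sum f B"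
proof -
  have "0 \<le> sum f (A \<inter> B)" using assms(3) by (rule sum_nonneg)
  then show ?thesis using sum.union_inter[OF assms(1,2), of f] by linarith
qed

lemma sum_UN_le_sum:
  fixes f :: "'b \<Rightarrow> real"
  assumes "finite I" "\<And>i. i \<in> I \<Longrightarrow> finite (A i)" "\<And>x. 0 \<le> f x"
  shows "sum f (\<Union>i\<in>I. A i) \<le> (\<Sum>i\<in>I. sum f (A i))"
  using assms(1,2)
proof (induction I rule: finite_induct)
  case (insert i I)
  then show ?case
    using sum_Un_le_add[of "A i" "\<Union>i\<in>I. A i" f] assms(3) by simp
qed simp

lemma sum_le_multiplicity:
  fixes f :: "'b \<Rightarrow> real"
  assumes "finite D" "\<And>y. 0 \<le> f y" "\<And>y. y \<in> T ` D \<Longrightarrow> real (card {x \<in> D. T x = y}) \<le> k"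
  shows "(\<Sum>x\<in>D. f (T x)) \<le> k * (\<Sum>y\<in>T ` D. f y)"
proof -
  have "(\<Sum>x\<in>D. f (T x)) = (\<Sum>y\<in>T ` D. \<Sum>x\<in>{x \<in> D. T x = y}. f (T x))"
    using assms(1) by (rule sum.image_gen)
  also have "\<dots> = (\<Sum>y\<in>T ` D. real (card {x \<in> D. T x = y}) * f y)"
    by (intro sum.cong refl) simp
  also have "\<dots> \<le> (\<Sum>y\<in>T ` D. k * f y)"
    using assms by (intro sum_mono mult_right_mono) auto
  finally show ?thesis by (simp add: sum_distrib_left)
qed

text \<open>In the application, \<open>a\<close>, \<open>a'\<close> and \<open>a''\<close> are
  exponentials of fibre entropies for a weight and two perturbations of which it is the midpoint;
  convexity becomes \<open>sq\<close>. They are normalised such that the sums over words of any one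
  length stay bounded.\<close>

locale weight_comparison =
  fixes M :: "'b list set" and a a' a'' :: "'b list \<Rightarrow> real" and p :: nat and c c0 C :: real
  assumes M_append: "u @ v \<in> M \<Longrightarrow> u \<in> M \<and> v \<in> M"
    and fin: "finite {u \<in> M. length u = n}"
    and a_pos: "u \<in> M \<Longrightarrow> 0 < a u" and a'_pos: "u \<in> M \<Longrightarrow> 0 < a' u"
    and a'_nonneg: "0 \<le> a' u"
    and sub: "u @ v \<in> M \<Longrightarrow> a (u @ v) \<le> a u * a v"
    and quasi: "u \<in> M \<Longrightarrow> v \<in> M \<Longrightarrow> \<exists>z. length z \<le> p \<and> u @ z @ v \<in> M \<and> c * a' u * a' v \<le> a' (u @ z @ v)"
    and sq: "u \<in> M \<Longrightarrow> (a u)\<^sup>2 \<le> a' u * a'' u"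
    and low: "c0 \<le> (\<Sum>u\<in>{u \<in> M. length u = n}. a u)"
    and up: "(\<Sum>u\<in>{u \<in> M. length u = n}. a u) \<le> C"
    and up': "(\<Sum>u\<in>{u \<in> M. length u = n}. a' u) \<le> C"
    and up'': "(\<Sum>u\<in>{u \<in> M. length u = n}. a'' u) \<le> C"
    and c_pos: "0 < c" and c0_pos: "0 < c0" and p_pos: "0 < p"
begin

abbreviation W :: "nat \<Rightarrow> 'b list set" where
  "W n \<equiv> {u \<in> M. length u = n}"

lemma C_pos: "0 < C"
  using low[of 0] up[of 0] c0_pos by linarith

lemma a''_pos:
  assumes "u \<in> M"
  shows "0 < a'' u"
proof -
  have "0 < a' u * a'' u" using sq[OF assms] zero_less_power[OF a_pos[OF assms], of 2] by linarith
  then show ?thesis using a'_pos[OF assms] by (simp add: zero_less_mult_iff)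
qed

text \<open>Cutting at both ends of the occurrence, submultiplicativity gives the product of the
  weights of prefix, \<open>J\<close> and suffix. Prefixes and suffixes each sum to at most
  \<open>C\<close>.\<close>

lemma sum_occurrence_le:
  assumes J: "J \<in> M"
  shows "(\<Sum>u\<in>{u \<in> W n. i + length J \<le> n \<and> take (length J) (drop i u) = J}. a u) \<le> C\<^sup>2 * a J"
    (is "sum a ?S \<le> _")
proof (cases "i + length J \<le> n")
  case False
  then have e: "?S = {}" by auto
  show ?thesis unfolding e using a_pos[OF J] by (simp add: less_imp_le)
next
  case True
  define b where "b = length J"
  let ?T = "\<lambda>u. (take i u, drop (i + b) u)"
  have dec: "u = take i u @ J @ drop (i + b) u" if "u \<in> ?S" for u
  proof -
    have "take i u @ take b (drop i u) @ drop b (drop i u) = u" by (simp only: append_take_drop_id)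
    moreover have "take b (drop i u) = J" using that by (simp add: b_def)
    moreover have "drop b (drop i u) = drop (i + b) u" by (simp add: add.commute)
    ultimately show ?thesis by simp
  qed
  have inM: "take i u \<in> W i \<and> drop (i + b) u \<in> W (n - i - b)" if "u \<in> ?S" for u
    using that dec[OF that] M_append[of "take i u" "J @ drop (i + b) u"] M_append[of J "drop (i + b) u"] True
    by (auto simp: b_def)
  have "inj_on ?T ?S"
  proof (rule inj_onI)
    fix u v assume "u \<in> ?S" "v \<in> ?S" "?T u = ?T v"
    then show "u = v" using dec[of u] dec[of v] by (metis prod.inject)
  qed
  have "sum a ?S \<le> (\<Sum>u\<in>?S. a J * (a (fst (?T u)) * a (snd (?T u))))"
  proof (rule sum_mono)
    fix u assume u: "u \<in> ?S"
    have "a u = a (take i u @ J @ drop (i + b) u)" using dec[OF u] by simp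
    also have "\<dots> \<le> a (take i u) * a (J @ drop (i + b) u)"
      using dec[OF u] u by (intro sub) auto
    also have "\<dots> \<le> a (take i u) * (a J * a (drop (i + b) u))"
      using dec[OF u] u inM[OF u] M_append[of "take i u" "J @ drop (i + b) u"]
      by (intro mult_left_mono sub less_imp_le[OF a_pos]) auto
    finally show "a u \<le> a J * (a (fst (?T u)) * a (snd (?T u)))" by (simp add: mult_ac)
  qed
  also have "\<dots> = (\<Sum>x\<in>?T ` ?S. a J * (a (fst x) * a (snd x)))"
    using \<open>inj_on ?T ?S\<close> by (subst sum.reindex) auto
  also have "\<dots> \<le> (\<Sum>x\<in>W i \<times> W (n - i - b). a J * (a (fst x) * a (snd x)))"
  proof (rule sum_mono2)
    show "?T ` ?S \<subseteq> W i \<times> W (n - i - b)" using inM by blast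
  qed (use fin a_pos J in \<open>auto intro!: mult_nonneg_nonneg less_imp_le\<close>)
  also have "\<dots> = a J * (sum a (W i) * sum a (W (n - i - b)))"
    unfolding sum_product sum.cartesian_product by (simp add: sum_distrib_left case_prod_unfold)
  also have "\<dots> \<le> a J * (C * C)"
    using up a_pos J C_pos by (intro mult_left_mono mult_mono sum_nonneg) (auto intro: less_imp_le)
  finally show ?thesis by (simp add: power2_eq_square mult_ac)
qed

text \<open>A word \<open>J\<close> is inserted at about \<open>1 / a J\<close> places, which are spaced so that insertions do not overlap,
  into words that typically contain \<open>J\<close> only boundedly often. The resulting words are then counted with
  bounded multiplicity, so their total \<open>a'\<close>-weight bounds \<open>a' J / a J\<close>.\<close>

lemma comparison_bound:
  defines "K \<equiv> (3 * real p + 1) * C\<^sup>2 * (1 + C)"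
  defines "Q \<equiv> 4 * K / c0"
  assumes J: "J \<in> M"
  shows "c\<^sup>2 * (c0 / (4 * C))\<^sup>2 * (c0 / 2)\<^sup>2 * a' J \<le> (real p + 1)\<^sup>2 * (2 * Q + 1) * ((2 * real p + 1) * C) * a J"
proof -
  define b where "b = length J"
  \<comment> \<open>Space for \<open>J\<close> and its two connecting words, so that insertions at
    different multiples of \<open>g\<close> are disjoint.\<close>
  define g where "g = b + 2 * p"
  define m where "m = nat \<lceil>1 / a J\<rceil>"
  define c1 where "c1 = c0 / (4 * C)"
  have aJ: "0 < a J" "a J \<le> C"
  proof -
    show "0 < a J" using a_pos J .
    have "a J \<le> sum a (W b)" using J fin a_pos by (intro member_le_sum) (auto simp: b_def less_imp_le)
    then show "a J \<le> C" using up[of b] by linarith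
  qed
  have m: "1 / a J \<le> real m" "real m * a J \<le> 1 + C"
  proof -
    show "1 / a J \<le> real m" unfolding m_def by linarith
    have "real m \<le> 1 / a J + 1" using aJ unfolding m_def by (intro less_imp_le) (simp add: of_nat_nat, linarith)
    then have "real m * a J \<le> (1 / a J + 1) * a J" using aJ by (intro mult_right_mono) auto
    also have "\<dots> = 1 + a J" using aJ by (simp add: distrib_right)
    finally show "real m * a J \<le> 1 + C" using aJ by linarith
  qed
  have K: "0 < K" using C_pos p_pos unfolding K_def by (intro mult_pos_pos) auto
  have Q: "0 < Q" using K c0_pos unfolding Q_def by simp
  have c1: "0 < c1" using C_pos c0_pos unfolding c1_def by simp
  \<comment> \<open>Places near which \<open>u\<close> already contains \<open>J\<close>. The
    tolerance \<open>3 * p\<close> covers the shifts by connecting words that arise in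
    \<open>I1\<close> and \<open>I2\<close> below.\<close>
  define oc where "oc u = {k. k < m \<and> (\<exists>v\<le>3 * p. k * g + v + b \<le> length u \<and> take b (drop (k * g + v) u) = J)}" for u
  have fin_oc: "finite (oc u)" for u by (simp add: oc_def)
  define G where "G n = {u \<in> W n. c1 * a u \<le> a' u \<and> real (card (oc u)) \<le> Q}" for n
  have finG: "finite (G n)" for n by (rule finite_subset[OF _ fin[of n]]) (auto simp: G_def)
  \<comment> \<open>Each of the two exceptional sets has mass at most \<open>c0 / 4\<close>. In
    \<open>?B\<close>, \<open>a' u < c1 * a u\<close> and \<open>sq\<close> force
    \<open>a u \<le> c1 * a'' u\<close>. For \<open>?O\<close>, Markov's inequality applies: the
    total mass of occurrences is at most \<open>K\<close>, since the number \<open>m\<close> of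
    places is about \<open>1 / a J\<close>.\<close>
  have G: "c0 / 2 \<le> sum a (G n)" for n
  proof -
    let ?B = "{u \<in> W n. a' u < c1 * a u}" and ?O = "{u \<in> W n. Q < real (card (oc u))}"
    have "sum a ?B \<le> (\<Sum>u\<in>?B. c1 * a'' u)"
    proof (rule sum_mono)
      fix u assume u: "u \<in> ?B"
      then have au: "0 < a u" "0 < a' u" using a_pos a'_pos by auto
      have a'': "0 < a'' u" using u a''_pos by auto
      have "a u * a u \<le> a' u * a'' u" using sq[of u] u by (simp add: power2_eq_square)
      also have "\<dots> \<le> (c1 * a u) * a'' u" using u a'' by (intro mult_right_mono) auto
      finally have "a u * a u \<le> a u * (c1 * a'' u)" by (simp add: mult_ac)
      then show "a u \<le> c1 * a'' u" using au by simp
    qed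
    also have "\<dots> \<le> (\<Sum>u\<in>W n. c1 * a'' u)"
    proof (rule sum_mono2[OF fin])
      fix u assume "u \<in> W n - ?B"
      then show "0 \<le> c1 * a'' u" using c1 a''_pos[of u] by simp
    qed auto
    also have "\<dots> \<le> c1 * C" using up''[of n] c1 by (simp add: sum_distrib_left[symmetric])
    also have "\<dots> = c0 / 4" using C_pos by (simp add: c1_def)
    finally have B: "sum a ?B \<le> c0 / 4" .
    have "(\<Sum>u\<in>W n. a u * real (card (oc u))) \<le> (\<Sum>u\<in>W n. \<Sum>k<m. \<Sum>v\<le>3*p. if k * g + v + b \<le> n \<and> take b (drop (k * g + v) u) = J then a u else 0)"
    proof (rule sum_mono)
      fix u assume u: "u \<in> W n"
      have "a u * real (card (oc u)) = (\<Sum>k<m. if k \<in> oc u then a u else 0)"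
      proof -
        have "(\<Sum>k<m. if k \<in> oc u then a u else 0) = (\<Sum>k\<in>{..<m} \<inter> oc u. a u)"
          by (rule sum.inter_restrict[symmetric]) simp
        also have "{..<m} \<inter> oc u = oc u" by (auto simp: oc_def)
        finally show ?thesis by simp
      qed
      also have "\<dots> \<le> (\<Sum>k<m. \<Sum>v\<le>3*p. if k * g + v + b \<le> n \<and> take b (drop (k * g + v) u) = J then a u else 0)"
      proof (rule sum_mono)
        fix k assume "k \<in> {..<m}"
        show "(if k \<in> oc u then a u else 0) \<le> (\<Sum>v\<le>3*p. if k * g + v + b \<le> n \<and> take b (drop (k * g + v) u) = J then a u else 0)"
        proof (cases "k \<in> oc u")
          case True
          then obtain v where v: "v \<le> 3 * p" "k * g + v + b \<le> length u" "take b (drop (k * g + v) u) = J"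
            by (auto simp: oc_def)
          have "a u = (if k * g + v + b \<le> n \<and> take b (drop (k * g + v) u) = J then a u else 0)" using v u by simp
          also have "\<dots> \<le> (\<Sum>v\<le>3*p. if k * g + v + b \<le> n \<and> take b (drop (k * g + v) u) = J then a u else 0)"
            using v u a_pos by (intro member_le_sum) (auto intro: less_imp_le)
          finally show ?thesis using True by simp
        next
          case False
          have "0 < a u" using u a_pos by simp
          then show ?thesis using False by (simp add: sum_nonneg)
        qed
      qed
      finally show "a u * real (card (oc u)) \<le> (\<Sum>k<m. \<Sum>v\<le>3*p. if k * g + v + b \<le> n \<and> take b (drop (k * g + v) u) = J then a u else 0)" .
    qed
    also have "\<dots> = (\<Sum>k<m. \<Sum>v\<le>3*p. \<Sum>u\<in>W n. if k * g + v + b \<le> n \<and> take b (drop (k * g + v) u) = J then a u else 0)"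
      by (subst sum.swap, intro sum.cong refl, rule sum.swap)
    also have "\<dots> \<le> (\<Sum>k<m. \<Sum>v\<le>3*p. C\<^sup>2 * a J)"
    proof (intro sum_mono)
      fix k v
      have "(\<Sum>u\<in>W n. if k * g + v + b \<le> n \<and> take b (drop (k * g + v) u) = J then a u else 0)
        = (\<Sum>u\<in>{u \<in> W n. k * g + v + b \<le> n \<and> take b (drop (k * g + v) u) = J}. a u)"
        by (rule sum.inter_filter[OF fin, symmetric])
      also have "\<dots> \<le> C\<^sup>2 * a J" unfolding b_def by (rule sum_occurrence_le[OF J])
      finally show "(\<Sum>u\<in>W n. if k * g + v + b \<le> n \<and> take b (drop (k * g + v) u) = J then a u else 0) \<le> C\<^sup>2 * a J" .
    qed
    also have "\<dots> = (3 * real p + 1) * C\<^sup>2 * (real m * a J)" by (simp add: algebra_simps)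
    also have "\<dots> \<le> K" unfolding K_def using m(2) by (intro mult_left_mono) auto
    finally have E: "(\<Sum>u\<in>W n. a u * real (card (oc u))) \<le> K" .
    have "Q * sum a ?O \<le> (\<Sum>u\<in>?O. a u * real (card (oc u)))"
      unfolding sum_distrib_left using a_pos by (intro sum_mono) (auto simp: mult.commute intro!: mult_left_mono less_imp_le)
    also have "\<dots> \<le> (\<Sum>u\<in>W n. a u * real (card (oc u)))"
    proof (rule sum_mono2[OF fin])
      fix u assume "u \<in> W n - ?O"
      then have "0 < a u" using a_pos by simp
      then show "0 \<le> a u * real (card (oc u))" by simp
    qed auto
    finally have "Q * sum a ?O \<le> K" using E by linarith
    then have O: "sum a ?O \<le> c0 / 4" using Q K c0_pos by (simp add: Q_def field_simps)
    have fB: "finite ?B" "finite ?O" by (auto intro: finite_subset[OF _ fin[of n]])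
    have an: "0 \<le> a u" if "u \<in> M" for u using a_pos[OF that] by simp
    have "sum a (W n) \<le> sum a (G n \<union> (?B \<union> ?O))"
    proof (rule sum_mono2)
      show "finite (G n \<union> (?B \<union> ?O))" using finG fB by blast
      show "W n \<subseteq> G n \<union> (?B \<union> ?O)" by (auto simp: G_def)
    qed (auto simp: G_def an)
    also have "\<dots> \<le> sum a (G n) + sum a (?B \<union> ?O)"
      using finG fB an by (intro sum_Un_le_add) (auto simp: G_def)
    also have "sum a (?B \<union> ?O) \<le> sum a ?B + sum a ?O"
      using fB an by (intro sum_Un_le_add) auto
    finally show ?thesis using low[of n] B O by linarith
  qed
  have "\<forall>u v. \<exists>z. u \<in> M \<longrightarrow> v \<in> M \<longrightarrow> length z \<le> p \<and> u @ z @ v \<in> M \<and> c * a' u * a' v \<le> a' (u @ z @ v)"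
    using quasi by blast
  then obtain z where z: "\<And>u v. u \<in> M \<Longrightarrow> v \<in> M \<Longrightarrow> length (z u v) \<le> p \<and> u @ z u v @ v \<in> M \<and> c * a' u * a' v \<le> a' (u @ z u v @ v)"
    by metis
  define z1 where "z1 x = z x J" for x
  define z2 where "z2 x y = z (x @ z1 x @ J) y" for x y
  define T where "T = (\<lambda>(i :: nat, x, y). x @ z1 x @ J @ z2 x y @ y)"
  have z1: "length (z1 x) \<le> p" "x @ z1 x @ J \<in> M" "c * a' x * a' J \<le> a' (x @ z1 x @ J)" if "x \<in> M" for x
    using z[OF that J] by (auto simp: z1_def)
  have z2: "length (z2 x y) \<le> p" "x @ z1 x @ J @ z2 x y @ y \<in> M"
      "c * a' (x @ z1 x @ J) * a' y \<le> a' (x @ z1 x @ J @ z2 x y @ y)" if "x \<in> M" "y \<in> M" for x y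
    using z[OF z1(2)[OF that(1)] that(2)] by (auto simp: z2_def)
  define D where "D = (SIGMA i:{..<m}. G (i * g) \<times> G ((m - 1 - i) * g))"
  have finD: "finite D" unfolding D_def using finG by auto
  have Dx: "i < m" "x \<in> M" "length x = i * g" "y \<in> M" "length y = (m - 1 - i) * g" "c1 * a x \<le> a' x" "c1 * a y \<le> a' y"
    "real (card (oc x)) \<le> Q" "real (card (oc y)) \<le> Q" if "(i, x, y) \<in> D" for i x y
    using that by (auto simp: D_def G_def)
  \<comment> \<open>Each of the \<open>m\<close> places admits pairs of good words of mass at least
    \<open>(c0 / 2)\<close> squared. For good words \<open>c1\<close> turns \<open>a\<close> into
    \<open>a'\<close>, and \<open>quasi\<close> is used once for each of the two
    connections.\<close>
  have lower: "real m * (c\<^sup>2 * c1\<^sup>2 * (c0 / 2)\<^sup>2 * a' J) \<le> (\<Sum>d\<in>D. a' (T d))"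
  proof -
    have "real m * (c\<^sup>2 * c1\<^sup>2 * (c0 / 2)\<^sup>2 * a' J) = (\<Sum>i<m. (c\<^sup>2 * c1\<^sup>2 * a' J) * ((c0 / 2) * (c0 / 2)))"
      by (simp add: power2_eq_square)
    also have "\<dots> \<le> (\<Sum>i<m. (c\<^sup>2 * c1\<^sup>2 * a' J) * (sum a (G (i * g)) * sum a (G ((m - 1 - i) * g))))"
      using G c0_pos a'_nonneg by (intro sum_mono mult_left_mono mult_mono) (auto intro: order_trans[OF _ G])
    also have "\<dots> = (\<Sum>i<m. \<Sum>d\<in>G (i * g) \<times> G ((m - 1 - i) * g). (c\<^sup>2 * c1\<^sup>2 * a' J) * (a (fst d) * a (snd d)))"
      unfolding sum_product sum.cartesian_product by (simp add: sum_distrib_left case_prod_unfold)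
    also have "\<dots> = (\<Sum>d\<in>D. (c\<^sup>2 * c1\<^sup>2 * a' J) * (a (fst (snd d)) * a (snd (snd d))))"
      unfolding D_def using finG by (subst sum.Sigma) (auto simp: case_prod_unfold)
    also have "\<dots> \<le> (\<Sum>d\<in>D. a' (T d))"
    proof (rule sum_mono)
      fix d assume "d \<in> D"
      then obtain i x y where d: "d = (i, x, y)" "(i, x, y) \<in> D" by (cases d) auto
      note dx = Dx[OF d(2)]
      have "(c\<^sup>2 * c1\<^sup>2 * a' J) * (a x * a y) = c * (c * (c1 * a x) * a' J) * (c1 * a y)"
        by (simp add: power2_eq_square mult_ac)
      also have "\<dots> \<le> c * (c * a' x * a' J) * a' y"
        using dx c_pos c1 a'_nonneg a_pos[OF dx(2)] a_pos[OF dx(4)]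
        by (intro mult_mono mult_nonneg_nonneg) (auto intro: less_imp_le)
      also have "\<dots> \<le> c * a' (x @ z1 x @ J) * a' y"
        using z1(3)[OF dx(2)] c_pos a'_nonneg by (intro mult_right_mono mult_left_mono) auto
      also have "\<dots> \<le> a' (T d)" using z2(3)[OF dx(2,4)] by (simp add: T_def d)
      finally show "(c\<^sup>2 * c1\<^sup>2 * a' J) * (a (fst (snd d)) * a (snd (snd d))) \<le> a' (T d)" by (simp add: d)
    qed
    finally show ?thesis .
  qed
  have mult: "real (card {d \<in> D. T d = t}) \<le> (real p + 1)\<^sup>2 * (2 * Q + 1)" if t: "t \<in> T ` D" for t
  proof -
    define F where "F = {d \<in> D. T d = t}"
    define I where "I = fst ` F"
    obtain i0 x0 y0 where d0: "(i0, x0, y0) \<in> D" "t = T (i0, x0, y0)" using t by auto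
    note dx0 = Dx[OF d0(1)]
    have t0: "t = x0 @ z1 x0 @ J @ z2 x0 y0 @ y0" using d0 by (simp add: T_def)
    have finF: "finite F" unfolding F_def using finD by simp
    \<comment> \<open>If \<open>t\<close> also arises by an insertion at an earlier place, that copy
      of \<open>J\<close> lies entirely inside \<open>x0\<close>. As \<open>x0\<close> is good, this
      happens for few places only; \<open>I2\<close> is the same for later places and
      \<open>y0\<close>.\<close>
    have I1: "i \<in> oc x0" if i: "i \<in> I" "i < i0" for i
    proof -
      obtain x y where d: "(i, x, y) \<in> D" "t = x @ z1 x @ J @ z2 x y @ y" using i by (auto simp: I_def F_def T_def)
      note dx = Dx[OF d(1)]
      let ?v = "length (z1 x)"
      have v: "?v \<le> p" using z1 dx by auto
      have "i * g + ?v + b \<le> i * g + g" using v by (simp add: g_def)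
      also have "\<dots> \<le> i0 * g" using i(2) by (metis Suc_leI add.commute mult_Suc mult_le_mono1)
      finally have le: "i * g + ?v + b \<le> length x0" using dx0 by simp
      have "take b (drop (i * g + ?v) t) = J" using dx by (simp add: d(2) b_def)
      moreover have "take b (drop (i * g + ?v) t) = take b (drop (i * g + ?v) x0)" using le by (simp add: t0)
      ultimately show ?thesis using le v dx by (auto simp: oc_def intro!: exI[of _ ?v])
    qed
    have I2: "i - Suc i0 \<in> oc y0" if i: "i \<in> I" "i0 < i" for i
    proof -
      obtain x y where d: "(i, x, y) \<in> D" "t = x @ z1 x @ J @ z2 x y @ y" using i by (auto simp: I_def F_def T_def)
      note dx = Dx[OF d(1)]
      let ?w = "length (z1 x)" and ?q = "length (z1 x0)" and ?r = "length (z2 x0 y0)"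
      define k where "k = i - Suc i0"
      have ik: "i = Suc (i0 + k)" using i(2) by (simp add: k_def)
      \<comment> \<open>The start of the other copy of \<open>J\<close> within \<open>y0\<close>,
        relative to \<open>k * g\<close>. It lies between 0 and \<open>3 * p\<close> because all
        three connecting words have length at most \<open>p\<close>.\<close>
      define v where "v = 2 * p + ?w - ?q - ?r"
      have w: "?w \<le> p" "?q \<le> p" "?r \<le> p" using z1(1)[OF dx(2)] z1(1)[OF dx0(2)] z2(1)[OF dx0(2,4)] by auto
      have pos: "i * g + ?w = (i0 * g + ?q + b + ?r) + (k * g + v)"
        using w by (simp add: ik v_def g_def algebra_simps)
      have J1: "take b (drop (i * g + ?w) t) = J" using dx by (simp add: d(2) b_def)
      have "drop (i0 * g + ?q + b + ?r) t = y0" using dx0 by (simp add: t0 b_def)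
      then have J2: "drop (i * g + ?w) t = drop (k * g + v) y0"
        unfolding pos by (metis add.commute drop_drop)
      have "i * g + ?w + b \<le> length t" using dx by (simp add: d(2) b_def)
      moreover have "length t = (i0 * g + ?q + b + ?r) + length y0" using dx0(3) by (simp add: t0 b_def)
      ultimately have "k * g + v + b \<le> length y0" using pos by linarith
      moreover have "v \<le> 3 * p" using w by (simp add: v_def)
      moreover have "k < m" using dx(1) ik by simp
      ultimately show ?thesis using J1 J2 by (auto simp: oc_def k_def[symmetric])
    qed
    have "card I \<le> card (oc x0) + card (oc y0) + 1"
    proof -
      have "I \<subseteq> oc x0 \<union> {i0} \<union> (\<lambda>k. Suc i0 + k) ` oc y0"
      proof
        fix i assume i: "i \<in> I"
        consider "i < i0" | "i = i0" | "i0 < i" by linarith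
        then show "i \<in> oc x0 \<union> {i0} \<union> (\<lambda>k. Suc i0 + k) ` oc y0"
        proof cases
          case 3
          then show ?thesis using I2[OF i 3] by (auto intro!: image_eqI[of _ _ "i - Suc i0"])
        qed (use I1 i in auto)
      qed
      then have "card I \<le> card (oc x0 \<union> {i0} \<union> (\<lambda>k. Suc i0 + k) ` oc y0)"
        using fin_oc by (intro card_mono) auto
      also have "\<dots> \<le> card (oc x0) + card {i0} + card ((\<lambda>k. Suc i0 + k) ` oc y0)"
        by (intro order_trans[OF card_Un_le] add_mono card_Un_le order_refl)
      also have "\<dots> \<le> card (oc x0) + 1 + card (oc y0)" using card_image_le[OF fin_oc] by simp
      finally show ?thesis by simp
    qed
    then have cI: "real (card I) \<le> 2 * Q + 1" using dx0(8,9) by linarith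
    \<comment> \<open>For a fixed result, the place and the lengths of both connecting words
      determine where \<open>x\<close> and \<open>y\<close> are to be cut out.\<close>
    let ?f = "\<lambda>(i, x, y). (i, length (z1 x), length (z2 x y))"
    have "card F \<le> card (I \<times> {..p} \<times> {..p})"
    proof (rule card_inj_on_le)
      show "inj_on ?f F"
      proof (rule inj_onI)
        fix d e assume de: "d \<in> F" "e \<in> F" "?f d = ?f e"
        obtain i x y where d: "d = (i, x, y)" by (cases d)
        obtain i' x' y' where e: "e = (i', x', y')" by (cases e)
        have dx: "(i, x, y) \<in> D" "(i', x', y') \<in> D" "T (i, x, y) = t" "T (i', x', y') = t"
          using de d e by (auto simp: F_def)
        have t1: "t = x @ z1 x @ J @ z2 x y @ y" and t2: "t = x' @ z1 x' @ J @ z2 x' y' @ y'"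
          using dx(3,4) by (auto simp: T_def)
        have "i = i'" using de d e by simp
        moreover have "x = take (i * g) t" by (subst t1) (simp add: Dx(3)[OF dx(1)])
        moreover have "x' = take (i' * g) t" by (subst t2) (simp add: Dx(3)[OF dx(2)])
        moreover have "y = drop (i * g + length (z1 x) + b + length (z2 x y)) t"
          by (subst t1) (simp add: Dx(3)[OF dx(1)] b_def)
        moreover have "y' = drop (i' * g + length (z1 x') + b + length (z2 x' y')) t"
          by (subst t2) (simp add: Dx(3)[OF dx(2)] b_def)
        ultimately show "d = e" using de(3) d e by auto
      qed
      show "?f ` F \<subseteq> I \<times> {..p} \<times> {..p}"
      proof
        fix q assume "q \<in> ?f ` F"
        then obtain i x y where q: "(i, x, y) \<in> F" "q = (i, length (z1 x), length (z2 x y))" by auto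
        then have "(i, x, y) \<in> D" by (simp add: F_def)
        then show "q \<in> I \<times> {..p} \<times> {..p}"
          using z1(1)[OF Dx(2)] z2(1)[OF Dx(2) Dx(4)] q by (force simp: I_def)
      qed
      show "finite (I \<times> {..p} \<times> {..p})" using finF by (simp add: I_def)
    qed
    then have "card F \<le> card I * ((p + 1) * (p + 1))"
      by (simp add: card_cartesian_product)
    then have "real (card F) \<le> real (card I * ((p + 1) * (p + 1)))"
      by (simp only: of_nat_le_iff)
    then have "real (card F) \<le> real (card I) * (real p + 1)\<^sup>2"
      by (simp add: power2_eq_square algebra_simps)
    also have "\<dots> \<le> (2 * Q + 1) * (real p + 1)\<^sup>2" using cI by (intro mult_right_mono) auto
    finally show ?thesis by (simp add: F_def mult.commute)
  qed
  have upper: "sum a' (T ` D) \<le> (2 * real p + 1) * C"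
  proof -
    let ?n = "\<lambda>r. (m - 1) * g + b + r"
    have "T ` D \<subseteq> (\<Union>r\<le>2*p. W (?n r))"
    proof
      fix t assume "t \<in> T ` D"
      then obtain i x y where d: "(i, x, y) \<in> D" "t = x @ z1 x @ J @ z2 x y @ y" by (auto simp: T_def)
      note dx = Dx[OF d(1)]
      have "i + (m - 1 - i) = m - 1" using dx(1) by simp
      then have "i * g + (m - 1 - i) * g = (m - 1) * g" by (metis add_mult_distrib)
      then have "length t = ?n (length (z1 x) + length (z2 x y))" using dx by (simp add: d(2) b_def)
      moreover have "t \<in> M" using z2(2)[OF dx(2,4)] d(2) by simp
      moreover have "length (z1 x) + length (z2 x y) \<le> 2 * p" using z1(1)[OF dx(2)] z2(1)[OF dx(2,4)] by simp
      ultimately show "t \<in> (\<Union>r\<le>2*p. W (?n r))" by blast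
    qed
    then have "sum a' (T ` D) \<le> sum a' (\<Union>r\<le>2*p. W (?n r))"
      using fin a'_nonneg by (intro sum_mono2) auto
    also have "\<dots> \<le> (\<Sum>r\<le>2*p. sum a' (W (?n r)))"
      using fin a'_nonneg by (intro sum_UN_le_sum) auto
    also have "\<dots> \<le> (\<Sum>r\<le>2*p. C)" by (intro sum_mono up')
    finally show ?thesis by (simp add: algebra_simps)
  qed
  have "real m * (c\<^sup>2 * c1\<^sup>2 * (c0 / 2)\<^sup>2 * a' J) \<le> (real p + 1)\<^sup>2 * (2 * Q + 1) * sum a' (T ` D)"
    using lower by (rule order_trans) (intro sum_le_multiplicity finD a'_nonneg mult)
  also have "\<dots> \<le> (real p + 1)\<^sup>2 * (2 * Q + 1) * ((2 * real p + 1) * C)"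
    using upper Q by (intro mult_left_mono) auto
  finally have fin: "real m * (c\<^sup>2 * c1\<^sup>2 * (c0 / 2)\<^sup>2 * a' J) \<le> (real p + 1)\<^sup>2 * (2 * Q + 1) * ((2 * real p + 1) * C)" .
  have "1 / a J * (c\<^sup>2 * c1\<^sup>2 * (c0 / 2)\<^sup>2 * a' J) \<le> real m * (c\<^sup>2 * c1\<^sup>2 * (c0 / 2)\<^sup>2 * a' J)"
    using m(1) a'_nonneg by (intro mult_right_mono mult_nonneg_nonneg) auto
  then have "1 / a J * (c\<^sup>2 * c1\<^sup>2 * (c0 / 2)\<^sup>2 * a' J) * a J \<le> (real p + 1)\<^sup>2 * (2 * Q + 1) * ((2 * real p + 1) * C) * a J"
    using fin aJ(1) by (intro mult_right_mono) auto
  then show ?thesis using aJ(1) by (simp add: c1_def)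
qed

lemma comparison: "\<exists>K>0. \<forall>J\<in>M. a' J \<le> K * a J"
proof -
  define A where "A = c\<^sup>2 * (c0 / (4 * C))\<^sup>2 * (c0 / 2)\<^sup>2"
  define B where "B = (real p + 1)\<^sup>2 * (2 * (4 * ((3 * real p + 1) * C\<^sup>2 * (1 + C)) / c0) + 1) * ((2 * real p + 1) * C)"
  have A: "0 < A" using c_pos c0_pos C_pos by (simp add: A_def)
  have B: "0 < B" unfolding B_def using c0_pos C_pos by (intro mult_pos_pos add_nonneg_pos) auto
  have "a' J \<le> B / A * a J" if "J \<in> M" for J
  proof -
    have "A * a' J \<le> B * a J" using comparison_bound[OF that] unfolding A_def B_def .
    then show ?thesis using A by (simp add: field_simps)
  qed
  then show ?thesis using A B by (intro exI[of _ "B / A"]) simp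
qed

end

section \<open>Rigidity when the pressure is locally linear\<close>

lemma weighted_pmf_exists:
  fixes g :: "'b \<Rightarrow> real"
  assumes "finite S" "S \<noteq> {}" "\<And>x. x \<in> S \<Longrightarrow> 0 < g x"
  obtains r where "set_pmf r = S" "\<And>x. x \<in> S \<Longrightarrow> pmf r x = g x / sum g S"
proof -
  define f where "f x = (if x \<in> S then g x / sum g S else 0)" for x
  have pos: "0 < sum g S" using assms by (intro sum_pos)
  have nn: "0 \<le> f x" for x using assms(3) pos by (auto simp: f_def intro!: divide_nonneg_pos less_imp_le)
  have "(\<integral>\<^sup>+x. ennreal (f x) \<partial>count_space UNIV) = (\<Sum>x\<in>S. ennreal (f x))"
    using assms(1) by (intro nn_integral_count_space') (auto simp: f_def)
  also have "\<dots> = ennreal (\<Sum>x\<in>S. f x)" using nn by (intro sum_ennreal) auto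
  also have "(\<Sum>x\<in>S. f x) = 1" using pos by (simp add: f_def sum_divide_distrib[symmetric])
  finally have 1: "(\<integral>\<^sup>+x. ennreal (f x) \<partial>count_space UNIV) = 1" by simp
  have p: "pmf (embed_pmf f) x = f x" for x using pmf_embed_pmf[OF nn 1] by simp
  show ?thesis
  proof (rule that[of "embed_pmf f"])
    show "set_pmf (embed_pmf f) = S"
      using assms(3) pos by (auto simp: set_pmf_iff p f_def) (metis less_irrefl)+
  qed (simp add: p f_def)
qed

lemma sum_weighted_integral:
  fixes w :: "nat \<Rightarrow> real" and f :: "nat \<Rightarrow> 'b \<Rightarrow> real"
  assumes "finite (set_pmf K)"
  shows "(\<Sum>i<j. w i * (c + (\<integral>z. f i z \<partial>measure_pmf K))) = (\<Sum>i<j. w i) * c + (\<integral>z. (\<Sum>i<j. w i * f i z) \<partial>measure_pmf K)"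
  using assms by (simp add: distrib_left sum.distrib sum_distrib_right integrable_measure_pmf_finite)

context spec_lang
begin

section \<open>Entropies in the fibres of a projection\<close>

definition fib :: "nat \<Rightarrow> 'a list \<Rightarrow> 'a list set" where
  "fib j J = {u \<in> L. prw j u = J}"

definition fdists :: "nat \<Rightarrow> 'a list \<Rightarrow> 'a list pmf set" where
  "fdists j J = {q. set_pmf q \<subseteq> fib j J}"

definition Dlow :: "nat \<Rightarrow> (nat \<Rightarrow> real) \<Rightarrow> 'a list pmf \<Rightarrow> real" where
  "Dlow j w q = (\<Sum>i<j. w i * Hl i q)"

text \<open>What the levels below \<open>j\<close> can still contribute once the projection to level
  \<open>j\<close> is fixed: the pressure of a single fibre.\<close>

definition Ff :: "nat \<Rightarrow> (nat \<Rightarrow> real) \<Rightarrow> 'a list \<Rightarrow> real" where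
  "Ff j w J = Sup (Dlow j w ` fdists j J)"

lemma length_prw [simp]: "length (prw j u) = length u"
  by (simp add: prw_def)

lemma prw_append: "prw j (u @ v) = prw j u @ prw j v"
  by (simp add: prw_def)

lemma prw_0: "prw 0 u = u"
  by (simp add: prw_def pr_0 map_idI)

lemma prw_prw: "i \<le> j \<Longrightarrow> prw j (prw i u) = prw j u"
  by (simp add: prw_def pr_pr)

lemma fib_words: "u \<in> fib j J \<Longrightarrow> u \<in> words (length J)"
  by (auto simp: fib_def words_def)

lemma fdists_dists: "q \<in> fdists j J \<Longrightarrow> q \<in> dists (length J)"
  using fib_words by (auto simp: fdists_def dists_def)

lemma finite_fib [simp]: "finite (fib j J)"
  by (rule finite_subset[OF _ finite_words[of "length J"]]) (use fib_words in blast)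

lemma fdists_nonempty: "J \<in> prw j ` L \<Longrightarrow> fdists j J \<noteq> {}"
proof -
  assume "J \<in> prw j ` L"
  then obtain u where "u \<in> fib j J" by (auto simp: fib_def)
  then have "return_pmf u \<in> fdists j J" by (simp add: fdists_def)
  then show ?thesis by blast
qed

lemma Dlow_le:
  assumes "\<And>i. 0 \<le> w i" "q \<in> dists b"
  shows "Dlow j w q \<le> (\<Sum>i<j. w i) * (real b * lnA)"
  unfolding Dlow_def sum_distrib_right using assms by (intro sum_mono mult_left_mono Hl_le) auto

lemma Dlow_le_Ff:
  assumes "\<And>i. 0 \<le> w i" "q \<in> fdists j J"
  shows "Dlow j w q \<le> Ff j w J"
  unfolding Ff_def using assms Dlow_le[of w _ "length J" j] fdists_dists
  by (intro cSup_upper bdd_aboveI2[where M="(\<Sum>i<j. w i) * (real (length J) * lnA)"]) auto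

lemma Ff_le:
  assumes "J \<in> prw j ` L" "\<And>q. q \<in> fdists j J \<Longrightarrow> Dlow j w q \<le> c"
  shows "Ff j w J \<le> c"
  unfolding Ff_def using assms fdists_nonempty by (intro cSup_least) auto

lemma Ff_near_max:
  assumes "\<And>i. 0 \<le> w i" "J \<in> prw j ` L"
  obtains q where "q \<in> fdists j J" "Ff j w J - 1 < Dlow j w q"
  using less_cSupD[of "Dlow j w ` fdists j J" "Ff j w J - 1"] fdists_nonempty[OF assms(2)]
  unfolding Ff_def by auto

lemma Ff_convex:
  assumes J: "J \<in> prw j ` L" and w: "\<And>i. 0 \<le> w' i" "\<And>i. 0 \<le> w'' i"
    and mid: "\<And>i. i < j \<Longrightarrow> 2 * w i = w' i + w'' i"
  shows "2 * Ff j w J \<le> Ff j w' J + Ff j w'' J"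
proof -
  have "Ff j w J \<le> (Ff j w' J + Ff j w'' J) / 2"
  proof (rule Ff_le[OF J])
    fix q assume q: "q \<in> fdists j J"
    have "2 * Dlow j w q = (\<Sum>i<j. (w' i + w'' i) * Hl i q)"
      unfolding Dlow_def sum_distrib_left using mid by (intro sum.cong refl) (simp flip: mult.assoc)
    also have "\<dots> = Dlow j w' q + Dlow j w'' q" by (simp add: Dlow_def distrib_right sum.distrib)
    also have "\<dots> \<le> Ff j w' J + Ff j w'' J" using w q by (intro add_mono Dlow_le_Ff)
    finally show "Dlow j w q \<le> (Ff j w' J + Ff j w'' J) / 2" by simp
  qed
  then show ?thesis by simp
qed

lemma Ff_scale_le:
  assumes J: "J \<in> prw j ` L" and w: "\<And>i. 0 \<le> w i" and c: "0 \<le> c"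
    and s: "\<And>i. i < j \<Longrightarrow> w' i = c * w i"
  shows "Ff j w' J \<le> c * Ff j w J"
proof (rule Ff_le[OF J])
  fix q assume q: "q \<in> fdists j J"
  have "Dlow j w' q = c * Dlow j w q"
    unfolding Dlow_def sum_distrib_left using s by (intro sum.cong refl) simp
  also have "\<dots> \<le> c * Ff j w J" using c w q by (intro mult_left_mono Dlow_le_Ff)
  finally show "Dlow j w' q \<le> c * Ff j w J" .
qed

lemma Ff_scale:
  assumes J: "J \<in> prw j ` L" and w: "\<And>i. 0 \<le> w i" "\<And>i. 0 \<le> w' i" and c: "0 < c"
    and s: "\<And>i. i < j \<Longrightarrow> w' i = c * w i"
  shows "Ff j w' J = c * Ff j w J"
proof (rule antisym)
  show "Ff j w' J \<le> c * Ff j w J" using assms by (intro Ff_scale_le) auto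
  have "Ff j w J \<le> (1 / c) * Ff j w' J" using assms by (intro Ff_scale_le) auto
  then show "c * Ff j w J \<le> Ff j w' J" using c by (simp add: field_simps)
qed

lemma Ff_submult:
  assumes uv: "u @ v \<in> prw j ` L" and w: "\<And>i. 0 \<le> w i"
  shows "Ff j w (u @ v) \<le> Ff j w u + Ff j w v"
proof (rule Ff_le[OF uv])
  fix q assume q: "q \<in> fdists j (u @ v)"
  let ?a = "length u"
  have d: "q \<in> dists (?a + length v)" using fdists_dists[OF q] by simp
  have "take ?a x \<in> fib j u \<and> drop ?a x \<in> fib j v" if "x \<in> set_pmf q" for x
    using that q L_append[of "take ?a x" "drop ?a x"]
    by (auto simp: fdists_def fib_def prw_def take_map[symmetric] drop_map[symmetric])
  then have "map_pmf (take ?a) q \<in> fdists j u" "map_pmf (drop ?a) q \<in> fdists j v"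
    by (auto simp: fdists_def)
  then have "Dlow j w (map_pmf (take ?a) q) + Dlow j w (map_pmf (drop ?a) q) \<le> Ff j w u + Ff j w v"
    using w by (intro add_mono Dlow_le_Ff)
  moreover have "Dlow j w q \<le> Dlow j w (map_pmf (take ?a) q) + Dlow j w (map_pmf (drop ?a) q)"
    unfolding Dlow_def sum.distrib[symmetric] distrib_left[symmetric]
    using w Hl_split[OF d] by (intro sum_mono mult_left_mono)
  ultimately show "Dlow j w q \<le> Ff j w u + Ff j w v" by linarith
qed

text \<open>The connecting word depends on the two words to be linked, so gluing two fibres
  independently does not end in one fibre. Conditioning on the projection of the connecting word
  repairs this; there are finitely many of these, so the conditioning costs a bounded amount of
  entropy.\<close>

lemma Ff_quasi:
  assumes w: "\<And>i. 0 \<le> w i"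
  obtains C where "\<And>I J. I \<in> prw j ` L \<Longrightarrow> J \<in> prw j ` L \<Longrightarrow>
    \<exists>z. length z \<le> p \<and> I @ z @ J \<in> prw j ` L \<and> Ff j w I + Ff j w J \<le> Ff j w (I @ z @ J) + C"
proof -
  define Z where "Z = {z. set z \<subseteq> pr j ` A \<and> length z \<le> p}"
  have finZ: "finite Z" unfolding Z_def using finite_A by (intro finite_lists_length_le) auto
  define c where "c = ln (real (card Z)) + ln (real p + 1)"
  define C where "C = (\<Sum>i<j. w i) * c + 2"
  have "\<exists>z. length z \<le> p \<and> I @ z @ J \<in> prw j ` L \<and> Ff j w I + Ff j w J \<le> Ff j w (I @ z @ J) + C"
    if I: "I \<in> prw j ` L" and J: "J \<in> prw j ` L" for I J
  proof -
    obtain q where q: "q \<in> fdists j I" "Ff j w I - 1 < Dlow j w q" using Ff_near_max w I by blast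
    obtain r where r: "r \<in> fdists j J" "Ff j w J - 1 < Dlow j w r" using Ff_near_max w J by blast
    let ?P = "pair_pmf q r"
    let ?l = "\<lambda>x. length (lk (fst x) (snd x))"
    let ?k = "\<lambda>x. prw j (lk (fst x) (snd x))"
    let ?g = "\<lambda>x. fst x @ lk (fst x) (snd x) @ snd x"
    have fq: "finite (set_pmf q)" "finite (set_pmf r)"
      using fdists_dists[OF q(1)] fdists_dists[OF r(1)] finite_dists by blast+
    then have fin: "finite (set_pmf ?P)" by simp
    have x: "fst x \<in> fib j I" "snd x \<in> fib j J" if "x \<in> set_pmf ?P" for x
      using that q r by (auto simp: fdists_def)
    have len: "length (fst x) = length I" "length (snd x) = length J" if "x \<in> set_pmf ?P" for x
      using x[OF that] by (auto simp: fib_def)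
    have lkx: "?l x \<le> p" "?g x \<in> L" if "x \<in> set_pmf ?P" for x
      using lk[of "fst x" "snd x"] x[OF that] by (auto simp: fib_def)
    have kZ: "?k x \<in> Z" if "x \<in> set_pmf ?P" for x
    proof -
      have "lk (fst x) (snd x) \<in> L" using lkx(2)[OF that] L_append by blast
      then show ?thesis using lkx(1)[OF that] L_lists by (auto simp: Z_def prw_def lists_eq_set)
    qed
    define K where "K = map_pmf ?k ?P"
    define cp where "cp z = cond_pmf ?P (?k -` {z})" for z
    have SK: "set_pmf K \<subseteq> Z" using kZ by (auto simp: K_def)
    have finK: "finite (set_pmf K)" using SK finZ finite_subset by blast
    have scp: "set_pmf (cp z) = set_pmf ?P \<inter> ?k -` {z}" if "z \<in> set_pmf K" for z
      unfolding cp_def using that by (intro set_cond_pmf) (auto simp: K_def)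
    have fcp: "finite (set_pmf (cp z))" if "z \<in> set_pmf K" for z using scp[OF that] fin by simp
    have Pb: "?P = bind_pmf K cp" unfolding K_def cp_def by (rule bind_cond_fibre[symmetric])
    define t where "t z = map_pmf ?g (cp z)" for z
    have H: "Hl i q + Hl i r \<le> (\<integral>z. Hl i (t z) \<partial>measure_pmf K) + c" for i
    proof -
      have "Hl i q + Hl i r = ent (pair_pmf (map_pmf (prw i) q) (map_pmf (prw i) r))"
        unfolding Hl_def using fq by (subst ent_pair_pmf) auto
      also have "\<dots> = ent (map_pmf (\<lambda>x. (prw i (fst x), prw i (snd x))) ?P)"
        by (simp add: map_pair[symmetric] case_prod_unfold)
      also have "\<dots> \<le> ent (map_pmf (\<lambda>x. (?l x, prw i (?g x))) ?P)"
      proof (rule ent_map_mono[OF fin, where h="\<lambda>(l, z). (take (length I) z, drop (length I + l) z)"])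
        fix x assume "x \<in> set_pmf ?P"
        then show "(prw i (fst x), prw i (snd x)) = (case (?l x, prw i (?g x)) of (l, z) \<Rightarrow> (take (length I) z, drop (length I + l) z))"
          using len[of x] by (simp add: prw_append)
      qed
      also have "\<dots> \<le> ent (map_pmf ?l ?P) + ent (map_pmf (\<lambda>x. prw i (?g x)) ?P)" by (rule ent_Pair_le[OF fin])
      also have "ent (map_pmf ?l ?P) \<le> ln (real (card {..p}))"
        using lkx by (intro ent_le_ln_card) auto
      also have "map_pmf (\<lambda>x. prw i (?g x)) ?P = bind_pmf K (\<lambda>z. map_pmf (prw i) (t z))"
        by (subst Pb) (simp add: map_bind_pmf t_def map_pmf_comp)
      also have "ent \<dots> \<le> ent K + (\<integral>z. ent (map_pmf (prw i) (t z)) \<partial>measure_pmf K)"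
        using finK fcp by (intro ent_bind_le) (auto simp: t_def)
      also have "ent K \<le> ln (real (card Z))" using finZ SK by (rule ent_le_ln_card)
      finally show ?thesis by (simp add: c_def Hl_def add.commute)
    qed
    have "Dlow j w q + Dlow j w r \<le> (\<Sum>i<j. w i * ((\<integral>z. Hl i (t z) \<partial>measure_pmf K) + c))"
      unfolding Dlow_def sum.distrib[symmetric] distrib_left[symmetric]
      using w H by (intro sum_mono mult_left_mono)
    also have "\<dots> = (\<integral>z. Dlow j w (t z) \<partial>measure_pmf K) + (\<Sum>i<j. w i) * c"
      unfolding Dlow_def using finK
      by (simp add: distrib_left sum.distrib sum_distrib_right integrable_measure_pmf_finite)
    finally have avg: "Dlow j w q + Dlow j w r - (\<Sum>i<j. w i) * c \<le> (\<integral>z. Dlow j w (t z) \<partial>measure_pmf K)" by simp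
    \<comment> \<open>Some projected connecting word does at least as well as the average, with one
      \<open>z\<close> for the whole weighted sum over levels.\<close>
    have "\<exists>z\<in>set_pmf K. Dlow j w q + Dlow j w r - (\<Sum>i<j. w i) * c \<le> Dlow j w (t z)"
    proof (rule ccontr)
      assume neg: "\<not> ?thesis"
      define m where "m = Max ((\<lambda>z. Dlow j w (t z)) ` set_pmf K)"
      have "(\<integral>z. Dlow j w (t z) \<partial>measure_pmf K) \<le> (\<integral>z. m \<partial>measure_pmf K)"
        using finK by (intro integral_pmf_mono) (auto simp: m_def)
      moreover have "m \<in> (\<lambda>z. Dlow j w (t z)) ` set_pmf K"
        unfolding m_def using finK set_pmf_not_empty by (intro Max_in) auto
      ultimately show False using neg avg by auto
    qed
    then obtain z where z: "z \<in> set_pmf K" "Dlow j w q + Dlow j w r - (\<Sum>i<j. w i) * c \<le> Dlow j w (t z)" by blast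
    have tz: "t z \<in> fdists j (I @ z @ J)"
      using scp[OF z(1)] x lkx(2) by (fastforce simp: fdists_def t_def fib_def prw_append)
    obtain y where "y \<in> set_pmf (t z)" using set_pmf_not_empty by fast
    then have "y \<in> L" "prw j y = I @ z @ J" using tz by (auto simp: fdists_def fib_def)
    then have "I @ z @ J \<in> prw j ` L" by (metis image_eqI)
    moreover have "length z \<le> p" using z(1) SK by (auto simp: Z_def)
    moreover have "Ff j w I + Ff j w J \<le> Ff j w (I @ z @ J) + C"
      using z(2) q(2) r(2) Dlow_le_Ff[of w "t z" j "I @ z @ J", OF w tz] by (simp add: C_def)
    ultimately show ?thesis by blast
  qed
  then show ?thesis using that by blast
qed

lemma chain_fibre:
  assumes q: "q \<in> dists b" and ij: "i \<le> j"
  shows "Hl i q = Hl j q + (\<integral>J. Hl i (cond_pmf q (prw j -` {J})) \<partial>measure_pmf (map_pmf (prw j) q))"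
proof -
  let ?K = "map_pmf (prw j) q"
  let ?c = "\<lambda>J. cond_pmf q (prw j -` {J})"
  have fin: "finite (set_pmf q)" using finite_dists[OF q] .
  have sc: "set_pmf (?c J) = set_pmf q \<inter> prw j -` {J}" if "J \<in> set_pmf ?K" for J
    using that by (intro set_cond_pmf) auto
  have "Hl i q = ent (bind_pmf ?K (\<lambda>J. map_pmf (prw i) (?c J)))"
    by (simp add: Hl_def map_bind_pmf[symmetric] bind_cond_fibre)
  also have "\<dots> = ent ?K + (\<integral>J. ent (map_pmf (prw i) (?c J)) \<partial>measure_pmf ?K)"
  proof (rule ent_bind_eq)
    show "prw j x = J" if "J \<in> set_pmf ?K" "x \<in> set_pmf (map_pmf (prw i) (?c J))" for x J
      using that(2) sc[OF that(1)] ij by (auto simp: prw_prw)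
    show "finite (set_pmf (map_pmf (prw i) (?c J)))" if "J \<in> set_pmf ?K" for J
      using sc[OF that] fin by simp
  qed (use fin in simp)
  finally show ?thesis by (simp add: Hl_def)
qed

lemma cond_fdists:
  assumes "q \<in> dists b" "J \<in> set_pmf (map_pmf (prw j) q)"
  shows "cond_pmf q (prw j -` {J}) \<in> fdists j J"
proof -
  have "set_pmf (cond_pmf q (prw j -` {J})) = set_pmf q \<inter> prw j -` {J}"
    using assms(2) by (intro set_cond_pmf) auto
  then show ?thesis using distsD[OF assms(1)] by (auto simp: fdists_def fib_def words_def)
qed

lemma Dlow_chain_le:
  assumes q: "q \<in> dists b" and w: "\<And>i. 0 \<le> w i"
  shows "Dlow j w q \<le> (\<Sum>i<j. w i) * Hl j q + (\<integral>J. Ff j w J \<partial>measure_pmf (map_pmf (prw j) q))"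
proof -
  let ?K = "map_pmf (prw j) q"
  let ?c = "\<lambda>J. cond_pmf q (prw j -` {J})"
  have finK: "finite (set_pmf ?K)" using finite_dists[OF q] by simp
  have "Dlow j w q = (\<Sum>i<j. w i * (Hl j q + (\<integral>J. Hl i (?c J) \<partial>measure_pmf ?K)))"
    unfolding Dlow_def using chain_fibre[OF q] by (intro sum.cong refl) (metis lessThan_iff less_imp_le)
  also have "\<dots> = (\<Sum>i<j. w i) * Hl j q + (\<integral>J. Dlow j w (?c J) \<partial>measure_pmf ?K)"
    unfolding Dlow_def by (rule sum_weighted_integral[OF finK])
  also have "(\<integral>J. Dlow j w (?c J) \<partial>measure_pmf ?K) \<le> (\<integral>J. Ff j w J \<partial>measure_pmf ?K)"
    using w cond_fdists[OF q] by (intro integral_pmf_mono finK Dlow_le_Ff) auto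
  finally show ?thesis by simp
qed


section \<open>Partition functions over projected words\<close>

definition wle :: "nat \<Rightarrow> (nat \<Rightarrow> real) \<Rightarrow> nat \<Rightarrow> real" where
  "wle j w i = (if i \<le> j then w i else 0)"

lemma wle_nonneg: "(\<And>i. 0 \<le> w i) \<Longrightarrow> 0 \<le> wle j w i"
  by (simp add: wle_def)

lemma sum_wle: "j < s \<Longrightarrow> (\<Sum>i<s. wle j w i * f i) = (\<Sum>i\<le>j. w i * f i)"
  by (intro sum.mono_neutral_cong_right) (auto simp: wle_def)

lemma Dw_wle: "j < s \<Longrightarrow> Dw (wle j w) q = Dlow j w q + w j * Hl j q"
  unfolding Dw_def Dlow_def by (simp add: sum_wle lessThan_Suc_atMost[symmetric])

text \<open>One half of a variational principle. By the chain rule at level \<open>j\<close>, a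
  distribution splits into its projection, whose entropy has the total weight as coefficient, and
  fibre parts bounded by \<open>Ff\<close>. Gibbs' inequality then bounds the sum by the logarithm
  of the partition function.\<close>

lemma Zl_wle_le:
  assumes j: "j < s" and w: "\<And>i. 0 \<le> w i" and W: "0 < (\<Sum>i\<le>j. w i)"
  shows "Zl (wle j w) b \<le> (\<Sum>i\<le>j. w i) * ln (\<Sum>J\<in>prw j ` words b. exp (Ff j w J / (\<Sum>i\<le>j. w i)))"
proof (rule Zl_le)
  fix q assume q: "q \<in> dists b"
  let ?W = "\<Sum>i\<le>j. w i"
  let ?K = "map_pmf (prw j) q"
  have "ent ?K \<le> (\<integral>J. - ln (exp (Ff j w J / ?W)) \<partial>measure_pmf ?K) + ln (\<Sum>J\<in>prw j ` words b. exp (Ff j w J / ?W))"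
    using q by (intro gibbs_ineq) (auto simp: dists_def)
  also have "(\<integral>J. - ln (exp (Ff j w J / ?W)) \<partial>measure_pmf ?K) = - (\<integral>J. Ff j w J \<partial>measure_pmf ?K) / ?W"
    by simp
  finally have "?W * Hl j q \<le> ?W * (- (\<integral>J. Ff j w J \<partial>measure_pmf ?K) / ?W + ln (\<Sum>J\<in>prw j ` words b. exp (Ff j w J / ?W)))"
    using W unfolding Hl_def by (intro mult_left_mono) auto
  also have "\<dots> = - (\<integral>J. Ff j w J \<partial>measure_pmf ?K) + ?W * ln (\<Sum>J\<in>prw j ` words b. exp (Ff j w J / ?W))"
    using W by (simp add: right_diff_distrib)
  finally show "Dw (wle j w) q \<le> ?W * ln (\<Sum>J\<in>prw j ` words b. exp (Ff j w J / ?W))"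
    using Dlow_chain_le[of q b w j, OF q w]
    by (simp add: Dw_wle[OF j] lessThan_Suc_atMost[symmetric] distrib_right)
qed

text \<open>The other half: the Gibbs distribution on projected words, followed by a near-maximiser
  in every fibre. The defect 1 is that of the near-maximisers.\<close>

lemma Zl_wle_ge:
  assumes j: "j < s" and w: "\<And>i. 0 \<le> w i" and W: "0 < (\<Sum>i\<le>j. w i)"
  shows "(\<Sum>i\<le>j. w i) * ln (\<Sum>J\<in>prw j ` words b. exp (Ff j w J / (\<Sum>i\<le>j. w i))) \<le> Zl (wle j w) b + 1"
proof -
  let ?W = "\<Sum>i\<le>j. w i" and ?S = "prw j ` words b"
  let ?g = "\<lambda>J. exp (Ff j w J / ?W)"
  define G where "G = sum ?g ?S"
  have G: "0 < G" unfolding G_def by (intro sum_pos) auto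
  obtain r where r: "set_pmf r = ?S" "\<And>J. J \<in> ?S \<Longrightarrow> pmf r J = ?g J / G"
    using weighted_pmf_exists[of ?S ?g] unfolding G_def by auto
  have "\<exists>q. J \<in> ?S \<longrightarrow> q \<in> fdists j J \<and> Ff j w J - 1 < Dlow j w q" for J
  proof (cases "J \<in> ?S")
    case True
    then have "J \<in> prw j ` L" by (auto simp: words_def)
    then show ?thesis using Ff_near_max[of w J j] w by metis
  qed simp
  then obtain k where k: "\<And>J. J \<in> ?S \<Longrightarrow> k J \<in> fdists j J \<and> Ff j w J - 1 < Dlow j w (k J)" by metis
  have finr: "finite (set_pmf r)" using r(1) by simp
  have fink: "finite (set_pmf (k J))" if "J \<in> ?S" for J
    using k[OF that] fdists_dists finite_dists by blast
  define q where "q = bind_pmf r k"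
  have q: "q \<in> dists b"
  proof -
    have "set_pmf (k J) \<subseteq> words b" if "J \<in> ?S" for J
      using that k[OF that] fdists_dists[of "k J" j J] by (auto simp: dists_def words_def)
    then show ?thesis by (auto simp: q_def dists_def r(1))
  qed
  have H: "Hl i q = ent r + (\<integral>J. Hl i (k J) \<partial>measure_pmf r)" if "i \<le> j" for i
    unfolding Hl_def q_def map_bind_pmf
  proof (rule ent_bind_eq[OF finr])
    show "finite (set_pmf (map_pmf (prw i) (k J)))" if "J \<in> set_pmf r" for J
      using fink that r(1) by simp
    show "prw j x = J" if "J \<in> set_pmf r" "x \<in> set_pmf (map_pmf (prw i) (k J))" for x J
      using that k[of J] r(1) \<open>i \<le> j\<close> by (auto simp: fdists_def fib_def prw_prw)
  qed
  have "ent r = (\<integral>J. ln G - Ff j w J / ?W \<partial>measure_pmf r)"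
    unfolding ent_def
  proof (intro integral_cong_AE, simp, simp, unfold AE_measure_pmf_iff, intro ballI)
    fix J assume "J \<in> set_pmf r"
    then show "- ln (pmf r J) = ln G - Ff j w J / ?W" using r G by (simp add: ln_div)
  qed
  also have "\<dots> = ln G - (\<integral>J. Ff j w J \<partial>measure_pmf r) / ?W"
    using finr by (simp add: integrable_measure_pmf_finite)
  finally have er: "?W * ent r = ?W * ln G - (\<integral>J. Ff j w J \<partial>measure_pmf r)"
    using W by (simp add: right_diff_distrib)
  have "(\<integral>J. Ff j w J - 1 \<partial>measure_pmf r) \<le> (\<integral>J. Dlow j w (k J) \<partial>measure_pmf r)"
    using k r(1) by (intro integral_pmf_mono finr) (auto intro: less_imp_le)
  then have "(\<integral>J. Ff j w J \<partial>measure_pmf r) - 1 \<le> (\<integral>J. Dlow j w (k J) \<partial>measure_pmf r)"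
    using finr by (simp add: integrable_measure_pmf_finite)
  moreover have "(\<integral>J. Dlow j w (k J) \<partial>measure_pmf r) + (\<Sum>i<j. w i) * ent r = Dlow j w q"
  proof -
    have "Dlow j w q = (\<Sum>i<j. w i * (ent r + (\<integral>J. Hl i (k J) \<partial>measure_pmf r)))"
      unfolding Dlow_def using H by (intro sum.cong) auto
    then show ?thesis
      unfolding Dlow_def using finr
      by (simp add: distrib_left sum.distrib sum_distrib_right integrable_measure_pmf_finite)
  qed
  moreover have "ent r \<le> Hl j q"
    using H[of j] by (simp add: integral_nonneg Hl_nonneg)
  then have "w j * ent r \<le> w j * Hl j q" using w by (intro mult_left_mono)
  moreover have "Dw (wle j w) q \<le> Zl (wle j w) b" using w q wle_nonneg by (intro Dw_le_Zl) auto
  ultimately have "?W * ln G \<le> Zl (wle j w) b + 1"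
    using er by (simp add: Dw_wle[OF j] lessThan_Suc_atMost[symmetric] distrib_right)
  then show ?thesis by (simp add: G_def)
qed

end

text \<open>Linearity of the pressure on an open cone \<open>S\<close> of weights upgrades entropy bounds to bounds for cardinalities.
  At each level, the induction perturbs a weight in both directions and compares the resulting weights of words.\<close>

locale rigid_lang = spec_lang +
  fixes S :: "(nat \<Rightarrow> real) set" and h :: "nat \<Rightarrow> real"
  assumes base_h: "base h"
    and S_nonneg: "w \<in> S \<Longrightarrow> 0 \<le> w i"
    and S_pos: "w \<in> S \<Longrightarrow> i < s \<Longrightarrow> 0 < w i"
    and S_open: "w \<in> S \<Longrightarrow> (\<And>i. s \<le> i \<Longrightarrow> u i = 0) \<Longrightarrow>
      \<exists>e>0. (\<lambda>i. w i + e * u i) \<in> S \<and> (\<lambda>i. w i - e * u i) \<in> S"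
    and S_lin: "w \<in> S \<Longrightarrow> Pr w = (\<Sum>i<s. w i * h i)"
    and S_nonempty: "S \<noteq> {}"
begin

definition ell :: "nat \<Rightarrow> (nat \<Rightarrow> real) \<Rightarrow> real" where
  "ell j w = (\<Sum>i\<le>j. w i * h i)"

text \<open>The growth rate of \<open>Ff j w\<close> to be expected from the rates \<open>h\<close>,
  as \<open>h i - h j\<close> is the rate of entropy at level \<open>i\<close> given level
  \<open>j\<close>. Similarly \<open>ell\<close> is the expected rate of
  \<open>Zl (wle j w)\<close>.\<close>

definition kap :: "nat \<Rightarrow> (nat \<Rightarrow> real) \<Rightarrow> real" where
  "kap j w = (\<Sum>i<j. w i * (h i - h j))"

text \<open>Only the upper bound with bounded error is asked for; the matching lower bound comes
  from \<open>base\<close>, see \<open>ell_lower\<close>.\<close>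

definition lin_at :: "nat \<Rightarrow> bool" where
  "lin_at j \<longleftrightarrow> (\<forall>w\<in>S. \<exists>C. \<forall>b. Zl (wle j w) b \<le> real b * ell j w + C)"

lemma W_pos: "w \<in> S \<Longrightarrow> j < s \<Longrightarrow> 0 < (\<Sum>i\<le>j. w i)"
  using S_pos by (intro sum_pos) auto

lemma lin_at_top: "lin_at (s - 1)"
  unfolding lin_at_def
proof
  fix w assume w: "w \<in> S"
  have ss: "{..s - 1} = {..<s}" using s_pos by auto
  have "Dw (wle (s - 1) w) = Dw w"
    using s_pos unfolding Dw_def by (intro ext sum.cong) (auto simp: wle_def)
  then have "Zl (wle (s - 1) w) b = Zl w b" for b by (simp add: Zl_def)
  moreover have "ell (s - 1) w = Pr w" using S_lin[OF w] unfolding ell_def ss by simp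
  ultimately show "\<exists>C. \<forall>b. Zl (wle (s - 1) w) b \<le> real b * ell (s - 1) w + C"
    using Zl_le_Pr[of w] S_nonneg[OF w] by (intro exI[of _ "Cw w"]) auto
qed

lemma ell_lower:
  assumes "w \<in> S" "j < s"
  shows "real b * ell j w - (\<Sum>i\<le>j. w i) \<le> Zl (wle j w) b"
  using base_lower[of h "wle j w" b, OF base_h] wle_nonneg S_nonneg[OF assms(1)] assms(2)
    sum_wle[of j w h] sum_wle[of j w "\<lambda>_. 1"] by (simp add: ell_def)

text \<open>Equal total weights up to level \<open>j\<close> give the three partition functions the
  same inverse temperature \<open>1 / W\<close>. After division by the expected growth,
  \<open>lin_at\<close> bounds them above and \<open>base\<close> bounds the one for
  \<open>w\<close> below, as \<open>weight_comparison\<close> requires.\<close>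

lemma fibre_comparison:
  assumes j: "j < s" and lin: "lin_at j" and W: "0 < W"
    and S: "w \<in> S" "w' \<in> S" "w'' \<in> S"
    and sW: "(\<Sum>i\<le>j. w i) = W" "(\<Sum>i\<le>j. w' i) = W" "(\<Sum>i\<le>j. w'' i) = W"
    and mid: "\<And>i. 2 * w i = w' i + w'' i"
  shows "\<exists>C. \<forall>J\<in>prw j ` L. Ff j w' J - real (length J) * ell j w' \<le> Ff j w J - real (length J) * ell j w + C"
proof -
  define a where "a w J = exp ((Ff j w J - real (length J) * ell j w) / W)" for w J
  note nn = S_nonneg
  have Wn: "{u \<in> prw j ` L. length u = n} = prw j ` words n" for n
    by (auto simp: words_def)
  have sum_a: "W * ln (sum (a v) (prw j ` words n)) = W * ln (\<Sum>J\<in>prw j ` words n. exp (Ff j v J / W)) - real n * ell j v"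
    for v n
  proof -
    have "sum (a v) (prw j ` words n) = (\<Sum>J\<in>prw j ` words n. exp (- (real n * ell j v) / W) * exp (Ff j v J / W))"
      by (intro sum.cong refl) (auto simp: a_def words_def diff_divide_distrib exp_diff exp_minus field_simps)
    also have "\<dots> = exp (- (real n * ell j v) / W) * (\<Sum>J\<in>prw j ` words n. exp (Ff j v J / W))"
      by (simp add: sum_distrib_left)
    finally have "sum (a v) (prw j ` words n) = exp (- (real n * ell j v) / W) * (\<Sum>J\<in>prw j ` words n. exp (Ff j v J / W))" .
    moreover have "0 < (\<Sum>J\<in>prw j ` words n. exp (Ff j v J / W))" by (intro sum_pos) auto
    ultimately show ?thesis using W by (simp add: ln_mult_pos right_diff_distrib)
  qed
  have spos: "0 < sum (a v) (prw j ` words n)" for v n by (intro sum_pos) (auto simp: a_def)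
  have up: "\<exists>C. \<forall>n. sum (a v) (prw j ` words n) \<le> C" if v: "v \<in> S" "(\<Sum>i\<le>j. v i) = W" for v
  proof -
    obtain C where C: "\<And>b. Zl (wle j v) b \<le> real b * ell j v + C" using lin v unfolding lin_at_def by blast
    have "sum (a v) (prw j ` words n) \<le> exp ((C + 1) / W)" for n
    proof -
      have "W * ln (\<Sum>J\<in>prw j ` words n. exp (Ff j v J / W)) \<le> Zl (wle j v) n + 1"
        using Zl_wle_ge[of j v n] j nn[OF v(1)] v(2) W by simp
      then have "W * ln (sum (a v) (prw j ` words n)) \<le> C + 1" using sum_a[of v n] C[of n] by linarith
      then have "ln (sum (a v) (prw j ` words n)) \<le> (C + 1) / W" using W by (simp add: field_simps)
      then show ?thesis using spos[of v n] by (metis exp_le_cancel_iff exp_ln)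
    qed
    then show ?thesis by blast
  qed
  obtain C0 C1 C2 where C: "\<And>n. sum (a w) (prw j ` words n) \<le> C0" "\<And>n. sum (a w') (prw j ` words n) \<le> C1"
    "\<And>n. sum (a w'') (prw j ` words n) \<le> C2"
    using up[OF S(1) sW(1)] up[OF S(2) sW(2)] up[OF S(3) sW(3)] by metis
  have low: "exp (- 1) \<le> sum (a w) (prw j ` words n)" for n
  proof -
    have "Zl (wle j w) n \<le> W * ln (\<Sum>J\<in>prw j ` words n. exp (Ff j w J / W))"
      using Zl_wle_le[of j w n] j nn[OF S(1)] sW(1) W by simp
    then have "- W \<le> W * ln (sum (a w) (prw j ` words n))"
      using sum_a[of w n] ell_lower[OF S(1) j, of n] sW(1) by linarith
    then have "W * (- 1) \<le> W * ln (sum (a w) (prw j ` words n))" by simp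
    then have "- 1 \<le> ln (sum (a w) (prw j ` words n))" using W by (rule mult_le_cancel_left_pos[THEN iffD1, rotated])
    then show ?thesis using spos[of w n] by (metis exp_le_cancel_iff exp_ln)
  qed
  obtain Cq where Cq: "\<And>I J. I \<in> prw j ` L \<Longrightarrow> J \<in> prw j ` L \<Longrightarrow>
    \<exists>z. length z \<le> p \<and> I @ z @ J \<in> prw j ` L \<and> Ff j w' I + Ff j w' J \<le> Ff j w' (I @ z @ J) + Cq"
    using Ff_quasi[of w' j] nn[OF S(2)] by metis
  define Ct where "Ct = max C0 (max C1 C2)"
  \<comment> \<open>Loss from \<open>Ff_quasi\<close>, plus the normalisation of up to
    \<open>p\<close> additional connecting letters.\<close>
  define cc where "cc = exp (- (Cq + real p * \<bar>ell j w'\<bar>) / W)"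
  interpret weight_comparison "prw j ` L" "a w" "a w'" "a w''" p cc "exp (- 1)" Ct
  proof
    fix u v assume uv: "u @ v \<in> prw j ` L"
    then obtain x where x: "x \<in> L" "u @ v = prw j x" by auto
    have "take (length u) (prw j x) = u" "drop (length u) (prw j x) = v"
      unfolding x(2)[symmetric] by simp_all
    then have "u = prw j (take (length u) x)" "v = prw j (drop (length u) x)"
      by (simp_all add: prw_def take_map drop_map)
    then show "u \<in> prw j ` L \<and> v \<in> prw j ` L"
      using L_append[of "take (length u) x" "drop (length u) x"] x(1) by auto
    show "a w (u @ v) \<le> a w u * a w v"
      using Ff_submult[OF uv, of w] nn[OF S(1)] W
      by (simp add: a_def exp_add[symmetric] add_divide_distrib[symmetric] divide_right_mono algebra_simps)
  next
    fix u v assume u: "u \<in> prw j ` L" and v: "v \<in> prw j ` L"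
    obtain z where z: "length z \<le> p" "u @ z @ v \<in> prw j ` L" "Ff j w' u + Ff j w' v \<le> Ff j w' (u @ z @ v) + Cq"
      using Cq[OF u v] by blast
    have "real (length z) * ell j w' \<le> real p * \<bar>ell j w'\<bar>"
      using z(1) by (intro order_trans[OF mult_left_mono[OF abs_ge_self] mult_right_mono]) auto
    then have "- (Cq + real p * \<bar>ell j w'\<bar>) + (Ff j w' u - real (length u) * ell j w') + (Ff j w' v - real (length v) * ell j w')
      \<le> Ff j w' (u @ z @ v) - real (length (u @ z @ v)) * ell j w'"
      using z(3) by (simp add: algebra_simps)
    then have "cc * a w' u * a w' v \<le> a w' (u @ z @ v)"
      using W unfolding cc_def a_def exp_add[symmetric] add_divide_distrib[symmetric]
      by (simp only: exp_le_cancel_iff divide_right_mono less_imp_le)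
    then show "\<exists>z. length z \<le> p \<and> u @ z @ v \<in> prw j ` L \<and> cc * a w' u * a w' v \<le> a w' (u @ z @ v)"
      using z by blast
  next
    fix u assume u: "u \<in> prw j ` L"
    have "2 * ell j w = ell j w' + ell j w''"
      unfolding ell_def sum_distrib_left sum.distrib[symmetric]
      using mid by (intro sum.cong refl) (metis distrib_right mult.assoc)
    then have "real (length u) * (2 * ell j w) = real (length u) * (ell j w' + ell j w'')" by simp
    moreover have "2 * Ff j w u \<le> Ff j w' u + Ff j w'' u"
      using Ff_convex[OF u, of w' w'' w] nn S mid by blast
    ultimately have "(Ff j w u - real (length u) * ell j w) + (Ff j w u - real (length u) * ell j w)
      \<le> (Ff j w' u - real (length u) * ell j w') + (Ff j w'' u - real (length u) * ell j w'')"
      by (simp add: algebra_simps)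
    then show "(a w u)\<^sup>2 \<le> a w' u * a w'' u"
      using W unfolding power2_eq_square a_def exp_add[symmetric] add_divide_distrib[symmetric]
      by (simp only: exp_le_cancel_iff divide_right_mono less_imp_le)
  next
    show "(\<Sum>u\<in>{u \<in> prw j ` L. length u = n}. a w u) \<le> Ct" for n
      using C(1)[of n] by (simp add: Wn Ct_def)
    show "(\<Sum>u\<in>{u \<in> prw j ` L. length u = n}. a w' u) \<le> Ct" for n
      using C(2)[of n] by (simp add: Wn Ct_def)
    show "(\<Sum>u\<in>{u \<in> prw j ` L. length u = n}. a w'' u) \<le> Ct" for n
      using C(3)[of n] by (simp add: Wn Ct_def)
    show "exp (- 1) \<le> (\<Sum>u\<in>{u \<in> prw j ` L. length u = n}. a w u)" for n
      using low[of n] by (simp add: Wn)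
    show "finite {u \<in> prw j ` L. length u = n}" for n by (simp add: Wn)
  qed (auto simp: a_def cc_def p_pos)
  obtain K where K: "0 < K" "\<And>J. J \<in> prw j ` L \<Longrightarrow> a w' J \<le> K * a w J" using comparison by blast
  have "Ff j w' J - real (length J) * ell j w' \<le> Ff j w J - real (length J) * ell j w + W * ln K"
    if J: "J \<in> prw j ` L" for J
  proof -
    have "a w' J \<le> exp (ln K + (Ff j w J - real (length J) * ell j w) / W)"
      using K(2)[OF J] K(1) by (simp add: a_def exp_add)
    then have "(Ff j w' J - real (length J) * ell j w') / W \<le> ln K + (Ff j w J - real (length J) * ell j w) / W"
      unfolding a_def exp_le_cancel_iff .
    then have "W * ((Ff j w' J - real (length J) * ell j w') / W) \<le> W * (ln K + (Ff j w J - real (length J) * ell j w) / W)"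
      using W by (intro mult_left_mono) auto
    then show ?thesis using W by (simp add: distrib_left)
  qed
  then show ?thesis by blast
qed

text \<open>\<open>Ff j\<close> sees only the weights below \<open>j\<close>. These are multiplied
  by \<open>1 + e\<close> and by \<open>1 - e\<close>, with the weight at \<open>j\<close>
  compensating so that the total stays \<open>W\<close>. By homogeneity, the two instances of
  \<open>fibre_comparison\<close> bound the same deviation from above and from below.\<close>

lemma fibre_linear:
  assumes j: "j < s" and lin: "lin_at j" and w: "w \<in> S"
  shows "\<exists>C. \<forall>J\<in>prw j ` L. \<bar>Ff j w J - real (length J) * kap j w\<bar> \<le> C"
proof (cases "j = 0")
  case True
  have "Ff j w J = 0" if J: "J \<in> prw j ` L" for J
  proof (rule antisym)
    show "Ff j w J \<le> 0" using True by (intro Ff_le[OF J]) (simp add: Dlow_def)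
    obtain q where "q \<in> fdists j J" using fdists_nonempty[OF J] by blast
    then show "0 \<le> Ff j w J" using Dlow_le_Ff[of w q j J] S_nonneg[OF w] True by (simp add: Dlow_def)
  qed
  then show ?thesis using True by (intro exI[of _ 0]) (simp add: kap_def)
next
  case False
  define u where "u i = (if i < j then w i else if i = j then - (\<Sum>i<j. w i) else 0)" for i
  have "\<And>i. s \<le> i \<Longrightarrow> u i = 0" using j by (auto simp: u_def)
  then obtain e where e: "0 < e" "(\<lambda>i. w i + e * u i) \<in> S" "(\<lambda>i. w i - e * u i) \<in> S"
    using S_open[OF w, of u] by blast
  define wp where "wp = (\<lambda>i. w i + e * u i)"
  define wm where "wm = (\<lambda>i. w i - e * u i)"
  note S = w e(2,3)[folded wp_def wm_def]
  define W where "W = (\<Sum>i\<le>j. w i)"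
  have W: "0 < W" unfolding W_def by (rule W_pos[OF w j])
  have su: "(\<Sum>i\<le>j. u i) = 0" "(\<Sum>i\<le>j. u i * h i) = kap j w"
    by (simp_all add: lessThan_Suc_atMost[symmetric] u_def kap_def right_diff_distrib sum_subtractf sum_distrib_right)
  have sW: "(\<Sum>i\<le>j. w i) = W" "(\<Sum>i\<le>j. wp i) = W" "(\<Sum>i\<le>j. wm i) = W"
    using su(1) by (simp_all add: W_def wp_def wm_def sum.distrib sum_subtractf sum_distrib_left[symmetric])
  have el: "ell j wp = ell j w + e * kap j w" "ell j wm = ell j w - e * kap j w"
    unfolding su(2)[symmetric]
    by (simp_all add: ell_def wp_def wm_def distrib_right left_diff_distrib sum.distrib sum_subtractf sum_distrib_left mult.assoc)
  have e1: "e < 1"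
  proof -
    have "0 < wm 0" using S_pos[OF S(3)] j by simp
    then have "0 < (1 - e) * w 0" using False by (simp add: wm_def u_def left_diff_distrib)
    then show ?thesis using S_pos[OF w, of 0] j by (simp add: zero_less_mult_iff)
  qed
  have mid: "2 * w i = wp i + wm i" "2 * w i = wm i + wp i" for i by (simp_all add: wp_def wm_def)
  obtain C1 where C1: "\<And>J. J \<in> prw j ` L \<Longrightarrow> Ff j wp J - real (length J) * ell j wp \<le> Ff j w J - real (length J) * ell j w + C1"
    using fibre_comparison[OF j lin W S(1,2,3) sW(1,2,3) mid(1)] by blast
  obtain C2 where C2: "\<And>J. J \<in> prw j ` L \<Longrightarrow> Ff j wm J - real (length J) * ell j wm \<le> Ff j w J - real (length J) * ell j w + C2"
    using fibre_comparison[OF j lin W S(1,3,2) sW(1,3,2) mid(2)] by blast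
  have "\<bar>Ff j w J - real (length J) * kap j w\<bar> \<le> max C1 C2 / e" if J: "J \<in> prw j ` L" for J
  proof -
    have "Ff j wp J = (1 + e) * Ff j w J"
      using e(1) S_nonneg[OF w] S_nonneg[OF S(2)]
      by (intro Ff_scale[OF J]) (auto simp: wp_def u_def distrib_right)
    then have "e * (Ff j w J - real (length J) * kap j w) \<le> C1"
      using C1[OF J] by (simp add: el algebra_simps)
    then have 1: "e * (Ff j w J - real (length J) * kap j w) \<le> max C1 C2" by linarith
    have "Ff j wm J = (1 - e) * Ff j w J"
      using e1 S_nonneg[OF w] S_nonneg[OF S(3)]
      by (intro Ff_scale[OF J]) (auto simp: wm_def u_def left_diff_distrib)
    then have "- (e * (Ff j w J - real (length J) * kap j w)) \<le> C2"
      using C2[OF J] by (simp add: el algebra_simps)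
    then have 2: "- (e * (Ff j w J - real (length J) * kap j w)) \<le> max C1 C2" by linarith
    have "e * \<bar>Ff j w J - real (length J) * kap j w\<bar> \<le> max C1 C2"
      using 1 2 e(1) by (metis abs_le_iff abs_mult abs_of_pos)
    then show ?thesis using e(1) by (simp add: field_simps)
  qed
  then show ?thesis by blast
qed

text \<open>By \<open>fibre_linear\<close> all summands of the partition function at level
  \<open>j\<close> agree up to a bounded factor, so the bound for the sum bounds their
  number.\<close>

lemma card_prw_upper:
  assumes j: "j < s" and lin: "lin_at j"
  shows "\<exists>C. \<forall>n. ln (real (card (prw j ` words n))) \<le> real n * h j + C"
proof -
  obtain w where w: "w \<in> S" using S_nonempty by blast
  define W where "W = (\<Sum>i\<le>j. w i)"
  have W: "0 < W" unfolding W_def by (rule W_pos[OF w j])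
  obtain C1 where C1: "\<And>J. J \<in> prw j ` L \<Longrightarrow> \<bar>Ff j w J - real (length J) * kap j w\<bar> \<le> C1"
    using fibre_linear[OF j lin w] by blast
  obtain C2 where C2: "\<And>b. Zl (wle j w) b \<le> real b * ell j w + C2" using lin w unfolding lin_at_def by blast
  have lW: "ell j w - kap j w = h j * W"
    by (simp add: ell_def kap_def W_def lessThan_Suc_atMost[symmetric] right_diff_distrib sum_subtractf
        sum_distrib_left sum_distrib_right algebra_simps)
  have "ln (real (card (prw j ` words n))) \<le> real n * h j + (C1 + C2 + 1) / W" for n
  proof -
    let ?S = "prw j ` words n"
    have c0: "0 < card ?S" by (simp add: card_gt_0_iff)
    have "real (card ?S) * exp ((real n * kap j w - C1) / W) = (\<Sum>J\<in>?S. exp ((real n * kap j w - C1) / W))" by simp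
    also have "\<dots> \<le> (\<Sum>J\<in>?S. exp (Ff j w J / W))"
    proof (rule sum_mono)
      fix J assume "J \<in> ?S"
      then have "J \<in> prw j ` L" "length J = n" by (auto simp: words_def)
      then show "exp ((real n * kap j w - C1) / W) \<le> exp (Ff j w J / W)"
        using C1[of J] W by (simp add: divide_right_mono abs_le_iff)
    qed
    finally have "ln (real (card ?S) * exp ((real n * kap j w - C1) / W)) \<le> ln (\<Sum>J\<in>?S. exp (Ff j w J / W))"
      using c0 by (intro ln_mono) auto
    then have "ln (real (card ?S)) + (real n * kap j w - C1) / W \<le> ln (\<Sum>J\<in>?S. exp (Ff j w J / W))"
      using c0 by (simp add: ln_mult_pos)
    then have "W * (ln (real (card ?S)) + (real n * kap j w - C1) / W) \<le> W * ln (\<Sum>J\<in>?S. exp (Ff j w J / W))"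
      using W by (intro mult_left_mono) auto
    also have "\<dots> \<le> Zl (wle j w) n + 1"
      using Zl_wle_ge[of j w n] j S_nonneg[OF w] W by (simp add: W_def)
    also have "\<dots> \<le> real n * ell j w + C2 + 1" using C2[of n] by simp
    finally have "W * ln (real (card ?S)) \<le> real n * (ell j w - kap j w) + C1 + C2 + 1"
      using W by (simp add: distrib_left) (simp add: right_diff_distrib)
    also have "\<dots> = W * (real n * h j) + W * ((C1 + C2 + 1) / W)"
      unfolding lW using W by simp
    also have "\<dots> = W * (real n * h j + (C1 + C2 + 1) / W)" by (simp only: distrib_left)
    finally have "W * ln (real (card ?S)) \<le> W * (real n * h j + (C1 + C2 + 1) / W)" .
    then show ?thesis using W by simp
  qed
  then show ?thesis by blast
qed

text \<open>The chain rule at level \<open>Suc j\<close>: the fibres contribute linearly by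
  \<open>fibre_linear\<close>, and the entropy of the projection is bounded through the number of
  projected words.\<close>

lemma lin_at_step:
  assumes j: "Suc j < s" and lin: "lin_at (Suc j)"
  shows "lin_at j"
  unfolding lin_at_def
proof
  fix w assume w: "w \<in> S"
  obtain C1 where C1: "\<And>J. J \<in> prw (Suc j) ` L \<Longrightarrow> \<bar>Ff (Suc j) w J - real (length J) * kap (Suc j) w\<bar> \<le> C1"
    using fibre_linear[OF j lin w] by blast
  obtain C2 where C2: "\<And>n. ln (real (card (prw (Suc j) ` words n))) \<le> real n * h (Suc j) + C2"
    using card_prw_upper[OF j lin] by blast
  define V where "V = (\<Sum>i<Suc j. w i)"
  have V: "0 \<le> V" unfolding V_def using S_nonneg[OF w] by (intro sum_nonneg)
  have "Zl (wle j w) b \<le> real b * ell j w + (V * C2 + C1)" for b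
  proof (rule Zl_le)
    fix q assume q: "q \<in> dists b"
    have fin: "finite (set_pmf (map_pmf (prw (Suc j)) q))" using finite_dists[OF q] by simp
    have "Dw (wle j w) q = Dlow (Suc j) w q" using j Dw_wle[of j w q] by (simp add: Dlow_def)
    also have "\<dots> \<le> V * Hl (Suc j) q + (\<integral>J. Ff (Suc j) w J \<partial>measure_pmf (map_pmf (prw (Suc j)) q))"
      unfolding V_def using S_nonneg[OF w] by (intro Dlow_chain_le[OF q])
    also have "(\<integral>J. Ff (Suc j) w J \<partial>measure_pmf (map_pmf (prw (Suc j)) q))
      \<le> (\<integral>J. real b * kap (Suc j) w + C1 \<partial>measure_pmf (map_pmf (prw (Suc j)) q))"
    proof (rule integral_pmf_mono[OF fin])
      fix J assume "J \<in> set_pmf (map_pmf (prw (Suc j)) q)"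
      then have "J \<in> prw (Suc j) ` L" "length J = b" using distsD[OF q] by (auto simp: words_def)
      then show "Ff (Suc j) w J \<le> real b * kap (Suc j) w + C1" using C1[of J] by (simp add: abs_le_iff)
    qed
    also have "\<dots> = real b * kap (Suc j) w + C1" by simp
    also have "V * Hl (Suc j) q \<le> V * (real b * h (Suc j) + C2)"
      using Hl_le_ln_card[OF q, of "Suc j"] C2[of b] V by (intro mult_left_mono) auto
    finally have "Dw (wle j w) q \<le> real b * (V * h (Suc j) + kap (Suc j) w) + (V * C2 + C1)"
      by (simp add: algebra_simps)
    also have "V * h (Suc j) + kap (Suc j) w = ell j w"
      by (simp add: ell_def kap_def V_def lessThan_Suc_atMost[symmetric] right_diff_distrib sum_subtractf sum_distrib_right distrib_right del: sum.lessThan_Suc)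
    finally show "Dw (wle j w) q \<le> real b * ell j w + (V * C2 + C1)" .
  qed
  then show "\<exists>C. \<forall>b. Zl (wle j w) b \<le> real b * ell j w + C" by blast
qed

lemma lin_at_all: "j < s \<Longrightarrow> lin_at j"
proof -
  assume j: "j < s"
  have "j \<le> s - 1" using j by simp
  then show ?thesis
  proof (induction j rule: inc_induct)
    case (step n)
    show ?case by (rule lin_at_step) (use step j in auto)
  qed (rule lin_at_top)
qed

text \<open>For the uniform distribution on a fibre, the entropy at a level \<open>i < j\<close>
  falls short of the logarithm of the cardinality by at most what the level-\<open>i\<close> fibres
  contain, which induction bounds. The weighted sum of these entropies is at most
  \<open>Ff j w J\<close>, which \<open>fibre_linear\<close> controls.\<close>

lemma card_fib_upper:
  assumes "j < s"
  shows "\<exists>C. \<forall>J\<in>prw j ` L. ln (real (card (fib j J))) \<le> real (length J) * (h 0 - h j) + C"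
  using assms
proof (induction j rule: less_induct)
  case (less j)
  show ?case
  proof (cases "j = 0")
    case True
    have "ln (real (card (fib j J))) \<le> 0" if "J \<in> prw j ` L" for J
    proof -
      have "fib j J \<subseteq> {J}" using True by (auto simp: fib_def prw_0)
      then have "card (fib j J) \<le> 1" using card_mono[of "{J}" "fib j J"] by simp
      then show ?thesis by (cases "card (fib j J)") auto
    qed
    then show ?thesis using True by (intro exI[of _ 0]) simp
  next
    case False
    obtain w where w: "w \<in> S" using S_nonempty by blast
    have "\<forall>i. \<exists>C. i < j \<longrightarrow> (\<forall>J\<in>prw i ` L. ln (real (card (fib i J))) \<le> real (length J) * (h 0 - h i) + C)"
      using less by (meson less_trans)
    then obtain C where C: "\<And>i J. i < j \<Longrightarrow> J \<in> prw i ` L \<Longrightarrow> ln (real (card (fib i J))) \<le> real (length J) * (h 0 - h i) + C i"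
      by metis
    obtain C1 where C1: "\<And>J. J \<in> prw j ` L \<Longrightarrow> \<bar>Ff j w J - real (length J) * kap j w\<bar> \<le> C1"
      using fibre_linear[OF less.prems lin_at_all[OF less.prems] w] by blast
    define V where "V = (\<Sum>i<j. w i)"
    have V: "0 < V" unfolding V_def using False less.prems S_pos[OF w] by (intro sum_pos) auto
    define C2 where "C2 = (\<Sum>i<j. w i * C i) + C1"
    have "ln (real (card (fib j J))) \<le> real (length J) * (h 0 - h j) + C2 / V" if J: "J \<in> prw j ` L" for J
    proof -
      define n where "n = length J"
      define q where "q = pmf_of_set (fib j J)"
      have ne: "fib j J \<noteq> {}" using J by (auto simp: fib_def)
      have q: "q \<in> fdists j J" using ne by (simp add: q_def fdists_def)
      have qd: "q \<in> dists n" unfolding n_def by (rule fdists_dists[OF q])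
      have "prw 0 = id" by (simp add: prw_0 fun_eq_iff)
      then have pr0: "map_pmf (prw 0) q = q" by (simp add: pmf.map_id)
      have H0: "Hl 0 q = ln (real (card (fib j J)))"
        unfolding Hl_def pr0 using ne unfolding q_def ent_def
        by (subst integral_pmf_of_set) (auto simp: pmf_of_set ln_div card_gt_0_iff)
      have Hi: "ln (real (card (fib j J))) - real n * (h 0 - h i) - C i \<le> Hl i q" if i: "i < j" for i
      proof -
        let ?K = "map_pmf (prw i) q"
        have "Hl 0 q = Hl i q + (\<integral>J. Hl 0 (cond_pmf q (prw i -` {J})) \<partial>measure_pmf ?K)"
          using chain_fibre[OF qd, of 0 i] by simp
        also have "(\<integral>J. Hl 0 (cond_pmf q (prw i -` {J})) \<partial>measure_pmf ?K) \<le> (\<integral>J. real n * (h 0 - h i) + C i \<partial>measure_pmf ?K)"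
        proof (rule integral_pmf_mono)
          show "finite (set_pmf ?K)" using finite_dists[OF qd] by simp
          fix J' assume J': "J' \<in> set_pmf ?K"
          have c: "cond_pmf q (prw i -` {J'}) \<in> fdists i J'" by (rule cond_fdists[OF qd J'])
          have "Hl 0 (cond_pmf q (prw i -` {J'})) \<le> ln (real (card (prw 0 ` fib i J')))"
            unfolding Hl_def using c by (intro ent_le_ln_card) (auto simp: fdists_def)
          also have "prw 0 ` fib i J' = fib i J'" by (simp add: prw_0)
          also have "J' \<in> prw i ` L" "length J' = n" using J' distsD[OF qd] by (auto simp: words_def)
          then have "ln (real (card (fib i J'))) \<le> real n * (h 0 - h i) + C i" using C[OF i] by blast
          finally show "Hl 0 (cond_pmf q (prw i -` {J'})) \<le> real n * (h 0 - h i) + C i" .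
        qed
        finally show ?thesis using H0 by simp
      qed
      have "(\<Sum>i<j. w i * (ln (real (card (fib j J))) - real n * (h 0 - h i) - C i)) \<le> Dlow j w q"
        unfolding Dlow_def using Hi S_nonneg[OF w] by (intro sum_mono mult_left_mono) auto
      also have "\<dots> \<le> Ff j w J" using S_nonneg[OF w] q by (intro Dlow_le_Ff)
      also have "\<dots> \<le> real n * kap j w + C1" using C1[OF J] by (simp add: n_def abs_le_iff)
      finally have "V * ln (real (card (fib j J))) \<le> real n * ((\<Sum>i<j. w i * (h 0 - h i)) + kap j w) + C2"
        by (simp add: V_def C2_def right_diff_distrib distrib_left sum_subtractf sum.distrib sum_distrib_left sum_distrib_right algebra_simps)
      also have "(\<Sum>i<j. w i * (h 0 - h i)) + kap j w = V * (h 0 - h j)"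
        unfolding V_def kap_def sum.distrib[symmetric] sum_distrib_right
        by (intro sum.cong refl) (simp add: algebra_simps)
      also have "real n * (V * (h 0 - h j)) + C2 = V * (real n * (h 0 - h j)) + V * (C2 / V)"
        using V by simp
      also have "\<dots> = V * (real n * (h 0 - h j) + C2 / V)" by (simp only: distrib_left)
      finally have "V * ln (real (card (fib j J))) \<le> V * (real n * (h 0 - h j) + C2 / V)" .
      then show ?thesis using V by (simp add: n_def)
    qed
    then show ?thesis by blast
  qed
qed

end

section \<open>An averaging lemma\<close>

lemma le_nat_floor_iff: "0 \<le> x \<Longrightarrow> n \<le> nat \<lfloor>x\<rfloor> \<longleftrightarrow> real n \<le> x"
  by (simp add: le_nat_iff le_floor_iff)

lemma sum_reciprocal_telescope:
  "a \<le> b + 1 \<Longrightarrow> 0 < a \<Longrightarrow> (\<Sum>T=a..b. 1 / (real T * (real T + 1))) = 1 / real a - 1 / (real b + 1)"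
proof (induction b)
  case 0
  then have "a = 1" by simp
  then show ?case by simp
next
  case (Suc b)
  show ?case
  proof (cases "a = Suc (Suc b)")
    case True
    then show ?thesis by simp
  next
    case False
    then have "a \<le> b + 1" using Suc.prems by simp
    then have "(\<Sum>T=a..Suc b. 1 / (real T * (real T + 1))) = 1 / real a - 1 / (real b + 1) + 1 / (real (Suc b) * (real (Suc b) + 1))"
      using Suc.IH[OF _ Suc.prems(2)] by simp
    also have "\<dots> = 1 / real a - 1 / (real (Suc b) + 1)"
    proof -
      define x where "x = real b + 1"
      have "0 < x" by (simp add: x_def)
      then have "1 / (x * (x + 1)) = 1 / x - 1 / (x + 1)" by (simp add: field_simps)
      then show ?thesis by (simp add: x_def add.commute)
    qed
    finally show ?thesis .
  qed
qed

text \<open>Weighting the scale \<open>T\<close> with \<open>1 / (T (T + 1))\<close> makes the average of \<open>S (\<lambda> T)\<close> proportional to \<open>\<lambda>\<close>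
  up to a bounded error.\<close>

lemma weighted_scale_sum:
  fixes g :: "nat \<Rightarrow> real" and l G :: real and b T0 Y :: nat
  assumes g: "\<And>k. 0 \<le> g k" "\<And>k. g k \<le> G" and l: "0 < l" "l \<le> 1" and b: "0 < b" and T0: "0 < T0"
  defines "M \<equiv> \<lambda>T. nat \<lfloor>l * real T\<rfloor> div b"
  defines "A \<equiv> (\<Sum>T=T0..Y. 1 / (real T * (real T + 1)) * (\<Sum>k<M T. g k))"
  defines "U \<equiv> l / real b * (\<Sum>k<Y. g k / (real k + 1))"
  shows "A \<le> U" "U - G * (real T0 + 4) \<le> A"
proof -
  define c where "c T = 1 / (real T * (real T + 1))" for T
  \<comment> \<open>The index \<open>k\<close> enters the inner sum at scale \<open>1 / z k\<close>,
    and \<open>a k\<close> rounds this up; see \<open>kM\<close>. By telescoping, its total weight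
    is then about \<open>1 / a k\<close>, hence about \<open>z k\<close>.\<close>
  define z where "z k = l / (real b * (real k + 1))" for k
  define a where "a k = nat \<lceil>1 / z k\<rceil>" for k
  have G: "0 \<le> G" using g(1)[of 0] g(2)[of 0] by linarith
  have zpos: "0 < z k" for k using l b by (simp add: z_def)
  have z1: "z k \<le> 1 / (real k + 1)" for k
    unfolding z_def using l b by (intro frac_le) (auto simp: mult_le_cancel_right1)
  have zle1: "z k \<le> 1" for k using z1[of k] by (rule order_trans) simp
  have kM: "k < M T \<longleftrightarrow> a k \<le> T" for k T
  proof -
    have "k < M T \<longleftrightarrow> (k + 1) * b \<le> nat \<lfloor>l * real T\<rfloor>"
      unfolding M_def using b by (metis Suc_eq_plus1 Suc_le_eq less_eq_div_iff_mult_less_eq)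
    also have "\<dots> \<longleftrightarrow> real ((k + 1) * b) \<le> l * real T"
      using l by (intro le_nat_floor_iff) auto
    also have "\<dots> \<longleftrightarrow> 1 / z k \<le> real T" using l b by (simp add: z_def field_simps)
    also have "\<dots> \<longleftrightarrow> a k \<le> T" by (simp add: a_def nat_le_iff ceiling_le_iff)
    finally show ?thesis .
  qed
  have az: "1 / z k \<le> real (a k)" "real (a k) \<le> 1 / z k + 1" for k
    using zpos[of k] by (auto simp: a_def of_nat_ceiling)
  have a1: "0 < a k" for k using zpos[of k] by (simp add: a_def)
  have MT: "M T \<le> T" for T
  proof -
    have "l * real T \<le> real T" using mult_right_mono[of l 1 "real T"] l by simp
    then have "nat \<lfloor>l * real T\<rfloor> \<le> T" by linarith
    then show ?thesis unfolding M_def using div_le_dividend[of "nat \<lfloor>l * real T\<rfloor>" b] by linarith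
  qed
  have c0: "0 \<le> c T" for T by (simp add: c_def)
  have full: "(\<Sum>T=1..Y. c T * (\<Sum>k<M T. g k)) = (\<Sum>k<Y. g k * (\<Sum>T=a k..Y. c T))"
  proof -
    have "(\<Sum>T=1..Y. c T * (\<Sum>k<M T. g k)) = (\<Sum>T=1..Y. \<Sum>k<Y. if a k \<le> T then g k * c T else 0)"
    proof (intro sum.cong refl)
      fix T assume T: "T \<in> {1..Y}"
      have "(\<Sum>k<M T. g k * c T) = (\<Sum>k\<in>{k\<in>{..<Y}. a k \<le> T}. g k * c T)"
        using MT[of T] T by (intro sum.cong) (auto simp: kM[symmetric])
      also have "\<dots> = (\<Sum>k<Y. if a k \<le> T then g k * c T else 0)" by (rule sum.inter_filter) simp
      finally show "c T * (\<Sum>k<M T. g k) = (\<Sum>k<Y. if a k \<le> T then g k * c T else 0)"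
        by (simp add: sum_distrib_left mult.commute)
    qed
    also have "\<dots> = (\<Sum>k<Y. \<Sum>T=1..Y. if a k \<le> T then g k * c T else 0)" by (rule sum.swap)
    also have "\<dots> = (\<Sum>k<Y. g k * (\<Sum>T=a k..Y. c T))"
    proof (intro sum.cong refl)
      fix k
      have "{T\<in>{1..Y}. a k \<le> T} = {a k..Y}" using a1[of k] by auto
      then show "(\<Sum>T=1..Y. if a k \<le> T then g k * c T else 0) = g k * (\<Sum>T=a k..Y. c T)"
        by (simp add: sum.inter_filter[symmetric] sum_distrib_left)
    qed
    finally show ?thesis .
  qed
  have tail: "(\<Sum>T=a k..Y. c T) = (if a k \<le> Y then 1 / real (a k) - 1 / (real Y + 1) else 0)" for k
    using sum_reciprocal_telescope[of "a k" Y] a1[of k] by (simp add: c_def)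
  have Uz: "U = (\<Sum>k<Y. g k * z k)"
    unfolding U_def z_def sum_distrib_left by (intro sum.cong refl) (simp add: field_simps)
  have upper: "(\<Sum>T=1..Y. c T * (\<Sum>k<M T. g k)) \<le> U"
    unfolding full Uz
  proof (intro sum_mono mult_left_mono g)
    fix k
    have "1 / real (a k) \<le> z k" using az(1)[of k] zpos[of k] a1[of k] by (simp add: field_simps)
    moreover have "1 / real (a k) - 1 / (real Y + 1) \<le> 1 / real (a k)" by simp
    ultimately have "1 / real (a k) - 1 / (real Y + 1) \<le> z k" by linarith
    then show "(\<Sum>T=a k..Y. c T) \<le> z k" using zpos[of k] unfolding tail by simp
  qed
  have "A \<le> (\<Sum>T=1..Y. c T * (\<Sum>k<M T. g k))"
    unfolding A_def c_def[symmetric] using T0 c0 g(1) by (intro sum_mono2) (auto intro!: mult_nonneg_nonneg sum_nonneg)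
  then show "A \<le> U" using upper by linarith
  have lower1: "U - G * 4 \<le> (\<Sum>T=1..Y. c T * (\<Sum>k<M T. g k))"
  proof -
    \<comment> \<open>The first summand covers the rounding error \<open>z k * z k\<close> and
      telescopes; the others cover the truncation at \<open>Y\<close>, including the case that
      \<open>k\<close> enters only after \<open>Y\<close>. Over all \<open>k < Y\<close> either part
      adds up to at most 2.\<close>
    have "z k - (\<Sum>T=a k..Y. c T) \<le> 2 * (1 / (real k + 1) - 1 / (real k + 2)) + 1 / (real Y + 1) + 1 / (real Y + 1)" for k
    proof (cases "a k \<le> Y")
      case True
      have "z k - 1 / real (a k) \<le> z k * z k"
      proof -
        have "1 / (1 / z k + 1) \<le> 1 / real (a k)" using az[of k] a1[of k] zpos[of k] by (intro divide_left_mono) auto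
        moreover have "1 / (1 / z k + 1) = z k / (1 + z k)" using zpos[of k] by (simp add: field_simps)
        moreover have "z k - z k / (1 + z k) = z k * z k / (1 + z k)" using zpos[of k] by (simp add: field_simps)
        moreover have "z k * z k / (1 + z k) \<le> z k * z k" using zpos[of k] by (simp add: field_simps)
        ultimately show ?thesis by linarith
      qed
      also have "\<dots> \<le> (1 / (real k + 1)) * (1 / (real k + 1))"
        using z1[of k] zpos[of k] by (intro mult_mono) auto
      also have "\<dots> \<le> 2 * (1 / (real k + 1) - 1 / (real k + 2))"
      proof -
        define x where "x = real k + 1"
        have x: "1 \<le> x" by (simp add: x_def)
        have "x * (x + 1) \<le> 2 * (x * x)" using mult_right_mono[OF x, of x] x by (simp add: distrib_left)
        then have "1 / (x * x) \<le> 2 / (x * (x + 1))" using x by (simp add: divide_simps)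
        also have "\<dots> = 2 * (1 / x - 1 / (x + 1))" using x by (simp add: field_simps)
        finally show ?thesis by (simp add: x_def add.commute)
      qed
      finally have 1: "z k - 1 / real (a k) \<le> 2 * (1 / (real k + 1) - 1 / (real k + 2))" .
      have "0 \<le> 1 / (real Y + 1)" by simp
      then show ?thesis using 1 True unfolding tail if_P[OF True] by linarith
    next
      case False
      then have "real Y + 1 \<le> 1 / z k + 1" using az(2)[of k] by linarith
      have "real Y < real (a k)" using False by simp
      have "real Y < 1 / z k"
      proof (rule ccontr)
        assume "\<not> real Y < 1 / z k"
        then have "1 / z k \<le> real Y" by simp
        then have "a k \<le> Y" by (simp add: a_def nat_le_iff ceiling_le_iff)
        then show False using False by simp
      qed
      then have "z k * real Y \<le> 1" using zpos[of k] by (simp add: field_simps)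
      then have "z k * (real Y + 1) \<le> 2" using zle1[of k] by (simp add: distrib_left)
      then have "z k \<le> 1 / (real Y + 1) + 1 / (real Y + 1)" by (simp add: field_simps)
      moreover have "0 \<le> 2 * (1 / (real k + 1) - 1 / (real k + 2))" by (simp add: field_simps)
      ultimately show ?thesis using False unfolding tail by simp
    qed
    then have "(\<Sum>k<Y. g k * (z k - (\<Sum>T=a k..Y. c T))) \<le> (\<Sum>k<Y. G * (2 * (1 / (real k + 1) - 1 / (real k + 2)) + 1 / (real Y + 1) + 1 / (real Y + 1)))"
      (is "_ \<le> sum ?r _")
    proof (intro sum_mono)
      fix k
      have r: "0 \<le> 2 * (1 / (real k + 1) - 1 / (real k + 2)) + 1 / (real Y + 1) + 1 / (real Y + 1)"
        by (intro add_nonneg_nonneg) (simp_all add: field_simps)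
      have "g k * (z k - (\<Sum>T=a k..Y. c T)) \<le> g k * (2 * (1 / (real k + 1) - 1 / (real k + 2)) + 1 / (real Y + 1) + 1 / (real Y + 1))"
        using \<open>\<And>k. z k - _ k \<le> _ k\<close> g by (intro mult_left_mono)
      also have "\<dots> \<le> G * (2 * (1 / (real k + 1) - 1 / (real k + 2)) + 1 / (real Y + 1) + 1 / (real Y + 1))"
        using r g by (intro mult_right_mono)
      finally show "g k * (z k - (\<Sum>T=a k..Y. c T)) \<le> ?r k" .
    qed
    also have "sum ?r {..<Y} = G * (2 * (\<Sum>k<Y. 1 / (real k + 1) - 1 / (real k + 2)) + real Y * (2 / (real Y + 1)))"
    proof -
      define f where "f k = 1 / (real k + 1) - 1 / (real k + 2)" for k
      show ?thesis unfolding f_def[symmetric] by (simp add: sum_distrib_left[symmetric] sum.distrib)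
    qed
    also have "(\<Sum>k<Y. 1 / (real k + 1) - 1 / (real k + 2)) = 1 - 1 / (real Y + 1)"
      by (induction Y) (simp_all add: algebra_simps)
    also have "G * (2 * (1 - 1 / (real Y + 1)) + real Y * (2 / (real Y + 1))) \<le> G * 4"
    proof (rule mult_left_mono[OF _ G])
      have 1: "real Y * (2 / (real Y + 1)) \<le> 2" by (simp add: field_simps)
      have 2: "2 * (1 - 1 / (real Y + 1)) \<le> 2" by simp
      show "2 * (1 - 1 / (real Y + 1)) + real Y * (2 / (real Y + 1)) \<le> 4"
        using add_mono[OF 2 1] by simp
    qed
    finally show ?thesis unfolding full Uz by (simp add: right_diff_distrib sum_subtractf)
  qed
  have "(\<Sum>T=1..Y. c T * (\<Sum>k<M T. g k)) \<le> A + (\<Sum>T=1..<T0. c T * (\<Sum>k<M T. g k))"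
  proof -
    have nn: "0 \<le> c T * (\<Sum>k<M T. g k)" for T using c0 g(1) by (intro mult_nonneg_nonneg sum_nonneg)
    have "(\<Sum>T=1..Y. c T * (\<Sum>k<M T. g k)) \<le> (\<Sum>T\<in>{T0..Y} \<union> {1..<T0}. c T * (\<Sum>k<M T. g k))"
      using nn by (intro sum_mono2) auto
    also have "\<dots> = A + (\<Sum>T=1..<T0. c T * (\<Sum>k<M T. g k))"
      unfolding A_def c_def[symmetric] by (intro sum.union_disjoint) auto
    finally show ?thesis .
  qed
  moreover have "(\<Sum>T=1..<T0. c T * (\<Sum>k<M T. g k)) \<le> (\<Sum>T=1..<T0. G)"
  proof (rule sum_mono)
    fix T assume T: "T \<in> {1..<T0}"
    have "(\<Sum>k<M T. g k) \<le> (\<Sum>k<M T. G)" using g by (intro sum_mono)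
    also have "\<dots> \<le> real T * G" using MT[of T] G by (simp add: mult_right_mono)
    finally have "c T * (\<Sum>k<M T. g k) \<le> c T * (real T * G)" using c0 by (intro mult_left_mono)
    also have "\<dots> = G / (real T + 1)" using T by (simp add: c_def)
    also have "\<dots> \<le> G" using G T by (simp add: field_simps)
    finally show "c T * (\<Sum>k<M T. g k) \<le> G" .
  qed
  moreover have "(\<Sum>T=1..<T0. G) \<le> G * real T0" using G by (simp add: mult.commute mult_left_mono)
  ultimately show "U - G * (real T0 + 4) \<le> A" using lower1 by (simp add: distrib_left)
qed

text \<open>In the weighted average over scales, level sums become \<open>lam\<close> times sums
  over \<open>k\<close> with common weights, so the hypothesis applies for each \<open>k\<close>
  separately. If every scale in the window failed, \<open>\<eta>\<close> times a harmonic sum would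
  exceed the bounded errors. \<open>T1\<close> does not depend on \<open>g\<close>: one finite
  window serves all sequences.\<close>

lemma good_scale_exists:
  fixes lam :: "nat \<Rightarrow> real" and G P \<eta> :: real and b s T0 :: nat
  assumes lam: "\<And>j. j < s \<Longrightarrow> 0 < lam j" "\<And>j. j < s \<Longrightarrow> lam j \<le> 1"
    and P: "0 \<le> P" and eta: "0 < \<eta>" and b: "0 < b" and T0: "0 < T0" and G: "0 \<le> G"
  shows "\<exists>T1. \<forall>g :: nat \<Rightarrow> nat \<Rightarrow> real. (\<forall>j k. 0 \<le> g j k \<and> g j k \<le> G) \<longrightarrow>
    (\<forall>k. (\<Sum>j<s. (lam j - (if j = 0 then 0 else lam (j - 1))) * g j k) \<le> P * real b) \<longrightarrow>
    (\<exists>T\<in>{T0..T1}. (\<Sum>j<s. (\<Sum>k<nat \<lfloor>lam j * real T\<rfloor> div b. g j k)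
       - (if j = 0 then 0 else \<Sum>k<nat \<lfloor>lam (j - 1) * real T\<rfloor> div b. g j k)) \<le> (P + \<eta>) * real T)"
proof -
  define C where "C = real s * (G * (real T0 + 4)) + (P + \<eta>) * real T0"
  obtain T1 :: nat where T1: "exp (C / \<eta> + 1) < real T1" using reals_Archimedean2 by blast
  have harm: "harm T1 = (\<Sum>k<T1. 1 / (real k + 1))" for T1
    by (simp add: harm_altdef inverse_eq_divide add.commute)
  have "C / \<eta> + 1 \<le> ln (real T1 + 1)"
    using T1 by (intro ln_ge_iff[THEN iffD2]) linarith+
  also have "\<dots> \<le> harm T1" using ln_le_harm[of T1] by (simp add: add.commute)
  finally have big: "C < \<eta> * harm T1" using eta by (simp add: field_simps)
  show ?thesis
  proof (intro exI[of _ T1] allI impI)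
    fix g :: "nat \<Rightarrow> nat \<Rightarrow> real"
    assume g: "\<forall>j k. 0 \<le> g j k \<and> g j k \<le> G"
      and gP: "\<forall>k. (\<Sum>j<s. (lam j - (if j = 0 then 0 else lam (j - 1))) * g j k) \<le> P * real b"
    define Sg where "Sg i j T = (\<Sum>k<nat \<lfloor>lam i * real T\<rfloor> div b. g j k)" for i j T
    define E where "E T = (\<Sum>j<s. Sg j j T - (if j = 0 then 0 else Sg (j - 1) j T))" for T
    define c where "c T = 1 / (real T * (real T + 1))" for T
    define U where "U i j = lam i / real b * (\<Sum>k<T1. g j k / (real k + 1))" for i j
    have up: "(\<Sum>T=T0..T1. c T * Sg i j T) \<le> U i j"
      and lo: "U i j - G * (real T0 + 4) \<le> (\<Sum>T=T0..T1. c T * Sg i j T)" if "i < s" for i j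
      using weighted_scale_sum[of "g j" G "lam i" b T0 T1] g lam[OF that] b T0
      by (auto simp: U_def c_def Sg_def)
    have "(\<Sum>T=T0..T1. c T * E T) = (\<Sum>j<s. (\<Sum>T=T0..T1. c T * Sg j j T) - (if j = 0 then 0 else \<Sum>T=T0..T1. c T * Sg (j - 1) j T))"
      unfolding E_def sum_distrib_left
      by (subst sum.swap, intro sum.cong refl) (simp add: right_diff_distrib sum_subtractf)
    also have "\<dots> \<le> (\<Sum>j<s. U j j - (if j = 0 then 0 else U (j - 1) j) + G * (real T0 + 4))"
    proof (rule sum_mono)
      fix j assume j: "j \<in> {..<s}"
      have nn: "0 \<le> G * (real T0 + 4)" using G by simp
      show "(\<Sum>T=T0..T1. c T * Sg j j T) - (if j = 0 then 0 else \<Sum>T=T0..T1. c T * Sg (j - 1) j T)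
        \<le> U j j - (if j = 0 then 0 else U (j - 1) j) + G * (real T0 + 4)"
      proof (cases "j = 0")
        case True
        then show ?thesis using up[of j j] j nn by simp
      next
        case False
        then have "j - 1 < s" using j by auto
        then show ?thesis using up[of j j] lo[of "j - 1" j] j False by simp
      qed
    qed
    also have "\<dots> = (\<Sum>j<s. U j j - (if j = 0 then 0 else U (j - 1) j)) + real s * (G * (real T0 + 4))"
      by (simp add: sum.distrib)
    also have "(\<Sum>j<s. U j j - (if j = 0 then 0 else U (j - 1) j))
      = (\<Sum>j<s. \<Sum>k<T1. (1 / (real b * (real k + 1))) * ((lam j - (if j = 0 then 0 else lam (j - 1))) * g j k))"
    proof (intro sum.cong refl)
      fix j
      have Ue: "U i j = (\<Sum>k<T1. (1 / (real b * (real k + 1))) * (lam i * g j k))" for i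
        unfolding U_def sum_distrib_left by (intro sum.cong refl) simp
      show "U j j - (if j = 0 then 0 else U (j - 1) j)
        = (\<Sum>k<T1. (1 / (real b * (real k + 1))) * ((lam j - (if j = 0 then 0 else lam (j - 1))) * g j k))"
      proof (cases "j = 0")
        case True
        then show ?thesis using Ue[of j] by simp
      next
        case False
        then show ?thesis
          by (simp only: Ue if_False sum_subtractf[symmetric] left_diff_distrib right_diff_distrib)
      qed
    qed
    also have "\<dots> = (\<Sum>k<T1. (1 / (real b * (real k + 1))) * (\<Sum>j<s. (lam j - (if j = 0 then 0 else lam (j - 1))) * g j k))"
      unfolding sum_distrib_left by (rule sum.swap)
    also have "\<dots> \<le> (\<Sum>k<T1. (1 / (real b * (real k + 1))) * (P * real b))"
      using gP b by (intro sum_mono mult_left_mono) auto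
    also have "\<dots> = P * harm T1"
      unfolding harm sum_distrib_left using b by (intro sum.cong refl) simp
    finally have total: "(\<Sum>T=T0..T1. c T * E T) \<le> P * harm T1 + real s * (G * (real T0 + 4))" by simp
    have "\<exists>T\<in>{T0..T1}. E T \<le> (P + \<eta>) * real T"
    proof (rule ccontr)
      assume "\<not> ?thesis"
      then have neg: "(P + \<eta>) * real T \<le> E T" if "T \<in> {T0..T1}" for T
        using that by (meson linear)
      have "(P + \<eta>) * (\<Sum>T=T0..T1. 1 / (real T + 1)) = (\<Sum>T=T0..T1. c T * ((P + \<eta>) * real T))"
        unfolding sum_distrib_left using T0 by (intro sum.cong refl) (simp add: c_def)
      also have "\<dots> \<le> (\<Sum>T=T0..T1. c T * E T)"
        using neg by (intro sum_mono mult_left_mono) (auto simp: c_def)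
      finally have 1: "(P + \<eta>) * (\<Sum>T=T0..T1. 1 / (real T + 1)) \<le> P * harm T1 + real s * (G * (real T0 + 4))"
        using total by linarith
      have "harm T1 \<le> (\<Sum>k\<in>{T0..T1} \<union> {..<T0}. 1 / (real k + 1))"
        unfolding harm by (intro sum_mono2) auto
      also have "\<dots> = (\<Sum>T=T0..T1. 1 / (real T + 1)) + (\<Sum>k<T0. 1 / (real k + 1))"
        by (intro sum.union_disjoint) auto
      also have "(\<Sum>k<T0. 1 / (real k + 1)) \<le> (\<Sum>k<T0. 1)" by (intro sum_mono) simp
      finally have "harm T1 - real T0 \<le> (\<Sum>T=T0..T1. 1 / (real T + 1))" by simp
      then have "(P + \<eta>) * (harm T1 - real T0) \<le> (P + \<eta>) * (\<Sum>T=T0..T1. 1 / (real T + 1))"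
        using P eta by (intro mult_left_mono) auto
      then show False using 1 big unfolding C_def by (simp add: algebra_simps)
    qed
    then show "\<exists>T\<in>{T0..T1}. (\<Sum>j<s. (\<Sum>k<nat \<lfloor>lam j * real T\<rfloor> div b. g j k)
       - (if j = 0 then 0 else \<Sum>k<nat \<lfloor>lam (j - 1) * real T\<rfloor> div b. g j k)) \<le> (P + \<eta>) * real T"
      unfolding E_def Sg_def .
  qed
qed

section \<open>Near-maximisers\<close>

context spec_lang
begin

text \<open>A near-maximiser of a concave functional cannot be improved by mixing in a point mass. The positive
  amount \<open>e\<close> inside the logarithm makes this hold without exact maximisers.\<close>

lemma near_maximiser_pointwise:
  assumes w: "\<And>j. 0 \<le> w j" and q: "q \<in> dists b" "Zl w b - e\<^sup>2 \<le> Dw w q"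
    and e: "0 < e" "e < 1" and u: "u \<in> words b"
  shows "(\<Sum>j<s. w j * - ln ((1 - e) * pmf (map_pmf (prw j) q) (prw j u) + e)) \<le> Zl w b + e"
proof -
  define k where "k c = (if c then return_pmf u else q)" for c
  define q' where "q' = bind_pmf (bernoulli_pmf e) k"
  have k: "k c \<in> dists b" for c using q u by (auto simp: k_def dists_def)
  have q': "q' \<in> dists b" using k by (auto simp: q'_def dists_def)
  have fin: "finite (set_pmf (bernoulli_pmf e))" by (rule finite_subset[of _ UNIV]) auto
  have H: "(1 - e) * Hl j q + e * - ln ((1 - e) * pmf (map_pmf (prw j) q) (prw j u) + e) \<le> Hl j q'" for j
  proof -
    let ?m = "map_pmf (prw j) q'"
    have m: "?m = bind_pmf (bernoulli_pmf e) (\<lambda>c. map_pmf (prw j) (k c))" by (simp add: q'_def map_bind_pmf)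
    have pm: "pmf ?m y = e * pmf (return_pmf (prw j u)) y + (1 - e) * pmf (map_pmf (prw j) q) y" for y
      using e by (simp add: m pmf_bind k_def integral_bernoulli_pmf[OF less_imp_le less_imp_le])
    have sub: "set_pmf (map_pmf (prw j) q) \<subseteq> set_pmf ?m" "prw j u \<in> set_pmf ?m"
      using e by (auto simp: m set_pmf_bernoulli k_def)
    have fm: "finite (set_pmf ?m)" using finite_dists[OF q'] by simp
    have "Hl j q \<le> (\<integral>y. - ln (pmf ?m y) \<partial>measure_pmf (map_pmf (prw j) q)) + ln (\<Sum>y\<in>set_pmf ?m. pmf ?m y)"
      unfolding Hl_def using sub fm by (intro gibbs_ineq) (auto simp: pmf_positive_iff)
    then have 1: "Hl j q \<le> (\<integral>y. - ln (pmf ?m y) \<partial>measure_pmf (map_pmf (prw j) q))"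
      using fm by (simp add: sum_pmf_eq_1)
    have "Hl j q' = (\<integral>c. (\<integral>y. - ln (pmf ?m y) \<partial>measure_pmf (map_pmf (prw j) (k c))) \<partial>measure_pmf (bernoulli_pmf e))"
    proof -
      have "Hl j q' = (\<integral>y. - ln (pmf ?m y) \<partial>measure_pmf (bind_pmf (bernoulli_pmf e) (\<lambda>c. map_pmf (prw j) (k c))))"
        unfolding Hl_def ent_def m[symmetric] ..
      also have "\<dots> = (\<integral>c. (\<integral>y. - ln (pmf ?m y) \<partial>measure_pmf (map_pmf (prw j) (k c))) \<partial>measure_pmf (bernoulli_pmf e))"
        using finite_dists[OF k] by (intro integral_bind_pmf_finite fin) simp
      finally show ?thesis .
    qed
    also have "\<dots> = e * - ln (pmf ?m (prw j u)) + (1 - e) * (\<integral>y. - ln (pmf ?m y) \<partial>measure_pmf (map_pmf (prw j) q))"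
      using e by (subst integral_bernoulli_pmf) (auto simp: k_def)
    also have "pmf ?m (prw j u) = (1 - e) * pmf (map_pmf (prw j) q) (prw j u) + e" by (simp add: pm)
    finally show ?thesis using mult_left_mono[OF 1, of "1 - e"] e by linarith
  qed
  let ?X = "\<Sum>j<s. w j * - ln ((1 - e) * pmf (map_pmf (prw j) q) (prw j u) + e)"
  have "(1 - e) * Dw w q + e * ?X = (\<Sum>j<s. w j * ((1 - e) * Hl j q + e * - ln ((1 - e) * pmf (map_pmf (prw j) q) (prw j u) + e)))"
    unfolding Dw_def sum_distrib_left sum.distrib[symmetric] by (intro sum.cong refl) (simp add: algebra_simps)
  also have "\<dots> \<le> Dw w q'" unfolding Dw_def using w H by (intro sum_mono mult_left_mono) auto
  also have "\<dots> \<le> Zl w b" using w q' by (intro Dw_le_Zl)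
  finally have "(1 - e) * Dw w q + e * ?X \<le> Zl w b" .
  moreover have "(1 - e) * (Zl w b - e\<^sup>2) \<le> (1 - e) * Dw w q" using q(2) e by (intro mult_left_mono) auto
  \<comment> \<open>A defect of size \<open>e\<close> squared, divided by the mixing weight
    \<open>e\<close>, leaves the error \<open>e\<close> of the conclusion.\<close>
  moreover have "(1 - e) * e\<^sup>2 \<le> e * e" using e by (simp add: power2_eq_square mult_le_cancel_right2)
  ultimately have "e * ?X \<le> e * (Zl w b + e)" by (simp add: algebra_simps)
  then show ?thesis using e by simp
qed

end

section \<open>Hausdorff measures\<close>

lemma diam_pow_le:
  assumes "0 \<le> t" "bounded U" "diameter U \<le> d" "0 < d"
  shows "diam_pow t U \<le> ennreal (d powr t)"
proof -
  have "diameter U powr t \<le> d powr t"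
    using assms by (intro powr_mono2) (auto simp: diameter_ge_0)
  then show ?thesis using assms by (auto simp: diam_pow_def intro!: ennreal_leI)
qed

lemma premeasure_finite_cover:
  assumes F: "finite F" and d: "0 \<le> \<delta>"
    and V: "\<And>i. i \<in> F \<Longrightarrow> bounded (V i) \<and> diameter (V i) \<le> \<delta>"
    and E: "E \<subseteq> (\<Union>i\<in>F. V i)"
  shows "hausdorff_premeasure \<delta> t E \<le> (\<Sum>i\<in>F. diam_pow t (V i))"
proof -
  obtain f where f: "bij_betw f {0..<card F} F" using ex_bij_betw_nat_finite[OF F] by blast
  define U where "U n = (if n < card F then V (f n) else {})" for n
  have fF: "f n \<in> F" if "n < card F" for n using bij_betwE[OF f] that by auto
  have "(\<Sum>n. diam_pow t (U n)) = (\<Sum>n<card F. diam_pow t (U n))"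
    by (rule suminf_finite) (auto simp: U_def diam_pow_def)
  also have "\<dots> = (\<Sum>n\<in>{0..<card F}. diam_pow t (V (f n)))"
    by (intro sum.cong) (auto simp: U_def)
  also have "\<dots> = (\<Sum>i\<in>F. diam_pow t (V i))" by (rule sum.reindex_bij_betw[OF f])
  finally have S: "(\<Sum>n. diam_pow t (U n)) = (\<Sum>i\<in>F. diam_pow t (V i))" .
  have "E \<subseteq> (\<Union>n. U n)"
  proof
    fix x assume "x \<in> E"
    then obtain i where i: "i \<in> F" "x \<in> V i" using E by blast
    then have "i \<in> f ` {0..<card F}" using f by (simp add: bij_betw_def)
    then obtain n where "n < card F" "f n = i" by auto
    then show "x \<in> (\<Union>n. U n)" using i by (auto simp: U_def intro!: exI[of _ n])
  qed
  moreover have "bounded (U n) \<and> diameter (U n) \<le> \<delta>" for n using V fF d by (simp add: U_def)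
  ultimately show ?thesis unfolding hausdorff_premeasure_def S[symmetric] by (intro Inf_lower) blast
qed

lemma hausdorff_measure_leI:
  "(\<And>\<delta>. 0 < \<delta> \<Longrightarrow> hausdorff_premeasure \<delta> t E \<le> c) \<Longrightarrow> hausdorff_measure t E \<le> c"
  unfolding hausdorff_measure_def by (intro SUP_least) auto

lemma premeasure_le_measure: "0 < \<delta> \<Longrightarrow> hausdorff_premeasure \<delta> t E \<le> hausdorff_measure t E"
  unfolding hausdorff_measure_def by (intro SUP_upper) auto

lemma premeasure_antimono: "\<delta> \<le> \<delta>' \<Longrightarrow> hausdorff_premeasure \<delta>' t E \<le> hausdorff_premeasure \<delta> t E"
  unfolding hausdorff_premeasure_def by (intro Inf_superset_mono) (blast intro: order_trans)

lemma hausdorff_cover: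
  assumes "hausdorff_measure t E < c" "0 < \<delta>"
  obtains U :: "nat \<Rightarrow> 'a::metric_space set" where "\<And>i. bounded (U i)" "\<And>i. diameter (U i) \<le> \<delta>"
    "E \<subseteq> (\<Union>i. U i)" "(\<Sum>i. diam_pow t (U i)) < c"
proof -
  have "hausdorff_premeasure \<delta> t E < c" using premeasure_le_measure[OF assms(2)] assms(1) by (rule le_less_trans)
  then show ?thesis unfolding hausdorff_premeasure_def Inf_less_iff using that by blast
qed

lemma hausdorff_measure_zero_above:
  assumes t: "0 \<le> t" "t < t'" and fin: "hausdorff_measure t E < \<infinity>"
  shows "hausdorff_measure t' E = 0"
proof -
  obtain c where c: "hausdorff_measure t E < ennreal c" "0 < c"
  proof -
    obtain r where "hausdorff_measure t E = ennreal r" "0 \<le> r" using fin by (cases "hausdorff_measure t E") auto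
    then show ?thesis using that[of "r + 1"] by (simp add: ennreal_less_iff)
  qed
  have small: "hausdorff_premeasure \<delta> t' E \<le> ennreal (\<delta> powr (t' - t) * c)" if d: "0 < \<delta>" for \<delta>
  proof -
    obtain U where U: "\<And>i. bounded (U i)" "\<And>i. diameter (U i) \<le> \<delta>" "E \<subseteq> (\<Union>i. U i)" "(\<Sum>i. diam_pow t (U i)) < ennreal c"
      using hausdorff_cover[OF c(1) d] by blast
    have "diam_pow t' (U i) \<le> ennreal (\<delta> powr (t' - t)) * diam_pow t (U i)" for i
    proof -
      have D: "0 \<le> diameter (U i)" using U(1) by (rule diameter_ge_0)
      have "diameter (U i) powr t' \<le> \<delta> powr (t' - t) * (if t = 0 then 1 else diameter (U i) powr t)"
      proof (cases "diameter (U i) = 0")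
        case True
        then show ?thesis using d by simp
      next
        case False
        have "diameter (U i) powr t' = diameter (U i) powr (t' - t) * diameter (U i) powr t"
          by (simp add: powr_add[symmetric])
        also have "\<dots> \<le> \<delta> powr (t' - t) * diameter (U i) powr t"
          using t D U(2)[of i] by (intro mult_right_mono powr_mono2) auto
        finally show ?thesis using False D by auto
      qed
      then show ?thesis
        using t by (auto simp: diam_pow_def ennreal_mult[symmetric] intro!: ennreal_leI)
    qed
    then have "(\<Sum>i. diam_pow t' (U i)) \<le> (\<Sum>i. ennreal (\<delta> powr (t' - t)) * diam_pow t (U i))"
      by (intro suminf_le) auto
    also have "\<dots> = ennreal (\<delta> powr (t' - t)) * (\<Sum>i. diam_pow t (U i))" by simp
    also have "\<dots> \<le> ennreal (\<delta> powr (t' - t)) * ennreal c" using U(4) by (intro mult_left_mono) auto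
    also have "\<dots> = ennreal (\<delta> powr (t' - t) * c)" using c by (simp add: ennreal_mult)
    finally have "(\<Sum>i. diam_pow t' (U i)) \<le> ennreal (\<delta> powr (t' - t) * c)" .
    moreover have "hausdorff_premeasure \<delta> t' E \<le> (\<Sum>i. diam_pow t' (U i))"
      unfolding hausdorff_premeasure_def using U by (intro Inf_lower) blast
    ultimately show ?thesis by (rule order_trans[rotated])
  qed
  have "hausdorff_premeasure \<delta> t' E \<le> 0" if d: "0 < \<delta>" for \<delta>
  proof (rule ennreal_le_epsilon)
    fix e :: real assume e: "0 < e"
    define x where "x = min \<delta> ((e / c) powr (1 / (t' - t)))"
    have x: "0 < x" using d e c by (simp add: x_def)
    have "x powr (t' - t) \<le> ((e / c) powr (1 / (t' - t))) powr (t' - t)"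
      using t x by (intro powr_mono2) (auto simp: x_def)
    also have "\<dots> = e / c" using t e c by (simp add: powr_powr)
    finally have "x powr (t' - t) * c \<le> e" using c by (simp add: field_simps)
    then have "hausdorff_premeasure x t' E \<le> ennreal e"
      using small[OF x] by (meson ennreal_leI order_trans)
    moreover have "hausdorff_premeasure \<delta> t' E \<le> hausdorff_premeasure x t' E"
      by (rule premeasure_antimono) (simp add: x_def)
    ultimately show "hausdorff_premeasure \<delta> t' E \<le> 0 + ennreal e" by simp
  qed
  then have "hausdorff_measure t' E \<le> 0" by (rule hausdorff_measure_leI)
  then show ?thesis by simp
qed

lemma hausdorff_dim_eqI:
  assumes k: "0 \<le> k" and above: "\<And>t. k < t \<Longrightarrow> hausdorff_measure t E = 0"
    and pos: "hausdorff_measure k E \<noteq> 0"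
  shows "hausdorff_dim E = k"
proof -
  let ?S = "{t. 0 \<le> t \<and> hausdorff_measure t E = 0}"
  have ge: "k < t" if "t \<in> ?S" for t
  proof (rule ccontr)
    assume "\<not> k < t"
    moreover have "t \<noteq> k" using that pos by auto
    ultimately have "hausdorff_measure k E = 0"
      using that hausdorff_measure_zero_above[of t k E] by auto
    then show False using pos by simp
  qed
  have "Inf ?S = k"
  proof (rule cInf_eq_non_empty)
    have "k + 1 \<in> ?S" using above[of "k + 1"] k by simp
    then show "?S \<noteq> {}" by blast
    show "y \<le> k" if "\<And>x. x \<in> ?S \<Longrightarrow> y \<le> x" for y
    proof (rule dense_ge)
      fix t assume "k < t"
      then show "y \<le> t" using above[of t] k that by auto
    qed
  qed (use ge in \<open>auto intro: less_imp_le\<close>)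
  then show ?thesis by (simp add: hausdorff_dim_def)
qed

section \<open>Counting along levels\<close>

text \<open>A position is charged at the least level whose range contains it. This is the most
  detailed information on that letter that an approximate cube provides, since \<open>pr j\<close>
  forgets more as \<open>j\<close> grows.\<close>

lemma level_sum:
  fixes f :: "nat \<Rightarrow> nat \<Rightarrow> real"
  assumes mono: "\<And>i j. i \<le> j \<Longrightarrow> j < n \<Longrightarrow> M i \<le> M j" and n: "0 < n"
  shows "(\<Sum>j<n. (\<Sum>k<M j. f j k) - (if j = 0 then 0 else \<Sum>k<M (j - 1). f j k))
    = (\<Sum>k<M (n - 1). f (LEAST j. k < M j) k)"
  using assms
proof (induction n)
  case (Suc n)
  show ?case
  proof (cases "n = 0")
    case True
    have "(LEAST j. k < M j) = 0" if "k < M 0" for k using that by (intro Least_eq_0)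
    then show ?thesis using True by simp
  next
    case False
    have le: "M (n - 1) \<le> M n" using Suc.prems(1)[of "n - 1" n] by simp
    have "(\<Sum>k<M n. f (LEAST j. k < M j) k) = (\<Sum>k\<in>{..<M (n - 1)} \<union> {M (n - 1)..<M n}. f (LEAST j. k < M j) k)"
      using le by (intro sum.cong) auto
    also have "\<dots> = (\<Sum>k<M (n - 1). f (LEAST j. k < M j) k) + (\<Sum>k\<in>{M (n - 1)..<M n}. f (LEAST j. k < M j) k)"
      by (rule sum.union_disjoint) auto
    also have "(\<Sum>k\<in>{M (n - 1)..<M n}. f (LEAST j. k < M j) k) = (\<Sum>k\<in>{M (n - 1)..<M n}. f n k)"
    proof (rule sum.cong)
      fix k assume k: "k \<in> {M (n - 1)..<M n}"
      have "(LEAST j. k < M j) = n"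
      proof (rule Least_equality)
        fix j assume "k < M j"
        show "n \<le> j"
        proof (rule ccontr)
          assume "\<not> n \<le> j"
          then have "M j \<le> M (n - 1)" using Suc.prems(1)[of j "n - 1"] by simp
          then show False using k \<open>k < M j\<close> by auto
        qed
      qed (use k in auto)
      then show "f (LEAST j. k < M j) k = f n k" by simp
    qed simp
    also have "(\<Sum>k<M (n - 1). f (LEAST j. k < M j) k)
      = (\<Sum>j<n. (\<Sum>k<M j. f j k) - (if j = 0 then 0 else \<Sum>k<M (j - 1). f j k))"
      using Suc.IH Suc.prems(1) False by simp
    also have "(\<Sum>k\<in>{M (n - 1)..<M n}. f n k) = (\<Sum>k<M n. f n k) - (\<Sum>k<M (n - 1). f n k)"
    proof -
      have "{..<M n} = {..<M (n - 1)} \<union> {M (n - 1)..<M n}" using le by auto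
      then show ?thesis using sum.union_disjoint[of "{..<M (n - 1)}" "{M (n - 1)..<M n}" "f n"] by force
    qed
    finally show ?thesis using False by simp
  qed
qed simp

text \<open>Each counted family has a product of weights at least \<open>exp (- \<tau>)\<close>, and
  the sum of these products over all families factorises.\<close>

lemma card_light_PiE:
  fixes g :: "'i \<Rightarrow> 'b \<Rightarrow> real"
  assumes I: "finite I" "\<And>i. i \<in> I \<Longrightarrow> finite (S i)" and g: "\<And>i x. i \<in> I \<Longrightarrow> x \<in> S i \<Longrightarrow> 0 < g i x"
  shows "real (card {\<phi> \<in> PiE I S. (\<Sum>i\<in>I. - ln (g i (\<phi> i))) \<le> \<tau>}) \<le> exp \<tau> * (\<Prod>i\<in>I. \<Sum>x\<in>S i. g i x)"
proof -
  let ?A = "{\<phi> \<in> PiE I S. (\<Sum>i\<in>I. - ln (g i (\<phi> i))) \<le> \<tau>}"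
  have fin: "finite (PiE I S)" using I by (intro finite_PiE) auto
  have "real (card ?A) = (\<Sum>\<phi>\<in>?A. 1)" by simp
  also have "\<dots> \<le> (\<Sum>\<phi>\<in>?A. exp \<tau> * (\<Prod>i\<in>I. g i (\<phi> i)))"
  proof (rule sum_mono)
    fix \<phi> assume \<phi>: "\<phi> \<in> ?A"
    have "(\<Prod>i\<in>I. g i (\<phi> i)) = (\<Prod>i\<in>I. exp (ln (g i (\<phi> i))))"
      using g \<phi> by (intro prod.cong) (auto simp: PiE_mem)
    also have "\<dots> = exp (- (\<Sum>i\<in>I. - ln (g i (\<phi> i))))" using I by (simp add: exp_sum sum_negf)
    also have "\<dots> \<ge> exp (- \<tau>)" using \<phi> by simp
    finally have "exp \<tau> * exp (- \<tau>) \<le> exp \<tau> * (\<Prod>i\<in>I. g i (\<phi> i))" by simp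
    then show "1 \<le> exp \<tau> * (\<Prod>i\<in>I. g i (\<phi> i))" by (simp add: exp_minus)
  qed
  also have "\<dots> \<le> (\<Sum>\<phi>\<in>PiE I S. exp \<tau> * (\<Prod>i\<in>I. g i (\<phi> i)))"
  proof (rule sum_mono2[OF fin])
    fix \<phi> assume "\<phi> \<in> PiE I S - ?A"
    then have "0 \<le> g i (\<phi> i)" if "i \<in> I" for i using g[OF that, of "\<phi> i"] that by (auto simp: PiE_mem)
    then show "0 \<le> exp \<tau> * (\<Prod>i\<in>I. g i (\<phi> i))" by (simp add: prod_nonneg)
  qed auto
  also have "\<dots> = exp \<tau> * (\<Prod>i\<in>I. \<Sum>x\<in>S i. g i x)"
    using I by (simp add: sum_distrib_left[symmetric] prod_sum_PiE)
  finally show ?thesis .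
qed

lemma choose_representatives:
  assumes "finite (f ` A)"
  obtains Y where "Y \<subseteq> A" "finite Y" "card Y = card (f ` A)" "\<And>x. x \<in> A \<Longrightarrow> \<exists>y\<in>Y. f y = f x"
proof
  let ?Y = "inv_into A f ` (f ` A)"
  show "?Y \<subseteq> A" by (auto intro: inv_into_into)
  show "finite ?Y" using assms by simp
  show "card ?Y = card (f ` A)" by (intro card_image inj_on_inv_into) auto
  show "\<exists>y\<in>?Y. f y = f x" if "x \<in> A" for x using that by (auto intro!: bexI[of _ x] f_inv_into_f)
qed

section \<open>Codings by sequences with approximate cubes\<close>

context spec_lang
begin

text \<open>For the language of a subshift this is the subshift itself, by
  \<open>XL_language\<close>.\<close>

definition XL :: "(nat \<Rightarrow> 'a) set" where
  "XL = {x. \<forall>n. map x [0..<n] \<in> L}"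

lemma map_upt_split: "i \<le> j \<Longrightarrow> j \<le> k \<Longrightarrow> map x [i..<k] = map x [i..<j] @ map x [j..<k]"
  using upt_add_eq_append[of i j "k - j"] by simp

lemma XL_factor:
  assumes "x \<in> XL"
  shows "map x [i..<j] \<in> words (j - i)"
proof (cases "i \<le> j")
  case True
  have "map x [0..<i] @ map x [i..<j] \<in> L"
    using assms True unfolding map_upt_split[of 0 i j x, OF le0 True, symmetric] by (simp add: XL_def)
  then show ?thesis using L_append[of "map x [0..<i]" "map x [i..<j]"] by (simp add: words_def)
qed (simp add: words_def Nil_in_L)

lemma nested_words_limit:
  assumes U: "\<And>k. U k \<in> L" "\<And>k. k \<le> length (U k)" "\<And>k. \<exists>v. U (Suc k) = U k @ v"
  defines "x \<equiv> \<lambda>n. U (Suc n) ! n"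
  shows "x \<in> XL" "map x [0..<length (U k)] = U k"
proof -
  have pre: "\<exists>v. U l = U k @ v" if "k \<le> l" for k l
    using that
  proof (induction l rule: dec_induct)
    case (step n)
    then show ?case using U(3)[of n] by auto
  qed simp
  have nth: "U k ! n = x n" if n: "n < length (U k)" for n k
  proof -
    let ?l = "max k (Suc n)"
    obtain v where v: "U ?l = U k @ v" using pre[of k ?l] by auto
    obtain v' where v': "U ?l = U (Suc n) @ v'" using pre[of "Suc n" ?l] by auto
    have "U k ! n = U ?l ! n" unfolding v using n by (rule nth_append_left[symmetric])
    also have "\<dots> = x n" unfolding x_def v' using U(2)[of "Suc n"] by (intro nth_append_left) simp
    finally show ?thesis .
  qed
  have mx: "map x [0..<length (U k)] = U k" for k by (rule nth_equalityI) (auto simp: nth)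
  then show "map x [0..<length (U k)] = U k" .
  show "x \<in> XL"
    unfolding XL_def
  proof (intro CollectI allI)
    fix n
    have "map x [0..<n] @ map x [n..<length (U n)] = U n"
      unfolding map_upt_split[of 0 n "length (U n)" x, OF le0 U(2), symmetric] by (rule mx)
    then show "map x [0..<n] \<in> L" using U(1)[of n] L_append[of "map x [0..<n]" "map x [n..<length (U n)]"] by simp
  qed
qed

text \<open>Words \<open>I k\<close> are placed in consecutive slots of prescribed lengths; only the position of \<open>I k\<close> inside its
  slot depends on the words, and it takes at most \<open>p + 1\<close> values.\<close>

primrec slotw :: "(nat \<Rightarrow> 'a list) \<Rightarrow> nat \<Rightarrow> 'a list" where
  "slotw I 0 = []"
| "slotw I (Suc k) = glue (slotw I k) (I k)"

text \<open>Slots are not empty because \<open>p\<close> is positive, so the first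
  \<open>Suc n\<close> slots reach beyond position \<open>n\<close>.\<close>

definition slotx :: "(nat \<Rightarrow> 'a list) \<Rightarrow> nat \<Rightarrow> 'a" where
  "slotx I n = slotw I (Suc n) ! n"

definition offs :: "(nat \<Rightarrow> 'a list) \<Rightarrow> nat \<Rightarrow> nat" where
  "offs I k = length (lk (slotw I k) (I k))"

lemma slotw_words:
  assumes t: "t 0 = 0" "\<And>k. t k + p \<le> t (Suc k)" and I: "\<And>k. I k \<in> words (t (Suc k) - t k - p)"
  shows "slotw I k \<in> words (t k)"
proof (induction k)
  case 0
  then show ?case by (simp add: t(1) words_def Nil_in_L)
next
  case (Suc k)
  have "glue (slotw I k) (I k) \<in> words (t k + (t (Suc k) - t k - p) + p)" by (rule glue_words[OF Suc I])
  moreover have "t k + (t (Suc k) - t k - p) + p = t (Suc k)" using t(2)[of k] by simp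
  ultimately show ?case by simp
qed

lemma slot_props:
  assumes t: "t 0 = 0" "\<And>k. t k + p \<le> t (Suc k)" and I: "\<And>k. I k \<in> words (t (Suc k) - t k - p)"
  shows "slotx I \<in> XL" "offs I k \<le> p"
    "map (slotx I) [t k + offs I k..<t k + offs I k + (t (Suc k) - t k - p)] = I k"
proof -
  note U = slotw_words[of t I, OF t I]
  have tk: "k \<le> t k" for k
  proof (induction k)
    case (Suc k)
    then show ?case using t(2)[of k] p_pos by simp
  qed simp
  have len: "length (slotw I k) = t k" for k using U[of k] by (simp add: words_def)
  have lim: "slotw I k \<in> L" "k \<le> length (slotw I k)" "\<exists>v. slotw I (Suc k) = slotw I k @ v" for k
    using U[of k] tk[of k] by (simp_all add: words_def glue_def)
  have x: "slotx I = (\<lambda>n. slotw I (Suc n) ! n)" by (rule ext) (rule slotx_def)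
  show X: "slotx I \<in> XL" unfolding x by (rule nested_words_limit[OF lim])
  have pre: "map (slotx I) [0..<t k] = slotw I k" for k
    using nested_words_limit(2)[of "slotw I", OF lim, of k] unfolding x len .
  have UL: "slotw I k \<in> L" "I k \<in> L" using U[of k] I[of k] by (auto simp: words_def)
  show o: "offs I k \<le> p" using lk[OF UL] by (simp add: offs_def)
  let ?b = "t (Suc k) - t k - p" and ?o = "t k + offs I k"
  have "map (slotx I) [?o..<?o + ?b] = take ?b (drop ?o (map (slotx I) [0..<t (Suc k)]))"
    using o t(2)[of k] by (simp add: take_map drop_map take_upt drop_upt)
  also have "\<dots> = take ?b (drop ?o (glue (slotw I k) (I k)))" unfolding pre by simp
  also have "\<dots> = I k" using U[of k] I[of k] by (simp add: glue_def words_def offs_def)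
  finally show "map (slotx I) [?o..<?o + ?b] = I k" .
qed

lemma XL_nonempty: "XL \<noteq> {}"
proof -
  have "\<exists>u. u \<in> words k" for k using words_nonempty by blast
  then obtain I where I: "\<And>k. I k \<in> words k" by metis
  define t where "t k = k * (p + 1)" for k
  have "t 0 = 0" "t k + p \<le> t (Suc k)" for k by (auto simp: t_def)
  moreover have "(\<lambda>k. I 1) k \<in> words (t (Suc k) - t k - p)" for k using I[of 1] by (simp add: t_def)
  ultimately show ?thesis using slot_props(1)[of t "\<lambda>k. I 1"] by blast
qed

text \<open>The growth rate of the number of words at a level is the pressure for a unit weight.\<close>

definition htop :: "nat \<Rightarrow> real" where
  "htop j = Pr (\<lambda>i. if i = j then 1 else 0)"

text \<open>The uniform distribution on one representative for every projected word attains the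
  bound by the logarithm of the cardinality.\<close>

lemma Zl_unit:
  assumes j: "j < s"
  shows "Zl (\<lambda>i. if i = j then 1 else 0) n = ln (real (card (prw j ` words n)))"
proof (rule antisym)
  have D: "Dw (\<lambda>i. if i = j then 1 else 0) q = Hl j q" for q
  proof -
    have "Dw (\<lambda>i. if i = j then 1 else 0) q = (\<Sum>i<s. if i = j then Hl i q else 0)"
      unfolding Dw_def by (intro sum.cong) auto
    then show ?thesis using j by simp
  qed
  show "Zl (\<lambda>i. if i = j then 1 else 0) n \<le> ln (real (card (prw j ` words n)))"
    by (rule Zl_le) (simp add: D Hl_le_ln_card)
  obtain Y where Y: "Y \<subseteq> words n" "finite Y" "card Y = card (prw j ` words n)" "\<And>x. x \<in> words n \<Longrightarrow> \<exists>y\<in>Y. prw j y = prw j x"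
    using choose_representatives[of "prw j" "words n"] by auto
  have img: "prw j ` Y = prw j ` words n" using Y(1,4) by (auto simp: image_iff) metis
  have inj: "inj_on (prw j) Y" using Y(2,3) img by (intro eq_card_imp_inj_on) auto
  have ne: "Y \<noteq> {}" using img by auto
  define q where "q = pmf_of_set Y"
  have q: "q \<in> dists n" using Y ne by (simp add: q_def dists_def)
  have "map_pmf (prw j) q = pmf_of_set (prw j ` Y)"
    unfolding q_def using inj ne Y(2) by (rule map_pmf_of_set_inj)
  then have "Hl j q = ln (real (card (prw j ` Y)))"
    unfolding Hl_def ent_def using ne Y(2)
    by (simp add: integral_pmf_of_set ln_div card_gt_0_iff pmf_of_set cong: sum.cong)
  then show "ln (real (card (prw j ` words n))) \<le> Zl (\<lambda>i. if i = j then 1 else 0) n"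
    using Dw_le_Zl[of "\<lambda>i. if i = j then 1 else 0" q n] q by (simp add: D img)
qed

lemma htop_bounds:
  assumes j: "j < s"
  obtains C where "\<And>n. real n * htop j \<le> ln (real (card (prw j ` words n)))"
    "\<And>n. ln (real (card (prw j ` words n))) \<le> real n * htop j + C"
proof
  show "real n * htop j \<le> ln (real (card (prw j ` words n)))" for n
    unfolding htop_def Zl_unit[OF j, symmetric] by (rule Pr_le_Zl) simp
  show "ln (real (card (prw j ` words n))) \<le> real n * htop j + Cw (\<lambda>i. if i = j then 1 else 0)" for n
    unfolding htop_def Zl_unit[OF j, symmetric] by (rule Zl_le_Pr) simp
qed

lemma htop_nonneg: "j < s \<Longrightarrow> 0 \<le> htop j"
  unfolding htop_def by (intro Pr_geI[where c=0]) (auto intro: Zl_nonneg)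

end

text \<open>The relation \<open>eqv T\<close> describes the approximate cube of side about \<open>N ^ (- T)\<close> around a sequence; at level \<open>j\<close>
  it fixes the first \<open>lam j * T\<close> projected letters.\<close>

locale coding = spec_lang A L p s pr
  for A :: "'a set" and L p s pr +
  fixes lam :: "nat \<Rightarrow> real" and R :: "(nat \<Rightarrow> 'a) \<Rightarrow> 'm::euclidean_space" and N CR :: real and K0 :: nat
  assumes lam_mono: "i < j \<Longrightarrow> j < s \<Longrightarrow> lam i < lam j"
    and lam_0: "0 < lam 0" and lam_top: "lam (s - 1) = 1"
    and N: "1 < N" and CR: "0 < CR"
    and compact_K: "compact (R ` XL)"
begin

definition Lv :: "nat \<Rightarrow> nat \<Rightarrow> nat" where
  "Lv j T = nat \<lfloor>lam j * real T\<rfloor>"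

definition eqv :: "nat \<Rightarrow> (nat \<Rightarrow> 'a) \<Rightarrow> (nat \<Rightarrow> 'a) \<Rightarrow> bool" where
  "eqv T x y \<longleftrightarrow> (\<forall>j<s. \<forall>k<Lv j T. pr j (x k) = pr j (y k))"

definition dl :: "nat \<Rightarrow> real" where
  "dl T = 1 / N ^ T"

definition ww :: "nat \<Rightarrow> real" where
  "ww j = (if j < s then lam j - (if j = 0 then 0 else lam (j - 1)) else 0)"

end

text \<open>Separate from \<open>coding\<close> because these assumptions mention \<open>eqv\<close>
  and \<open>dl\<close>. They say that classes at scale \<open>T\<close> have diameter comparable
  with \<open>dl T\<close>, and that a set of this diameter meets a bounded number of them.\<close>

locale coding_geom = coding A L p s pr lam R N CR K0
  for A :: "'a set" and L p s pr lam and R :: "(nat \<Rightarrow> 'a) \<Rightarrow> 'm::euclidean_space" and N CR K0 +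
  assumes dist_R: "x \<in> XL \<Longrightarrow> y \<in> XL \<Longrightarrow> eqv T x y \<Longrightarrow> dist (R x) (R y) \<le> CR * dl T"
    and cover_R: "bounded U \<Longrightarrow> diameter U \<le> dl T \<Longrightarrow>
      \<exists>Y. finite Y \<and> card Y \<le> K0 \<and> Y \<subseteq> {x \<in> XL. R x \<in> U} \<and> (\<forall>x\<in>XL. R x \<in> U \<longrightarrow> (\<exists>y\<in>Y. eqv T x y))"
begin

lemma lam_pos: "j < s \<Longrightarrow> 0 < lam j"
  using lam_0 lam_mono[of 0 j] by (cases "j = 0") auto

lemma lam_le: "i \<le> j \<Longrightarrow> j < s \<Longrightarrow> lam i \<le> lam j"
  using lam_mono[of i j] by (cases "i = j") auto

lemma lam_le_1: "j < s \<Longrightarrow> lam j \<le> 1"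
  using lam_le[of j "s - 1"] lam_top by auto

lemma ww_pos: "j < s \<Longrightarrow> 0 < ww j"
  using lam_pos[of j] lam_mono[of "j - 1" j] by (auto simp: ww_def)

lemma ww_nonneg: "0 \<le> ww j"
  using ww_pos[of j] by (cases "j < s") (auto simp: ww_def)

lemma dl_pos: "0 < dl T"
  using N by (simp add: dl_def)

lemma dl_powr: "dl T powr t = exp (- (real T * (t * ln N)))"
  using N by (simp add: dl_def powr_def ln_div ln_realpow algebra_simps)

lemma Lv_mono: "i \<le> j \<Longrightarrow> j < s \<Longrightarrow> Lv i T \<le> Lv j T"
  using lam_le unfolding Lv_def by (intro nat_mono floor_mono mult_right_mono) auto

lemma Lv_top: "Lv (s - 1) T = T"
  using lam_top by (simp add: Lv_def)

lemma Lv_bounds: "j < s \<Longrightarrow> real (Lv j T) \<le> lam j * real T" "j < s \<Longrightarrow> lam j * real T < real (Lv j T) + 1"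
  using lam_pos[of j] by (simp_all add: Lv_def)

lemma eqv_sym: "eqv T x y \<Longrightarrow> eqv T y x"
  by (simp add: eqv_def)

lemma eqv_trans: "eqv T x y \<Longrightarrow> eqv T y z \<Longrightarrow> eqv T x z"
  by (simp add: eqv_def)

definition cls :: "nat \<Rightarrow> (nat \<Rightarrow> 'a) \<Rightarrow> 'm set" where
  "cls T y = R ` {x \<in> XL. eqv T x y}"

lemma cls_small: "bounded (cls T y)" "diameter (cls T y) \<le> CR * dl T"
proof -
  have d: "dist u v \<le> CR * dl T" if uv: "u \<in> cls T y" "v \<in> cls T y" for u v
  proof -
    obtain x x' where x: "x \<in> XL" "eqv T x y" "u = R x" "x' \<in> XL" "eqv T x' y" "v = R x'"
      using uv by (auto simp: cls_def)
    then show ?thesis using dist_R[OF x(1,4) eqv_trans[OF x(2) eqv_sym[OF x(5)]]] by simp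
  qed
  show "diameter (cls T y) \<le> CR * dl T"
    using d CR dl_pos[of T] by (intro diameter_le) (auto simp: dist_norm)
  show "bounded (cls T y)"
  proof (cases "cls T y = {}")
    case False
    then obtain u where "u \<in> cls T y" by blast
    then show ?thesis unfolding bounded_def by (intro exI[of _ u] exI[of _ "CR * dl T"]) (simp add: d)
  qed simp
qed

lemma cls_cover:
  assumes F: "finite F" "\<And>T y. (T, y) \<in> F \<Longrightarrow> T0 \<le> T"
    and cov: "\<And>x. x \<in> XL \<Longrightarrow> \<exists>(T, y)\<in>F. eqv T x y" and t: "0 \<le> t"
  shows "hausdorff_premeasure (CR * dl T0) t (R ` XL) \<le> ennreal (\<Sum>(T, y)\<in>F. (CR * dl T) powr t)"
proof -
  have mono: "CR * dl T \<le> CR * dl T0" if "T0 \<le> T" for T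
    using CR N that power_increasing[of T0 T N] unfolding dl_def by (intro mult_left_mono divide_left_mono) auto
  have "hausdorff_premeasure (CR * dl T0) t (R ` XL) \<le> (\<Sum>i\<in>F. diam_pow t (cls (fst i) (snd i)))"
  proof (rule premeasure_finite_cover[OF F(1)])
    show "0 \<le> CR * dl T0" using CR dl_pos[of T0] by simp
    show "bounded (cls (fst i) (snd i)) \<and> diameter (cls (fst i) (snd i)) \<le> CR * dl T0" if "i \<in> F" for i
      using cls_small[of "fst i" "snd i"] mono[of "fst i"] F(2)[of "fst i" "snd i"] that by auto
    show "R ` XL \<subseteq> (\<Union>i\<in>F. cls (fst i) (snd i))"
      using cov unfolding cls_def by fastforce
  qed
  also have "\<dots> \<le> (\<Sum>i\<in>F. ennreal ((CR * dl (fst i)) powr t))"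
    using t cls_small CR dl_pos by (intro sum_mono diam_pow_le) auto
  also have "\<dots> = ennreal (\<Sum>(T, y)\<in>F. (CR * dl T) powr t)"
    by (simp add: sum_ennreal case_prod_unfold)
  finally show ?thesis .
qed

end

section \<open>Upper bound for the Hausdorff dimension\<close>

context coding_geom
begin

definition blk :: "nat \<Rightarrow> (nat \<Rightarrow> 'a) \<Rightarrow> nat \<Rightarrow> 'a list" where
  "blk b x k = map x [k * b..<k * b + b]"

lemma blk_words: "x \<in> XL \<Longrightarrow> blk b x k \<in> words b"
  using XL_factor[of x "k * b" "k * b + b"] by (simp add: blk_def)

lemma blk_nth:
  assumes "0 < b"
  shows "blk b x (k div b) ! (k mod b) = x k"
proof -
  have "[k div b * b..<k div b * b + b] ! (k mod b) = k div b * b + k mod b"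
    by (rule nth_upt, rule add_strict_left_mono) (use assms in simp)
  then show ?thesis using assms by (simp add: blk_def div_mult_mod_eq)
qed

definition Mb :: "nat \<Rightarrow> nat \<Rightarrow> nat \<Rightarrow> nat" where
  "Mb b T j = Lv j T div b"

definition lv :: "nat \<Rightarrow> nat \<Rightarrow> nat \<Rightarrow> nat" where
  "lv b T k = (LEAST j. k < Mb b T j)"

text \<open>Blocks that lie within the range of some level are recorded at the most detailed such
  level. The at most \<open>s\<close> blocks cut by the level boundaries are recorded in full, at
  the price of a constant factor in the count.\<close>

definition code :: "nat \<Rightarrow> nat \<Rightarrow> (nat \<Rightarrow> 'a) \<Rightarrow> (nat \<Rightarrow> 'a list) \<times> (nat \<Rightarrow> 'a list)" where
  "code b T x = (\<lambda>k\<in>{..<Mb b T (s - 1)}. prw (lv b T k) (blk b x k), \<lambda>j\<in>{..<s}. blk b x (Mb b T j))"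

lemma Mb_mono: "i \<le> j \<Longrightarrow> j < s \<Longrightarrow> Mb b T i \<le> Mb b T j"
  unfolding Mb_def by (intro div_le_mono Lv_mono)

lemma lv_le: "k < Mb b T j \<Longrightarrow> lv b T k \<le> j"
  unfolding lv_def by (rule Least_le)

lemma code_eqv:
  assumes b: "0 < b" and eq: "code b T x = code b T y"
  shows "eqv T x y"
  unfolding eqv_def
proof (intro allI impI)
  fix j k assume j: "j < s" and k: "k < Lv j T"
  let ?i = "k div b" and ?m = "k mod b"
  have m: "?m < b" using b by simp
  show "pr j (x k) = pr j (y k)"
  proof (cases "?i < Mb b T j")
    case True
    have js: "j \<le> s - 1" "s - 1 < s" using j by simp_all
    have i: "?i < Mb b T (s - 1)" using True Mb_mono[OF js, of b T] by (rule less_le_trans)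
    have "fst (code b T x) ?i = fst (code b T y) ?i" using eq by simp
    then have "prw (lv b T ?i) (blk b x ?i) = prw (lv b T ?i) (blk b y ?i)" using i by (simp add: code_def)
    then have "prw (lv b T ?i) (blk b x ?i) ! ?m = prw (lv b T ?i) (blk b y ?i) ! ?m" by simp
    moreover have "length (blk b x ?i) = b" "length (blk b y ?i) = b" by (simp_all add: blk_def)
    ultimately have "pr (lv b T ?i) (x k) = pr (lv b T ?i) (y k)"
      using m by (simp add: prw_def blk_nth[OF b])
    then show ?thesis using pr_pr[OF lv_le[OF True]] by metis
  next
    case False
    have "?i \<le> Mb b T j" unfolding Mb_def using k by (intro div_le_mono) simp
    then have i: "?i = Mb b T j" using False by simp
    have "snd (code b T x) j = snd (code b T y) j" using eq by simp
    then have "blk b x ?i ! ?m = blk b y ?i ! ?m" using j by (simp add: code_def i)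
    then show ?thesis by (simp add: blk_nth[OF b])
  qed
qed

lemma Pr_nonneg: "(\<And>j. 0 \<le> w j) \<Longrightarrow> 0 \<le> Pr w"
  by (intro Pr_geI[where c=0]) (auto intro: Zl_nonneg)

lemma sum_smoothed_le:
  assumes q: "q \<in> dists b" and e: "0 < e" "e < 1"
  shows "(\<Sum>J\<in>prw j ` words b. (1 - e) * pmf (map_pmf (prw j) q) J + e) \<le> 1 + e * real (card (words b))"
proof -
  have "(\<Sum>J\<in>prw j ` words b. pmf (map_pmf (prw j) q) J) = 1"
    using q by (intro sum_pmf_eq_1) (auto simp: dists_def)
  then have "(\<Sum>J\<in>prw j ` words b. (1 - e) * pmf (map_pmf (prw j) q) J + e) = (1 - e) + real (card (prw j ` words b)) * e"
    by (simp add: sum.distrib sum_distrib_left[symmetric])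
  also have "\<dots> \<le> 1 + e * real (card (words b))"
  proof -
    have "real (card (prw j ` words b)) * e \<le> real (card (words b)) * e"
      using e card_image_le[OF finite_words, of "prw j" b] by (intro mult_right_mono) auto
    then show ?thesis using e(1) by (subst mult.commute[of e]) linarith
  qed
  finally show ?thesis .
qed

text \<open>Smoothed masses of a near-maximiser of length \<open>b\<close> serve as weights of
  blocks. By \<open>near_maximiser_pointwise\<close> every block of every sequence obeys the
  hypothesis of \<open>good_scale_exists\<close>, so every sequence has a scale in the window at
  which its code is light, and light codes are few.\<close>

lemma good_cover_exists:
  assumes eta: "0 < \<eta>"
  obtains W where "0 < W" "\<And>T0. 0 < T0 \<Longrightarrow> \<exists>T1 Y. (\<forall>T\<in>{T0..T1}. finite (Y T) \<and> real (card (Y T)) \<le> W * exp ((Pr ww + 3 * \<eta>) * real T))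
    \<and> (\<forall>x\<in>XL. \<exists>T\<in>{T0..T1}. \<exists>y\<in>Y T. eqv T x y)"
proof -
  define P where "P = Pr ww"
  have P: "0 \<le> P" unfolding P_def using ww_nonneg by (rule Pr_nonneg)
  obtain b :: nat where b: "(Cw ww + 1) / \<eta> < real b" using reals_Archimedean2 by blast
  have Cw0: "0 \<le> Cw ww" using ww_nonneg by (rule Cw_nonneg)
  then have b0: "0 < b" using b eta by (cases b) (auto simp: field_simps)
  have bC: "Cw ww + 1 \<le> real b * \<eta>" using b eta by (simp add: field_simps)
  have cw: "0 < card (words b)" by (simp add: card_gt_0_iff)
  \<comment> \<open>Small enough that adding \<open>e\<close> to each mass increases the total by a
    factor of at most \<open>exp (real b * \<eta>)\<close> per block, that is, by
    \<open>\<eta>\<close> per letter.\<close>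
  define e where "e = min (1 / 2) (real b * \<eta> / real (card (words b)))"
  have e: "0 < e" "e < 1" "e * real (card (words b)) \<le> real b * \<eta>"
    using cw b0 eta by (auto simp: e_def min_def field_simps)
  obtain q where q: "q \<in> dists b" "Zl ww b - e\<^sup>2 < Dw ww q"
    using Zl_near_max[of ww "e\<^sup>2" b] ww_nonneg e by auto
  define gg where "gg j J = (1 - e) * pmf (map_pmf (prw j) q) J + e" for j J
  have gg: "e \<le> gg j J" "gg j J \<le> 1" for j J
  proof -
    show "e \<le> gg j J" using e by (simp add: gg_def)
    have "(1 - e) * pmf (map_pmf (prw j) q) J \<le> (1 - e) * 1" using e pmf_le_1 by (intro mult_left_mono) auto
    then show "gg j J \<le> 1" by (simp add: gg_def)
  qed
  have gg0: "0 < gg j J" for j J using gg(1)[of j J] e by linarith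
  have lgg: "0 \<le> - ln (gg j J)" "- ln (gg j J) \<le> - ln e" for j J
    using gg gg0 e by (simp_all add: ln_le_zero_iff)
  have kkt: "(\<Sum>j<s. ww j * - ln (gg j (prw j u))) \<le> (P + \<eta>) * real b" if u: "u \<in> words b" for u
  proof -
    have "(\<Sum>j<s. ww j * - ln (gg j (prw j u))) \<le> Zl ww b + e"
      unfolding gg_def using near_maximiser_pointwise[of ww q b e u] ww_nonneg q e u by simp
    also have "\<dots> \<le> real b * P + Cw ww + 1" using Zl_le_Pr[of ww b] ww_nonneg e by (simp add: P_def)
    also have "\<dots> \<le> (P + \<eta>) * real b" using bC by (simp add: algebra_simps)
    finally show ?thesis .
  qed
  have sumgg: "(\<Sum>J\<in>prw j ` words b. gg j J) \<le> exp (real b * \<eta>)" for j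
  proof -
    have "(\<Sum>J\<in>prw j ` words b. gg j J) \<le> 1 + e * real (card (words b))"
      unfolding gg_def using q(1) e by (intro sum_smoothed_le)
    also have "\<dots> \<le> 1 + real b * \<eta>" using e(3) by simp
    also have "\<dots> \<le> exp (real b * \<eta>)" by (rule exp_ge_add_one_self)
    finally show ?thesis .
  qed
  define g where "g x j k = - ln (gg j (prw j (blk b x k)))" for x j k
  define Good where "Good T = {x \<in> XL. (\<Sum>k<Mb b T (s - 1). g x (lv b T k) k) \<le> (P + 2 * \<eta>) * real T}" for T
  define W where "W = real (card (words b)) ^ s"
  have count: "finite (code b T ` Good T) \<and> real (card (code b T ` Good T)) \<le> W * exp ((P + 3 * \<eta>) * real T)" for T
  proof -
    let ?M = "Mb b T (s - 1)"
    let ?A = "{\<phi> \<in> PiE {..<?M} (\<lambda>k. prw (lv b T k) ` words b). (\<Sum>k<?M. - ln (gg (lv b T k) (\<phi> k))) \<le> (P + 2 * \<eta>) * real T}"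
    let ?B = "PiE {..<s} (\<lambda>_. words b)"
    have sub: "code b T ` Good T \<subseteq> ?A \<times> ?B"
    proof
      fix z assume "z \<in> code b T ` Good T"
      then obtain x where x: "x \<in> XL" "(\<Sum>k<?M. g x (lv b T k) k) \<le> (P + 2 * \<eta>) * real T" and z: "z = code b T x"
        by (auto simp: Good_def)
      have f: "fst z = (\<lambda>k\<in>{..<?M}. prw (lv b T k) (blk b x k))" "snd z = (\<lambda>j\<in>{..<s}. blk b x (Mb b T j))"
        by (simp_all add: z code_def)
      have "fst z \<in> PiE {..<?M} (\<lambda>k. prw (lv b T k) ` words b)" "snd z \<in> ?B"
        unfolding f using blk_words[OF x(1)] by (auto intro!: restrict_PiE_iff[THEN iffD2])
      moreover have "(\<Sum>k<?M. - ln (gg (lv b T k) (fst z k))) = (\<Sum>k<?M. g x (lv b T k) k)"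
        unfolding f g_def by (intro sum.cong) auto
      ultimately show "z \<in> ?A \<times> ?B" using x(2) by (simp add: mem_Times_iff)
    qed
    have finA: "finite ?A" by (rule finite_subset[of _ "PiE {..<?M} (\<lambda>k. prw (lv b T k) ` words b)"]) (auto intro: finite_PiE)
    have "finite ?B" by (rule finite_PiE) simp_all
    then have fin: "finite (?A \<times> ?B)" by (rule finite_cartesian_product[OF finA])
    have "(\<Prod>k<?M. \<Sum>J\<in>prw (lv b T k) ` words b. gg (lv b T k) J) \<le> (\<Prod>k<?M. exp (real b * \<eta>))"
      using sumgg gg0 by (intro prod_mono conjI sum_nonneg) (auto intro: less_imp_le)
    also have "\<dots> = exp (real ?M * (real b * \<eta>))" by (simp add: exp_of_nat_mult)
    also have "\<dots> \<le> exp (\<eta> * real T)"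
    proof -
      have "?M * b \<le> T" using Lv_top[of T] div_times_less_eq_dividend[of "Lv (s - 1) T" b] by (simp add: Mb_def)
      then have "real ?M * real b \<le> real T" by (metis of_nat_le_iff of_nat_mult)
      then have "real ?M * real b * \<eta> \<le> real T * \<eta>" using eta by (intro mult_right_mono) auto
      then show ?thesis by (simp add: mult_ac)
    qed
    finally have pb: "(\<Prod>k<?M. \<Sum>J\<in>prw (lv b T k) ` words b. gg (lv b T k) J) \<le> exp (\<eta> * real T)" .
    have "real (card (code b T ` Good T)) \<le> real (card (?A \<times> ?B))"
      unfolding of_nat_le_iff by (rule card_mono[OF fin sub])
    also have "\<dots> = real (card ?A) * W" by (simp add: card_cartesian_product card_PiE W_def)
    also have "\<dots> \<le> (exp ((P + 2 * \<eta>) * real T) * (\<Prod>k<?M. \<Sum>J\<in>prw (lv b T k) ` words b. gg (lv b T k) J)) * W"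
      using gg0 by (intro mult_right_mono card_light_PiE) (auto simp: W_def)
    also have "\<dots> \<le> exp ((P + 2 * \<eta>) * real T) * exp (\<eta> * real T) * W"
      using pb by (intro mult_right_mono mult_left_mono) (auto simp: W_def)
    also have "\<dots> = W * exp ((P + 3 * \<eta>) * real T)" by (simp add: exp_add[symmetric] algebra_simps)
    finally show ?thesis using finite_subset[OF sub fin] by simp
  qed
  have "\<exists>Y. \<forall>T. Y T \<subseteq> Good T \<and> finite (Y T) \<and> card (Y T) = card (code b T ` Good T) \<and> (\<forall>x\<in>Good T. \<exists>y\<in>Y T. code b T y = code b T x)"
  proof (rule choice, rule allI)
    fix T
    show "\<exists>Y. Y \<subseteq> Good T \<and> finite Y \<and> card Y = card (code b T ` Good T) \<and> (\<forall>x\<in>Good T. \<exists>y\<in>Y. code b T y = code b T x)"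
      using choose_representatives[of "code b T" "Good T"] count[of T] by metis
  qed
  then obtain Y where Y: "\<And>T. finite (Y T)" "\<And>T. card (Y T) = card (code b T ` Good T)"
    "\<And>T x. x \<in> Good T \<Longrightarrow> \<exists>y\<in>Y T. code b T y = code b T x" by metis
  have main: "\<exists>T1. \<forall>x\<in>XL. \<exists>T\<in>{T0..T1}. x \<in> Good T" if T0: "0 < T0" for T0
  proof -
    have "0 \<le> P + \<eta>" using P eta by simp
    moreover have "0 \<le> - ln e" using e by (simp add: ln_le_zero_iff)
    ultimately obtain T1 where T1: "\<forall>g :: nat \<Rightarrow> nat \<Rightarrow> real. (\<forall>j k. 0 \<le> g j k \<and> g j k \<le> - ln e) \<longrightarrow>
      (\<forall>k. (\<Sum>j<s. (lam j - (if j = 0 then 0 else lam (j - 1))) * g j k) \<le> (P + \<eta>) * real b) \<longrightarrow>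
      (\<exists>T\<in>{T0..T1}. (\<Sum>j<s. (\<Sum>k<nat \<lfloor>lam j * real T\<rfloor> div b. g j k)
         - (if j = 0 then 0 else \<Sum>k<nat \<lfloor>lam (j - 1) * real T\<rfloor> div b. g j k)) \<le> (P + \<eta> + \<eta>) * real T)"
      using good_scale_exists[of s lam "P + \<eta>" \<eta> b T0 "- ln e"] lam_pos lam_le_1 eta b0 T0 by auto
    have "\<exists>T\<in>{T0..T1}. x \<in> Good T" if x: "x \<in> XL" for x
    proof -
      have "\<forall>j k. 0 \<le> g x j k \<and> g x j k \<le> - ln e" using lgg by (simp add: g_def)
      moreover have "\<forall>k. (\<Sum>j<s. (lam j - (if j = 0 then 0 else lam (j - 1))) * g x j k) \<le> (P + \<eta>) * real b"
      proof
        fix k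
        have "(\<Sum>j<s. (lam j - (if j = 0 then 0 else lam (j - 1))) * g x j k) = (\<Sum>j<s. ww j * - ln (gg j (prw j (blk b x k))))"
          unfolding g_def ww_def by (intro sum.cong) auto
        then show "(\<Sum>j<s. (lam j - (if j = 0 then 0 else lam (j - 1))) * g x j k) \<le> (P + \<eta>) * real b"
          using kkt[OF blk_words[OF x]] by simp
      qed
      ultimately obtain T where T: "T \<in> {T0..T1}" "(\<Sum>j<s. (\<Sum>k<Mb b T j. g x j k)
         - (if j = 0 then 0 else \<Sum>k<Mb b T (j - 1). g x j k)) \<le> (P + \<eta> + \<eta>) * real T"
        using T1 unfolding Mb_def Lv_def by blast
      then have "(\<Sum>k<Mb b T (s - 1). g x (lv b T k) k) \<le> (P + \<eta> + \<eta>) * real T"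
        using level_sum[of s "Mb b T" "g x"] Mb_mono s_pos by (simp add: lv_def)
      then show ?thesis using T(1) x by (auto simp: Good_def add.assoc)
    qed
    then show ?thesis by blast
  qed
  show ?thesis
  proof (rule that[of W])
    show "0 < W" using cw by (simp add: W_def)
    fix T0 :: nat assume "0 < T0"
    then obtain T1 where T1: "\<And>x. x \<in> XL \<Longrightarrow> \<exists>T\<in>{T0..T1}. x \<in> Good T" using main by blast
    have "\<exists>T\<in>{T0..T1}. \<exists>y\<in>Y T. eqv T x y" if "x \<in> XL" for x
    proof -
      obtain T where T: "T \<in> {T0..T1}" "x \<in> Good T" using T1[OF \<open>x \<in> XL\<close>] by blast
      obtain y where y: "y \<in> Y T" "code b T y = code b T x" using Y(3)[OF T(2)] by blast
      show ?thesis using T(1) y code_eqv[OF b0, of T x y] by auto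
    qed
    then show "\<exists>T1 Y. (\<forall>T\<in>{T0..T1}. finite (Y T) \<and> real (card (Y T)) \<le> W * exp ((Pr ww + 3 * \<eta>) * real T))
      \<and> (\<forall>x\<in>XL. \<exists>T\<in>{T0..T1}. \<exists>y\<in>Y T. eqv T x y)"
      using Y(1,2) count unfolding P_def by (intro exI[of _ T1] exI[of _ Y]) auto
  qed
qed

lemma hausdorff_measure_zero_above_dim:
  assumes t: "Pr ww / ln N < t"
  shows "hausdorff_measure t (R ` XL) = 0"
proof -
  have lnN: "0 < ln N" using N by simp
  have P0: "0 \<le> Pr ww" using ww_nonneg by (rule Pr_nonneg)
  have t0: "0 \<le> t" using t P0 lnN by (meson divide_nonneg_pos less_eq_real_def order_trans)
  \<comment> \<open>Three of the four parts are lost in the count of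
    \<open>good_cover_exists\<close>; the fourth makes the sum over scales geometric.\<close>
  define \<eta> where "\<eta> = (t * ln N - Pr ww) / 4"
  have eta: "0 < \<eta>" using t lnN by (simp add: \<eta>_def field_simps)
  obtain W where W: "0 < W" "\<And>T0. 0 < T0 \<Longrightarrow> \<exists>T1 Y. (\<forall>T\<in>{T0..T1}. finite (Y T) \<and> real (card (Y T)) \<le> W * exp ((Pr ww + 3 * \<eta>) * real T))
    \<and> (\<forall>x\<in>XL. \<exists>T\<in>{T0..T1}. \<exists>y\<in>Y T. eqv T x y)"
    using good_cover_exists[OF eta] by blast
  define r where "r = exp (- \<eta>)"
  have r: "0 < r" "r < 1" using eta by (auto simp: r_def)
  define C where "C = W * CR powr t / (1 - r)"
  have bound: "hausdorff_premeasure (CR * dl T0) t (R ` XL) \<le> ennreal (C * r ^ T0)" if T0: "0 < T0" for T0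
  proof -
    obtain T1 Y where Y: "\<And>T. T \<in> {T0..T1} \<Longrightarrow> finite (Y T) \<and> real (card (Y T)) \<le> W * exp ((Pr ww + 3 * \<eta>) * real T)"
      "\<And>x. x \<in> XL \<Longrightarrow> \<exists>T\<in>{T0..T1}. \<exists>y\<in>Y T. eqv T x y" using W(2)[OF T0] by blast
    let ?F = "SIGMA T:{T0..T1}. Y T"
    have "hausdorff_premeasure (CR * dl T0) t (R ` XL) \<le> ennreal (\<Sum>(T, y)\<in>?F. (CR * dl T) powr t)"
    proof (rule cls_cover)
      show "finite ?F" using Y(1) by (intro finite_SigmaI) auto
      show "\<exists>(T, y)\<in>?F. eqv T x y" if "x \<in> XL" for x using Y(2)[OF that] by fastforce
    qed (use t0 in auto)
    also have "(\<Sum>(T, y)\<in>?F. (CR * dl T) powr t) = (\<Sum>T=T0..T1. real (card (Y T)) * (CR * dl T) powr t)"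
      using Y(1) by (subst sum.Sigma[symmetric]) auto
    also have "\<dots> \<le> (\<Sum>T=T0..T1. W * CR powr t * r ^ T)"
    proof (rule sum_mono)
      fix T assume T: "T \<in> {T0..T1}"
      have "(CR * dl T) powr t = CR powr t * exp (- (real T * (t * ln N)))"
        using CR dl_pos[of T] by (simp add: powr_mult dl_powr)
      moreover have "(Pr ww + 3 * \<eta>) * real T - real T * (t * ln N) = real T * - \<eta>"
        by (simp add: \<eta>_def field_simps)
      then have "exp ((Pr ww + 3 * \<eta>) * real T) * exp (- (real T * (t * ln N))) = r ^ T"
        by (simp add: exp_add[symmetric] r_def exp_of_nat_mult[symmetric])
      moreover have "real (card (Y T)) * (CR * dl T) powr t \<le> W * exp ((Pr ww + 3 * \<eta>) * real T) * (CR * dl T) powr t"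
        using Y(1)[OF T] by (intro mult_right_mono) auto
      ultimately show "real (card (Y T)) * (CR * dl T) powr t \<le> W * CR powr t * r ^ T"
        by (simp add: mult_ac)
    qed
    also have "\<dots> = W * CR powr t * (\<Sum>T=T0..T1. r ^ T)" by (simp add: sum_distrib_left)
    also have "\<dots> \<le> W * CR powr t * (r ^ T0 / (1 - r))"
    proof (intro mult_left_mono)
      show "(\<Sum>T=T0..T1. r ^ T) \<le> r ^ T0 / (1 - r)"
      proof (cases "T0 \<le> T1")
        case True
        have "(1 - r) * (\<Sum>T=T0..T1. r ^ T) \<le> r ^ T0" using sum_gp_multiplied[OF True, of r] r by simp
        then show ?thesis using r by (simp add: field_simps)
      qed (use r in simp)
    qed (use W in simp)
    finally show ?thesis by (simp add: C_def ennreal_leI)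
  qed
  have C: "0 \<le> C" using W r by (simp add: C_def)
  have "hausdorff_premeasure \<delta> t (R ` XL) \<le> 0" if d: "0 < \<delta>" for \<delta>
  proof (rule ennreal_le_epsilon)
    fix e :: real assume e: "0 < e"
    have "(\<lambda>T. C * r ^ T) \<longlonglongrightarrow> C * 0" using r by (intro tendsto_mult tendsto_const LIMSEQ_realpow_zero) auto
    then have 1: "\<forall>\<^sub>F T in sequentially. C * r ^ T < e" using e by (intro order_tendstoD) auto
    have "(\<lambda>T. CR * (1 / N) ^ T) \<longlonglongrightarrow> CR * 0" using N by (intro tendsto_mult tendsto_const LIMSEQ_realpow_zero) auto
    then have 2: "\<forall>\<^sub>F T in sequentially. CR * (1 / N) ^ T < \<delta>" using d by (intro order_tendstoD) auto
    have "\<forall>\<^sub>F T in sequentially. 0 < T \<and> C * r ^ T < e \<and> CR * (1 / N) ^ T < \<delta>"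
      using eventually_gt_at_top[of 0] 1 2 by eventually_elim auto
    then have "\<exists>T. 0 < T \<and> C * r ^ T < e \<and> CR * (1 / N) ^ T < \<delta>"
      by (rule eventually_happens'[OF sequentially_bot])
    then obtain T where T: "0 < T" "C * r ^ T < e" "CR * dl T < \<delta>" by (auto simp: dl_def power_divide)
    have "hausdorff_premeasure \<delta> t (R ` XL) \<le> hausdorff_premeasure (CR * dl T) t (R ` XL)"
      using T(3) by (intro premeasure_antimono) simp
    also have "\<dots> \<le> ennreal (C * r ^ T)" by (rule bound[OF T(1)])
    also have "\<dots> \<le> 0 + ennreal e" using T(2) by (simp add: ennreal_leI)
    finally show "hausdorff_premeasure \<delta> t (R ` XL) \<le> 0 + ennreal e" .
  qed
  then have "hausdorff_measure t (R ` XL) \<le> 0" by (rule hausdorff_measure_leI)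
  then show ?thesis by simp
qed

end

section \<open>Box counting\<close>

context coding_geom
begin

definition seg :: "nat \<Rightarrow> nat \<Rightarrow> nat" where
  "seg j T = (if j = 0 then 0 else Lv (j - 1) T)"

text \<open>The box dimension times \<open>ln N\<close>, by \<open>box_dim_eq\<close>. Every level
  contributes its own maximal growth rate, whereas \<open>Pr ww\<close> asks for one distribution
  that serves all levels.\<close>

definition bet :: real where
  "bet = (\<Sum>j<s. ww j * htop j)"

lemma bet_nonneg: "0 \<le> bet"
  unfolding bet_def using ww_nonneg htop_nonneg by (intro sum_nonneg mult_nonneg_nonneg) auto

lemma seg_le: "j < s \<Longrightarrow> seg j T \<le> Lv j T"
  using Lv_mono[of "j - 1" j T] by (auto simp: seg_def)

lemma seg_diff: "j < s \<Longrightarrow> real (Lv j T - seg j T) \<le> ww j * real T + 1"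
    "j < s \<Longrightarrow> ww j * real T - 1 \<le> real (Lv j T - seg j T)"
proof -
  assume j: "j < s"
  have 1: "real (Lv j T - seg j T) = real (Lv j T) - real (seg j T)" using seg_le[OF j, of T] by simp
  have 2: "real (Lv j T) \<le> lam j * real T" "lam j * real T < real (Lv j T) + 1" using Lv_bounds[OF j] by auto
  show "real (Lv j T - seg j T) \<le> ww j * real T + 1" "ww j * real T - 1 \<le> real (Lv j T - seg j T)"
  proof -
    consider "j = 0" | "0 < j" by blast
    then have "real (Lv j T - seg j T) \<le> ww j * real T + 1 \<and> ww j * real T - 1 \<le> real (Lv j T - seg j T)"
    proof cases
      case 1
      then show ?thesis using 2 j by (simp add: seg_def ww_def)
    next
      case 2
      then have "j - 1 < s" using j by simp
      from Lv_bounds[OF this, of T] have 3: "real (Lv (j - 1) T) \<le> lam (j - 1) * real T" "lam (j - 1) * real T < real (Lv (j - 1) T) + 1"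
        by auto
      have "ww j * real T = lam j * real T - lam (j - 1) * real T" using 2 j by (simp add: ww_def left_diff_distrib)
      then show ?thesis using 1 \<open>0 < j\<close> \<open>real (Lv j T) \<le> lam j * real T\<close> \<open>lam j * real T < real (Lv j T) + 1\<close> 3
        by (simp add: seg_def)
    qed
    then show "real (Lv j T - seg j T) \<le> ww j * real T + 1" "ww j * real T - 1 \<le> real (Lv j T - seg j T)" by auto
  qed
qed

lemma level_of:
  assumes "j < s" "k < Lv j T"
  obtains i where "i \<le> j" "seg i T \<le> k" "k < Lv i T"
proof
  let ?i = "LEAST i. k < Lv i T"
  show "k < Lv ?i T" using assms(2) by (rule LeastI)
  show "?i \<le> j" using assms(2) by (rule Least_le)
  show "seg ?i T \<le> k"
  proof (cases "?i = 0")
    case False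
    then have "\<not> k < Lv (?i - 1) T" by (intro not_less_Least) simp
    then show ?thesis using False by (simp add: seg_def)
  qed (simp add: seg_def)
qed

definition segw :: "nat \<Rightarrow> nat \<Rightarrow> (nat \<Rightarrow> 'a) \<Rightarrow> 'a list" where
  "segw T j x = map x [seg j T..<Lv j T]"

lemma segw_words: "x \<in> XL \<Longrightarrow> segw T j x \<in> words (Lv j T - seg j T)"
  by (simp add: segw_def XL_factor)

lemma segw_eqv_iff:
  "eqv T x y \<longleftrightarrow> (\<forall>j<s. prw j (segw T j x) = prw j (segw T j y))"
proof
  assume eq: "eqv T x y"
  show "\<forall>j<s. prw j (segw T j x) = prw j (segw T j y)"
    using eq by (auto simp: segw_def prw_def eqv_def)
next
  assume eq: "\<forall>j<s. prw j (segw T j x) = prw j (segw T j y)"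
  show "eqv T x y"
    unfolding eqv_def
  proof (intro allI impI)
    fix j k assume j: "j < s" and k: "k < Lv j T"
    obtain i where i: "i \<le> j" "seg i T \<le> k" "k < Lv i T" using level_of[OF j k] by blast
    have "prw i (segw T i x) = prw i (segw T i y)" using eq i(1) j by simp
    then have "\<forall>k\<in>{seg i T..<Lv i T}. pr i (x k) = pr i (y k)" by (simp add: segw_def prw_def)
    then have "pr i (x k) = pr i (y k)" using i by simp
    then show "pr j (x k) = pr j (y k)" using pr_pr[OF i(1)] by metis
  qed
qed

text \<open>A class is given by the level-\<open>j\<close> projections of the \<open>s\<close>
  segments between consecutive boundaries, and these are counted independently.\<close>

lemma classes_upper:
  obtains C where "0 < C" "\<And>T. \<exists>Y\<subseteq>XL. finite Y \<and> real (card Y) \<le> C * exp (real T * bet) \<and> (\<forall>x\<in>XL. \<exists>y\<in>Y. eqv T x y)"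
proof -
  have "\<forall>j. \<exists>C. j < s \<longrightarrow> (\<forall>n. ln (real (card (prw j ` words n))) \<le> real n * htop j + C)"
    using htop_bounds by metis
  then obtain C where C: "\<And>j n. j < s \<Longrightarrow> ln (real (card (prw j ` words n))) \<le> real n * htop j + C j" by metis
  define D where "D = (\<Sum>j<s. htop j + C j)"
  have "\<exists>Y\<subseteq>XL. finite Y \<and> real (card Y) \<le> exp D * exp (real T * bet) \<and> (\<forall>x\<in>XL. \<exists>y\<in>Y. eqv T x y)" for T
  proof -
    let ?f = "\<lambda>x. \<lambda>j\<in>{..<s}. prw j (segw T j x)"
    let ?P = "PiE {..<s} (\<lambda>j. prw j ` words (Lv j T - seg j T))"
    have sub: "?f ` XL \<subseteq> ?P" using segw_words by (auto intro!: restrict_PiE_iff[THEN iffD2])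
    have finP: "finite ?P" by (rule finite_PiE) auto
    obtain Y where Y: "Y \<subseteq> XL" "finite Y" "card Y = card (?f ` XL)" "\<And>x. x \<in> XL \<Longrightarrow> \<exists>y\<in>Y. ?f y = ?f x"
      using choose_representatives[OF finite_subset[OF sub finP]] by blast
    have "real (card Y) \<le> real (card ?P)" unfolding Y(3) of_nat_le_iff by (rule card_mono[OF finP sub])
    also have "\<dots> = (\<Prod>j<s. real (card (prw j ` words (Lv j T - seg j T))))" by (simp add: card_PiE)
    also have "\<dots> = exp (\<Sum>j<s. ln (real (card (prw j ` words (Lv j T - seg j T)))))"
      by (simp add: exp_sum card_gt_0_iff)
    also have "\<dots> \<le> exp (\<Sum>j<s. ww j * htop j * real T + (htop j + C j))"
      unfolding exp_le_cancel_iff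
    proof (rule sum_mono)
      fix j assume "j \<in> {..<s}"
      then have j: "j < s" by simp
      have "real (Lv j T - seg j T) * htop j \<le> (ww j * real T + 1) * htop j"
        using seg_diff(1)[OF j] htop_nonneg[OF j] by (intro mult_right_mono)
      then show "ln (real (card (prw j ` words (Lv j T - seg j T)))) \<le> ww j * htop j * real T + (htop j + C j)"
        using C[OF j, of "Lv j T - seg j T"] by (simp add: algebra_simps)
    qed
    also have "\<dots> = exp D * exp (real T * bet)"
      by (simp add: D_def bet_def sum.distrib exp_add[symmetric] sum_distrib_left mult_ac add.commute)
    finally have "real (card Y) \<le> exp D * exp (real T * bet)" .
    moreover have "\<exists>y\<in>Y. eqv T x y" if x: "x \<in> XL" for x
    proof -
      obtain y where y: "y \<in> Y" "?f y = ?f x" using Y(4)[OF x] by blast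
      have "prw j (segw T j y) = prw j (segw T j x)" if "j < s" for j
        using fun_cong[OF y(2), of j] that by simp
      then have "eqv T x y" unfolding segw_eqv_iff by simp
      then show ?thesis using y(1) by blast
    qed
    ultimately show ?thesis using Y by blast
  qed
  then show ?thesis using that[of "exp D"] by simp
qed

lemma slot_eqv:
  assumes t: "t 0 = 0" "\<And>k. t k + p \<le> t (Suc k)"
    and I: "\<And>k. I k \<in> words (t (Suc k) - t k - p)" and I': "\<And>k. I' k \<in> words (t (Suc k) - t k - p)"
    and eq: "eqv T (slotx I) (slotx I')" and o: "offs I k = offs I' k" and j: "j < s" "t (Suc k) \<le> Lv j T"
  shows "prw j (I k) = prw j (I' k)"
proof -
  let ?b = "t (Suc k) - t k - p"
  have "t k + offs I k + ?b \<le> t (Suc k)" using slot_props(2)[of t I k, OF t I] t(2)[of k] by simp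
  then have "map (pr j) (map (slotx I) [t k + offs I k..<t k + offs I k + ?b]) = map (pr j) (map (slotx I') [t k + offs I k..<t k + offs I k + ?b])"
    using eq j by (auto simp: eqv_def)
  then have "map (pr j) (map (slotx I) [t k + offs I k..<t k + offs I k + ?b]) = map (pr j) (map (slotx I') [t k + offs I' k..<t k + offs I' k + ?b])"
    unfolding o .
  then show ?thesis
    unfolding prw_def slot_props(3)[of t I k, OF t I] slot_props(3)[of t I' k, OF t I'] .
qed

text \<open>Any choice of projected words, one per segment and \<open>p\<close> letters shorter than
  it, is realised by a sequence in slots that end at the level boundaries.\<close>

lemma classes_lower:
  obtains c T0 where "0 < c" "\<And>T Y. T0 \<le> T \<Longrightarrow> finite Y \<Longrightarrow> (\<And>x. x \<in> XL \<Longrightarrow> \<exists>y\<in>Y. eqv T x y) \<Longrightarrow> c * exp (real T * bet) \<le> real (card Y)"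
proof -
  have "\<forall>j. \<exists>T0. j < s \<longrightarrow> (\<forall>T\<ge>T0. p \<le> Lv j T - seg j T)"
  proof
    fix j
    show "\<exists>T0. j < s \<longrightarrow> (\<forall>T\<ge>T0. p \<le> Lv j T - seg j T)"
    proof (cases "j < s")
      case True
      obtain T0 :: nat where T0: "(real p + 1) / ww j < real T0" using reals_Archimedean2 by blast
      have "p \<le> Lv j T - seg j T" if "T0 \<le> T" for T
      proof -
        have "(real p + 1) / ww j < real T" using T0 that by linarith
        then have "real p + 1 < ww j * real T" using ww_pos[OF True] by (simp add: field_simps)
        then have "real p \<le> real (Lv j T - seg j T)" using seg_diff(2)[OF True, of T] by linarith
        then show ?thesis by (simp only: of_nat_le_iff)
      qed
      then show ?thesis by blast
    qed simp
  qed
  then obtain T0 where T0: "\<And>j T. j < s \<Longrightarrow> T0 j \<le> T \<Longrightarrow> p \<le> Lv j T - seg j T" by metis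
  define c where "c = exp (- (\<Sum>j<s. (1 + real p) * htop j)) / (real p + 1) ^ s"
  have "c * exp (real T * bet) \<le> real (card Y)"
    if T: "(\<Sum>j<s. T0 j) \<le> T" and Y: "finite Y" and cov: "\<And>x. x \<in> XL \<Longrightarrow> \<exists>y\<in>Y. eqv T x y" for T Y
  proof -
    have pT: "p \<le> Lv j T - seg j T" if "j < s" for j
    proof -
      have "T0 j \<le> (\<Sum>j<s. T0 j)" using that by (intro member_le_sum) auto
      then show ?thesis using T0[OF that, of T] T by linarith
    qed
    \<comment> \<open>The first \<open>s\<close> slots are the segments up to \<open>T\<close>;
      later slots of length \<open>p + 1\<close> only continue the sequence, each carrying an
      arbitrary letter.\<close>
    define t where "t k = (if k = 0 then 0 else if k \<le> s then Lv (k - 1) T else T + (k - s) * (p + 1))" for k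
    have t0: "t 0 = 0" by (simp add: t_def)
    have tj: "t (Suc j) = Lv j T" "t j = seg j T" if "j < s" for j
      using that by (auto simp: t_def seg_def)
    have ts: "t s = T" using s_pos Lv_top[of T] by (simp add: t_def)
    have tm: "t k + p \<le> t (Suc k)" for k
    proof (cases "k < s")
      case True
      then show ?thesis using pT[OF True] seg_le[OF True, of T] by (simp add: tj[OF True])
    next
      case False
      then have "t k = T + (k - s) * (p + 1)" using ts by (cases "k = s") (auto simp: t_def)
      moreover have "t (Suc k) = T + (Suc k - s) * (p + 1)" using False by (simp add: t_def)
      ultimately show ?thesis using False by (simp add: Suc_diff_le)
    qed
    define n where "n j = Lv j T - seg j T - p" for j
    have "\<forall>j J. \<exists>u. J \<in> prw j ` words (n j) \<longrightarrow> u \<in> words (n j) \<and> prw j u = J" by auto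
    then obtain rep where rep: "\<And>j J. J \<in> prw j ` words (n j) \<Longrightarrow> rep j J \<in> words (n j) \<and> prw j (rep j J) = J" by metis
    have "\<forall>k. \<exists>u. u \<in> words k" using words_nonempty by blast
    then obtain dw where dw: "\<And>k. dw k \<in> words k" by metis
    define I where "I \<phi> k = (if k < s then rep k (\<phi> k) else dw (t (Suc k) - t k - p))" for \<phi> k
    let ?P = "PiE {..<s} (\<lambda>j. prw j ` words (n j))"
    have Iw: "I \<phi> k \<in> words (t (Suc k) - t k - p)" if "\<phi> \<in> ?P" for \<phi> k
    proof (cases "k < s")
      case True
      then have "\<phi> k \<in> prw k ` words (n k)" using that by (auto simp: PiE_def)
      then show ?thesis using rep True by (simp add: I_def n_def tj)
    qed (simp add: I_def dw)
    have xX: "slotx (I \<phi>) \<in> XL" and off: "offs (I \<phi>) k \<le> p" if "\<phi> \<in> ?P" for \<phi> k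
      using slot_props(1,2)[of t "I \<phi>", OF t0 tm Iw[OF that]] by auto
    have "\<forall>\<phi>. \<exists>y. \<phi> \<in> ?P \<longrightarrow> y \<in> Y \<and> eqv T (slotx (I \<phi>)) y" using cov xX by blast
    then obtain yy where yy: "\<And>\<phi>. \<phi> \<in> ?P \<Longrightarrow> yy \<phi> \<in> Y \<and> eqv T (slotx (I \<phi>)) (yy \<phi>)" by metis
    let ?g = "\<lambda>\<phi>. (yy \<phi>, \<lambda>k\<in>{..<s}. offs (I \<phi>) k)"
    let ?Q = "Y \<times> PiE {..<s} (\<lambda>_. {..p})"
    \<comment> \<open>The class alone does not show where the words start in their slots. Together
      with the offsets it determines them, hence the factor \<open>(p + 1) ^ s\<close>.\<close>
    have inj: "inj_on ?g ?P"
    proof (rule inj_onI)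
      fix \<phi> \<psi> assume \<phi>: "\<phi> \<in> ?P" and \<psi>: "\<psi> \<in> ?P" and eq: "?g \<phi> = ?g \<psi>"
      have "eqv T (slotx (I \<phi>)) (slotx (I \<psi>))"
        using yy[OF \<phi>] yy[OF \<psi>] eq eqv_trans eqv_sym by (metis prod.inject)
      moreover have "offs (I \<phi>) j = offs (I \<psi>) j" if "j < s" for j
        using eq that by (metis (no_types, lifting) lessThan_iff prod.inject restrict_apply')
      ultimately have pe: "prw j (I \<phi> j) = prw j (I \<psi> j)" if "j < s" for j
        using slot_eqv[of t "I \<phi>" "I \<psi>" T j j, OF t0 tm Iw[OF \<phi>] Iw[OF \<psi>]] that by (simp add: tj)
      show "\<phi> = \<psi>"
      proof (rule PiE_ext[OF \<phi> \<psi>])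
        fix j assume j: "j \<in> {..<s}"
        then have "\<phi> j \<in> prw j ` words (n j)" "\<psi> j \<in> prw j ` words (n j)" using \<phi> \<psi> by (auto simp: PiE_def)
        then show "\<phi> j = \<psi> j" using rep[of "\<phi> j" j] rep[of "\<psi> j" j] pe[of j] j by (simp add: I_def)
      qed
    qed
    have finQ: "finite ?Q" using Y by (intro finite_cartesian_product finite_PiE) auto
    have "card ?P \<le> card ?Q"
    proof (rule card_inj_on_le[OF inj _ finQ])
      show "?g ` ?P \<subseteq> ?Q"
      proof
        fix z assume "z \<in> ?g ` ?P"
        then obtain \<phi> where \<phi>: "\<phi> \<in> ?P" "z = ?g \<phi>" by blast
        have "(\<lambda>k\<in>{..<s}. offs (I \<phi>) k) \<in> PiE {..<s} (\<lambda>_. {..p})"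
          using off[OF \<phi>(1)] by (auto intro!: restrict_PiE_iff[THEN iffD2])
        then show "z \<in> ?Q" using yy[OF \<phi>(1)] \<phi>(2) by simp
      qed
    qed
    also have "card ?Q = card Y * (p + 1) ^ s" by (simp add: card_cartesian_product card_PiE)
    finally have "real (card ?P) \<le> real (card Y * (p + 1) ^ s)" by (simp only: of_nat_le_iff)
    then have 1: "real (card ?P) \<le> real (card Y) * (real p + 1) ^ s" by (simp add: add.commute)
    have "exp (\<Sum>j<s. ww j * htop j * real T - (1 + real p) * htop j) \<le> exp (\<Sum>j<s. ln (real (card (prw j ` words (n j)))))"
      unfolding exp_le_cancel_iff
    proof (rule sum_mono)
      fix j assume "j \<in> {..<s}"
      then have j: "j < s" by simp
      have "(ww j * real T - 1 - real p) * htop j \<le> real (n j) * htop j"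
        using seg_diff(2)[OF j, of T] pT[OF j] htop_nonneg[OF j] by (intro mult_right_mono) (auto simp: n_def)
      also have "\<dots> \<le> ln (real (card (prw j ` words (n j))))" using htop_bounds[OF j] by metis
      finally show "ww j * htop j * real T - (1 + real p) * htop j \<le> ln (real (card (prw j ` words (n j))))"
        by (simp add: algebra_simps)
    qed
    also have "\<dots> = real (card ?P)" by (simp add: exp_sum card_gt_0_iff card_PiE)
    also have "(\<Sum>j<s. ww j * htop j * real T - (1 + real p) * htop j) = real T * bet - (\<Sum>j<s. (1 + real p) * htop j)"
      by (simp add: bet_def sum_subtractf sum_distrib_left mult_ac)
    finally have "exp (real T * bet - (\<Sum>j<s. (1 + real p) * htop j)) \<le> real (card Y) * (real p + 1) ^ s" using 1 by linarith
    moreover have "exp (real T * bet - (\<Sum>j<s. (1 + real p) * htop j)) = exp (- (\<Sum>j<s. (1 + real p) * htop j)) * exp (real T * bet)"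
      by (simp add: exp_add[symmetric])
    ultimately have "exp (- (\<Sum>j<s. (1 + real p) * htop j)) * exp (real T * bet) \<le> real (card Y) * (real p + 1) ^ s" by linarith
    moreover have "0 < (real p + 1) ^ s" by (intro zero_less_power) simp
    ultimately show ?thesis unfolding c_def by (simp add: field_simps)
  qed
  moreover have "0 < c" unfolding c_def by (intro divide_pos_pos zero_less_power) auto
  ultimately show ?thesis using that by blast
qed

lemma hausdorff_measure_bet_finite: "hausdorff_measure (bet / ln N) (R ` XL) < \<infinity>"
proof -
  have lnN: "0 < ln N" using N by simp
  define t where "t = bet / ln N"
  have t: "0 \<le> t" using bet_nonneg lnN by (simp add: t_def)
  obtain C where C: "0 < C" "\<And>T. \<exists>Y\<subseteq>XL. finite Y \<and> real (card Y) \<le> C * exp (real T * bet) \<and> (\<forall>x\<in>XL. \<exists>y\<in>Y. eqv T x y)"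
    using classes_upper by blast
  have bound: "hausdorff_premeasure (CR * dl T) t (R ` XL) \<le> ennreal (C * CR powr t)" for T
  proof -
    obtain Y where Y: "finite Y" "real (card Y) \<le> C * exp (real T * bet)" "\<And>x. x \<in> XL \<Longrightarrow> \<exists>y\<in>Y. eqv T x y"
      using C(2)[of T] by blast
    have "hausdorff_premeasure (CR * dl T) t (R ` XL) \<le> ennreal (\<Sum>(T, y)\<in>{T} \<times> Y. (CR * dl T) powr t)"
      by (rule cls_cover) (use Y t in auto)
    also have "(\<Sum>(T, y)\<in>{T} \<times> Y. (CR * dl T) powr t) = real (card Y) * (CR * dl T) powr t"
      by (subst sum.cartesian_product[symmetric]) simp
    also have "\<dots> \<le> (C * exp (real T * bet)) * (CR * dl T) powr t" using Y(2) by (intro mult_right_mono) auto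
    also have "\<dots> = C * CR powr t"
      using CR dl_pos[of T] lnN by (simp add: powr_mult dl_powr t_def exp_minus field_simps)
    finally show ?thesis by (simp add: ennreal_leI)
  qed
  have "hausdorff_premeasure \<delta> t (R ` XL) \<le> ennreal (C * CR powr t)" if d: "0 < \<delta>" for \<delta>
  proof -
    have "(\<lambda>T. CR * (1 / N) ^ T) \<longlonglongrightarrow> CR * 0" using N by (intro tendsto_mult tendsto_const LIMSEQ_realpow_zero) auto
    then have "\<forall>\<^sub>F T in sequentially. CR * (1 / N) ^ T < \<delta>" using d by (intro order_tendstoD) auto
    then have "\<exists>T. CR * (1 / N) ^ T < \<delta>" by (rule eventually_happens'[OF sequentially_bot])
    then obtain T where T: "CR * dl T < \<delta>" by (auto simp: dl_def power_divide)
    have "hausdorff_premeasure \<delta> t (R ` XL) \<le> hausdorff_premeasure (CR * dl T) t (R ` XL)"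
      using T by (intro premeasure_antimono) simp
    then show ?thesis using bound[of T] by (rule order_trans)
  qed
  then have "hausdorff_measure t (R ` XL) \<le> ennreal (C * CR powr t)" by (rule hausdorff_measure_leI)
  then show ?thesis unfolding t_def by (rule le_less_trans) simp
qed

end

section \<open>Covering numbers and the box dimension\<close>

lemma covering_number_le:
  assumes "finite C" "\<And>U. U \<in> C \<Longrightarrow> bounded U \<and> diameter U \<le> \<delta>" "E \<subseteq> \<Union>C"
  shows "covering_number \<delta> E \<le> card C"
  unfolding covering_number_def using assms by (intro Least_le) blast

lemma covering_number_attained:
  assumes "finite C0" "\<And>U. U \<in> C0 \<Longrightarrow> bounded U \<and> diameter U \<le> \<delta>" "E \<subseteq> \<Union>C0"
  obtains C where "finite C" "card C = covering_number \<delta> E" "\<And>U. U \<in> C \<Longrightarrow> bounded U \<and> diameter U \<le> \<delta>" "E \<subseteq> \<Union>C"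
proof -
  let ?Q = "\<lambda>n. \<exists>C. finite C \<and> card C = n \<and> (\<forall>U\<in>C. bounded U \<and> diameter U \<le> \<delta>) \<and> E \<subseteq> \<Union>C"
  have "?Q (card C0)" using assms by blast
  then have "?Q (LEAST n. ?Q n)" by (rule LeastI)
  then show ?thesis using that unfolding covering_number_def by blast
qed

context coding_geom
begin

lemma cover_by_classes:
  assumes "CR * dl T \<le> \<delta>" "\<And>x. x \<in> XL \<Longrightarrow> \<exists>y\<in>Y. eqv T x y"
  shows "\<And>U. U \<in> cls T ` Y \<Longrightarrow> bounded U \<and> diameter U \<le> \<delta>" "R ` XL \<subseteq> \<Union>(cls T ` Y)"
proof -
  show "bounded U \<and> diameter U \<le> \<delta>" if U: "U \<in> cls T ` Y" for U
  proof -
    obtain y where "U = cls T y" using U by blast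
    then show ?thesis using cls_small[of T y] assms(1) by simp
  qed
  show "R ` XL \<subseteq> \<Union>(cls T ` Y)" using assms(2) unfolding cls_def by blast
qed

lemma small_scale_exists: "0 < \<delta> \<Longrightarrow> \<exists>T. CR * dl T \<le> \<delta>"
proof -
  assume d: "0 < \<delta>"
  have "(\<lambda>T. CR * (1 / N) ^ T) \<longlonglongrightarrow> CR * 0" using N by (intro tendsto_mult tendsto_const LIMSEQ_realpow_zero) auto
  then have "\<forall>\<^sub>F T in sequentially. CR * (1 / N) ^ T < \<delta>" using d by (intro order_tendstoD) auto
  then have "\<exists>T. CR * (1 / N) ^ T < \<delta>" by (rule eventually_happens'[OF sequentially_bot])
  then show ?thesis by (auto simp: dl_def power_divide intro: less_imp_le)
qed

lemma covering_number_growth: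
  obtains c C T0 where "0 < c" "0 < C"
    "\<And>\<delta> T. CR * dl T \<le> \<delta> \<Longrightarrow> real (covering_number \<delta> (R ` XL)) \<le> C * exp (real T * bet)"
    "\<And>\<delta> T. 0 < \<delta> \<Longrightarrow> \<delta> \<le> dl T \<Longrightarrow> T0 \<le> T \<Longrightarrow> c * exp (real T * bet) \<le> real (covering_number \<delta> (R ` XL))"
proof -
  obtain C where C: "0 < C" "\<And>T. \<exists>Y\<subseteq>XL. finite Y \<and> real (card Y) \<le> C * exp (real T * bet) \<and> (\<forall>x\<in>XL. \<exists>y\<in>Y. eqv T x y)"
    using classes_upper by blast
  obtain c T0 where c: "0 < c" "\<And>T Y. T0 \<le> T \<Longrightarrow> finite Y \<Longrightarrow> (\<And>x. x \<in> XL \<Longrightarrow> \<exists>y\<in>Y. eqv T x y) \<Longrightarrow> c * exp (real T * bet) \<le> real (card Y)"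
    using classes_lower by blast
  have up: "real (covering_number \<delta> (R ` XL)) \<le> C * exp (real T * bet)" if d: "CR * dl T \<le> \<delta>" for \<delta> T
  proof -
    obtain Y where Y: "finite Y" "real (card Y) \<le> C * exp (real T * bet)" "\<And>x. x \<in> XL \<Longrightarrow> \<exists>y\<in>Y. eqv T x y"
      using C(2)[of T] by blast
    have "covering_number \<delta> (R ` XL) \<le> card (cls T ` Y)"
      using Y(1) by (intro covering_number_le cover_by_classes[OF d Y(3)]) auto
    also have "\<dots> \<le> card Y" by (rule card_image_le[OF Y(1)])
    finally show ?thesis using Y(2) by linarith
  qed
  have lo: "c * exp (real T * bet) \<le> real K0 * real (covering_number \<delta> (R ` XL))" if d: "0 < \<delta>" "\<delta> \<le> dl T" "T0 \<le> T" for \<delta> T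
  proof -
    \<comment> \<open>A crude finite cover, only to ensure that the minimum in
      \<open>covering_number\<close> is attained.\<close>
    obtain T' where T': "CR * dl T' \<le> \<delta>" using small_scale_exists[OF d(1)] by blast
    obtain Y' where Y': "finite Y'" "\<And>x. x \<in> XL \<Longrightarrow> \<exists>y\<in>Y'. eqv T' x y" using C(2)[of T'] by blast
    obtain D where D: "finite D" "card D = covering_number \<delta> (R ` XL)" "\<And>U. U \<in> D \<Longrightarrow> bounded U \<and> diameter U \<le> \<delta>"
      "R ` XL \<subseteq> \<Union>D"
      using covering_number_attained[of "cls T' ` Y'" \<delta> "R ` XL"] Y'(1) cover_by_classes[OF T' Y'(2)] by auto
    have "\<forall>U\<in>D. \<exists>Y. finite Y \<and> card Y \<le> K0 \<and> (\<forall>x\<in>XL. R x \<in> U \<longrightarrow> (\<exists>y\<in>Y. eqv T x y))"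
    proof
      fix U assume "U \<in> D"
      then have "bounded U" "diameter U \<le> dl T" using D(3)[of U] d(2) by auto
      then show "\<exists>Y. finite Y \<and> card Y \<le> K0 \<and> (\<forall>x\<in>XL. R x \<in> U \<longrightarrow> (\<exists>y\<in>Y. eqv T x y))"
        using cover_R[of U T] by blast
    qed
    then obtain YU where YU: "\<And>U. U \<in> D \<Longrightarrow> finite (YU U) \<and> card (YU U) \<le> K0 \<and> (\<forall>x\<in>XL. R x \<in> U \<longrightarrow> (\<exists>y\<in>YU U. eqv T x y))"
      by metis
    have "c * exp (real T * bet) \<le> real (card (\<Union>U\<in>D. YU U))"
    proof (rule c(2)[OF d(3)])
      show "finite (\<Union>U\<in>D. YU U)" using D(1) YU by blast
      show "\<exists>y\<in>(\<Union>U\<in>D. YU U). eqv T x y" if x: "x \<in> XL" for x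
      proof -
        obtain U where "U \<in> D" "R x \<in> U" using D(4) x by blast
        then show ?thesis using YU x by blast
      qed
    qed
    also have "card (\<Union>U\<in>D. YU U) \<le> (\<Sum>U\<in>D. card (YU U))" by (rule card_UN_le[OF D(1)])
    also have "\<dots> \<le> (\<Sum>U\<in>D. K0)" using YU by (intro sum_mono) auto
    also have "real (\<Sum>U\<in>D. K0) = real K0 * real (covering_number \<delta> (R ` XL))" using D(2) by simp
    finally show ?thesis by simp
  qed
  have K0: "0 < real K0"
  proof (rule ccontr)
    assume "\<not> 0 < real K0"
    then have "c * exp (real T0 * bet) \<le> 0" using lo[of "dl T0" T0] dl_pos by auto
    moreover have "0 < c * exp (real T0 * bet)" using c(1) by simp
    ultimately show False by linarith
  qed
  have "c / real K0 * exp (real T * bet) \<le> real (covering_number \<delta> (R ` XL))" if "0 < \<delta>" "\<delta> \<le> dl T" "T0 \<le> T" for \<delta> T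
    using lo[OF that] K0 by (simp add: field_simps)
  then show ?thesis using that[of "c / real K0" C T0] c(1) K0 C(1) up by auto
qed

lemma box_limit:
  "((\<lambda>\<delta>. ln (real (covering_number \<delta> (R ` XL))) / - ln \<delta>) \<longlongrightarrow> bet / ln N) (at_right 0)"
proof -
  obtain c C T0 where cC: "0 < c" "0 < C"
    "\<And>\<delta> T. CR * dl T \<le> \<delta> \<Longrightarrow> real (covering_number \<delta> (R ` XL)) \<le> C * exp (real T * bet)"
    "\<And>\<delta> T. 0 < \<delta> \<Longrightarrow> \<delta> \<le> dl T \<Longrightarrow> T0 \<le> T \<Longrightarrow> c * exp (real T * bet) \<le> real (covering_number \<delta> (R ` XL))"
    using covering_number_growth by blast
  have lnN: "0 < ln N" using N by simp
  let ?f = "\<lambda>\<delta>. ln (real (covering_number \<delta> (R ` XL)))"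
  let ?b = "bet / ln N"
  define A1 where "A1 = ln C + \<bar>ln CR\<bar> * ?b + bet"
  define A2 where "A2 = ln c - bet"
  define A where "A = max \<bar>A1\<bar> \<bar>A2\<bar>"
  define L0 where "L0 = max (\<bar>ln CR\<bar> + 1) ((real T0 + 1) * ln N)"
  have b0: "0 \<le> ?b" using bet_nonneg lnN by simp
  have est: "\<bar>?f \<delta> / - ln \<delta> - ?b\<bar> \<le> A / - ln \<delta>" if d: "0 < \<delta>" "L0 < - ln \<delta>" for \<delta>
  proof -
    define l where "l = - ln \<delta>"
    have del: "\<delta> = exp (- l)" using d by (simp add: l_def)
    have l: "\<bar>ln CR\<bar> + 1 < l" "(real T0 + 1) * ln N < l" using d by (auto simp: l_def L0_def)
    then have l0: "0 < l" by linarith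
    \<comment> \<open>The last scale with \<open>\<delta> \<le> dl T'\<close> gives the lower bound;
      \<open>T\<close> below is the first one with \<open>CR * dl T \<le> \<delta>\<close>. They
      differ by a bounded number, which disappears after division by \<open>l\<close>.\<close>
    define T' where "T' = nat \<lfloor>l / ln N\<rfloor>"
    have T': "real T' \<le> l / ln N" "l / ln N \<le> real T' + 1" using l0 lnN by (simp_all add: T'_def)
    have "real T0 + 1 < l / ln N" using l(2) lnN by (simp add: field_simps)
    then have T0: "T0 \<le> T'" using T'(2) by linarith
    have "\<delta> \<le> dl T'"
    proof -
      have "real T' * ln N \<le> l" using T'(1) lnN by (simp add: field_simps)
      then have "\<delta> \<le> exp (- (real T' * ln N))" by (simp add: del)
      then show ?thesis using dl_powr[of T' 1] dl_pos[of T'] by simp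
    qed
    then have lo: "c * exp (real T' * bet) \<le> real (covering_number \<delta> (R ` XL))" using cC(4) d(1) T0 by blast
    have pos: "0 < c * exp (real T' * bet)" using cC(1) by simp
    then have "ln (c * exp (real T' * bet)) \<le> ?f \<delta>" using lo by (intro ln_mono) auto
    then have "ln c + real T' * bet \<le> ?f \<delta>" using cC(1) by (simp add: ln_mult_pos)
    moreover have "(l / ln N - 1) * bet \<le> real T' * bet" using T'(2) bet_nonneg by (intro mult_right_mono) auto
    moreover have "(l / ln N - 1) * bet = l * ?b - bet" using lnN by (simp add: field_simps)
    ultimately have low: "l * ?b + A2 \<le> ?f \<delta>" by (simp add: A2_def)
    define T where "T = nat \<lceil>(l + ln CR) / ln N\<rceil>"
    have nn: "0 \<le> (l + ln CR) / ln N" using l lnN by (intro divide_nonneg_pos) auto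
    have T: "(l + ln CR) / ln N \<le> real T" "real T \<le> (l + ln CR) / ln N + 1"
      using nn by (simp_all add: T_def)
    have "CR * dl T \<le> \<delta>"
    proof -
      have "l + ln CR \<le> real T * ln N" using T(1) lnN by (simp add: field_simps)
      then have "exp (ln CR + - (real T * ln N)) \<le> \<delta>" by (simp add: del)
      then have "CR * exp (- (real T * ln N)) \<le> \<delta>" using CR by (simp only: exp_add exp_ln)
      then show ?thesis using dl_powr[of T 1] dl_pos[of T] by simp
    qed
    then have up: "real (covering_number \<delta> (R ` XL)) \<le> C * exp (real T * bet)" by (rule cC(3))
    have "?f \<delta> \<le> ln (C * exp (real T * bet))" using up lo pos by (intro ln_mono) auto
    then have "?f \<delta> \<le> ln C + real T * bet" using cC(2) by (simp add: ln_mult_pos)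
    moreover have "real T * bet \<le> ((l + ln CR) / ln N + 1) * bet" using T(2) bet_nonneg by (intro mult_right_mono) auto
    moreover have "((l + ln CR) / ln N + 1) * bet = l * ?b + ln CR * ?b + bet" using lnN by (simp add: field_simps)
    moreover have "ln CR * ?b \<le> \<bar>ln CR\<bar> * ?b" using b0 by (intro mult_right_mono) auto
    ultimately have upp: "?f \<delta> \<le> l * ?b + A1" by (simp add: A1_def)
    have "\<bar>?f \<delta> - l * ?b\<bar> \<le> A" using low upp unfolding A_def by linarith
    moreover have "?f \<delta> / l - ?b = (?f \<delta> - l * ?b) / l" using l0 by (simp add: field_simps)
    ultimately show ?thesis using l0 by (simp add: l_def[symmetric] divide_right_mono)
  qed
  have lim: "LIM x at_right (0::real). - ln x :> at_top"
    using ln_at_0 by (simp add: filterlim_uminus_at_top)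
  have "((\<lambda>\<delta>. A / - ln \<delta>) \<longlongrightarrow> 0) (at_right 0)"
    by (rule tendsto_divide_0[OF tendsto_const]) (rule filterlim_at_top_imp_at_infinity[OF lim])
  moreover have "\<forall>\<^sub>F \<delta> in at_right 0. norm (?f \<delta> / - ln \<delta> - ?b) \<le> A / - ln \<delta>"
  proof -
    have "\<forall>\<^sub>F \<delta> in at_right 0. L0 < - ln \<delta>" using lim by (simp only: filterlim_at_top_dense)
    moreover have "\<forall>\<^sub>F \<delta> in at_right (0::real). 0 < \<delta>" by (simp add: eventually_at_right_less)
    ultimately show ?thesis by eventually_elim (use est in simp)
  qed
  ultimately have "((\<lambda>\<delta>. ?f \<delta> / - ln \<delta> - ?b) \<longlongrightarrow> 0) (at_right 0)" by (rule Lim_null_comparison[rotated])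
  then show ?thesis by (rule LIM_zero_cancel)
qed

lemma box_dim_eq: "box_dim (R ` XL) = bet / ln N"
proof -
  have "((\<lambda>\<delta>. ereal (ln (real (covering_number \<delta> (R ` XL))) / - ln \<delta>)) \<longlongrightarrow> ereal (bet / ln N)) (at_right 0)"
    using box_limit by (rule tendsto_ereal)
  then have "lower_box_dim (R ` XL) = ereal (bet / ln N)" "upper_box_dim (R ` XL) = ereal (bet / ln N)"
    unfolding lower_box_dim_def upper_box_dim_def
    by (auto intro!: lim_imp_Liminf lim_imp_Limsup simp: trivial_limit_at_right_real)
  then show ?thesis unfolding box_dim_def by (intro the_equality) auto
qed

lemma Pr_le_bet: "Pr ww \<le> bet"
proof -
  have "\<forall>j. \<exists>C. j < s \<longrightarrow> (\<forall>n. ln (real (card (prw j ` words n))) \<le> real n * htop j + C)"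
    using htop_bounds by metis
  then obtain C where C: "\<And>j n. j < s \<Longrightarrow> ln (real (card (prw j ` words n))) \<le> real n * htop j + C j" by metis
  show ?thesis
  proof (rule Pr_leI[where c="\<Sum>j<s. ww j * C j"])
    fix b
    show "Zl ww b \<le> real b * bet + (\<Sum>j<s. ww j * C j)"
    proof (rule Zl_le)
      fix q assume q: "q \<in> dists b"
      have "Dw ww q \<le> (\<Sum>j<s. ww j * (real b * htop j + C j))"
        unfolding Dw_def using Hl_le_ln_card[OF q] C ww_nonneg
        by (intro sum_mono mult_left_mono) (auto intro: order_trans)
      also have "\<dots> = real b * bet + (\<Sum>j<s. ww j * C j)"
        by (simp add: bet_def distrib_left sum.distrib sum_distrib_left mult_ac)
      finally show "Dw ww q \<le> real b * bet + (\<Sum>j<s. ww j * C j)" .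
    qed
  qed (rule ww_nonneg)
qed

end

section \<open>Positive measure in the rigid case\<close>

context coding_geom
begin

text \<open>Open sets are wanted for compactness, and diameters of the form \<open>dl T\<close> for
  counting classes. The slack \<open>e\<close> gives room for enlarging, even for a set of diameter
  0; the factor \<open>N powr t\<close> is the price of rounding to a scale.\<close>

lemma enlarge:
  fixes U :: "'m set"
  assumes U: "bounded U" "U \<noteq> {}" "diameter U < dl T0" and t: "0 \<le> t" and e: "0 < e"
  obtains V T where "open V" "bounded V" "U \<subseteq> V" "diameter V \<le> dl T" "T0 \<le> T"
    "ennreal (dl T powr t) \<le> ennreal (N powr t) * (diam_pow t U + ennreal e)"
proof -
  define d where "d = diameter U"
  have d0: "0 \<le> d" unfolding d_def by (rule diameter_ge_0[OF U(1)])
  \<comment> \<open>For positive \<open>t\<close> this solves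
    \<open>D0 powr t = d powr t + e\<close>.\<close>
  define D0 where "D0 = (if t = 0 then d + 1 else (d powr t + e) powr (1 / t))"
  define D where "D = min D0 (dl T0)"
  have D0: "d < D0"
  proof (cases "t = 0")
    case False
    have "d = (d powr t) powr (1 / t)" using False d0 by (simp add: powr_powr)
    also have "\<dots> < (d powr t + e) powr (1 / t)" using False t e by (intro powr_less_mono2) auto
    finally show ?thesis using False by (simp add: D0_def)
  qed (simp add: D0_def)
  have dD: "d < D" using D0 U(3) by (simp add: D_def d_def)
  define r where "r = (D - d) / 2"
  have r: "0 < r" using dD by (simp add: r_def)
  define V where "V = (\<Union>u\<in>U. ball u r)"
  have dV: "dist x y \<le> D" if xy: "x \<in> V" "y \<in> V" for x y
  proof -
    obtain u v where uv: "u \<in> U" "v \<in> U" "dist u x < r" "dist v y < r" using xy by (auto simp: V_def)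
    have "dist u v \<le> d" unfolding d_def using diameter_bounded_bound[OF U(1) uv(1,2)] .
    moreover have "dist x y \<le> dist u x + dist u v + dist v y"
      by (metis add.commute dist_commute dist_triangle dist_triangle_le add_left_mono add.assoc order_trans)
    ultimately have "dist x y \<le> r + d + r" using uv by linarith
    then show ?thesis by (simp add: r_def field_simps)
  qed
  have UV: "U \<subseteq> V" using r by (auto simp: V_def)
  have bV: "bounded V"
  proof -
    obtain u where "u \<in> V" using U(2) UV by blast
    then show ?thesis unfolding bounded_def by (intro exI[of _ u] exI[of _ D]) (simp add: dV)
  qed
  have diV: "diameter V \<le> D" using dV d0 dD by (intro diameter_le) (auto simp: dist_norm)
  \<comment> \<open>The scale before \<open>m\<close> is the one wanted: its \<open>dl\<close> is at
    least \<open>D\<close> and less than \<open>N * D\<close>.\<close>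
  define m where "m = (LEAST T. dl T < D)"
  have "\<exists>T. dl T < D"
  proof -
    have lim: "(\<lambda>T. (1 / N) ^ T) \<longlonglongrightarrow> 0" using N by (intro LIMSEQ_realpow_zero) auto
    have "0 < D" using d0 dD by linarith
    then have "\<forall>\<^sub>F T in sequentially. (1 / N) ^ T < D" by (rule order_tendstoD(2)[OF lim])
    then have "\<exists>T. (1 / N) ^ T < D" by (rule eventually_happens'[OF sequentially_bot])
    then show ?thesis by (simp add: dl_def power_divide)
  qed
  then have m: "dl m < D" unfolding m_def by (rule LeastI_ex)
  have dl_mono: "dl T \<le> dl T'" if "T' \<le> T" for T T'
    using N that power_increasing[of T' T N] unfolding dl_def by (intro divide_left_mono) auto
  have "T0 < m"
  proof (rule ccontr)
    assume "\<not> T0 < m"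
    then have "dl T0 \<le> dl m" by (intro dl_mono) simp
    then show False using m by (simp add: D_def)
  qed
  then obtain T where T: "m = Suc T" "T0 \<le> T" by (metis Suc_le_mono Suc_leI less_imp_Suc_add le_add1 add_Suc_right)
  have DT: "D \<le> dl T" using not_less_Least[of T "\<lambda>T. dl T < D"] T(1) unfolding m_def by (simp add: not_less)
  have "dl T = N * dl m" using N by (simp add: T(1) dl_def)
  then have "dl T \<le> N * D" using m N by (simp add: less_imp_le)
  then have "dl T powr t \<le> (N * D) powr t" using dl_pos[of T] t by (intro powr_mono2) auto
  also have "\<dots> = N powr t * D powr t" using N d0 dD by (simp add: powr_mult)
  also have "\<dots> \<le> N powr t * (if t = 0 then 1 else d powr t + e)"
  proof (rule mult_left_mono)
    show "D powr t \<le> (if t = 0 then 1 else d powr t + e)"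
    proof (cases "t = 0")
      case False
      have "D powr t \<le> D0 powr t" using t d0 dD by (intro powr_mono2) (auto simp: D_def)
      also have "\<dots> = d powr t + e" using False e by (simp add: D0_def powr_powr add_nonneg_nonneg)
      finally show ?thesis using False by simp
    qed (use d0 dD in simp)
  qed simp
  finally have "ennreal (dl T powr t) \<le> ennreal (N powr t * (if t = 0 then 1 else d powr t + e))" by (rule ennreal_leI)
  also have "\<dots> = ennreal (N powr t) * ennreal (if t = 0 then 1 else d powr t + e)"
    using e by (intro ennreal_mult) auto
  also have "ennreal (if t = 0 then 1 else d powr t + e) \<le> diam_pow t U + ennreal e"
    using U(2) e by (auto simp: diam_pow_def d_def ennreal_plus)
  finally have "ennreal (dl T powr t) \<le> ennreal (N powr t) * (diam_pow t U + ennreal e)"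
    by (simp add: mult_left_mono)
  moreover have "diameter V \<le> dl T" using diV DT by linarith
  moreover have "open V" by (auto simp: V_def)
  ultimately show ?thesis using that UV bV T(2) by blast
qed

lemma scale_cover:
  fixes U :: "nat \<Rightarrow> 'm set"
  assumes U: "\<And>i. bounded (U i)" "\<And>i. diameter (U i) < dl T0" and t: "0 \<le> t"
    and a: "(\<Sum>i. diam_pow t (U i)) \<le> ennreal a" "0 < a"
  obtains V T where "\<And>i. U i \<noteq> {} \<Longrightarrow> open (V i) \<and> bounded (V i) \<and> U i \<subseteq> V i \<and> diameter (V i) \<le> dl (T i) \<and> T0 \<le> T i"
    "(\<Sum>i. if U i = {} then 0 else ennreal (dl (T i) powr t)) \<le> ennreal (N powr t * (2 * a))"
proof -
  \<comment> \<open>The slacks sum to \<open>a\<close>, so enlarging at most doubles the bound for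
    the sum.\<close>
  define e where "e i = a * (1 / 2) ^ Suc i" for i :: nat
  have e: "0 < e i" for i using a by (simp add: e_def)
  have "\<forall>i. \<exists>V T. U i \<noteq> {} \<longrightarrow> (open V \<and> bounded V \<and> U i \<subseteq> V \<and> diameter V \<le> dl T \<and> T0 \<le> T) \<and>
    ennreal (dl T powr t) \<le> ennreal (N powr t) * (diam_pow t (U i) + ennreal (e i))"
    using enlarge[OF U(1) _ U(2) t e] by metis
  then obtain V T where VT: "\<And>i. U i \<noteq> {} \<Longrightarrow> (open (V i) \<and> bounded (V i) \<and> U i \<subseteq> V i \<and> diameter (V i) \<le> dl (T i) \<and> T0 \<le> T i) \<and>
    ennreal (dl (T i) powr t) \<le> ennreal (N powr t) * (diam_pow t (U i) + ennreal (e i))" by metis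
  have "(\<Sum>i. if U i = {} then 0 else ennreal (dl (T i) powr t)) \<le> (\<Sum>i. ennreal (N powr t) * (diam_pow t (U i) + ennreal (e i)))"
    using VT by (intro suminf_le) auto
  also have "\<dots> = ennreal (N powr t) * ((\<Sum>i. diam_pow t (U i)) + (\<Sum>i. ennreal (e i)))"
    by (simp add: suminf_add[symmetric])
  also have "(\<Sum>i. ennreal (e i)) = ennreal a"
  proof (rule suminf_ennreal_eq)
    show "e sums a" unfolding e_def using sums_mult[OF power_half_series, of a] by simp
  qed (use e in \<open>simp add: less_imp_le\<close>)
  also have "ennreal (N powr t) * ((\<Sum>i. diam_pow t (U i)) + ennreal a) \<le> ennreal (N powr t) * (ennreal a + ennreal a)"
    using a(1) by (intro mult_left_mono add_right_mono) auto
  also have "\<dots> = ennreal (N powr t * (2 * a))"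
    using a(2) by (simp add: ennreal_plus[symmetric] ennreal_mult[symmetric] del: ennreal_plus)
  finally show ?thesis using that[of V T] VT by blast
qed

lemma sum_ww: "(\<Sum>j<s. ww j) = 1"
proof -
  have "(\<Sum>j<Suc n. ww j) = lam n" if "n < s" for n
    using that by (induction n) (auto simp: ww_def)
  from this[of "s - 1"] show ?thesis using s_pos lam_top by simp
qed

lemma word_extend_XL:
  assumes u: "u \<in> L"
  obtains x where "x \<in> XL" "map x [0..<length u] = u"
proof -
  define U where "U k = (((\<lambda>v. v @ xt 1 v) ^^ k) u)" for k
  have U: "U k \<in> L \<and> length (U k) = length u + k" for k
  proof (induction k)
    case (Suc k)
    then show ?case using xt[of "U k" 1] by (simp add: U_def)
  qed (use u in \<open>simp add: U_def\<close>)
  have lim: "U k \<in> L" "k \<le> length (U k)" "\<exists>v. U (Suc k) = U k @ v" for k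
    using U[of k] by (simp_all add: U_def)
  show ?thesis
    by (rule that[OF nested_words_limit(1)[of U, OF lim]])
       (use nested_words_limit(2)[of U, OF lim, of 0] in \<open>simp add: U_def\<close>)
qed

lemma ln_card_le_exp: "0 < n \<Longrightarrow> ln (real n) \<le> a \<Longrightarrow> real n \<le> exp a"
  by (metis exp_le_cancel_iff exp_ln of_nat_0_less_iff)

text \<open>A prefix of a class member is determined by its \<open>s\<close> segments, each in a
  fibre over a projected word fixed by the class, and by its letters from \<open>T\<close> on. As
  the \<open>ww j\<close> sum to 1, the exponents combine to the one stated.\<close>

lemma card_compatible:
  assumes fib: "\<And>j. j < s \<Longrightarrow> \<exists>C. \<forall>J\<in>prw j ` L. ln (real (card (fib j J))) \<le> real (length J) * (h 0 - h j) + C"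
    and top: "\<exists>C. \<forall>n. ln (real (card (words n))) \<le> real n * h 0 + C"
  obtains C where "0 < C" "\<And>T n y. y \<in> XL \<Longrightarrow> T \<le> n \<Longrightarrow>
    real (card {u. \<exists>x\<in>XL. eqv T x y \<and> u = map x [0..<n]}) \<le> C * exp (real n * h 0 - real T * (\<Sum>j<s. ww j * h j))"
proof -
  obtain Cf where Cf: "\<And>j J. j < s \<Longrightarrow> J \<in> prw j ` L \<Longrightarrow> ln (real (card (fib j J))) \<le> real (length J) * (h 0 - h j) + Cf j"
    using fib by metis
  obtain Ct where Ct: "\<And>n. ln (real (card (words n))) \<le> real n * h 0 + Ct" using top by blast
  define D where "D = (\<Sum>j<s. \<bar>h 0 - h j\<bar> + Cf j) + Ct"
  have "real (card {u. \<exists>x\<in>XL. eqv T x y \<and> u = map x [0..<n]}) \<le> exp D * exp (real n * h 0 - real T * (\<Sum>j<s. ww j * h j))"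
    if y: "y \<in> XL" and Tn: "T \<le> n" for T n y
  proof -
    let ?A = "{u. \<exists>x\<in>XL. eqv T x y \<and> u = map x [0..<n]}"
    let ?F = "\<lambda>j. fib j (prw j (segw T j y))"
    let ?f = "\<lambda>u. (\<lambda>j\<in>{..<s}. take (Lv j T - seg j T) (drop (seg j T) u), drop T u)"
    let ?B = "PiE {..<s} ?F \<times> words (n - T)"
    have LT: "Lv j T \<le> T" if "j < s" for j using Lv_mono[of j "s - 1" T] Lv_top[of T] that by simp
    have seg_u: "take (Lv j T - seg j T) (drop (seg j T) (map x [0..<n])) = segw T j x" if "j < s" for j x
      using seg_le[OF that, of T] LT[OF that] Tn by (simp add: segw_def take_map drop_map take_upt drop_upt)
    have sub: "?f ` ?A \<subseteq> ?B"
    proof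
      fix z assume "z \<in> ?f ` ?A"
      then obtain x where x: "x \<in> XL" "eqv T x y" "z = ?f (map x [0..<n])" by blast
      have "segw T j x \<in> ?F j" if "j < s" for j
        using x(2) that segw_words[OF x(1), of T j] by (auto simp: segw_eqv_iff fib_def words_def)
      then have "(\<lambda>j\<in>{..<s}. take (Lv j T - seg j T) (drop (seg j T) (map x [0..<n]))) \<in> PiE {..<s} ?F"
        using seg_u by (auto intro!: restrict_PiE_iff[THEN iffD2])
      moreover have "drop T (map x [0..<n]) \<in> words (n - T)"
        using XL_factor[OF x(1), of T n] by (simp add: drop_map drop_upt)
      ultimately show "z \<in> ?B" using x(3) by simp
    qed
    have inj: "inj_on ?f ?A"
    proof (rule inj_onI)
      fix u v assume u: "u \<in> ?A" and v: "v \<in> ?A" and eq: "?f u = ?f v"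
      obtain x where x: "u = map x [0..<n]" using u by blast
      obtain x' where x': "v = map x' [0..<n]" using v by blast
      have e1: "segw T j x = segw T j x'" if "j < s" for j
      proof -
        have "fst (?f u) j = fst (?f v) j" using eq by simp
        then show ?thesis using that seg_u unfolding x x' by simp
      qed
      have e2: "drop T u = drop T v" using eq by simp
      have "x k = x' k" if "k < n" for k
      proof (cases "k < T")
        case True
        then obtain j where j: "j \<le> s - 1" "seg j T \<le> k" "k < Lv j T"
          using level_of[of "s - 1" k T] s_pos Lv_top[of T] by auto
        then have "segw T j x = segw T j x'" using e1 s_pos by simp
        then show ?thesis using j by (simp add: segw_def)
      next
        case False
        then have "drop T u ! (k - T) = x k" "drop T v ! (k - T) = x' k" using that by (simp_all add: x x')
        then show ?thesis using e2 by simp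
      qed
      then show "u = v" by (simp add: x x')
    qed
    have finB: "finite ?B" by (intro finite_cartesian_product finite_PiE) auto
    have ne: "0 < card (?F j)" for j
    proof -
      have "segw T j y \<in> ?F j" using segw_words[OF y, of T j] by (simp add: fib_def words_def)
      then show ?thesis by (auto simp: card_gt_0_iff)
    qed
    have cw: "0 < card (words k)" for k by (simp add: card_gt_0_iff)
    have "real (card ?A) \<le> real (card ?B)"
      unfolding of_nat_le_iff by (rule card_inj_on_le[OF inj sub finB])
    also have "\<dots> = (\<Prod>j<s. real (card (?F j))) * real (card (words (n - T)))"
      by (simp add: card_cartesian_product card_PiE)
    also have "\<dots> \<le> (\<Prod>j<s. exp (ww j * real T * (h 0 - h j) + (\<bar>h 0 - h j\<bar> + Cf j))) * exp (real (n - T) * h 0 + Ct)"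
    proof (intro mult_mono prod_mono conjI)
      fix j assume "j \<in> {..<s}"
      then have j: "j < s" by simp
      have "prw j (segw T j y) \<in> prw j ` L" using segw_words[OF y, of T j] by (auto simp: words_def)
      then have "ln (real (card (?F j))) \<le> real (Lv j T - seg j T) * (h 0 - h j) + Cf j"
        using Cf[OF j] by (metis (no_types, lifting) length_prw length_map length_upt segw_def)
      moreover have "real (Lv j T - seg j T) * (h 0 - h j) \<le> ww j * real T * (h 0 - h j) + \<bar>h 0 - h j\<bar>"
      proof -
        have "\<bar>real (Lv j T - seg j T) - ww j * real T\<bar> \<le> 1" using seg_diff[OF j, of T] by linarith
        then have "\<bar>real (Lv j T - seg j T) - ww j * real T\<bar> * \<bar>h 0 - h j\<bar> \<le> 1 * \<bar>h 0 - h j\<bar>" by (intro mult_right_mono) auto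
        then have "\<bar>(real (Lv j T - seg j T) - ww j * real T) * (h 0 - h j)\<bar> \<le> \<bar>h 0 - h j\<bar>" by (simp only: abs_mult mult_1)
        then have "(real (Lv j T - seg j T) - ww j * real T) * (h 0 - h j) \<le> \<bar>h 0 - h j\<bar>" by linarith
        then show ?thesis by (simp add: left_diff_distrib)
      qed
      ultimately show "real (card (?F j)) \<le> exp (ww j * real T * (h 0 - h j) + (\<bar>h 0 - h j\<bar> + Cf j))"
        using ne[of j] by (intro ln_card_le_exp) auto
    next
      show "real (card (words (n - T))) \<le> exp (real (n - T) * h 0 + Ct)" using cw Ct by (intro ln_card_le_exp) auto
    qed (auto intro: prod_nonneg)
    also have "\<dots> = exp ((\<Sum>j<s. ww j * real T * (h 0 - h j) + (\<bar>h 0 - h j\<bar> + Cf j)) + (real (n - T) * h 0 + Ct))"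
      by (simp add: exp_sum exp_add)
    also have "(\<Sum>j<s. ww j * real T * (h 0 - h j) + (\<bar>h 0 - h j\<bar> + Cf j)) = real T * ((\<Sum>j<s. ww j) * h 0 - (\<Sum>j<s. ww j * h j)) + (D - Ct)"
      by (simp add: D_def sum.distrib sum_distrib_left sum_distrib_right right_diff_distrib sum_subtractf mult_ac)
    also have "real T * ((\<Sum>j<s. ww j) * h 0 - (\<Sum>j<s. ww j * h j)) + (D - Ct) + (real (n - T) * h 0 + Ct)
      = D + (real n * h 0 - real T * (\<Sum>j<s. ww j * h j))"
      using Tn by (simp add: sum_ww of_nat_diff algebra_simps)
    finally show ?thesis by (simp only: exp_add)
  qed
  then show ?thesis using that[of "exp D"] by simp
qed

text \<open>A mass distribution argument with counting in place of a limit measure. Compactness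
  reduces to finitely many classes, which can be compared on words of one sufficiently large
  length.\<close>

lemma hausdorff_measure_pos:
  assumes fib: "\<And>j. j < s \<Longrightarrow> \<exists>C. \<forall>J\<in>prw j ` L. ln (real (card (fib j J))) \<le> real (length J) * (h 0 - h j) + C"
    and top: "\<exists>C. \<forall>n. ln (real (card (words n))) \<le> real n * h 0 + C"
    and base: "base h" and P0: "0 \<le> (\<Sum>j<s. ww j * h j)"
  shows "hausdorff_measure ((\<Sum>j<s. ww j * h j) / ln N) (R ` XL) \<noteq> 0"
proof
  assume zero: "hausdorff_measure ((\<Sum>j<s. ww j * h j) / ln N) (R ` XL) = 0"
  define P where "P = (\<Sum>j<s. ww j * h j)"
  have lnN: "0 < ln N" using N by simp
  define t where "t = P / ln N"
  have t: "0 \<le> t" using P0 lnN by (simp add: t_def P_def)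
  have dlt: "dl T powr t = exp (- (real T * P))" for T using lnN by (simp add: dl_powr t_def)
  obtain C where C: "0 < C" "\<And>T n y. y \<in> XL \<Longrightarrow> T \<le> n \<Longrightarrow>
    real (card {u. \<exists>x\<in>XL. eqv T x y \<and> u = map x [0..<n]}) \<le> C * exp (real n * h 0 - real T * P)"
    using card_compatible[of h, OF fib top] unfolding P_def by blast
  \<comment> \<open>At a length \<open>n\<close> beyond all scales in \<open>F\<close> there are at
    least \<open>exp (real n * h 0 - 1)\<close> words, by \<open>base\<close>. Each of them begins
    some sequence, and by \<open>card_compatible\<close> a class of scale \<open>T\<close> accounts
    for at most \<open>C * exp (real n * h 0 - real T * P)\<close> of them.\<close>
  have fincov: "exp (- 1) \<le> C * (\<Sum>(T, y)\<in>F. exp (- (real T * P)))"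
    if F: "finite F" "\<And>T y. (T, y) \<in> F \<Longrightarrow> y \<in> XL" and cov: "\<And>x. x \<in> XL \<Longrightarrow> \<exists>(T, y)\<in>F. eqv T x y" for F
  proof -
    define n where "n = Max (insert 0 (fst ` F))"
    have n: "T \<le> n" if "(T, y) \<in> F" for T y
    proof -
      have "T \<in> fst ` F" using that by force
      then show ?thesis unfolding n_def using F(1) by (intro Max_ge) auto
    qed
    obtain q where q: "q \<in> dists n" "real n * h 0 - 1 \<le> Hl 0 q" using base s_pos unfolding base_def by blast
    have "prw 0 ` words n = words n" by (simp add: prw_0)
    then have "real n * h 0 - 1 \<le> ln (real (card (words n)))" using Hl_le_ln_card[OF q(1), of 0] q(2) by simp
    then have "exp (real n * h 0 - 1) \<le> exp (ln (real (card (words n))))" by simp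
    also have "\<dots> = real (card (words n))" by (simp add: card_gt_0_iff)
    also have "\<dots> \<le> real (card (\<Union>(T, y)\<in>F. {u. \<exists>x\<in>XL. eqv T x y \<and> u = map x [0..<n]}))"
      unfolding of_nat_le_iff
    proof (rule card_mono)
      have "{u. \<exists>x\<in>XL. eqv T x y \<and> u = map x [0..<n]} \<subseteq> words n" for T y
        using XL_factor[of _ 0 n] by auto
      then have "finite {u. \<exists>x\<in>XL. eqv T x y \<and> u = map x [0..<n]}" for T y
        by (rule finite_subset) simp
      then show "finite (\<Union>(T, y)\<in>F. {u. \<exists>x\<in>XL. eqv T x y \<and> u = map x [0..<n]})" using F(1) by auto
      show "words n \<subseteq> (\<Union>(T, y)\<in>F. {u. \<exists>x\<in>XL. eqv T x y \<and> u = map x [0..<n]})"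
      proof
        fix u assume u: "u \<in> words n"
        then obtain x where x: "x \<in> XL" "map x [0..<length u] = u" using word_extend_XL[of u] by (auto simp: words_def)
        obtain T y where "(T, y) \<in> F" "eqv T x y" using cov[OF x(1)] by blast
        then show "u \<in> (\<Union>(T, y)\<in>F. {u. \<exists>x\<in>XL. eqv T x y \<and> u = map x [0..<n]})"
          using x u by (force simp: words_def)
      qed
    qed
    also have "\<dots> \<le> (\<Sum>(T, y)\<in>F. real (card {u. \<exists>x\<in>XL. eqv T x y \<and> u = map x [0..<n]}))"
      using card_UN_le[OF F(1), of "\<lambda>(T, y). {u. \<exists>x\<in>XL. eqv T x y \<and> u = map x [0..<n]}"]
      unfolding of_nat_le_iff[symmetric, where 'a=real] by (simp add: case_prod_unfold)
    also have "\<dots> \<le> (\<Sum>(T, y)\<in>F. C * exp (real n * h 0 - real T * P))"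
      using C(2) F(2) n by (intro sum_mono) auto
    also have "\<dots> = exp (real n * h 0) * (C * (\<Sum>(T, y)\<in>F. exp (- (real T * P))))"
      by (simp add: sum_distrib_left case_prod_unfold exp_diff exp_minus divide_inverse mult_ac)
    finally have "exp (real n * h 0) * exp (- 1) \<le> exp (real n * h 0) * (C * (\<Sum>(T, y)\<in>F. exp (- (real T * P))))"
      by (simp add: exp_add[symmetric])
    then show ?thesis by simp
  qed
  have K0: "\<exists>y. y \<in> XL" using XL_nonempty by blast
  \<comment> \<open>Chosen to turn the estimate at the end into
    \<open>exp (- 1) \<le> exp (- 1) / 2\<close>; \<open>K0 + 1\<close> keeps the denominator
    positive.\<close>
  define a where "a = exp (- 1) / (C * (real K0 + 1) * N powr t * 4)"
  have a: "0 < a" unfolding a_def using C(1) N by (intro divide_pos_pos mult_pos_pos) auto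
  have "hausdorff_measure t (R ` XL) < ennreal a" using zero a by (simp add: t_def P_def)
  then obtain U where U: "\<And>i. bounded (U i)" "\<And>i. diameter (U i) \<le> dl 0 / 2" "R ` XL \<subseteq> (\<Union>i. U i)" "(\<Sum>i. diam_pow t (U i)) < ennreal a"
    using hausdorff_cover[of t "R ` XL" "ennreal a" "dl 0 / 2"] dl_pos[of 0] by auto
  have dU: "diameter (U i) < dl 0" for i using U(2)[of i] dl_pos[of 0] by linarith
  obtain V T where V: "\<And>i. U i \<noteq> {} \<Longrightarrow> open (V i) \<and> bounded (V i) \<and> U i \<subseteq> V i \<and> diameter (V i) \<le> dl (T i) \<and> 0 \<le> T i"
    and sumV: "(\<Sum>i. if U i = {} then 0 else ennreal (dl (T i) powr t)) \<le> ennreal (N powr t * (2 * a))"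
    using scale_cover[OF U(1) dU t less_imp_le[OF U(4)] a] by blast
  have sub: "R ` XL \<subseteq> (\<Union>i\<in>{i. U i \<noteq> {}}. V i)"
  proof
    fix z assume "z \<in> R ` XL"
    then obtain i where "z \<in> U i" using U(3) by blast
    then show "z \<in> (\<Union>i\<in>{i. U i \<noteq> {}}. V i)" using V[of i] by blast
  qed
  have opn: "open (V i)" if "i \<in> {i. U i \<noteq> {}}" for i using V[of i] that by simp
  obtain I where I: "I \<subseteq> {i. U i \<noteq> {}}" "finite I" "R ` XL \<subseteq> (\<Union>i\<in>I. V i)"
    by (rule compactE_image[OF compact_K opn sub])
  have "\<forall>i\<in>I. \<exists>Y. finite Y \<and> card Y \<le> K0 \<and> Y \<subseteq> {x \<in> XL. R x \<in> V i} \<and> (\<forall>x\<in>XL. R x \<in> V i \<longrightarrow> (\<exists>y\<in>Y. eqv (T i) x y))"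
  proof
    fix i assume "i \<in> I"
    then have "bounded (V i)" "diameter (V i) \<le> dl (T i)" using V[of i] I(1) by auto
    then show "\<exists>Y. finite Y \<and> card Y \<le> K0 \<and> Y \<subseteq> {x \<in> XL. R x \<in> V i} \<and> (\<forall>x\<in>XL. R x \<in> V i \<longrightarrow> (\<exists>y\<in>Y. eqv (T i) x y))"
      by (rule cover_R)
  qed
  from bchoice[OF this] obtain Y where "\<forall>i\<in>I. finite (Y i) \<and> card (Y i) \<le> K0 \<and> Y i \<subseteq> {x \<in> XL. R x \<in> V i} \<and> (\<forall>x\<in>XL. R x \<in> V i \<longrightarrow> (\<exists>y\<in>Y i. eqv (T i) x y))"
    by blast
  note Y = bspec[OF this]
  let ?F = "\<Union>i\<in>I. {T i} \<times> Y i"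
  have finF: "finite ?F"
  proof (intro finite_UN_I I(2) finite_cartesian_product)
    show "finite (Y i)" if "i \<in> I" for i using Y[OF that] by simp
  qed simp
  have "exp (- 1) \<le> C * (\<Sum>(T, y)\<in>?F. exp (- (real T * P)))"
  proof (rule fincov[OF finF])
    show "y \<in> XL" if Ty: "(T', y) \<in> ?F" for T' y
    proof -
      obtain i where "i \<in> I" "y \<in> Y i" using Ty by blast
      then show ?thesis using Y[of i] by blast
    qed
    show "\<exists>(T, y)\<in>?F. eqv T x y" if x: "x \<in> XL" for x
    proof -
      obtain i where "i \<in> I" "R x \<in> V i" using I(3) x by blast
      then obtain y where "y \<in> Y i" "eqv (T i) x y" using Y[of i] x by blast
      then show ?thesis using \<open>i \<in> I\<close> by blast
    qed
  qed
  also have "(\<Sum>(T, y)\<in>?F. exp (- (real T * P))) \<le> (\<Sum>i\<in>I. \<Sum>(T, y)\<in>{T i} \<times> Y i. exp (- (real T * P)))"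
  proof (rule sum_UN_le_sum[OF I(2)])
    show "finite ({T i} \<times> Y i)" if "i \<in> I" for i using Y[OF that] by simp
  qed auto
  also have "\<dots> = (\<Sum>i\<in>I. real (card (Y i)) * exp (- (real (T i) * P)))"
    by (intro sum.cong refl, subst sum.cartesian_product[symmetric]) simp
  also have "\<dots> \<le> (\<Sum>i\<in>I. real K0 * exp (- (real (T i) * P)))"
    using Y by (intro sum_mono mult_right_mono) auto
  also have "\<dots> = real K0 * (\<Sum>i\<in>I. dl (T i) powr t)" by (simp add: sum_distrib_left dlt)
  finally have "exp (- 1) \<le> C * (real K0 * (\<Sum>i\<in>I. dl (T i) powr t))" using C(1) by (simp add: mult_left_mono)
  moreover have "(\<Sum>i\<in>I. dl (T i) powr t) \<le> N powr t * (2 * a)"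
  proof -
    have "ennreal (\<Sum>i\<in>I. dl (T i) powr t) = (\<Sum>i\<in>I. if U i = {} then 0 else ennreal (dl (T i) powr t))"
    proof -
      have "ennreal (\<Sum>i\<in>I. dl (T i) powr t) = (\<Sum>i\<in>I. ennreal (dl (T i) powr t))"
        by (rule sum_ennreal[symmetric]) simp
      also have "\<dots> = (\<Sum>i\<in>I. if U i = {} then 0 else ennreal (dl (T i) powr t))"
        using I(1) by (intro sum.cong) auto
      finally show ?thesis .
    qed
    also have "\<dots> \<le> (\<Sum>i. if U i = {} then 0 else ennreal (dl (T i) powr t))"
      by (rule sum_le_suminf) (use I(2) in auto)
    also have "\<dots> \<le> ennreal (N powr t * (2 * a))" by (rule sumV)
    finally show ?thesis using a by (subst (asm) ennreal_le_iff) auto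
  qed
  then have "C * (real K0 * (\<Sum>i\<in>I. dl (T i) powr t)) \<le> C * ((real K0 + 1) * (N powr t * (2 * a)))"
    using C(1) a by (intro mult_left_mono mult_mono) (auto intro: sum_nonneg)
  moreover have "C * ((real K0 + 1) * (N powr t * (2 * a))) = exp (- 1) / 2"
    using C(1) N by (simp add: a_def field_simps add_nonneg_eq_0_iff)
  ultimately have "exp (- 1 :: real) \<le> exp (- 1) / 2" by linarith
  then show False by simp
qed

end

section \<open>Slots of growing length\<close>

lemma nat_floor_bounds:
  assumes "0 \<le> x"
  shows "real (nat \<lfloor>x\<rfloor>) \<le> x" "x - 1 \<le> real (nat \<lfloor>x\<rfloor>)"
  using assms by linarith+

lemma powr_diff_le:
  fixes c :: real
  assumes "1 \<le> c"
  shows "(real m + 1) powr c - real m powr c \<le> c * (real m + 1) powr (c - 1)"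
proof (cases "m = 0")
  case True
  then show ?thesis using assms by simp
next
  case False
  have "\<exists>z. real m < z \<and> z < real m + 1 \<and> (real m + 1) powr c - real m powr c = (real m + 1 - real m) * (c * z powr (c - 1))"
    using False by (intro MVT2) (auto intro!: derivative_eq_intros)
  then obtain z where z: "real m < z" "z < real m + 1" "(real m + 1) powr c - real m powr c = c * z powr (c - 1)" by auto
  have "z powr (c - 1) \<le> (real m + 1) powr (c - 1)" using z False assms by (intro powr_mono2) auto
  then show ?thesis unfolding z(3) using assms by (intro mult_left_mono) auto
qed

text \<open>About \<open>n powr \<alpha>\<close> slots fit into a prefix of length \<open>n\<close>. For \<open>\<alpha> > 2 / 3\<close> the slot lengths grow more slowly than
  \<open>k powr (1 / 2)\<close>, so the deviations of a sum of independent bounded-rate terms stay below the number of slots.\<close>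

locale growing_slots =
  fixes \<alpha> :: real and c0 :: nat
  assumes alpha: "2 / 3 < \<alpha>" "\<alpha> < 1" and c0: "0 < c0"
begin

text \<open>The linear term makes every slot at least \<open>c0\<close> long, so that it can hold a
  word and a connection from the beginning. It is of lower order because \<alpha> < 1.\<close>

definition t :: "nat \<Rightarrow> nat" where
  "t k = c0 * k + nat \<lfloor>real k powr (1 / \<alpha>)\<rfloor>"

definition mc :: "nat \<Rightarrow> nat" where
  "mc n = (LEAST k. n < t (Suc k))"

lemma t_0 [simp]: "t 0 = 0"
  by (simp add: t_def)

lemma t_step: "t k + c0 \<le> t (Suc k)"
proof -
  have "real k powr (1 / \<alpha>) \<le> real (Suc k) powr (1 / \<alpha>)" using alpha by (intro powr_mono2) auto
  then have "nat \<lfloor>real k powr (1 / \<alpha>)\<rfloor> \<le> nat \<lfloor>real (Suc k) powr (1 / \<alpha>)\<rfloor>" by (intro nat_mono floor_mono)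
  then show ?thesis by (simp add: t_def)
qed

lemma t_mono: "k \<le> l \<Longrightarrow> t k \<le> t l"
proof (rule lift_Suc_mono_le[of t])
  show "t k \<le> t (Suc k)" for k using t_step[of k] by simp
qed

lemma t_ge: "k \<le> t k"
  using c0 mult_le_mono1[of 1 c0 k] by (simp add: t_def trans_le_add1)

lemma mc_less_iff: "k < mc n \<longleftrightarrow> t (Suc k) \<le> n"
proof
  show "k < mc n \<Longrightarrow> t (Suc k) \<le> n" unfolding mc_def using not_less_Least[of k "\<lambda>k. n < t (Suc k)"] by simp
  have "\<exists>k. n < t (Suc k)" using t_ge[of "Suc n"] by (intro exI[of _ n]) simp
  then have "n < t (Suc (mc n))" unfolding mc_def by (rule LeastI_ex)
  then show "k < mc n" if "t (Suc k) \<le> n"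
    using that t_mono[of "Suc (mc n)" "Suc k"] by (cases "k < mc n") auto
qed

lemma t_mc: "t (mc n) \<le> n" "n < t (Suc (mc n))"
proof -
  show "n < t (Suc (mc n))" using mc_less_iff[of "mc n" n] by simp
  show "t (mc n) \<le> n"
  proof (cases "mc n")
    case (Suc k)
    then show ?thesis using mc_less_iff[of k n] by simp
  qed simp
qed

lemma mc_mono: "n \<le> n' \<Longrightarrow> mc n \<le> mc n'"
  using mc_less_iff[of "mc n'" n'] mc_less_iff[of "mc n'" n] by (cases "mc n \<le> mc n'") auto

lemma t_bounds: "real k powr (1 / \<alpha>) - 1 \<le> real (t k)" "real (t k) \<le> real c0 * real k + real k powr (1 / \<alpha>)"
proof -
  have "real (nat \<lfloor>real k powr (1 / \<alpha>)\<rfloor>) \<le> real k powr (1 / \<alpha>)"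
    "real k powr (1 / \<alpha>) - 1 \<le> real (nat \<lfloor>real k powr (1 / \<alpha>)\<rfloor>)" by (intro nat_floor_bounds; simp)+
  moreover have "0 \<le> real c0 * real k" by simp
  ultimately show "real k powr (1 / \<alpha>) - 1 \<le> real (t k)" "real (t k) \<le> real c0 * real k + real k powr (1 / \<alpha>)"
    unfolding t_def of_nat_add of_nat_mult by linarith+
qed

lemma t_gap: "real (t (Suc k)) - real (t k) \<le> real c0 + 1 + (1 / \<alpha>) * (real k + 1) powr (1 / \<alpha> - 1)"
proof -
  have S: "real (Suc k) = real k + 1" by simp
  have "real (nat \<lfloor>real (Suc k) powr (1 / \<alpha>)\<rfloor>) \<le> real (Suc k) powr (1 / \<alpha>)"
    by (intro nat_floor_bounds) simp
  moreover have "real k powr (1 / \<alpha>) - 1 \<le> real (nat \<lfloor>real k powr (1 / \<alpha>)\<rfloor>)"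
    by (intro nat_floor_bounds) simp
  moreover have "real (Suc k) powr (1 / \<alpha>) - real k powr (1 / \<alpha>) \<le> (1 / \<alpha>) * (real k + 1) powr (1 / \<alpha> - 1)"
    unfolding S using alpha by (intro powr_diff_le) simp
  moreover have "real c0 * real (Suc k) = real c0 * real k + real c0" by (simp add: distrib_left)
  ultimately show ?thesis unfolding t_def of_nat_add of_nat_mult by linarith
qed

lemma mc_upper:
  assumes "0 \<le> l"
  shows "real (mc (nat \<lfloor>l * real T\<rfloor>)) \<le> (l * real T + 1) powr \<alpha>"
proof -
  let ?m = "mc (nat \<lfloor>l * real T\<rfloor>)"
  have lT: "0 \<le> l * real T" using assms by simp
  have "real (t ?m) \<le> real (nat \<lfloor>l * real T\<rfloor>)" using t_mc(1) by (simp only: of_nat_le_iff)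
  also have "\<dots> \<le> l * real T" using lT by simp
  finally have "real ?m powr (1 / \<alpha>) \<le> l * real T + 1" using t_bounds(1)[of ?m] by linarith
  then have "(real ?m powr (1 / \<alpha>)) powr \<alpha> \<le> (l * real T + 1) powr \<alpha>" using alpha by (intro powr_mono2) auto
  then show ?thesis using alpha by (simp add: powr_powr)
qed

lemma mc_lower:
  assumes l: "0 \<le> l" and pos: "0 \<le> l * real T - 1 - real c0 * ((l * real T + 1) powr \<alpha> + 1)"
  shows "(l * real T - 1 - real c0 * ((l * real T + 1) powr \<alpha> + 1)) powr \<alpha> - 1 \<le> real (mc (nat \<lfloor>l * real T\<rfloor>))"
proof -
  let ?m = "mc (nat \<lfloor>l * real T\<rfloor>)"
  have "real (nat \<lfloor>l * real T\<rfloor>) < real (t (Suc ?m))" using t_mc(2) by (simp only: of_nat_less_iff)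
  then have "l * real T - 1 \<le> real (t (Suc ?m))" by linarith
  also have "\<dots> \<le> real c0 * real (Suc ?m) + real (Suc ?m) powr (1 / \<alpha>)" by (rule t_bounds(2))
  also have "real c0 * real (Suc ?m) \<le> real c0 * ((l * real T + 1) powr \<alpha> + 1)"
    using mc_upper[OF l, of T] by (intro mult_left_mono) auto
  finally have "l * real T - 1 - real c0 * ((l * real T + 1) powr \<alpha> + 1) \<le> real (Suc ?m) powr (1 / \<alpha>)" by simp
  then have "(l * real T - 1 - real c0 * ((l * real T + 1) powr \<alpha> + 1)) powr \<alpha> \<le> (real (Suc ?m) powr (1 / \<alpha>)) powr \<alpha>"
    using alpha pos by (intro powr_mono2) auto
  also have "\<dots> = real ?m + 1" using alpha by (simp add: powr_powr)
  finally show ?thesis by simp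
qed

lemma mc_asymp:
  assumes l: "0 < l"
  shows "(\<lambda>T. real (mc (nat \<lfloor>l * real T\<rfloor>)) / real T powr \<alpha>) \<longlonglongrightarrow> l powr \<alpha>"
proof (rule tendsto_sandwich[where
      f="\<lambda>T. ((l * real T - 1 - real c0 * ((l * real T + 1) powr \<alpha> + 1)) powr \<alpha> - 1) / real T powr \<alpha>" and
      h="\<lambda>T. (l * real T + 1) powr \<alpha> / real T powr \<alpha>"])
  have a: "0 < \<alpha>" "\<alpha> < 1" using alpha by auto
  have "((\<lambda>x::real. (l * x + 1) powr \<alpha> / x powr \<alpha>) \<longlongrightarrow> l powr \<alpha>) at_top"
    using l a by real_asymp
  then show "(\<lambda>T. (l * real T + 1) powr \<alpha> / real T powr \<alpha>) \<longlonglongrightarrow> l powr \<alpha>"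
    by (rule filterlim_compose) (rule filterlim_real_sequentially)
  have "((\<lambda>x::real. ((l * x - 1 - real c0 * ((l * x + 1) powr \<alpha> + 1)) powr \<alpha> - 1) / x powr \<alpha>) \<longlongrightarrow> l powr \<alpha>) at_top"
    using l a by real_asymp
  then show "(\<lambda>T. ((l * real T - 1 - real c0 * ((l * real T + 1) powr \<alpha> + 1)) powr \<alpha> - 1) / real T powr \<alpha>) \<longlonglongrightarrow> l powr \<alpha>"
    by (rule filterlim_compose) (rule filterlim_real_sequentially)
  show "\<forall>\<^sub>F T in sequentially. real (mc (nat \<lfloor>l * real T\<rfloor>)) / real T powr \<alpha> \<le> (l * real T + 1) powr \<alpha> / real T powr \<alpha>"
    using l mc_upper[of l] by (intro always_eventually allI divide_right_mono) auto
  have "\<forall>\<^sub>F x::real in at_top. 0 \<le> l * x - 1 - real c0 * ((l * x + 1) powr \<alpha> + 1)"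
    using l a by real_asymp
  then have "\<forall>\<^sub>F T in sequentially. 0 \<le> l * real T - 1 - real c0 * ((l * real T + 1) powr \<alpha> + 1)"
    by (rule eventually_compose_filterlim[OF _ filterlim_real_sequentially])
  then show "\<forall>\<^sub>F T in sequentially. ((l * real T - 1 - real c0 * ((l * real T + 1) powr \<alpha> + 1)) powr \<alpha> - 1) / real T powr \<alpha>
    \<le> real (mc (nat \<lfloor>l * real T\<rfloor>)) / real T powr \<alpha>"
  proof eventually_elim
    case (elim T)
    then show ?case using l mc_lower[of l T] by (intro divide_right_mono) auto
  qed
qed

text \<open>With about \<open>T powr \<alpha>\<close> slots, the incomplete last one has length of
  order \<open>T powr (1 - \<alpha>)\<close>. This is negligible against
  \<open>T powr \<alpha>\<close> because \<alpha> > 1 / 2.\<close>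

lemma t_mc_asymp:
  assumes l: "0 < l"
  shows "(\<lambda>T. (l * real T - real (t (mc (nat \<lfloor>l * real T\<rfloor>)))) / real T powr \<alpha>) \<longlonglongrightarrow> 0"
proof (rule tendsto_sandwich[OF _ _ tendsto_const])
  have a: "0 < \<alpha>" "\<alpha> < 1" "1 / \<alpha> - 1 > 0" "1 - \<alpha> < \<alpha>" using alpha by auto
  let ?B = "\<lambda>x. (2 + real c0 + (1 / \<alpha>) * (2 * (l * x + 1) powr \<alpha>) powr (1 / \<alpha> - 1)) / x powr \<alpha>"
  have "((\<lambda>x::real. (2 + real c0 + (1 / \<alpha> * 2 powr (1 / \<alpha> - 1)) * (l * x + 1) powr (1 - \<alpha>)) / x powr \<alpha>) \<longlongrightarrow> 0) at_top"
    using l a by real_asymp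
  moreover have "\<forall>\<^sub>F x in at_top. (2 + real c0 + (1 / \<alpha> * 2 powr (1 / \<alpha> - 1)) * (l * x + 1) powr (1 - \<alpha>)) / x powr \<alpha> = ?B x"
    using eventually_ge_at_top[of 0]
  proof eventually_elim
    case (elim x)
    have "(2 * (l * x + 1) powr \<alpha>) powr (1 / \<alpha> - 1) = 2 powr (1 / \<alpha> - 1) * (l * x + 1) powr (\<alpha> * (1 / \<alpha> - 1))"
      by (simp add: powr_mult powr_powr)
    also have "\<alpha> * (1 / \<alpha> - 1) = 1 - \<alpha>" using a by (simp add: right_diff_distrib)
    finally show ?case by simp
  qed
  ultimately have "(?B \<longlongrightarrow> 0) at_top" by (rule Lim_transform_eventually)
  then show "(\<lambda>T. ?B (real T)) \<longlonglongrightarrow> 0"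
    by (rule filterlim_compose) (rule filterlim_real_sequentially)
  show "\<forall>\<^sub>F T in sequentially. 0 \<le> (l * real T - real (t (mc (nat \<lfloor>l * real T\<rfloor>)))) / real T powr \<alpha>"
  proof (intro always_eventually allI divide_nonneg_nonneg)
    fix T
    have "real (t (mc (nat \<lfloor>l * real T\<rfloor>))) \<le> real (nat \<lfloor>l * real T\<rfloor>)" using t_mc(1) by (simp only: of_nat_le_iff)
    also have "\<dots> \<le> l * real T" using l by simp
    finally show "0 \<le> l * real T - real (t (mc (nat \<lfloor>l * real T\<rfloor>)))" by simp
  qed simp
  show "\<forall>\<^sub>F T in sequentially. (l * real T - real (t (mc (nat \<lfloor>l * real T\<rfloor>)))) / real T powr \<alpha> \<le> ?B (real T)"
  proof (intro always_eventually allI divide_right_mono)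
    fix T
    let ?m = "mc (nat \<lfloor>l * real T\<rfloor>)"
    have "real (nat \<lfloor>l * real T\<rfloor>) < real (t (Suc ?m))" using t_mc(2) by (simp only: of_nat_less_iff)
    then have "l * real T - real (t ?m) \<le> 1 + (real (t (Suc ?m)) - real (t ?m))" by linarith
    also have "\<dots> \<le> 1 + (real c0 + 1 + (1 / \<alpha>) * (real ?m + 1) powr (1 / \<alpha> - 1))" using t_gap[of ?m] by simp
    also have "(real ?m + 1) powr (1 / \<alpha> - 1) \<le> (2 * (l * real T + 1) powr \<alpha>) powr (1 / \<alpha> - 1)"
    proof (rule powr_mono2)
      have "1 \<le> (l * real T + 1) powr \<alpha>" using l a by (intro ge_one_powr_ge_zero) auto
      then show "real ?m + 1 \<le> 2 * (l * real T + 1) powr \<alpha>" using mc_upper[of l T] l by simp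
    qed (use a in auto)
    finally show "l * real T - real (t ?m) \<le> 2 + real c0 + (1 / \<alpha>) * (2 * (l * real T + 1) powr \<alpha>) powr (1 / \<alpha> - 1)"
      using a by (simp add: mult_left_mono divide_right_mono)
  qed simp
qed

end

section \<open>Sums of independent variables with slowly growing range\<close>

lemma indep_vars_coordinates:
  assumes M: "\<And>i. prob_space (M i)"
  shows "prob_space.indep_vars (PiM UNIV M) M (\<lambda>i \<omega>. \<omega> i) UNIV"
proof -
  interpret P: prob_space "PiM UNIV M" by (intro prob_space_PiM M)
  have "distr (PiM UNIV M) (PiM UNIV M) (\<lambda>x. \<lambda>i\<in>UNIV. x i) = PiM UNIV (\<lambda>i. distr (PiM UNIV M) (M i) (\<lambda>\<omega>. \<omega> i))"
    using M by (simp add: distr_PiM_component restrict_def distr_id2)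
  then show ?thesis by (subst P.indep_vars_iff_distr_eq_PiM) simp_all
qed

text \<open>The squares of the ranges sum to order \<open>m powr (1 + 2 * r)\<close>, so Hoeffding's
  inequality bounds the probability of a deviation \<open>m\<close> by
  \<open>2 * exp (- c * m powr (1 - 2 * r))\<close> for some positive \<open>c\<close>. This is
  summable for \<open>r < 1 / 2\<close>, and the Borel-Cantelli lemma applies.\<close>

lemma AE_eventually_sum_deviation_le:
  fixes X :: "nat \<Rightarrow> 'b \<Rightarrow> real"
  assumes P: "prob_space M" and indep: "prob_space.indep_vars M (\<lambda>_. borel) X UNIV"
    and bd: "\<And>k. AE \<omega> in M. X k \<omega> \<in> {0..C * (real k + 1) powr r}" and C: "0 < C" and r: "0 \<le> r" "r < 1 / 2"
  shows "AE \<omega> in M. \<forall>\<^sub>F m in sequentially. \<bar>\<Sum>k<m. X k \<omega> - (\<integral>\<omega>. X k \<omega> \<partial>M)\<bar> \<le> real m"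
proof -
  interpret prob_space M by (rule P)
  have rv [measurable]: "X k \<in> borel_measurable M" for k
    using indep unfolding indep_vars_def by auto
  define mu where "mu k = (\<integral>\<omega>. X k \<omega> \<partial>M)" for k
  define B where "B m = {\<omega> \<in> space M. \<bar>(\<Sum>k<m. X k \<omega>) - (\<Sum>k<m. mu k)\<bar> \<ge> real m}" for m
  have [measurable]: "B m \<in> sets M" for m unfolding B_def by measurable
  let ?d = "1 - 2 * r" and ?c = "2 / C\<^sup>2"
  have bound: "prob (B m) \<le> 2 * exp (- (?c * real m powr ?d))" if m: "0 < m" for m
  proof -
    interpret H: Hoeffding_ineq M "{..<m}" X "\<lambda>_. 0" "\<lambda>k. C * (real k + 1) powr r" "\<Sum>k<m. mu k"
    proof unfold_locales
      show "indep_vars (\<lambda>_. borel) X {..<m}" using indep by (rule indep_vars_subset) simp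
      show "(\<Sum>k<m. mu k) \<equiv> (\<Sum>k<m. expectation (X k))" by (simp add: mu_def)
    qed (use bd in auto)
    let ?D = "\<Sum>k<m. (C * (real k + 1) powr r - 0)\<^sup>2"
    have D0: "0 < ?D" using m C by (intro sum_pos) (auto simp: lessThan_empty_iff)
    have "?D \<le> (\<Sum>k<m. (C * real m powr r)\<^sup>2)"
      using C r by (intro sum_mono power_mono) (auto intro!: mult_left_mono powr_mono2)
    also have "\<dots> = C\<^sup>2 * (real m powr 1 * (real m powr r * real m powr r))"
      using m by (simp add: power2_eq_square)
    also have "\<dots> = C\<^sup>2 * real m powr (1 + 2 * r)"
      unfolding powr_add[symmetric] by simp
    finally have D: "?D \<le> C\<^sup>2 * real m powr (1 + 2 * r)" .
    have "prob (B m) \<le> 2 * exp (- 2 * (real m)\<^sup>2 / ?D)"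
      unfolding B_def by (rule H.Hoeffding_ineq_abs_ge) (use D0 in auto)
    also have "?c * real m powr ?d \<le> 2 * (real m)\<^sup>2 / ?D"
    proof -
      have "?c * real m powr ?d * ?D \<le> ?c * real m powr ?d * (C\<^sup>2 * real m powr (1 + 2 * r))"
        using D by (intro mult_left_mono) auto
      also have "\<dots> = 2 * (real m powr ?d * real m powr (1 + 2 * r))" using C by simp
      also have "real m powr ?d * real m powr (1 + 2 * r) = real m powr 2" unfolding powr_add[symmetric] by simp
      also have "\<dots> = (real m)\<^sup>2" using m by (simp add: powr_realpow)
      finally show ?thesis using D0 by (simp add: le_divide_eq)
    qed
    then have "2 * exp (- 2 * (real m)\<^sup>2 / ?D) \<le> 2 * exp (- (?c * real m powr ?d))" by simp
    finally show ?thesis by simp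
  qed
  have d: "0 < ?d" and c: "0 < ?c" using r C by auto
  have "\<forall>\<^sub>F x::real in at_top. 2 * exp (- (?c * x powr ?d)) \<le> 1 / x\<^sup>2"
    using d c by real_asymp
  then have "\<forall>\<^sub>F m in sequentially. 2 * exp (- (?c * real m powr ?d)) \<le> 1 / (real m)\<^sup>2"
    by (rule eventually_compose_filterlim[OF _ filterlim_real_sequentially])
  then have "\<forall>\<^sub>F m in sequentially. norm (prob (B m)) \<le> 1 / (real m)\<^sup>2"
    using eventually_gt_at_top[of 0]
  proof eventually_elim
    case (elim m)
    then show ?case using bound[of m] by simp
  qed
  then have sm: "summable (\<lambda>m. prob (B m))"
    by (rule summable_comparison_test_ev)
       (use inverse_power_summable[of 2, where ?'a=real] in \<open>simp add: inverse_eq_divide\<close>)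
  have "AE \<omega> in M. \<forall>\<^sub>F m in sequentially. \<omega> \<in> space M - B m"
    by (rule borel_cantelli_AE1[OF _ _ sm]) (simp_all add: less_top[symmetric])
  then show ?thesis
  proof (rule AE_mp, intro AE_I2 impI)
    fix \<omega> assume \<omega>: "\<omega> \<in> space M" "\<forall>\<^sub>F m in sequentially. \<omega> \<in> space M - B m"
    show "\<forall>\<^sub>F m in sequentially. \<bar>\<Sum>k<m. X k \<omega> - (\<integral>\<omega>. X k \<omega> \<partial>M)\<bar> \<le> real m"
      using \<omega>(2)
    proof eventually_elim
      case (elim m)
      then show ?case by (auto simp: B_def mu_def sum_subtractf)
    qed
  qed
qed

text \<open>Level \<open>j\<close> owns the complete slots between two consecutive boundaries. Their
  total length is \<open>(lam j - lam (j - 1)) * T\<close> up to an error of smaller order than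
  \<open>T powr \<alpha>\<close>, and their number is asymptotic to \<open>(lam j powr \<alpha> -
  lam (j - 1) powr \<alpha>) * T powr \<alpha>\<close>.\<close>

lemma (in growing_slots) level_drift:
  fixes lam h e :: "nat \<Rightarrow> real"
  assumes lam: "\<And>j. j < s \<Longrightarrow> 0 < lam j"
    and D: "D < (\<Sum>j<s. (lam j powr \<alpha> - (if j = 0 then 0 else lam (j - 1) powr \<alpha>)) * e j)"
  defines "M \<equiv> \<lambda>j T. mc (nat \<lfloor>lam j * real T\<rfloor>)"
  shows "\<forall>\<^sub>F T in sequentially. real T * (\<Sum>j<s. (lam j - (if j = 0 then 0 else lam (j - 1))) * h j) + real T powr \<alpha> * D
    \<le> (\<Sum>j<s. h j * (real (t (M j T)) - (if j = 0 then 0 else real (t (M (j - 1) T)))) +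
           e j * (real (M j T) - (if j = 0 then 0 else real (M (j - 1) T))))"
proof -
  let ?lhs = "\<lambda>T. (\<Sum>j<s. h j * (real (t (M j T)) - (if j = 0 then 0 else real (t (M (j - 1) T)))) +
           e j * (real (M j T) - (if j = 0 then 0 else real (M (j - 1) T))))"
  let ?P = "\<Sum>j<s. (lam j - (if j = 0 then 0 else lam (j - 1))) * h j"
  define a where "a j T = (lam j * real T - real (t (M j T))) / real T powr \<alpha>" for j T
  define b where "b j T = real (M j T) / real T powr \<alpha>" for j T
  have lims: "a j \<longlonglongrightarrow> 0" "b j \<longlonglongrightarrow> lam j powr \<alpha>" if "j < s" for j
    unfolding a_def b_def M_def using t_mc_asymp[OF lam[OF that]] mc_asymp[OF lam[OF that]] by auto
  have "(\<lambda>T. \<Sum>j<s. h j * ((if j = 0 then 0 else a (j - 1) T) - a j T) + e j * (b j T - (if j = 0 then 0 else b (j - 1) T)))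
    \<longlonglongrightarrow> (\<Sum>j<s. h j * ((if j = 0 then 0 else 0) - 0) + e j * (lam j powr \<alpha> - (if j = 0 then 0 else lam (j - 1) powr \<alpha>)))"
  proof (rule tendsto_sum)
    fix j assume "j \<in> {..<s}"
    then have j: "j < s" "j - 1 < s" by auto
    show "(\<lambda>T. h j * ((if j = 0 then 0 else a (j - 1) T) - a j T) + e j * (b j T - (if j = 0 then 0 else b (j - 1) T)))
      \<longlonglongrightarrow> h j * ((if j = 0 then 0 else 0) - 0) + e j * (lam j powr \<alpha> - (if j = 0 then 0 else lam (j - 1) powr \<alpha>))"
    proof -
      have "(\<lambda>T. if j = 0 then 0 else a (j - 1) T) \<longlonglongrightarrow> (if j = 0 then 0 else 0)"
        "(\<lambda>T. if j = 0 then 0 else b (j - 1) T) \<longlonglongrightarrow> (if j = 0 then 0 else lam (j - 1) powr \<alpha>)"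
        using lims[OF j(2)] by (cases "j = 0"; simp)+
      then show ?thesis by (intro tendsto_intros lims[OF j(1)])
    qed
  qed
  moreover have "(\<Sum>j<s. h j * ((if j = 0 then 0 else 0) - 0) + e j * (lam j powr \<alpha> - (if j = 0 then 0 else lam (j - 1) powr \<alpha>)))
    = (\<Sum>j<s. (lam j powr \<alpha> - (if j = 0 then 0 else lam (j - 1) powr \<alpha>)) * e j)"
    by (intro sum.cong) (auto simp: mult.commute)
  ultimately have "\<forall>\<^sub>F T in sequentially. D < (\<Sum>j<s. h j * ((if j = 0 then 0 else a (j - 1) T) - a j T)
      + e j * (b j T - (if j = 0 then 0 else b (j - 1) T)))"
    using D by (intro order_tendstoD(1)) simp_all
  then show ?thesis
    using eventually_gt_at_top[of 0]
  proof eventually_elim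
    case (elim T)
    let ?Q = "real T powr \<alpha>"
    have Q: "0 < ?Q" using elim by simp
    have "?Q * D \<le> ?Q * (\<Sum>j<s. h j * ((if j = 0 then 0 else a (j - 1) T) - a j T) + e j * (b j T - (if j = 0 then 0 else b (j - 1) T)))"
      using elim Q by (intro mult_left_mono) auto
    also have "\<dots> = (\<Sum>j<s. h j * (real (t (M j T)) - (if j = 0 then 0 else real (t (M (j - 1) T)))) +
        e j * (real (M j T) - (if j = 0 then 0 else real (M (j - 1) T)))
        - real T * ((lam j - (if j = 0 then 0 else lam (j - 1))) * h j))"
      unfolding sum_distrib_left
    proof (intro sum.cong refl)
      fix j assume "j \<in> {..<s}"
      have A: "?Q * a i T = lam i * real T - real (t (M i T))" "?Q * b i T = real (M i T)" for i
        using Q by (simp_all add: a_def b_def)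
      have "?Q * (h j * (x - a j T) + e j * (b j T - y)) = h j * (?Q * x - ?Q * a j T) + e j * (?Q * b j T - ?Q * y)" for x y
        by (simp add: algebra_simps)
      then show "?Q * (h j * ((if j = 0 then 0 else a (j - 1) T) - a j T) + e j * (b j T - (if j = 0 then 0 else b (j - 1) T)))
        = h j * (real (t (M j T)) - (if j = 0 then 0 else real (t (M (j - 1) T)))) +
          e j * (real (M j T) - (if j = 0 then 0 else real (M (j - 1) T)))
          - real T * ((lam j - (if j = 0 then 0 else lam (j - 1))) * h j)"
        by (cases "j = 0") (simp_all add: A, simp_all add: algebra_simps)
    qed
    also have "\<dots> = ?lhs T - real T * ?P"
      by (simp add: sum_subtractf sum_distrib_left)
    finally show ?case by linarith
  qed
qed

section \<open>Random sequences charging no set of finite measure\<close>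

text \<open>In \<open>drift\<close>, \<open>4 * s\<close> pays for the deviations of the information from the entropies and \<open>2 * ln (p + 1)\<close> for
  the unknown positions of the words in their slots.\<close>

locale random_slots = coding_geom A L p s pr lam R N CR K0 + growing_slots \<alpha> c0
  for A :: "'a set" and L p s pr lam and R :: "(nat \<Rightarrow> 'a) \<Rightarrow> 'm::euclidean_space" and N CR K0 \<alpha> c0 +
  fixes h e :: "nat \<Rightarrow> real" and q :: "nat \<Rightarrow> 'a list pmf" and c1 :: real
  assumes c0_gt: "p < c0" and c1: "0 < c1"
    and q_dists: "q k \<in> dists (t (Suc k) - t k - p)"
    and q_ent: "j < s \<Longrightarrow> (real (t (Suc k)) - real (t k)) * h j + e j \<le> Hl j (q k)"
    and q_mass: "u \<in> words (t (Suc k) - t k - p) \<Longrightarrow>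
      exp (- real (t (Suc k) - t k - p) * c1) \<le> pmf (map_pmf (prw j) (q k)) (prw j u)"
    and drift: "4 * real s + 2 * ln (real p + 1) + 1
      < (\<Sum>j<s. (lam j powr \<alpha> - (if j = 0 then 0 else lam (j - 1) powr \<alpha>)) * e j)"
begin

abbreviation "rnd \<equiv> PiM UNIV (\<lambda>k. measure_pmf (q k))"

definition info :: "nat \<Rightarrow> nat \<Rightarrow> 'a list \<Rightarrow> real" where
  "info k j u = - ln (pmf (map_pmf (prw j) (q k)) (prw j u))"

text \<open>Splitting the almost sure event by the index \<open>m0\<close> makes the later estimates
  hold from one scale on, uniformly on each part. Subsets of these parts are estimated through
  measurable sets that contain them.\<close>

definition good :: "nat \<Rightarrow> (nat \<Rightarrow> 'a list) set" where
  "good m0 = {\<omega>. (\<forall>k. \<omega> k \<in> set_pmf (q k)) \<and>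
     (\<forall>j<s. \<forall>m\<ge>m0. \<bar>\<Sum>k<m. info k j (\<omega> k) - Hl j (q k)\<bar> \<le> real m)}"

lemma t_slot: "t k + p \<le> t (Suc k)"
  using t_step[of k] c0_gt by simp

lemma q_words: "u \<in> set_pmf (q k) \<Longrightarrow> u \<in> words (t (Suc k) - t k - p)"
  using q_dists[of k] by (auto simp: dists_def)

lemma good_supp: "\<omega> \<in> good m0 \<Longrightarrow> \<omega> k \<in> set_pmf (q k)"
  unfolding good_def by blast

lemma good_words: "\<omega> \<in> good m0 \<Longrightarrow> \<omega> k \<in> words (t (Suc k) - t k - p)"
  by (rule q_words) (rule good_supp)

lemma good_slots:
  assumes "\<omega> \<in> good m0"
  shows "slotx \<omega> \<in> XL" "offs \<omega> k \<le> p"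
proof -
  have I: "\<And>k. \<omega> k \<in> words (t (Suc k) - t k - p)" using assms by (rule good_words)
  show "slotx \<omega> \<in> XL" "offs \<omega> k \<le> p" by (rule slot_props[of t \<omega>, OF t_0 t_slot I])+
qed

lemma space_rnd [simp]: "space rnd = UNIV"
  by (simp add: space_PiM)

lemma prob_space_rnd: "prob_space rnd"
  by (intro prob_space_PiM prob_space_measure_pmf)

lemma AE_good: "AE \<omega> in rnd. \<exists>m0. \<omega> \<in> good m0"
proof -
  interpret P: prob_space rnd by (rule prob_space_rnd)
  have supp: "AE \<omega> in rnd. \<omega> k \<in> set_pmf (q k)" for k
    by (rule AE_PiM_component) (simp_all add: prob_space_measure_pmf AE_measure_pmf)
  define r where "r = 1 / \<alpha> - 1"
  define C where "C = c1 * (real c0 + 1 + 1 / \<alpha>)"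
  \<comment> \<open>The bound \<open>r < 1 / 2\<close>, required for the deviations, is exactly
    \<alpha> > 2 / 3.\<close>
  have r: "0 \<le> r" "r < 1 / 2" using alpha by (auto simp: r_def field_simps)
  have C: "0 < C" using c1 alpha by (simp add: C_def add_nonneg_pos)
  have range: "info k j u \<in> {0..C * (real k + 1) powr r}" if u: "u \<in> set_pmf (q k)" for k j u
  proof -
    let ?x = "pmf (map_pmf (prw j) (q k)) (prw j u)" and ?b = "t (Suc k) - t k - p"
    have x: "exp (- real ?b * c1) \<le> ?x" using q_mass[OF q_words[OF u]] .
    then have x0: "0 < ?x" by (rule less_le_trans[OF exp_gt_zero])
    have "- real ?b * c1 \<le> ln ?x" using x x0 by (simp add: ln_ge_iff)
    then have "info k j u \<le> real ?b * c1" by (simp add: info_def)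
    also have "real ?b \<le> real (t (Suc k)) - real (t k)" using t_slot[of k] by simp
    also have "\<dots> \<le> real c0 + 1 + (1 / \<alpha>) * (real k + 1) powr r" unfolding r_def by (rule t_gap)
    also have "\<dots> \<le> (real c0 + 1) * (real k + 1) powr r + (1 / \<alpha>) * (real k + 1) powr r"
    proof -
      have "1 \<le> (real k + 1) powr r" using r by (intro ge_one_powr_ge_zero) auto
      then have "(real c0 + 1) * 1 \<le> (real c0 + 1) * (real k + 1) powr r" by (intro mult_left_mono) auto
      then show ?thesis by simp
    qed
    finally have "info k j u \<le> ((real c0 + 1) * (real k + 1) powr r + (1 / \<alpha>) * (real k + 1) powr r) * c1"
      using c1 by simp
    also have "\<dots> = C * (real k + 1) powr r" by (simp add: C_def algebra_simps)
    finally have "info k j u \<le> C * (real k + 1) powr r" .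
    moreover have "0 \<le> info k j u" unfolding info_def using x0 pmf_le_1[of "map_pmf (prw j) (q k)" "prw j u"] by simp
    ultimately show ?thesis by simp
  qed
  have indep: "P.indep_vars (\<lambda>k. measure_pmf (q k)) (\<lambda>k \<omega>. \<omega> k) UNIV"
    by (rule indep_vars_coordinates) (rule prob_space_measure_pmf)
  have mean: "(\<integral>\<omega>. info k j (\<omega> k) \<partial>rnd) = Hl j (q k)" for k j
  proof -
    have "(\<integral>\<omega>. info k j (\<omega> k) \<partial>rnd) = (\<integral>u. info k j u \<partial>distr rnd (measure_pmf (q k)) (\<lambda>\<omega>. \<omega> k))"
      by (rule integral_distr[symmetric]) auto
    also have "\<dots> = (\<integral>u. info k j u \<partial>measure_pmf (q k))"
      by (subst distr_PiM_component) (auto simp: prob_space_measure_pmf)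
    also have "\<dots> = Hl j (q k)"
      unfolding info_def Hl_def ent_def by (simp add: integral_map_pmf)
    finally show ?thesis .
  qed
  have dev: "AE \<omega> in rnd. \<forall>\<^sub>F m in sequentially. \<bar>\<Sum>k<m. info k j (\<omega> k) - Hl j (q k)\<bar> \<le> real m" for j
  proof -
    have "P.indep_vars (\<lambda>_. borel) (\<lambda>k \<omega>. info k j (\<omega> k)) UNIV"
      by (rule P.indep_vars_compose2[OF indep]) simp
    moreover have "AE \<omega> in rnd. info k j (\<omega> k) \<in> {0..C * (real k + 1) powr r}" for k
      using supp[of k] by (rule AE_mp) (use range in \<open>auto intro!: AE_I2\<close>)
    ultimately have "AE \<omega> in rnd. \<forall>\<^sub>F m in sequentially.
        \<bar>\<Sum>k<m. info k j (\<omega> k) - (\<integral>\<omega>. info k j (\<omega> k) \<partial>rnd)\<bar> \<le> real m"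
      by (rule AE_eventually_sum_deviation_le[OF prob_space_rnd _ _ C r])
    then show ?thesis by (simp only: mean)
  qed
  have "AE \<omega> in rnd. (\<forall>k. \<omega> k \<in> set_pmf (q k)) \<and>
      (\<forall>j\<in>{..<s}. \<forall>\<^sub>F m in sequentially. \<bar>\<Sum>k<m. info k j (\<omega> k) - Hl j (q k)\<bar> \<le> real m)"
  proof (rule AE_conjI)
    show "AE \<omega> in rnd. \<forall>k. \<omega> k \<in> set_pmf (q k)" using supp by (simp add: AE_all_countable)
    show "AE \<omega> in rnd. \<forall>j\<in>{..<s}. \<forall>\<^sub>F m in sequentially. \<bar>\<Sum>k<m. info k j (\<omega> k) - Hl j (q k)\<bar> \<le> real m"
      using dev by (subst AE_finite_all) auto
  qed
  then show ?thesis
  proof (rule AE_mp, intro AE_I2 impI, elim conjE)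
    fix \<omega> assume a: "\<forall>k. \<omega> k \<in> set_pmf (q k)"
      "\<forall>j\<in>{..<s}. \<forall>\<^sub>F m in sequentially. \<bar>\<Sum>k<m. info k j (\<omega> k) - Hl j (q k)\<bar> \<le> real m"
    have "\<forall>\<^sub>F m in sequentially. \<forall>j\<in>{..<s}. \<bar>\<Sum>k<m. info k j (\<omega> k) - Hl j (q k)\<bar> \<le> real m"
      using a(2) by (intro eventually_ball_finite) auto
    then show "\<exists>m0. \<omega> \<in> good m0" using a(1) by (auto simp: eventually_sequentially good_def)
  qed
qed

lemma cylinder:
  "{\<omega>. \<forall>k<n. prw (J k) (\<omega> k) = prw (J k) (w k)} \<in> sets rnd"
  "emeasure rnd {\<omega>. \<forall>k<n. prw (J k) (\<omega> k) = prw (J k) (w k)} = (\<Prod>k<n. ennreal (pmf (map_pmf (prw (J k)) (q k)) (prw (J k) (w k))))"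
proof -
  interpret P: product_prob_space "\<lambda>k. measure_pmf (q k)" UNIV
    by (intro product_prob_spaceI prob_space_measure_pmf)
  define D where "D k = prw (J k) -` {prw (J k) (w k)}" for k
  have eq: "{\<omega>. \<forall>k<n. prw (J k) (\<omega> k) = prw (J k) (w k)} = {\<omega>\<in>space rnd. \<forall>k\<in>{..<n}. \<omega> k \<in> D k}"
    by (auto simp: D_def)
  show "{\<omega>. \<forall>k<n. prw (J k) (\<omega> k) = prw (J k) (w k)} \<in> sets rnd"
    unfolding eq by (intro sets.sets_Collect_finite_All sets_Collect_single') auto
  have "emeasure rnd {\<omega>\<in>space rnd. \<forall>k\<in>{..<n}. \<omega> k \<in> D k} = (\<Prod>k<n. emeasure (measure_pmf (q k)) (D k))"
    by (rule P.emeasure_PiM_Collect) auto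
  then show "emeasure rnd {\<omega>. \<forall>k<n. prw (J k) (\<omega> k) = prw (J k) (w k)} = (\<Prod>k<n. ennreal (pmf (map_pmf (prw (J k)) (q k)) (prw (J k) (w k))))"
    unfolding eq by (simp add: pmf_map D_def measure_pmf.emeasure_eq_measure)
qed

text \<open>On the slots owned by level \<open>j\<close>, information is compared with entropy by
  subtracting two initial sums. Each has a deviation of at most the total number of slots, which
  gives \<open>2 * s * M (s - 1)\<close> over all levels.\<close>

lemma info_lower:
  assumes \<omega>: "\<omega> \<in> good m0" and mono: "\<And>i j. i \<le> j \<Longrightarrow> j < s \<Longrightarrow> M i \<le> M j" and m0: "m0 \<le> M 0"
  shows "(\<Sum>j<s. h j * (real (t (M j)) - (if j = 0 then 0 else real (t (M (j - 1))))) +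
           e j * (real (M j) - (if j = 0 then 0 else real (M (j - 1))))) - 2 * real s * real (M (s - 1))
     \<le> (\<Sum>k<M (s - 1). info k (LEAST j. k < M j) (\<omega> k))"
proof -
  let ?f = "\<lambda>j k. info k j (\<omega> k)"
  have "(\<Sum>j<s. h j * (real (t (M j)) - (if j = 0 then 0 else real (t (M (j - 1))))) +
           e j * (real (M j) - (if j = 0 then 0 else real (M (j - 1)))) - 2 * real (M (s - 1)))
     \<le> (\<Sum>j<s. (\<Sum>k<M j. ?f j k) - (if j = 0 then 0 else \<Sum>k<M (j - 1). ?f j k))"
  proof (rule sum_mono)
    fix j assume "j \<in> {..<s}"
    then have j: "j < s" by simp
    define m' where "m' = (if j = 0 then 0 else M (j - 1))"
    have m': "m' \<le> M j" "M j \<le> M (s - 1)" using j mono[of "j - 1" j] mono[of j "s - 1"] by (auto simp: m'_def)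
    \<comment> \<open>The case \<open>m = 0\<close> is needed for the empty lower sum at level
      0.\<close>
    have dev: "\<bar>(\<Sum>k<m. ?f j k) - (\<Sum>k<m. Hl j (q k))\<bar> \<le> real m" if "m = 0 \<or> m0 \<le> m" for m
      using \<omega> that j by (auto simp: good_def sum_subtractf)
    have "\<bar>(\<Sum>k<M j. ?f j k) - (\<Sum>k<M j. Hl j (q k))\<bar> \<le> real (M j)"
      using m0 mono[of 0 j] j by (intro dev) auto
    moreover have "\<bar>(\<Sum>k<m'. ?f j k) - (\<Sum>k<m'. Hl j (q k))\<bar> \<le> real m'"
      using m0 mono[of 0 "j - 1"] less_imp_diff_less[OF j, of 1] by (intro dev) (auto simp: m'_def)
    moreover have "h j * (real (t (M j)) - real (t m')) + e j * (real (M j) - real m')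
      \<le> (\<Sum>k<M j. Hl j (q k)) - (\<Sum>k<m'. Hl j (q k))"
    proof -
      have "(\<Sum>k<M j. Hl j (q k)) - (\<Sum>k<m'. Hl j (q k)) = (\<Sum>k\<in>{m'..<M j}. Hl j (q k))"
        using sum_diff_nat_ivl[of 0 m' "M j" "\<lambda>k. Hl j (q k)"] m'(1) by (simp add: atLeast0LessThan)
      moreover have "(\<Sum>k\<in>{m'..<M j}. (real (t (Suc k)) - real (t k)) * h j + e j) \<le> (\<Sum>k\<in>{m'..<M j}. Hl j (q k))"
        using q_ent[OF j] by (intro sum_mono)
      moreover have "(\<Sum>k\<in>{m'..<M j}. (real (t (Suc k)) - real (t k)) * h j + e j)
        = h j * (real (t (M j)) - real (t m')) + e j * (real (M j) - real m')"
        using sum_Suc_diff'[OF m'(1), of "\<lambda>k. real (t k)"] m'(1)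
        by (simp add: sum.distrib sum_distrib_right[symmetric] of_nat_diff mult.commute[of "h j"] mult.commute[of "e j"])
      ultimately show ?thesis by simp
    qed
    moreover have "real m' \<le> real (M (s - 1))" "real (M j) \<le> real (M (s - 1))" using m' by auto
    ultimately have "h j * (real (t (M j)) - real (t m')) + e j * (real (M j) - real m') - 2 * real (M (s - 1))
      \<le> (\<Sum>k<M j. ?f j k) - (\<Sum>k<m'. ?f j k)" by linarith
    then show "h j * (real (t (M j)) - (if j = 0 then 0 else real (t (M (j - 1))))) +
           e j * (real (M j) - (if j = 0 then 0 else real (M (j - 1)))) - 2 * real (M (s - 1))
      \<le> (\<Sum>k<M j. ?f j k) - (if j = 0 then 0 else \<Sum>k<M (j - 1). ?f j k)"
      by (cases "j = 0") (simp_all add: m'_def)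
  qed
  also have "\<dots> = (\<Sum>k<M (s - 1). ?f (LEAST j. k < M j) k)"
    by (rule level_sum) (use mono s_pos in auto)
  finally show ?thesis by (simp add: sum_subtractf)
qed

text \<open>Members of a class with the same offsets have the same projected words in all complete
  slots, so they share a cylinder, whose mass \<open>info_lower\<close> bounds. There are at most
  \<open>(p + 1) ^ n\<close> vectors of offsets.\<close>

lemma class_bound:
  "\<forall>\<^sub>F T in sequentially. \<forall>y. \<exists>B\<in>sets rnd. {\<omega> \<in> good m0. eqv T (slotx \<omega>) y} \<subseteq> B \<and>
     emeasure rnd B \<le> ennreal (exp (- (real T * (\<Sum>j<s. ww j * h j)) - real T powr \<alpha>))"
proof -
  let ?P = "\<Sum>j<s. ww j * h j"
  define D where "D = 4 * real s + 2 * ln (real p + 1) + 1"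
  define M where "M T j = mc (Lv j T)" for T j
  have "(\<Sum>j<s. (lam j - (if j = 0 then 0 else lam (j - 1))) * h j) = ?P"
    by (intro sum.cong) (auto simp: ww_def)
  then have ev: "\<forall>\<^sub>F T in sequentially. real T * ?P + real T powr \<alpha> * D
    \<le> (\<Sum>j<s. h j * (real (t (M T j)) - (if j = 0 then 0 else real (t (M T (j - 1))))) +
           e j * (real (M T j) - (if j = 0 then 0 else real (M T (j - 1)))))"
    using level_drift[of s lam D e h, OF lam_pos drift[folded D_def]] unfolding M_def Lv_def by (simp only:)
  have "\<forall>\<^sub>F T in sequentially. m0 \<le> M T 0"
  proof -
    obtain T0 :: nat where T0: "(real (t m0) + 1) / lam 0 < real T0" using reals_Archimedean2 by blast
    show ?thesis
      unfolding eventually_sequentially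
    proof (intro exI allI impI)
      fix T assume "T0 \<le> T"
      then have "(real (t m0) + 1) / lam 0 < real T" using T0 by simp
      then have "real (t m0) + 1 < lam 0 * real T" using lam_0 by (simp add: divide_less_eq mult.commute)
      then have "t m0 \<le> Lv 0 T" using Lv_bounds(2)[OF s_pos, of T] by simp
      then show "m0 \<le> M T 0" using mc_less_iff[of "m0 - 1" "Lv 0 T"] by (cases m0) (auto simp: M_def)
    qed
  qed
  with ev show ?thesis
    using eventually_gt_at_top[of 0]
  proof eventually_elim
    case (elim T)
    define n where "n = M T (s - 1)"
    define J where "J k = (LEAST j. k < M T j)" for k
    have mono: "M T i \<le> M T j" if "i \<le> j" "j < s" for i j
      unfolding M_def by (intro mc_mono Lv_mono that)
    have J: "J k < s" "t (Suc k) \<le> Lv (J k) T" if "k < n" for k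
    proof -
      have "J k \<le> s - 1" unfolding J_def using that n_def by (intro Least_le) simp
      then show "J k < s" using s_pos by simp
      have "k < M T (J k)" unfolding J_def using that n_def by (intro LeastI[of "\<lambda>j. k < M T j"]) simp
      then show "t (Suc k) \<le> Lv (J k) T" by (simp add: M_def mc_less_iff)
    qed
    \<comment> \<open>This factor 2 explains \<open>drift\<close>: the deviations
      \<open>2 * s * n\<close> cost at most \<open>4 * s\<close>, the offsets at most
      \<open>2 * ln (p + 1)\<close>, both times \<open>T powr \<alpha>\<close>, and the remaining 1
      is the net gain.\<close>
    have n: "real n \<le> 2 * real T powr \<alpha>"
    proof -
      have "real n \<le> (1 * real T + 1) powr \<alpha>" using mc_upper[of 1 T] unfolding n_def M_def Lv_top by simp
      also have "\<dots> \<le> (2 * real T) powr \<alpha>" using elim alpha by (intro powr_mono2) auto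
      also have "\<dots> = 2 powr \<alpha> * real T powr \<alpha>" by (simp add: powr_mult)
      also have "\<dots> \<le> 2 powr 1 * real T powr \<alpha>" using alpha by (intro mult_right_mono powr_mono) auto
      finally show ?thesis by simp
    qed
    define cyl where "cyl w = {\<omega>. \<forall>k<n. prw (J k) (\<omega> k) = prw (J k) (w k)}" for w :: "nat \<Rightarrow> 'a list"
    define E0 where "E0 = real T * ?P + real T powr \<alpha> * (2 * ln (real p + 1) + 1)"
    have cyl: "emeasure rnd (cyl w) \<le> ennreal (exp (- E0))" if w: "w \<in> good m0" for w
    proof -
      have pos: "0 < pmf (map_pmf (prw (J k)) (q k)) (prw (J k) (w k))" for k
        using good_supp[OF w, of k] by (intro pmf_positive) simp
      have "E0 \<le> real T * ?P + real T powr \<alpha> * D - 2 * real s * real n"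
      proof -
        have "2 * real s * real n \<le> 2 * real s * (2 * real T powr \<alpha>)" using n by (intro mult_left_mono) auto
        then show ?thesis by (simp add: E0_def D_def algebra_simps)
      qed
      also have "\<dots> \<le> (\<Sum>k<n. info k (J k) (w k))"
        unfolding n_def J_def using info_lower[of w m0 "M T", OF w mono elim(2)] elim(1) by linarith
      finally have E0: "E0 \<le> (\<Sum>k<n. info k (J k) (w k))" .
      have "emeasure rnd (cyl w) = ennreal (\<Prod>k<n. pmf (map_pmf (prw (J k)) (q k)) (prw (J k) (w k)))"
        unfolding cyl_def cylinder(2) by (rule prod_ennreal) simp
      also have "(\<Prod>k<n. pmf (map_pmf (prw (J k)) (q k)) (prw (J k) (w k))) = (\<Prod>k<n. exp (- info k (J k) (w k)))"
        using pos by (intro prod.cong) (auto simp: info_def)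
      also have "\<dots> = exp (- (\<Sum>k<n. info k (J k) (w k)))" by (simp add: exp_sum sum_negf[symmetric])
      also have "\<dots> \<le> exp (- E0)" using E0 by simp
      finally show ?thesis by (simp add: ennreal_leI)
    qed
    show ?case
    proof
      fix y
      define E where "E = {\<omega> \<in> good m0. eqv T (slotx \<omega>) y}"
      have EI: "\<omega> k \<in> words (t (Suc k) - t k - p)" if "\<omega> \<in> E" for \<omega> k
        using that by (intro good_words[of \<omega> m0]) (simp add: E_def)
      define g where "g \<omega> = restrict (offs \<omega>) {..<n}" for \<omega> :: "nat \<Rightarrow> 'a list"
      let ?V = "PiE {..<n} (\<lambda>_. {..p})"
      have gV: "g ` E \<subseteq> ?V"
      proof (rule image_subsetI)
        fix \<omega> assume "\<omega> \<in> E"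
        then have "offs \<omega> k \<le> p" for k using good_slots(2)[of \<omega> m0] by (simp add: E_def)
        then show "g \<omega> \<in> ?V" by (simp add: g_def)
      qed
      have fin: "finite (g ` E)" by (rule finite_subset[OF gV]) (intro finite_PiE; simp)
      obtain Y where Y: "Y \<subseteq> E" "finite Y" "card Y = card (g ` E)" "\<And>x. x \<in> E \<Longrightarrow> \<exists>y\<in>Y. g y = g x"
        using choose_representatives[of g E] fin by auto
      have cardY: "card Y \<le> (p + 1) ^ n"
        using Y(3) card_mono[OF _ gV] by (simp add: card_PiE finite_PiE)
      have "E \<subseteq> (\<Union>w\<in>Y. cyl w)"
      proof
        fix \<omega> assume \<omega>: "\<omega> \<in> E"
        then obtain w where w: "w \<in> Y" "g w = g \<omega>" using Y(4) by blast
        have wE: "w \<in> E" by (rule subsetD[OF Y(1) w(1)])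
        have eq: "eqv T (slotx \<omega>) (slotx w)"
        proof (rule eqv_trans)
          show "eqv T (slotx \<omega>) y" using \<omega> by (simp add: E_def)
          show "eqv T y (slotx w)" using wE eqv_sym[of T "slotx w" y] by (simp add: E_def)
        qed
        have "prw (J k) (\<omega> k) = prw (J k) (w k)" if k: "k < n" for k
        proof (rule slot_eqv[of t \<omega> w T k "J k", OF t_0 t_slot EI[OF \<omega>] EI[OF wE] eq])
          show "offs \<omega> k = offs w k" using fun_cong[OF w(2), of k] k by (simp add: g_def)
        qed (rule J[OF k])+
        then have "\<omega> \<in> cyl w" by (simp add: cyl_def)
        then show "\<omega> \<in> (\<Union>w\<in>Y. cyl w)" using w(1) by (rule UN_I[rotated])
      qed
      moreover have "emeasure rnd (\<Union>w\<in>Y. cyl w) \<le> ennreal (exp (- (real T * ?P) - real T powr \<alpha>))"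
      proof -
        have "emeasure rnd (\<Union>w\<in>Y. cyl w) \<le> (\<Sum>w\<in>Y. emeasure rnd (cyl w))"
          using Y(2) cylinder(1) by (intro emeasure_subadditive_finite) (auto simp: cyl_def)
        also have "\<dots> \<le> (\<Sum>w\<in>Y. ennreal (exp (- E0)))"
          using Y(1) by (intro sum_mono cyl) (auto simp: E_def)
        also have "\<dots> = ennreal (real (card Y) * exp (- E0))"
          by (simp add: ennreal_mult ennreal_of_nat_eq_real_of_nat)
        also have "\<dots> \<le> ennreal (exp (- (real T * ?P) - real T powr \<alpha>))"
        proof (rule ennreal_leI)
          have "real (card Y) \<le> real ((p + 1) ^ n)" using cardY by (simp only: of_nat_le_iff)
          also have "\<dots> = exp (real n * ln (real p + 1))" by (simp add: exp_of_nat_mult add.commute)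
          also have "\<dots> \<le> exp (2 * real T powr \<alpha> * ln (real p + 1))"
            using n by (simp add: mult_right_mono)
          finally have "real (card Y) * exp (- E0) \<le> exp (2 * real T powr \<alpha> * ln (real p + 1)) * exp (- E0)"
            by (intro mult_right_mono) auto
          also have "\<dots> = exp (- (real T * ?P) - real T powr \<alpha>)"
            by (simp add: exp_add[symmetric] E0_def algebra_simps)
          finally show "real (card Y) * exp (- E0) \<le> exp (- (real T * ?P) - real T powr \<alpha>)" .
        qed
        finally show ?thesis .
      qed
      moreover have "(\<Union>w\<in>Y. cyl w) \<in> sets rnd"
        using Y(2) cylinder(1) by (intro sets.finite_UN) (auto simp: cyl_def)
      ultimately show "\<exists>B\<in>sets rnd. {\<omega> \<in> good m0. eqv T (slotx \<omega>) y} \<subseteq> B \<and>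
          emeasure rnd B \<le> ennreal (exp (- (real T * ?P) - real T powr \<alpha>))"
        unfolding E_def by blast
    qed
  qed
qed


text \<open>A set of finite measure is covered by sets whose powers of diameters have bounded sum.
  Each of them meets at most \<open>K0\<close> classes, so by \<open>class_bound\<close> the random
  sequences coded into it have arbitrarily small outer probability as the scale grows. Countably
  many null sets cannot exhaust the almost sure event.\<close>

theorem not_countable_union_finite:
  assumes \<kappa>: "\<kappa> = (\<Sum>j<s. ww j * h j) / ln N" "0 \<le> \<kappa>"
    and S: "\<And>i::nat. hausdorff_measure \<kappa> (S i) < \<infinity>" "R ` XL \<subseteq> (\<Union>i. S i)"
  shows False
proof -
  interpret P: prob_space rnd by (rule prob_space_rnd)
  have \<kappa>N: "(\<Sum>j<s. ww j * h j) = \<kappa> * ln N" using N by (simp add: \<kappa>(1))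
  have small: "\<exists>B\<in>sets rnd. {\<omega> \<in> good m0. R (slotx \<omega>) \<in> S i} \<subseteq> B \<and> emeasure rnd B \<le> ennreal \<epsilon>"
    if \<epsilon>: "0 < \<epsilon>" for m0 i \<epsilon>
  proof -
    obtain a where a: "0 < a" "hausdorff_measure \<kappa> (S i) < ennreal a"
    proof -
      obtain x where "0 \<le> x" "hausdorff_measure \<kappa> (S i) = ennreal x"
        using S(1)[of i] by (cases "hausdorff_measure \<kappa> (S i)") auto
      then show ?thesis by (intro that[of "x + 1"]) (auto simp: ennreal_less_iff)
    qed
    define c where "c = real K0 * (N powr \<kappa> * (2 * a))"
    have c: "0 \<le> c" using a by (simp add: c_def)
    have "((\<lambda>x::real. c * exp (- (x powr \<alpha>))) \<longlongrightarrow> 0) at_top"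
    proof -
      have "((\<lambda>x::real. exp (- (x powr \<alpha>))) \<longlongrightarrow> 0) at_top" using alpha by real_asymp
      then show ?thesis by (rule tendsto_mult_right_zero)
    qed
    then have "(\<lambda>T. c * exp (- (real T powr \<alpha>))) \<longlonglongrightarrow> 0"
      by (rule filterlim_compose) (rule filterlim_real_sequentially)
    then have "\<forall>\<^sub>F T in sequentially. c * exp (- (real T powr \<alpha>)) < \<epsilon>"
      using \<epsilon> by (rule order_tendstoD(2))
    with class_bound[of m0] have "\<forall>\<^sub>F T in sequentially. c * exp (- (real T powr \<alpha>)) < \<epsilon> \<and> (\<forall>y. \<exists>B\<in>sets rnd.
      {\<omega> \<in> good m0. eqv T (slotx \<omega>) y} \<subseteq> B \<and> emeasure rnd B \<le> ennreal (exp (- (real T * (\<Sum>j<s. ww j * h j)) - real T powr \<alpha>)))"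
      by eventually_elim blast
    then obtain T0 where ev: "\<forall>T\<ge>T0. c * exp (- (real T powr \<alpha>)) < \<epsilon> \<and> (\<forall>y. \<exists>B\<in>sets rnd.
      {\<omega> \<in> good m0. eqv T (slotx \<omega>) y} \<subseteq> B \<and> emeasure rnd B \<le> ennreal (exp (- (real T * (\<Sum>j<s. ww j * h j)) - real T powr \<alpha>)))"
      unfolding eventually_sequentially by (rule exE)
    have T0: "c * exp (- (real T0 powr \<alpha>)) < \<epsilon>"
      using ev[rule_format, OF order_refl] by simp
    have "\<exists>B\<in>sets rnd. {\<omega> \<in> good m0. eqv T (slotx \<omega>) y} \<subseteq> B \<and>
        emeasure rnd B \<le> ennreal (exp (- (real T * (\<Sum>j<s. ww j * h j)) - real T powr \<alpha>))" if "T0 \<le> T" for T y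
      using ev[rule_format, OF that] by simp
    then have "\<forall>T y. \<exists>B. T0 \<le> T \<longrightarrow> B \<in> sets rnd \<and> {\<omega> \<in> good m0. eqv T (slotx \<omega>) y} \<subseteq> B \<and>
        emeasure rnd B \<le> ennreal (exp (- (real T * (\<Sum>j<s. ww j * h j)) - real T powr \<alpha>))"
      by (simp only: Bex_def) blast
    then obtain B where B: "\<And>T y. T0 \<le> T \<Longrightarrow> B T y \<in> sets rnd \<and> {\<omega> \<in> good m0. eqv T (slotx \<omega>) y} \<subseteq> B T y \<and>
        emeasure rnd (B T y) \<le> ennreal (exp (- (real T * (\<Sum>j<s. ww j * h j)) - real T powr \<alpha>))"
      by (simp only: choice_iff) blast
    have Bm: "emeasure rnd (B T y) \<le> ennreal (exp (- (real T0 powr \<alpha>)) * dl T powr \<kappa>)" if T: "T0 \<le> T" for T y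
    proof -
      \<comment> \<open>A cover uses different scales; all of them profit at least from the gain at
        the coarsest admissible scale \<open>T0\<close>.\<close>
      have "real T0 powr \<alpha> \<le> real T powr \<alpha>" using T alpha by (intro powr_mono2) auto
      then have "exp (- (real T * (\<Sum>j<s. ww j * h j)) - real T powr \<alpha>) \<le> exp (- (real T0 powr \<alpha>)) * dl T powr \<kappa>"
        by (simp add: dl_powr \<kappa>N exp_add[symmetric])
      then show ?thesis using B[OF T, of y] ennreal_leI order_trans by blast
    qed
    have dlh: "0 < dl T0 / 2" using dl_pos[of T0] by simp
    obtain U where U: "\<And>l. bounded (U l)" "\<And>l. diameter (U l) \<le> dl T0 / 2" "S i \<subseteq> (\<Union>l. U l)"
      "(\<Sum>l. diam_pow \<kappa> (U l)) < ennreal a"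
      using hausdorff_cover[OF a(2) dlh] by blast
    have Ud: "diameter (U l) < dl T0" for l using U(2)[of l] dl_pos[of T0] by linarith
    obtain V T where VT: "\<And>l. U l \<noteq> {} \<Longrightarrow> open (V l) \<and> bounded (V l) \<and> U l \<subseteq> V l \<and> diameter (V l) \<le> dl (T l) \<and> T0 \<le> T l"
      "(\<Sum>l. if U l = {} then 0 else ennreal (dl (T l) powr \<kappa>)) \<le> ennreal (N powr \<kappa> * (2 * a))"
      using scale_cover[OF U(1) Ud \<kappa>(2) less_imp_le[OF U(4)] a(1)] by blast
    have "\<exists>Y. finite Y \<and> card Y \<le> K0 \<and> (\<forall>x\<in>XL. R x \<in> V l \<longrightarrow> (\<exists>y\<in>Y. eqv (T l) x y))" if "U l \<noteq> {}" for l
      using cover_R[of "V l" "T l"] VT(1)[OF that] by blast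
    then obtain Y where Y: "\<And>l. U l \<noteq> {} \<Longrightarrow> finite (Y l) \<and> card (Y l) \<le> K0 \<and> (\<forall>x\<in>XL. R x \<in> V l \<longrightarrow> (\<exists>y\<in>Y l. eqv (T l) x y))"
      by metis
    define C where "C l = (if U l = {} then {} else \<Union>y\<in>Y l. B (T l) y)" for l
    have Cs: "C l \<in> sets rnd" for l
      unfolding C_def using Y[of l] VT(1)[of l] B by (auto intro!: sets.finite_UN)
    have Cm: "emeasure rnd (C l) \<le> ennreal (real K0 * exp (- (real T0 powr \<alpha>))) * (if U l = {} then 0 else ennreal (dl (T l) powr \<kappa>))" for l
    proof (cases "U l = {}")
      case False
      have "emeasure rnd (\<Union>y\<in>Y l. B (T l) y) \<le> (\<Sum>y\<in>Y l. emeasure rnd (B (T l) y))"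
        using Y[OF False] VT(1)[OF False] B by (intro emeasure_subadditive_finite) auto
      also have "\<dots> \<le> (\<Sum>y\<in>Y l. ennreal (exp (- (real T0 powr \<alpha>)) * dl (T l) powr \<kappa>))"
        using VT(1)[OF False] by (intro sum_mono Bm) simp
      also have "\<dots> = ennreal (real (card (Y l)) * (exp (- (real T0 powr \<alpha>)) * dl (T l) powr \<kappa>))"
        by (simp add: ennreal_mult ennreal_of_nat_eq_real_of_nat)
      also have "\<dots> \<le> ennreal (real K0 * (exp (- (real T0 powr \<alpha>)) * dl (T l) powr \<kappa>))"
        using Y[OF False] by (intro ennreal_leI mult_right_mono) auto
      finally show ?thesis using False by (simp add: C_def ennreal_mult[symmetric] mult.assoc)
    qed (simp add: C_def)
    have "emeasure rnd (\<Union>l. C l) \<le> (\<Sum>l. emeasure rnd (C l))"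
      using Cs by (intro emeasure_subadditive_countably) auto
    also have "\<dots> \<le> (\<Sum>l. ennreal (real K0 * exp (- (real T0 powr \<alpha>))) * (if U l = {} then 0 else ennreal (dl (T l) powr \<kappa>)))"
      by (intro suminf_le Cm) auto
    also have "\<dots> = ennreal (real K0 * exp (- (real T0 powr \<alpha>))) * (\<Sum>l. if U l = {} then 0 else ennreal (dl (T l) powr \<kappa>))"
      by (rule ennreal_suminf_cmult)
    also have "\<dots> \<le> ennreal (real K0 * exp (- (real T0 powr \<alpha>))) * ennreal (N powr \<kappa> * (2 * a))"
      by (intro mult_left_mono VT(2)) simp
    also have "\<dots> = ennreal (c * exp (- (real T0 powr \<alpha>)))"
      using a(1) by (simp add: ennreal_mult[symmetric] c_def mult.commute mult.left_commute)
    also have "\<dots> \<le> ennreal \<epsilon>" using T0 by (intro ennreal_leI) simp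
    finally have "emeasure rnd (\<Union>l. C l) \<le> ennreal \<epsilon>" .
    moreover have "(\<Union>l. C l) \<in> sets rnd" using Cs by (intro sets.countable_UN) auto
    moreover have "{\<omega> \<in> good m0. R (slotx \<omega>) \<in> S i} \<subseteq> (\<Union>l. C l)"
    proof
      fix \<omega> assume \<omega>: "\<omega> \<in> {\<omega> \<in> good m0. R (slotx \<omega>) \<in> S i}"
      then have X: "slotx \<omega> \<in> XL" using good_slots(1)[of \<omega> m0] by simp
      obtain l where l: "R (slotx \<omega>) \<in> U l" using \<omega> U(3) by blast
      then have ne: "U l \<noteq> {}" by blast
      then have "R (slotx \<omega>) \<in> V l" using VT(1)[OF ne] l by blast
      then obtain y where y: "y \<in> Y l" "eqv (T l) (slotx \<omega>) y" using Y[OF ne] X by blast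
      have "\<omega> \<in> B (T l) y" using B[of "T l" y] VT(1)[OF ne] \<omega> y(2) by blast
      then show "\<omega> \<in> (\<Union>l. C l)" using ne y(1) by (auto simp: C_def)
    qed
    ultimately show ?thesis by blast
  qed
  have null: "AE \<omega> in rnd. \<not> (\<omega> \<in> good m0 \<and> R (slotx \<omega>) \<in> S i)" for m0 i
  proof -
    have "\<exists>B\<in>sets rnd. {\<omega> \<in> good m0. R (slotx \<omega>) \<in> S i} \<subseteq> B \<and> emeasure rnd B \<le> ennreal (1 / real (Suc n))" for n
      by (rule small) simp
    then have "\<forall>n. \<exists>B. B \<in> sets rnd \<and> {\<omega> \<in> good m0. R (slotx \<omega>) \<in> S i} \<subseteq> B \<and> emeasure rnd B \<le> ennreal (1 / real (Suc n))"
      by (simp only: Bex_def) blast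
    from choice[OF this] obtain B where "\<forall>n. B n \<in> sets rnd \<and> {\<omega> \<in> good m0. R (slotx \<omega>) \<in> S i} \<subseteq> B n \<and>
      emeasure rnd (B n) \<le> ennreal (1 / real (Suc n))" by (rule exE)
    then have B: "\<And>n. B n \<in> sets rnd" "\<And>n. {\<omega> \<in> good m0. R (slotx \<omega>) \<in> S i} \<subseteq> B n"
      "\<And>n. emeasure rnd (B n) \<le> ennreal (1 / real (Suc n))" by simp_all
    have "(\<Inter>n. B n) \<in> null_sets rnd"
    proof (rule null_setsI)
      show m: "(\<Inter>n. B n) \<in> sets rnd" using B(1) by (intro sets.countable_INT) auto
      have le: "emeasure rnd (\<Inter>n. B n) \<le> ennreal (1 / real (Suc n))" for n
        using order_trans[OF emeasure_mono[OF INT_lower[of n UNIV B] B(1)] B(3)] by simp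
      have "(\<lambda>n. ennreal (1 / real (Suc n))) \<longlonglongrightarrow> ennreal 0"
        using LIMSEQ_inverse_real_of_nat by (intro tendsto_ennrealI) (simp add: inverse_eq_divide)
      then have "emeasure rnd (\<Inter>n. B n) \<le> ennreal 0"
        by (rule Lim_bounded2) (use le in auto)
      then show "emeasure rnd (\<Inter>n. B n) = 0" by simp
    qed
    then show ?thesis by (rule AE_I') (use B(2) in auto)
  qed
  have "AE \<omega> in rnd. \<forall>m0 i. \<not> (\<omega> \<in> good m0 \<and> R (slotx \<omega>) \<in> S i)"
    using null by (simp only: AE_all_countable simp_thms)
  with AE_good have "AE \<omega> in rnd. False"
  proof eventually_elim
    case (elim \<omega>)
    then obtain m0 where m0: "\<omega> \<in> good m0" by blast
    then have "slotx \<omega> \<in> XL" using good_slots(1)[of \<omega> m0] by simp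
    then obtain i where "R (slotx \<omega>) \<in> S i" using S(2) by blast
    then show ?case using elim(2) m0 by blast
  qed
  then show False by simp
qed

end

section \<open>The dichotomy\<close>

text \<open>Newton interpolation: the correction for a new node is a multiple of a polynomial
  vanishing at all earlier nodes.\<close>

lemma interpolation:
  fixes y z :: "nat \<Rightarrow> real"
  assumes "\<And>i j. i < n \<Longrightarrow> j < n \<Longrightarrow> i \<noteq> j \<Longrightarrow> y i \<noteq> y j"
  shows "\<exists>c. \<forall>j<n. (\<Sum>i<n. c i * y j ^ i) = z j"
proof -
  have "\<exists>f. (\<forall>i\<ge>n. coeff f i = 0) \<and> (\<forall>j<n. poly f (y j) = z j)"
    using assms
  proof (induction n)
    case 0
    show ?case by (intro exI[of _ 0]) simp
  next
    case (Suc n)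
    obtain f where f: "\<forall>i\<ge>n. coeff f i = 0" "\<forall>j<n. poly f (y j) = z j"
      using Suc.IH Suc.prems by fastforce
    define g where "g = (\<Prod>k<n. [:- y k, 1:])"
    have g: "poly g x = (\<Prod>k<n. x - y k)" for x by (simp add: g_def poly_prod)
    have deg: "degree g \<le> n"
      using degree_prod_sum_le[of "{..<n}" "\<lambda>k. [:- y k, 1:]"] by (simp add: g_def)
    have gn: "poly g (y n) \<noteq> 0" unfolding g using Suc.prems by (auto simp: prod_zero_iff)
    have g0: "poly g (y j) = 0" if "j < n" for j unfolding g using that by (auto simp: prod_zero_iff)
    define a where "a = (z n - poly f (y n)) / poly g (y n)"
    show ?case
    proof (intro exI[of _ "f + smult a g"] conjI allI impI)
      show "coeff (f + smult a g) i = 0" if "Suc n \<le> i" for i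
        using f(1) deg that by (simp add: coeff_eq_0)
      show "poly (f + smult a g) (y j) = z j" if "j < Suc n" for j
        using f(2) g0 gn that by (cases "j = n") (auto simp: a_def)
    qed
  qed
  then obtain f where f: "\<forall>i\<ge>n. coeff f i = 0" "\<forall>j<n. poly f (y j) = z j" by blast
  have "(\<Sum>i<n. coeff f i * y j ^ i) = z j" if "j < n" for j
  proof -
    have "poly f (y j) = (\<Sum>i\<le>degree f. coeff f i * y j ^ i)" by (rule poly_altdef)
    also have "\<dots> = (\<Sum>i<n. coeff f i * y j ^ i)"
      using f(1) by (intro sum.mono_neutral_cong) (auto simp: coeff_eq_0 not_less not_le)
    finally show ?thesis using f(2) that by simp
  qed
  then show ?thesis by blast
qed

context coding_geom
begin

text \<open>Passing from one level to the next, an approximate cube of scale \<open>T\<close> gains about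
  \<open>(lam j powr a - lam (j - 1) powr a) * T powr a\<close> slots; hence these weights. The \<open>s\<close> exponents chosen below make them
  a basis, because \<open>lam j powr al i\<close> is a Vandermonde matrix up to scaling.\<close>

definition wa :: "real \<Rightarrow> nat \<Rightarrow> real" where
  "wa a j = (if j < s then lam j powr a - (if j = 0 then 0 else lam (j - 1) powr a) else 0)"

lemma wa_1: "wa 1 = ww"
proof
  show "wa 1 j = ww j" for j
    using lam_pos[of j] lam_pos[of "j - 1"] less_imp_diff_less[of j s 1] by (auto simp: wa_def ww_def)
qed

lemma wa_pos:
  assumes "0 < a" "j < s"
  shows "0 < wa a j"
proof (cases "j = 0")
  case False
  have "lam (j - 1) powr a < lam j powr a"
    using assms lam_mono[of "j - 1" j] lam_pos[of "j - 1"] False less_imp_diff_less[of j s 1] by (intro powr_less_mono2) auto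
  then show ?thesis using assms False by (simp add: wa_def)
qed (use assms lam_0 in \<open>simp add: wa_def\<close>)

lemma wa_nonneg: "0 < a \<Longrightarrow> 0 \<le> wa a j"
  using wa_pos[of a j] by (cases "j < s") (auto simp: wa_def)

lemma sum_wa_upto: "n < s \<Longrightarrow> (\<Sum>j\<le>n. wa a j) = lam n powr a"
  by (induction n) (auto simp: wa_def)

lemma sum_wa: "(\<Sum>j<s. wa a j) = 1"
proof -
  have "{..<s} = {..s - 1}" using s_pos by auto
  then show ?thesis using sum_wa_upto[of "s - 1" a] s_pos lam_top by simp
qed

text \<open>Turns a strict gain of pressure into the data of \<open>random_slots\<close>. The amount
  demanded from \<open>gain\<close> pays for smoothing (\<open>lnA\<close>), for the
  \<open>p\<close> letters by which a word is shorter than its slot (\<open>real p * H\<close>), and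
  for \<open>drift\<close>.\<close>

lemma no_finite_cover:
  assumes \<alpha>: "2 / 3 < \<alpha>" "\<alpha> < 1" and h: "base h" "(\<Sum>j<s. ww j * h j) = Pr ww"
    and lt: "(\<Sum>j<s. wa \<alpha> j * h j) < Pr (wa \<alpha>)"
    and S: "\<And>i::nat. hausdorff_measure (Pr ww / ln N) (S i) < \<infinity>" "R ` XL \<subseteq> (\<Union>i. S i)"
  shows False
proof -
  define H where "H = (\<Sum>j<s. \<bar>h j\<bar>)"
  have w: "0 \<le> wa \<alpha> j" for j using \<alpha> by (intro wa_nonneg) simp
  obtain e B where e: "lnA + real p * H + (4 * real s + 2 * ln (real p + 1) + 2) \<le> (\<Sum>j<s. wa \<alpha> j * e j)"
    "\<And>b. B \<le> b \<Longrightarrow> \<exists>q\<in>dists b. \<forall>j<s. real b * h j + e j \<le> Hl j q"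
    using gain[OF h(1) w lt] by blast
  interpret gs: growing_slots \<alpha> "B + p + 1" by unfold_locales (use \<alpha> in auto)
  define b where "b k = gs.t (Suc k) - gs.t k - p" for k
  have b: "B \<le> b k" "0 < b k" "real (b k) = real (gs.t (Suc k)) - real (gs.t k) - real p" for k
    using gs.t_step[of k] by (auto simp: b_def of_nat_diff)
  define e' where "e' j = e j - lnA - real p * \<bar>h j\<bar>" for j
  have "\<exists>q'\<in>dists (b k). (\<forall>j<s. (real (gs.t (Suc k)) - real (gs.t k)) * h j + e' j \<le> Hl j q') \<and>
    (\<forall>j. \<forall>u\<in>words (b k). exp (- real (b k) * (lnA + 1)) \<le> pmf (map_pmf (prw j) q') (prw j u))" for k
  proof -
    obtain q where q: "q \<in> dists (b k)" "\<And>j. j < s \<Longrightarrow> real (b k) * h j + e j \<le> Hl j q" using e(2)[OF b(1)] by blast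
    obtain q' where q': "q' \<in> dists (b k)" "\<And>j. Hl j q - lnA \<le> Hl j q'"
      "\<And>j u. u \<in> words (b k) \<Longrightarrow> exp (- real (b k) * (lnA + 1)) \<le> pmf (map_pmf (prw j) q') (prw j u)"
      using smooth[OF q(1) b(2)] by blast
    have "(real (gs.t (Suc k)) - real (gs.t k)) * h j + e' j \<le> Hl j q'" if j: "j < s" for j
    proof -
      have "real p * h j \<le> real p * \<bar>h j\<bar>" by (intro mult_left_mono) auto
      then have "(real (gs.t (Suc k)) - real (gs.t k)) * h j + e' j \<le> real (b k) * h j + e j - lnA"
        unfolding b(3) e'_def by (simp add: left_diff_distrib)
      then show ?thesis using q(2)[OF j] q'(2)[of j] by linarith
    qed
    then show ?thesis using q'(1,3) by blast
  qed
  then have "\<forall>k. \<exists>q'. q' \<in> dists (b k) \<and> (\<forall>j<s. (real (gs.t (Suc k)) - real (gs.t k)) * h j + e' j \<le> Hl j q') \<and>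
    (\<forall>j. \<forall>u\<in>words (b k). exp (- real (b k) * (lnA + 1)) \<le> pmf (map_pmf (prw j) q') (prw j u))" by blast
  from choice[OF this] obtain q where q: "\<forall>k. q k \<in> dists (b k) \<and>
    (\<forall>j<s. (real (gs.t (Suc k)) - real (gs.t k)) * h j + e' j \<le> Hl j (q k)) \<and>
    (\<forall>j. \<forall>u\<in>words (b k). exp (- real (b k) * (lnA + 1)) \<le> pmf (map_pmf (prw j) (q k)) (prw j u))"
    by (rule exE)
  interpret rs: random_slots A L p s pr lam R N CR K0 \<alpha> "B + p + 1" h e' q "lnA + 1"
  proof unfold_locales
    show "0 < lnA + 1" using lnA_nonneg by simp
    show "q k \<in> dists (gs.t (Suc k) - gs.t k - p)" for k using q by (simp add: b_def)
    show "(real (gs.t (Suc k)) - real (gs.t k)) * h j + e' j \<le> Hl j (q k)" if "j < s" for j k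
      using q that by blast
    show "exp (- real (gs.t (Suc k) - gs.t k - p) * (lnA + 1)) \<le> pmf (map_pmf (prw j) (q k)) (prw j u)"
      if "u \<in> words (gs.t (Suc k) - gs.t k - p)" for u k j
      using q that unfolding b_def by blast
    have "(\<Sum>j<s. wa \<alpha> j * e' j) = (\<Sum>j<s. wa \<alpha> j * e j) - (\<Sum>j<s. wa \<alpha> j) * lnA - real p * (\<Sum>j<s. wa \<alpha> j * \<bar>h j\<bar>)"
      by (simp add: e'_def right_diff_distrib sum_subtractf sum_distrib_right sum_distrib_left mult.left_commute)
    moreover have "(\<Sum>j<s. wa \<alpha> j * \<bar>h j\<bar>) \<le> H"
      unfolding H_def
    proof (rule sum_mono)
      fix j assume "j \<in> {..<s}"
      then have "wa \<alpha> j \<le> 1" using member_le_sum[of j "{..<s}" "wa \<alpha>"] w sum_wa[of \<alpha>] by simp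
      then show "wa \<alpha> j * \<bar>h j\<bar> \<le> \<bar>h j\<bar>" using w[of j] by (intro mult_left_le_one_le) auto
    qed
    then have "real p * (\<Sum>j<s. wa \<alpha> j * \<bar>h j\<bar>) \<le> real p * H" by (rule mult_left_mono) simp
    moreover have "(\<Sum>j<s. (lam j powr \<alpha> - (if j = 0 then 0 else lam (j - 1) powr \<alpha>)) * e' j) = (\<Sum>j<s. wa \<alpha> j * e' j)"
      by (intro sum.cong) (auto simp: wa_def)
    ultimately show "4 * real s + 2 * ln (real p + 1) + 1 < (\<Sum>j<s. (lam j powr \<alpha> - (if j = 0 then 0 else lam (j - 1) powr \<alpha>)) * e' j)"
      using e(1) by (simp add: sum_wa)
  qed simp
  have "0 \<le> Pr ww" using ww_nonneg by (rule Pr_nonneg)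
  then show False
    using N by (intro rs.not_countable_union_finite[OF _ _ S]) (simp_all add: h(2))
qed

text \<open>Equal spacing makes \<open>lam j powr al i\<close> a geometric progression in
  \<open>i\<close>, hence a power of one node per level. The last exponent is 1, whose weight is
  \<open>ww\<close> itself.\<close>

definition al :: "nat \<Rightarrow> real" where
  "al i = 2 / 3 + real i / (3 * real s)"

lemma al: "1 \<le> i \<Longrightarrow> i \<le> s \<Longrightarrow> 2 / 3 < al i \<and> al i \<le> 1" "i < s \<Longrightarrow> al i < 1" "al s = 1"
  using s_pos by (auto simp: al_def field_simps)

lemma wa_span:
  assumes u: "\<And>j. s \<le> j \<Longrightarrow> u j = 0"
  shows "\<exists>c. u = (\<lambda>j. \<Sum>i=1..s. c i * wa (al i) j)"
proof -
  define y where "y j = lam j powr (1 / (3 * real s))" for j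
  have s: "0 < 1 / (3 * real s)" using s_pos by simp
  have "y i < y j" if "i < j" "j < s" for i j
    unfolding y_def using s lam_mono[OF that] lam_pos[of i] that by (intro powr_less_mono2) auto
  then have inj: "y i \<noteq> y j" if "i < s" "j < s" "i \<noteq> j" for i j
    using that by (metis less_irrefl linorder_neqE_nat)
  \<comment> \<open>The partial sums of \<open>wa a\<close> over levels are
    \<open>lam j powr a\<close>, so it suffices to match the partial sums of \<open>u\<close>; after
    division by the common factor this is interpolation at the nodes \<open>y j\<close>.\<close>
  obtain c where c: "\<forall>j<s. (\<Sum>i<s. c i * y j ^ i) = (\<Sum>k\<le>j. u k) / (lam j powr (2 / 3) * y j)"
    using interpolation[of s y "\<lambda>j. (\<Sum>k\<le>j. u k) / (lam j powr (2 / 3) * y j)", OF inj] by blast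
  define d where "d i = c (i - 1)" for i
  have U: "(\<Sum>i=1..s. d i * lam j powr al i) = (\<Sum>k\<le>j. u k)" if j: "j < s" for j
  proof -
    have y: "0 < y j" using lam_pos[OF j] by (simp add: y_def)
    have pw: "lam j powr al (Suc i) = lam j powr (2 / 3) * y j * y j ^ i" for i
    proof -
      have "y j ^ Suc i = lam j powr (1 / (3 * real s) * real (Suc i))"
        using y unfolding y_def by (simp only: powr_powr[symmetric] powr_realpow)
      also have "1 / (3 * real s) * real (Suc i) = real (Suc i) / (3 * real s)" by simp
      finally show ?thesis by (simp only: al_def powr_add power_Suc mult.assoc)
    qed
    have "(\<Sum>i=1..s. d i * lam j powr al i) = (\<Sum>i<s. d (Suc i) * lam j powr al (Suc i))"
      by (rule sum.reindex_bij_witness[of _ Suc "\<lambda>i. i - 1"]) auto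
    also have "\<dots> = lam j powr (2 / 3) * y j * (\<Sum>i<s. c i * y j ^ i)"
      by (simp add: d_def pw sum_distrib_left mult_ac)
    also have "\<dots> = (\<Sum>k\<le>j. u k)" using c j y lam_pos[OF j] by simp
    finally show ?thesis .
  qed
  have "u j = (\<Sum>i=1..s. d i * wa (al i) j)" for j
  proof (cases "j < s")
    case True
    show ?thesis
    proof (cases j)
      case 0
      then show ?thesis using U[OF True] True by (simp add: wa_def)
    next
      case (Suc k)
      have "(\<Sum>i=1..s. d i * wa (al i) j) = (\<Sum>i=1..s. d i * lam j powr al i) - (\<Sum>i=1..s. d i * lam k powr al i)"
        using True Suc by (simp add: wa_def right_diff_distrib sum_subtractf)
      also have "\<dots> = u j" using U[of j] U[of k] True Suc by simp
      finally show ?thesis by simp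
    qed
  qed (simp add: u wa_def)
  then show ?thesis by blast
qed

text \<open>On positive combinations of the chosen weights, sublinearity bounds the pressure from
  above by the linear functional of \<open>h\<close>, and \<open>base_le_Pr\<close> bounds it from
  below. By \<open>wa_span\<close> these combinations form an open cone, so
  \<open>rigid_lang\<close> applies.\<close>

lemma rigid_case:
  assumes h: "base h" and eq: "\<And>i. 1 \<le> i \<Longrightarrow> i \<le> s \<Longrightarrow> Pr (wa (al i)) = (\<Sum>j<s. wa (al i) j * h j)"
  shows "Pr ww = bet" "hausdorff_measure (bet / ln N) (R ` XL) \<noteq> 0"
proof -
  define S where "S = {\<lambda>j. \<Sum>i=1..s. d i * wa (al i) j | d. \<forall>i\<in>{1..s}. 0 < d i}"
  have al0: "0 < al i" if "i \<in> {1..s}" for i using al(1)[of i] that by auto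
  interpret rl: rigid_lang A L p s pr S h
  proof unfold_locales
    show "base h" by (rule h)
    show "0 \<le> w i" if w: "w \<in> S" for w i
    proof -
      obtain d where d: "\<forall>i\<in>{1..s}. 0 < d i" "w = (\<lambda>j. \<Sum>i=1..s. d i * wa (al i) j)"
        using w unfolding S_def by blast
      show ?thesis unfolding d(2) using d(1) al0 wa_nonneg by (intro sum_nonneg mult_nonneg_nonneg) (auto intro: less_imp_le)
    qed
    show "0 < w i" if w: "w \<in> S" and i: "i < s" for w i
    proof -
      obtain d where d: "\<forall>i\<in>{1..s}. 0 < d i" "w = (\<lambda>j. \<Sum>i=1..s. d i * wa (al i) j)"
        using w unfolding S_def by blast
      show ?thesis unfolding d(2) using d(1) al0 wa_pos i by (intro sum_pos mult_pos_pos) auto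
    qed
    show "\<exists>e>0. (\<lambda>i. w i + e * u i) \<in> S \<and> (\<lambda>i. w i - e * u i) \<in> S" if w: "w \<in> S" and u: "\<And>i. s \<le> i \<Longrightarrow> u i = 0" for w u
    proof -
      obtain d where d: "\<forall>i\<in>{1..s}. 0 < d i" "w = (\<lambda>j. \<Sum>i=1..s. d i * wa (al i) j)"
        using w unfolding S_def by blast
      obtain c where c: "u = (\<lambda>j. \<Sum>i=1..s. c i * wa (al i) j)" using wa_span[of u] u by blast
      \<comment> \<open>Small enough to keep all coefficients positive when \<open>e * c i\<close>
        is added or subtracted.\<close>
      define e where "e = Min ((\<lambda>i. d i / (\<bar>c i\<bar> + 1)) ` {1..s})"
      have ne: "{1..s} \<noteq> {}" using s_pos by auto
      have e: "0 < e" unfolding e_def using d(1) ne by (subst Min_gr_iff) (auto intro: divide_pos_pos)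
      have le: "e * \<bar>c i\<bar> < d i" if i: "i \<in> {1..s}" for i
      proof -
        have "e \<le> d i / (\<bar>c i\<bar> + 1)" unfolding e_def using i by (intro Min_le) auto
        then have "e * (\<bar>c i\<bar> + 1) \<le> d i" by (simp add: pos_le_divide_eq)
        then show ?thesis using e by (simp add: distrib_left)
      qed
      have "(\<lambda>i. w i + r * u i) \<in> S" if r: "\<bar>r\<bar> = e" for r
      proof -
        have "\<forall>i\<in>{1..s}. 0 < d i + r * c i"
        proof
          fix i assume "i \<in> {1..s}"
          then have "\<bar>r * c i\<bar> < d i" using le[of i] r by (simp add: abs_mult)
          then show "0 < d i + r * c i" by linarith
        qed
        moreover have "(\<lambda>j. w j + r * u j) = (\<lambda>j. \<Sum>i=1..s. (d i + r * c i) * wa (al i) j)"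
          unfolding d(2) c by (simp add: sum_distrib_left sum.distrib distrib_right mult.assoc)
        ultimately show ?thesis unfolding S_def by (intro CollectI exI[of _ "\<lambda>i. d i + r * c i"] conjI)
      qed
      from this[of e] this[of "- e"] show ?thesis using e by (intro exI[of _ e]) simp
    qed
    show "Pr w = (\<Sum>i<s. w i * h i)" if w: "w \<in> S" for w
    proof -
      obtain d where d: "\<forall>i\<in>{1..s}. 0 < d i" "w = (\<lambda>j. \<Sum>i=1..s. d i * wa (al i) j)"
        using w unfolding S_def by blast
      have "Pr w \<le> (\<Sum>i=1..s. d i * Pr (wa (al i)))"
        unfolding d(2) using d(1) al0 wa_nonneg by (intro Pr_sum_le) (auto intro: less_imp_le)
      also have "\<dots> = (\<Sum>i=1..s. \<Sum>j<s. d i * wa (al i) j * h j)"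
        by (intro sum.cong) (simp_all add: eq sum_distrib_left mult.assoc)
      also have "\<dots> = (\<Sum>j<s. w j * h j)"
        unfolding d(2) by (subst sum.swap) (simp add: sum_distrib_right)
      finally have "Pr w \<le> (\<Sum>j<s. w j * h j)" .
      moreover have "(\<Sum>j<s. w j * h j) \<le> Pr w"
      proof (rule base_le_Pr[OF h])
        show "0 \<le> w j" for j unfolding d(2) using d(1) al0 wa_nonneg by (intro sum_nonneg mult_nonneg_nonneg) (auto intro: less_imp_le)
      qed
      ultimately show ?thesis by simp
    qed
    have "(\<lambda>j. \<Sum>i=1..s. 1 * wa (al i) j) \<in> S" unfolding S_def by (intro CollectI exI[of _ "\<lambda>_. 1"] conjI) auto
    then show "S \<noteq> {}" by blast
  qed
  have Pw: "Pr ww = (\<Sum>j<s. ww j * h j)" using eq[of s] s_pos by (simp add: al(3) wa_1)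
  \<comment> \<open>No level can grow faster than its rate in \<open>h\<close>, so the level-wise
    maxima in \<open>bet\<close> are attained together.\<close>
  have htop_le: "htop j \<le> h j" if j: "j < s" for j
  proof (rule field_le_epsilon)
    fix e :: real assume e: "0 < e"
    obtain C where C: "\<forall>n. ln (real (card (prw j ` words n))) \<le> real n * h j + C"
      using rl.card_prw_upper[OF j rl.lin_at_all[OF j]] by blast
    obtain n :: nat where n: "\<bar>C\<bar> / e < real n" using reals_Archimedean2 by blast
    have n0: "0 < real n" by (rule le_less_trans[OF _ n]) (use e in simp)
    have "real n * htop j \<le> ln (real (card (prw j ` words n)))" by (rule htop_bounds[OF j])
    also have "\<dots> \<le> real n * h j + C" using C by blast
    also have "\<dots> \<le> real n * (h j + e)" using n e by (simp add: divide_less_eq distrib_left)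
    finally show "htop j \<le> h j + e" using n0 by simp
  qed
  have "bet \<le> Pr ww" unfolding bet_def Pw using htop_le ww_nonneg by (intro sum_mono mult_left_mono) auto
  then show bet: "Pr ww = bet" using Pr_le_bet by simp
  have "prw 0 ` words n = words n" for n by (simp add: prw_0)
  then have "\<exists>C. \<forall>n. ln (real (card (words n))) \<le> real n * h 0 + C"
    using rl.card_prw_upper[OF s_pos rl.lin_at_all[OF s_pos]] by simp
  then have "hausdorff_measure ((\<Sum>j<s. ww j * h j) / ln N) (R ` XL) \<noteq> 0"
    using bet_nonneg bet Pw by (intro hausdorff_measure_pos rl.card_fib_upper h) auto
  then show "hausdorff_measure (bet / ln N) (R ` XL) \<noteq> 0" using bet Pw by simp
qed

theorem dichotomy:
  defines "K \<equiv> R ` XL" and "\<gamma> \<equiv> hausdorff_dim (R ` XL)"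
  shows "\<gamma> = box_dim K \<and> 0 < hausdorff_measure \<gamma> K \<and> hausdorff_measure \<gamma> K < \<infinity> \<or>
    \<gamma> < box_dim K \<and> hausdorff_measure \<gamma> K = \<infinity> \<and>
    \<not> (\<exists>S :: nat \<Rightarrow> 'm set. (\<forall>i. hausdorff_measure \<gamma> (S i) < \<infinity>) \<and> K \<subseteq> (\<Union>i. S i))"
proof -
  obtain h where h: "base h" "(\<Sum>j<s. ww j * h j) = Pr ww" by (rule base_exists[OF ww_nonneg])
  have lnN: "0 < ln N" using N by simp
  show ?thesis
  proof (cases "\<forall>i\<in>{1..s}. Pr (wa (al i)) = (\<Sum>j<s. wa (al i) j * h j)")
    case True
    then have r: "Pr ww = bet" "hausdorff_measure (bet / ln N) (R ` XL) \<noteq> 0"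
      using rigid_case[OF h(1)] by auto
    have "\<gamma> = bet / ln N"
      unfolding \<gamma>_def using bet_nonneg lnN hausdorff_measure_zero_above_dim r by (intro hausdorff_dim_eqI) auto
    then show ?thesis
      using r(2) hausdorff_measure_bet_finite by (simp add: K_def box_dim_eq zero_less_iff_neq_zero)
  next
    case False
    then obtain i where i: "i \<in> {1..s}" "Pr (wa (al i)) \<noteq> (\<Sum>j<s. wa (al i) j * h j)" by blast
    \<comment> \<open>The rates attain the pressure at \<open>ww\<close>, the weight with exponent
      1, so the gain occurs at an exponent below 1.\<close>
    have "i \<noteq> s" using i(2) h(2) by (auto simp: al(3) wa_1)
    then have a: "2 / 3 < al i" "al i < 1" using i(1) al(1)[of i] al(2)[of i] by auto
    have "0 \<le> wa (al i) j" for j using a by (intro wa_nonneg) simp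
    then have "(\<Sum>j<s. wa (al i) j * h j) \<le> Pr (wa (al i))" by (rule base_le_Pr[OF h(1)])
    then have "(\<Sum>j<s. wa (al i) j * h j) < Pr (wa (al i))" using i(2) by simp
    note nc = no_finite_cover[OF a h this]
    define \<kappa> where "\<kappa> = Pr ww / ln N"
    \<comment> \<open>If the measure were finite, the constant sequence \<open>K\<close> would be a
      cover excluded by \<open>nc\<close>.\<close>
    have inf: "hausdorff_measure \<kappa> K = \<infinity>"
      using nc[of "\<lambda>_. K"] unfolding \<kappa>_def K_def by (auto simp: less_top[symmetric])
    have g: "\<gamma> = \<kappa>"
      unfolding \<gamma>_def
    proof (rule hausdorff_dim_eqI)
      show "0 \<le> \<kappa>" using Pr_nonneg[OF ww_nonneg] lnN by (simp add: \<kappa>_def)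
      show "hausdorff_measure t (R ` XL) = 0" if "\<kappa> < t" for t
        using hausdorff_measure_zero_above_dim that unfolding \<kappa>_def .
      show "hausdorff_measure \<kappa> (R ` XL) \<noteq> 0" using inf by (simp add: K_def)
    qed
    have "\<kappa> \<le> bet / ln N" unfolding \<kappa>_def using Pr_le_bet lnN by (intro divide_right_mono) auto
    \<comment> \<open>At the box dimension the measure is always finite; this makes the inequality
      between the dimensions strict.\<close>
    moreover have "\<kappa> \<noteq> bet / ln N" using inf hausdorff_measure_bet_finite by (auto simp: K_def)
    ultimately have "\<gamma> < box_dim K" unfolding g K_def box_dim_eq by simp
    moreover have "\<not> (\<exists>S :: nat \<Rightarrow> 'm set. (\<forall>i. hausdorff_measure \<gamma> (S i) < \<infinity>) \<and> K \<subseteq> (\<Union>i. S i))"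
    proof
      assume "\<exists>S :: nat \<Rightarrow> 'm set. (\<forall>i. hausdorff_measure \<gamma> (S i) < \<infinity>) \<and> K \<subseteq> (\<Union>i. S i)"
      then obtain S :: "nat \<Rightarrow> 'm set" where S: "\<forall>i. hausdorff_measure \<gamma> (S i) < \<infinity>" "K \<subseteq> (\<Union>i. S i)" by (elim exE conjE)
      show False by (rule nc[of S]) (use S in \<open>simp_all add: g \<kappa>_def K_def\<close>)
    qed
    ultimately show ?thesis using inf g by simp
  qed
qed

end

section \<open>Base expansions and the coding map\<close>

definition expansion :: "int \<Rightarrow> (nat \<Rightarrow> int) \<Rightarrow> real" where
  "expansion b d = (\<Sum>k. of_int (d k) / of_int b ^ Suc k)"

text \<open>The integer part of \<open>b ^ n\<close> times the expansion, but one less if all later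
  digits are \<open>b - 1\<close>. Hence the closed intervals in
  \<open>prefix_code_bounds\<close>.\<close>

primrec prefix_code :: "int \<Rightarrow> (nat \<Rightarrow> int) \<Rightarrow> nat \<Rightarrow> int" where
  "prefix_code b d 0 = 0"
| "prefix_code b d (Suc n) = prefix_code b d n * b + d n"

locale base_digits =
  fixes b :: int and d :: "nat \<Rightarrow> int"
  assumes b: "2 \<le> b" and d: "d k \<in> {0..b - 1}"
begin

lemma shifted: "base_digits b (\<lambda>k. d (k + n))"
  by unfold_locales (rule b, rule d)

lemma top_sums: "(\<lambda>k. of_int (b - 1) / of_int b ^ Suc k :: real) sums 1"
proof -
  have "(\<lambda>k. (1 / of_int b :: real) ^ k) sums (1 / (1 - 1 / of_int b))"
    using b by (intro geometric_sums) (simp add: abs_if)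
  from sums_mult[OF this, of "of_int (b - 1) / of_int b"] show ?thesis
    using b by (simp add: power_divide field_simps)
qed

lemma term_le: "(of_int (d k) :: real) / of_int b ^ Suc k \<le> of_int (b - 1) / of_int b ^ Suc k"
  using d[of k] b by (intro divide_right_mono) (auto simp del: of_int_diff)

lemma summable_expansion: "summable (\<lambda>k. of_int (d k) / of_int b ^ Suc k :: real)"
  by (rule summable_comparison_test'[OF sums_summable[OF top_sums], of 0])
     (use d b term_le in \<open>auto simp: abs_of_nonneg\<close>)

lemma expansion_bounds: "0 \<le> expansion b d" "expansion b d \<le> 1"
proof -
  show "0 \<le> expansion b d"
    unfolding expansion_def using d b by (intro suminf_nonneg summable_expansion) (auto intro!: divide_nonneg_nonneg)
  have "expansion b d \<le> (\<Sum>k. of_int (b - 1) / of_int b ^ Suc k)"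
    unfolding expansion_def by (intro suminf_le term_le summable_expansion sums_summable[OF top_sums])
  then show "expansion b d \<le> 1" using sums_unique[OF top_sums] by simp
qed

lemma expansion_Suc: "of_int b * expansion b d = of_int (d 0) + expansion b (\<lambda>k. d (Suc k))"
proof -
  interpret s: base_digits b "\<lambda>k. d (k + 1)" by (rule shifted)
  have "expansion b d = of_int (d 0) / of_int b + (\<Sum>k. of_int (d (Suc k)) / of_int b ^ Suc (Suc k))"
    unfolding expansion_def using suminf_split_head[OF summable_expansion] by simp
  also have "(\<Sum>k. of_int (d (Suc k)) / of_int b ^ Suc (Suc k) :: real) = (\<Sum>k. of_int (d (Suc k)) / of_int b ^ Suc k / of_int b)"
    by (simp add: mult.commute)
  also have "\<dots> = expansion b (\<lambda>k. d (Suc k)) / of_int b"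
    unfolding expansion_def using s.summable_expansion by (subst suminf_divide) simp_all
  finally show ?thesis using b by (simp add: distrib_left)
qed

lemma expansion_split: "of_int b ^ n * expansion b d = of_int (prefix_code b d n) + expansion b (\<lambda>k. d (k + n))"
proof (induction n)
  case (Suc n)
  interpret s: base_digits b "\<lambda>k. d (k + n)" by (rule shifted)
  have "of_int b ^ Suc n * expansion b d = of_int b * (of_int b ^ n * expansion b d)" by simp
  also have "\<dots> = of_int b * of_int (prefix_code b d n) + of_int b * expansion b (\<lambda>k. d (k + n))"
    by (simp only: Suc distrib_left)
  also have "\<dots> = of_int (prefix_code b d (Suc n)) + expansion b (\<lambda>k. d (k + Suc n))"
    unfolding s.expansion_Suc by simp
  finally show ?case .
qed simp

lemma prefix_code_bounds:
  "of_int (prefix_code b d n) \<le> of_int b ^ n * expansion b d" "of_int b ^ n * expansion b d \<le> of_int (prefix_code b d n) + 1"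
proof -
  interpret s: base_digits b "\<lambda>k. d (k + n)" by (rule shifted)
  show "of_int (prefix_code b d n) \<le> of_int b ^ n * expansion b d" "of_int b ^ n * expansion b d \<le> of_int (prefix_code b d n) + 1"
    unfolding expansion_split using s.expansion_bounds by auto
qed

end

lemma prefix_code_cong: "(\<And>k. k < n \<Longrightarrow> d k = d' k) \<Longrightarrow> prefix_code b d n = prefix_code b d' n"
  by (induction n) auto

lemma prefix_code_inj:
  assumes "base_digits b d" "base_digits b d'"
  shows "prefix_code b d n = prefix_code b d' n \<Longrightarrow> k < n \<Longrightarrow> d k = d' k"
proof (induction n)
  case (Suc n)
  interpret d: base_digits b d by fact
  interpret d': base_digits b d' by fact
  have div: "(c * b + e) div b = c" "(c * b + e) mod b = e" if "e \<in> {0..b - 1}" for c e :: int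
    using that d.b by auto
  have "prefix_code b d n * b + d n = prefix_code b d' n * b + d' n" using Suc.prems(1) by simp
  then have "prefix_code b d n = prefix_code b d' n" "d n = d' n"
    using div[OF d.d[of n], of "prefix_code b d n"] div[OF d'.d[of n], of "prefix_code b d' n"] by simp_all
  then show ?case using Suc.IH Suc.prems(2) by (auto simp: less_Suc_eq)
qed simp

lemma expansion_diff_le:
  assumes "base_digits b d" "base_digits b d'" and eq: "\<And>k. k < n \<Longrightarrow> d k = d' k"
  shows "\<bar>expansion b d - expansion b d'\<bar> \<le> 1 / of_int b ^ n"
proof -
  interpret d: base_digits b d by fact
  interpret d': base_digits b d' by fact
  have bn: "0 < (of_int b :: real) ^ n" using d.b by simp
  have "prefix_code b d n = prefix_code b d' n" by (rule prefix_code_cong[OF eq])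
  then have "\<bar>of_int b ^ n * expansion b d - of_int b ^ n * expansion b d'\<bar> \<le> 1"
    using d.prefix_code_bounds[of n] d'.prefix_code_bounds[of n] by linarith
  then have "of_int b ^ n * \<bar>expansion b d - expansion b d'\<bar> \<le> 1"
    using bn by (simp add: right_diff_distrib[symmetric] abs_mult)
  then show ?thesis using bn by (simp add: le_divide_eq mult.commute)
qed

text \<open>Two numbers at distance at most 1, each within 1 above its integer code. The resulting
  five possible codes per coordinate are the origin of the constant
  \<open>5 ^ CARD('n)\<close>.\<close>

lemma prefix_code_diff_le:
  assumes "base_digits b d" "base_digits b d'" and le: "of_int b ^ n * \<bar>expansion b d - expansion b d'\<bar> \<le> 1"
  shows "\<bar>prefix_code b d n - prefix_code b d' n\<bar> \<le> 2"
proof -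
  interpret d: base_digits b d by fact
  interpret d': base_digits b d' by fact
  have "\<bar>of_int b ^ n * expansion b d - of_int b ^ n * expansion b d'\<bar> \<le> 1"
    using le d.b by (simp add: right_diff_distrib[symmetric] abs_mult)
  then have "real_of_int (prefix_code b d n) \<le> real_of_int (prefix_code b d' n) + 2"
    "real_of_int (prefix_code b d' n) \<le> real_of_int (prefix_code b d n) + 2"
    using d.prefix_code_bounds[of n] d'.prefix_code_bounds[of n] by linarith+
  then show ?thesis by linarith
qed

lemma Lambda_inverse_nth:
  assumes "\<And>r. m r \<noteq> 0"
  shows "(((\<lambda>v. matrix_inv (Lambda m) *v v) ^^ n) v) $ r = v $ r / of_int (m r) ^ n"
proof (induction n)
  case (Suc n)
  let ?D = "\<chi> i j. if i = j then 1 / of_int (m i) else (0::real)"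
  have LD: "Lambda m ** ?D = mat 1" "?D ** Lambda m = mat 1"
    using assms by (auto simp: vec_eq_iff Lambda_def matrix_matrix_mult_def mat_def if_distrib[of "\<lambda>x. x * _"] cong: if_cong)
  then have "Lambda m ** matrix_inv (Lambda m) = mat 1"
    unfolding matrix_inv_def by (rule someI2[where a="?D", OF conjI]) simp
  then have L: "Lambda m *v (matrix_inv (Lambda m) *v u) = u" for u
    by (simp add: matrix_vector_mul_assoc)
  have "(Lambda m *v u) $ r = of_int (m r) * u $ r" for u
    by (simp add: Lambda_def matrix_vector_mult_def if_distrib[of "\<lambda>x. x * _"] cong: if_cong)
  from this[of "matrix_inv (Lambda m) *v ((\<lambda>v. matrix_inv (Lambda m) *v v) ^^ n) v"]
  show ?case using assms[of r] Suc unfolding L by (simp add: field_simps)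
qed simp

lemma coding_map_nth:
  assumes dig: "\<And>r. base_digits (m r) (\<lambda>k. x k $ r)"
  shows "coding_map m x $ r = expansion (m r) (\<lambda>k. x k $ r)"
proof -
  have m: "m r \<noteq> 0" for r using base_digits.b[OF dig, of r] by simp
  define f :: "nat \<Rightarrow> real ^ 'a" where
    "f k = ((\<lambda>v. matrix_inv (Lambda m) *v v) ^^ Suc k) (\<chi> r. of_int (x k $ r))" for k
  have f: "f k $ r = of_int (x k $ r) / of_int (m r) ^ Suc k" for k r
    unfolding f_def Lambda_inverse_nth[OF m] by simp
  have "f sums (\<chi> r. expansion (m r) (\<lambda>k. x k $ r))"
    unfolding sums_def
  proof (rule vec_tendstoI)
    fix r
    have "(\<lambda>k. f k $ r) sums expansion (m r) (\<lambda>k. x k $ r)"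
      unfolding f expansion_def by (rule summable_sums[OF base_digits.summable_expansion[OF dig]])
    then show "(\<lambda>n. (\<Sum>k<n. f k) $ r) \<longlonglongrightarrow> (\<chi> r. expansion (m r) (\<lambda>k. x k $ r)) $ r"
      by (simp add: sums_def)
  qed
  then have "coding_map m x = (\<chi> r. expansion (m r) (\<lambda>k. x k $ r))"
    unfolding coding_map_def f_def[symmetric] by (rule sums_unique[symmetric])
  then show ?thesis by simp
qed

section \<open>Languages of subshifts\<close>

lemma subshift_mem: "subshift A X \<Longrightarrow> x \<in> X \<Longrightarrow> x k \<in> A"
  unfolding subshift_def using closedin_subset by (fastforce simp: PiE_iff)

lemma subshift_shift: "subshift A X \<Longrightarrow> x \<in> X \<Longrightarrow> (\<lambda>k. x (k + n)) \<in> X"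
proof (induction n)
  case (Suc n)
  then have "Defs.shift (\<lambda>k. x (k + n)) \<in> X" unfolding subshift_def by blast
  then show ?case by (simp add: Defs.shift_def)
qed simp

lemma languageI: "x \<in> X \<Longrightarrow> map x [i..<j] \<in> language X"
  unfolding language_def by blast

lemma languageE:
  assumes "subshift A X" "u \<in> language X"
  obtains x where "x \<in> X" "u = map x [0..<length u]"
proof (cases "u = []")
  case True
  obtain x where "x \<in> X" using assms(1) unfolding subshift_def by blast
  then show ?thesis using True that by simp
next
  case False
  then obtain x i j where x: "x \<in> X" "u = map x [i..<j]" using assms(2) unfolding language_def by blast
  have "u = map (\<lambda>k. x (k + i)) [0..<length u]"
    unfolding x(2) by (intro nth_equalityI) (auto simp: add.commute)
  then show ?thesis using that subshift_shift[OF assms(1) x(1)] by blast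
qed

lemma spec_lang_language:
  assumes X: "subshift A X" and A: "finite A" and W: "weak_specification X"
    and s: "0 < s" and pr: "\<And>a. pr 0 a = a" "\<And>i j a. i \<le> j \<Longrightarrow> pr j (pr i a) = pr j a"
  obtains p where "spec_lang A (language X) p s pr"
proof -
  obtain p where p: "\<forall>I\<in>language X. \<forall>J\<in>language X. \<exists>W\<in>language X. length W \<le> p \<and> I @ W @ J \<in> language X"
    using W unfolding weak_specification_def by blast
  \<comment> \<open>\<open>Suc p\<close>, because specification may hold with gap 0 while the locale
    wants a positive bound.\<close>
  have "spec_lang A (language X) (Suc p) s pr"
  proof
    show "language X \<subseteq> lists A"
    proof
      fix u assume "u \<in> language X"
      then obtain x where "x \<in> X" "u = map x [0..<length u]" by (rule languageE[OF X])
      then have "set u \<subseteq> A" using subshift_mem[OF X] by (metis (no_types, lifting) image_subsetI list.set_map)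
      then show "u \<in> lists A" by (simp add: lists_eq_set)
    qed
    show "u \<in> language X \<and> v \<in> language X" if uv: "u @ v \<in> language X" for u v
    proof -
      obtain x where x: "x \<in> X" "u @ v = map x [0..<length (u @ v)]" by (rule languageE[OF X uv])
      have "u @ v = map x [0..<length u] @ map x [length u..<length u + length v]"
        using x(2) upt_add_eq_append[of 0 "length u" "length v"] by simp
      then have "u = map x [0..<length u]" "v = map x [length u..<length u + length v]"
        by (simp_all add: append_eq_append_conv)
      then show ?thesis using languageI[OF x(1)] by metis
    qed
    show "\<exists>a. u @ [a] \<in> language X" if u: "u \<in> language X" for u
    proof -
      obtain x where x: "x \<in> X" "u = map x [0..<length u]" by (rule languageE[OF X u])
      have "u @ [x (length u)] = map x [0..<Suc (length u)]" using x(2) by simp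
      then show ?thesis using languageI[OF x(1)] by metis
    qed
    show "\<exists>z. length z \<le> Suc p \<and> u @ z @ v \<in> language X" if "u \<in> language X" "v \<in> language X" for u v
      using p that le_SucI by blast
  qed (use A s pr in \<open>auto simp: language_def\<close>)
  then show ?thesis using that by blast
qed

lemma openin_cylinder:
  assumes "x \<in> PiE UNIV (\<lambda>_. A)"
  shows "openin (product_topology (\<lambda>_. discrete_topology A) (UNIV :: nat set)) {y \<in> PiE UNIV (\<lambda>_. A). \<forall>k<n. y k = x k}"
proof -
  have "openin (product_topology (\<lambda>_. discrete_topology A) (UNIV :: nat set)) (PiE UNIV (\<lambda>k. if k < n then {x k} else A))"
  proof (rule product_topology_basis)
    show "openin (discrete_topology A) (if k < n then {x k} else A)" for k using assms by (auto simp: PiE_iff)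
    show "finite {k. (if k < n then {x k} else A) \<noteq> topspace (discrete_topology A)}"
      by (rule finite_subset[of _ "{..<n}"]) auto
  qed
  moreover have "PiE UNIV (\<lambda>k. if k < n then {x k} else A) = {y \<in> PiE UNIV (\<lambda>_. A). \<forall>k<n. y k = x k}"
    using assms by (auto simp: PiE_iff split: if_splits)
  ultimately show ?thesis by simp
qed

text \<open>A basic open set of the product topology restricts finitely many coordinates, so a point
  outside \<open>X\<close> is separated from \<open>X\<close> by one of its prefixes.\<close>

lemma subshift_closed:
  assumes X: "subshift A X" and x: "\<And>n. \<exists>y\<in>X. \<forall>k<n. y k = x k"
  shows "x \<in> X"
proof (rule ccontr)
  let ?T = "product_topology (\<lambda>_. discrete_topology A) (UNIV :: nat set)"
  assume n: "x \<notin> X"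
  have "x k \<in> A" for k using x[of "Suc k"] subshift_mem[OF X] by (metis lessI)
  then have "x \<in> topspace ?T - X" using n by (simp add: PiE_iff)
  moreover have "openin ?T (topspace ?T - X)" using X unfolding subshift_def by blast
  ultimately obtain U where U: "finite {i \<in> UNIV. U i \<noteq> topspace (discrete_topology A)}" "\<forall>i\<in>UNIV. openin (discrete_topology A) (U i)"
      "x \<in> PiE UNIV U" "PiE UNIV U \<subseteq> topspace ?T - X"
    unfolding openin_product_topology_alt by blast
  obtain n where n: "{i. U i \<noteq> A} \<subseteq> {..<n}" using U(1) finite_nat_iff_bounded by auto
  obtain y where y: "y \<in> X" "\<forall>k<n. y k = x k" using x by blast
  have "y k \<in> U k" for k
  proof (cases "k < n")
    case True
    then show ?thesis using U(3) y(2) by (auto simp: PiE_iff)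
  next
    case False
    then have "U k = A" using n by auto
    then show ?thesis using subshift_mem[OF X y(1)] by simp
  qed
  then have "y \<in> PiE UNIV U" by (simp add: PiE_iff)
  then show False using U(4) y(1) by blast
qed

lemma (in spec_lang) XL_language:
  assumes X: "subshift A X" and L: "L = language X"
  shows "XL = X"
proof
  show "X \<subseteq> XL"
  proof
    fix x assume "x \<in> X"
    then have "map x [0..<n] \<in> L" for n unfolding L by (rule languageI)
    then show "x \<in> XL" by (simp add: XL_def)
  qed
  show "XL \<subseteq> X"
  proof
    fix x assume x: "x \<in> XL"
    show "x \<in> X"
    proof (rule subshift_closed[OF X])
      fix n
      have "map x [0..<n] \<in> L" using x by (simp add: XL_def)
      then have "map x [0..<n] \<in> language X" by (simp add: L)
      then obtain y where y: "y \<in> X" "map x [0..<n] = map y [0..<length (map x [0..<n])]" by (rule languageE[OF X])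
      then show "\<exists>y\<in>X. \<forall>k<n. y k = x k" by (intro bexI[of _ y]) auto
    qed
  qed
qed

lemma compact_image_subshift:
  fixes f :: "(nat \<Rightarrow> 'a) \<Rightarrow> 'b::metric_space"
  assumes X: "subshift A X" and A: "finite A"
    and f: "\<And>x e. x \<in> PiE UNIV (\<lambda>_. A) \<Longrightarrow> 0 < e \<Longrightarrow> \<exists>n. \<forall>y\<in>PiE UNIV (\<lambda>_. A). (\<forall>k<n. y k = x k) \<longrightarrow> dist (f y) (f x) < e"
  shows "compact (f ` X)"
proof -
  let ?T = "product_topology (\<lambda>_. discrete_topology A) (UNIV :: nat set)"
  have "compact_space ?T" using A by (simp add: compact_space_product_topology compact_space_discrete_topology)
  then have "compactin ?T X" using X unfolding subshift_def by (intro closedin_compact_space) auto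
  moreover have "continuous_map ?T euclidean f"
    unfolding continuous_map_eq_topcontinuous_at topcontinuous_at_def
  proof (intro ballI conjI allI impI)
    fix x V assume x: "x \<in> topspace ?T" and V: "openin euclidean V \<and> f x \<in> V"
    obtain e where e: "0 < e" "ball (f x) e \<subseteq> V" by (rule openE[of V "f x"]) (use V in auto)
    have x': "x \<in> PiE UNIV (\<lambda>_. A)" using x by simp
    obtain n where n: "\<forall>y\<in>PiE UNIV (\<lambda>_. A). (\<forall>k<n. y k = x k) \<longrightarrow> dist (f y) (f x) < e" using f[OF x' e(1)] by (rule exE)
    show "\<exists>U. openin ?T U \<and> x \<in> U \<and> (\<forall>y\<in>U. f y \<in> V)"
    proof (intro exI[of _ "{y \<in> PiE UNIV (\<lambda>_. A). \<forall>k<n. y k = x k}"] conjI ballI)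
      show "f y \<in> V" if "y \<in> {y \<in> PiE UNIV (\<lambda>_. A). \<forall>k<n. y k = x k}" for y
      proof -
        have "dist (f y) (f x) < e" using n that by blast
        then show ?thesis using e(2) by (auto simp: dist_commute)
      qed
      show "openin ?T {y \<in> PiE UNIV (\<lambda>_. A). \<forall>k<n. y k = x k}" by (rule openin_cylinder[OF x'])
      show "x \<in> {y \<in> PiE UNIV (\<lambda>_. A). \<forall>k<n. y k = x k}" using x' by simp
    qed
  qed auto
  ultimately have "compactin euclidean (f ` X)" by (rule image_compactin)
  then show ?thesis by simp
qed

section \<open>Diagonal expansions\<close>

locale diagonal =
  fixes m :: "'n::finite \<Rightarrow> int"
  assumes m: "2 \<le> m r"
begin

text \<open>The distinct values of \<open>m\<close> are listed in decreasing order, and level \<open>j\<close> keeps the coordinates whose value is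
  at most the one at position \<open>j\<close>.\<close>

definition vals :: "int list" where
  "vals = rev (sorted_list_of_set (range m))"

abbreviation "s \<equiv> length vals"

definition lam :: "nat \<Rightarrow> real" where
  "lam j = ln (of_int (vals ! (s - 1))) / ln (of_int (vals ! j))"

definition lev :: "'n \<Rightarrow> nat" where
  "lev r = (SOME j. j < s \<and> vals ! j = m r)"

definition proj :: "nat \<Rightarrow> int ^ 'n \<Rightarrow> int ^ 'n" where
  "proj j a = (\<chi> r. if lev r < j then 0 else a $ r)"

lemma set_vals: "set vals = range m"
  by (simp add: vals_def)

lemma vals_less: "i < j \<Longrightarrow> j < s \<Longrightarrow> vals ! j < vals ! i"
proof -
  have "sorted_wrt (>) vals" unfolding vals_def by (simp add: sorted_wrt_rev)
  then show "i < j \<Longrightarrow> j < s \<Longrightarrow> vals ! j < vals ! i" by (simp add: sorted_wrt_iff_nth_less)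
qed

lemma vals_ge: "j < s \<Longrightarrow> 2 \<le> vals ! j"
  using m set_vals nth_mem by (metis imageE)

lemma s_pos: "0 < s"
  using set_vals by (cases vals) auto

lemma lev: "lev r < s" "vals ! lev r = m r"
proof -
  have "\<exists>j. j < s \<and> vals ! j = m r" using set_vals in_set_conv_nth[of "m r" vals] by auto
  then have "lev r < s \<and> vals ! lev r = m r" unfolding lev_def by (rule someI_ex)
  then show "lev r < s" "vals ! lev r = m r" by auto
qed

lemma ln_vals_pos: "j < s \<Longrightarrow> 0 < ln (real_of_int (vals ! j))"
  using vals_ge[of j] by simp

lemma proj_0: "proj 0 a = a"
  by (simp add: proj_def vec_eq_iff)

lemma proj_proj: "i \<le> j \<Longrightarrow> proj j (proj i a) = proj j a"
  by (simp add: proj_def vec_eq_iff)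

lemma lam_less: "i < j \<Longrightarrow> j < s \<Longrightarrow> lam i < lam j"
  unfolding lam_def using ln_vals_pos[of j] ln_vals_pos[of "s - 1"] vals_less[of i j] vals_ge[of j]
  by (intro divide_strict_left_mono) auto

text \<open>By the choice of \<open>lam\<close>, \<open>lam (lev r) * T\<close> digits in base
  \<open>m r\<close> resolve exactly the length \<open>N ^ (- T)\<close>, so rounding down costs at
  most one digit. This makes all sides of an approximate cube comparable.\<close>

lemma power_bounds:
  assumes n: "n = nat \<lfloor>lam (lev r) * real T\<rfloor>"
  shows "of_int (m r) ^ n \<le> real_of_int (vals ! (s - 1)) ^ T" "real_of_int (vals ! (s - 1)) ^ T \<le> of_int (m r) * of_int (m r) ^ n"
proof -
  let ?N = "real_of_int (vals ! (s - 1))" and ?b = "real_of_int (m r)"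
  have N: "0 < ln ?N" "0 < ?N" using ln_vals_pos[of "s - 1"] vals_ge[of "s - 1"] s_pos by auto
  have b: "0 < ln ?b" "0 < ?b" using m[of r] by auto
  have "0 \<le> lam (lev r) * real T" using N b by (simp add: lam_def lev)
  then have n: "real n \<le> lam (lev r) * real T" "lam (lev r) * real T \<le> real n + 1" unfolding n by linarith+
  have l: "lam (lev r) * real T * ln ?b = real T * ln ?N" using b by (simp add: lam_def lev)
  have e: "?b ^ k = exp (real k * ln ?b)" "?N ^ k = exp (real k * ln ?N)" for k
    using b N by (simp_all add: exp_of_nat_mult)
  have "real n * ln ?b \<le> real T * ln ?N" "real T * ln ?N \<le> (real n + 1) * ln ?b"
    unfolding l[symmetric] using n b by (simp_all add: mult_right_mono)
  moreover have "?b * ?b ^ n = ?b ^ Suc n" by simp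
  ultimately show "?b ^ n \<le> ?N ^ T" "?N ^ T \<le> ?b * ?b ^ n"
    by (simp_all only: e exp_le_cancel_iff of_nat_Suc add.commute)
qed

lemma base_digits_coordinate: "(\<And>k. x k \<in> digits m) \<Longrightarrow> base_digits (m r) (\<lambda>k. x k $ r)"
  by unfold_locales (use m in \<open>auto simp: digits_def\<close>)

lemma finite_digits: "finite (digits m)"
proof (rule inj_on_finite[of vec_nth])
  show "inj_on vec_nth (digits m)" by (simp add: inj_on_def vec_eq_iff)
  show "vec_nth ` digits m \<subseteq> PiE UNIV (\<lambda>r. {0..m r - 1})" by (auto simp: digits_def)
  show "finite (PiE UNIV (\<lambda>r. {0..m r - 1}))" by (intro finite_PiE) auto
qed

lemma dist_coding_map_le:
  assumes x: "\<And>k. x k \<in> digits m" and y: "\<And>k. y k \<in> digits m"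
    and eq: "\<And>r k. k < n r \<Longrightarrow> x k $ r = y k $ r"
  shows "dist (coding_map m x) (coding_map m y) \<le> (\<Sum>r\<in>UNIV. 1 / of_int (m r) ^ n r)"
proof -
  have X: "coding_map m x $ r = expansion (m r) (\<lambda>k. x k $ r)" for r
    using x by (intro coding_map_nth base_digits_coordinate)
  have Y: "coding_map m y $ r = expansion (m r) (\<lambda>k. y k $ r)" for r
    using y by (intro coding_map_nth base_digits_coordinate)
  have "dist (coding_map m x) (coding_map m y) \<le> (\<Sum>r\<in>UNIV. \<bar>(coding_map m x - coding_map m y) $ r\<bar>)"
    unfolding dist_norm by (rule norm_le_l1_cart)
  also have "\<dots> \<le> (\<Sum>r\<in>UNIV. 1 / of_int (m r) ^ n r)"
  proof (rule sum_mono)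
    fix r
    show "\<bar>(coding_map m x - coding_map m y) $ r\<bar> \<le> 1 / of_int (m r) ^ n r"
      unfolding vector_minus_component X Y
      by (rule expansion_diff_le) (auto intro: base_digits_coordinate x y eq)
  qed
  finally show ?thesis .
qed

lemma compact_coding_map_image:
  assumes X: "subshift (digits m) X"
  shows "compact (coding_map m ` X)"
proof (rule compact_image_subshift[OF X finite_digits])
  fix x :: "nat \<Rightarrow> int ^ 'n" and e :: real
  assume x: "x \<in> PiE UNIV (\<lambda>_. digits m)" and e: "0 < e"
  have "(\<lambda>n. \<Sum>r\<in>(UNIV::'n set). (1 / 2 :: real) ^ n) \<longlonglongrightarrow> (\<Sum>r\<in>(UNIV::'n set). 0)"
    by (intro tendsto_sum LIMSEQ_power_zero) simp
  then have "\<forall>\<^sub>F n in sequentially. (\<Sum>r\<in>(UNIV::'n set). (1 / 2 :: real) ^ n) < e"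
    using e by (intro order_tendstoD(2)) simp_all
  from eventually_happens'[OF sequentially_bot this]
  obtain n where n: "(\<Sum>r\<in>(UNIV::'n set). (1 / 2 :: real) ^ n) < e" by (rule exE)
  show "\<exists>n. \<forall>y\<in>PiE UNIV (\<lambda>_. digits m). (\<forall>k<n. y k = x k) \<longrightarrow> dist (coding_map m y) (coding_map m x) < e"
  proof (intro exI[of _ n] ballI impI)
    fix y assume y: "y \<in> PiE UNIV (\<lambda>_. digits m)" "\<forall>k<n. y k = x k"
    have "dist (coding_map m y) (coding_map m x) \<le> (\<Sum>r\<in>UNIV. 1 / of_int (m r) ^ n)"
      using x y by (intro dist_coding_map_le) auto
    also have "\<dots> \<le> (\<Sum>r\<in>(UNIV::'n set). (1 / 2) ^ n)"
    proof (rule sum_mono)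
      fix r
      have "(2::real) ^ n \<le> of_int (m r) ^ n" using m[of r] by (intro power_mono) auto
      then show "1 / real_of_int (m r) ^ n \<le> (1 / 2) ^ n"
        unfolding power_divide power_one using m[of r] by (intro divide_left_mono mult_pos_pos) auto
    qed
    finally show "dist (coding_map m y) (coding_map m x) < e" using n by simp
  qed
qed

text \<open>In the diameter bound, each coordinate contributes its factor \<open>m r\<close> from
  \<open>power_bounds\<close>; their sum is \<open>CR\<close>. For the covering bound, sequences
  coded into a set of diameter \<open>dl T\<close> have prefix codes within 2 of a fixed one in
  every coordinate, and equal prefix codes mean the same class.\<close>

lemma coding_geom_language:
  assumes X: "subshift (digits m) X" and W: "weak_specification X"
  obtains p where "coding_geom (digits m) (language X) p s proj lam (coding_map m) (of_int (vals ! (s - 1)))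
      (\<Sum>r\<in>UNIV. of_int (m r)) (5 ^ CARD('n))" "spec_lang.XL (language X) = X"
proof -
  let ?N = "real_of_int (vals ! (s - 1))" and ?C = "\<Sum>r\<in>UNIV. real_of_int (m r)"
  obtain p where sp: "spec_lang (digits m) (language X) p s proj"
    by (rule spec_lang_language[of "digits m" X s proj, OF X finite_digits W s_pos proj_0 proj_proj])
  interpret sp: spec_lang "digits m" "language X" p s proj by (rule sp)
  have XL: "sp.XL = X" by (rule sp.XL_language[OF X refl])
  have dig: "x k \<in> digits m" if "x \<in> sp.XL" for x k using that subshift_mem[OF X] by (simp add: XL)
  interpret c: coding "digits m" "language X" p s proj lam "coding_map m" ?N ?C "5 ^ CARD('n)"
  proof unfold_locales
    show "lam i < lam j" if "i < j" "j < s" for i j using lam_less that by blast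
    show "0 < lam 0" unfolding lam_def using s_pos by (intro divide_pos_pos ln_vals_pos) auto
    show "lam (s - 1) = 1" unfolding lam_def using ln_vals_pos[of "s - 1"] s_pos by simp
    show "1 < ?N" using vals_ge[of "s - 1"] s_pos by simp
    show "0 < ?C"
    proof (rule sum_pos)
      show "0 < real_of_int (m r)" for r using m[of r] by simp
    qed auto
    show "compact (coding_map m ` sp.XL)" unfolding XL by (rule compact_coding_map_image[OF X])
  qed
  \<comment> \<open>All levels up to \<open>lev r\<close> keep coordinate \<open>r\<close>. As
    \<open>Lv\<close> increases with the level, the condition at level \<open>lev r\<close> contains
    those at the lower levels.\<close>
  have eqv: "c.eqv T x y \<longleftrightarrow> (\<forall>r. \<forall>k<c.Lv (lev r) T. x k $ r = y k $ r)" for T x y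
  proof
    show "\<forall>r. \<forall>k<c.Lv (lev r) T. x k $ r = y k $ r" if e: "c.eqv T x y"
    proof (intro allI impI)
      fix r k assume "k < c.Lv (lev r) T"
      then have "proj (lev r) (x k) = proj (lev r) (y k)" using e lev(1) by (simp add: c.eqv_def)
      then have "proj (lev r) (x k) $ r = proj (lev r) (y k) $ r" by simp
      then show "x k $ r = y k $ r" by (simp add: proj_def)
    qed
    show "c.eqv T x y" if e: "\<forall>r. \<forall>k<c.Lv (lev r) T. x k $ r = y k $ r"
      unfolding c.eqv_def
    proof (intro allI impI)
      fix j k assume j: "j < s" and k: "k < c.Lv j T"
      have "x k $ r = y k $ r" if "\<not> lev r < j" for r
      proof -
        have "lam j \<le> lam (lev r)" using that lam_less[of j "lev r"] lev(1)[of r] by (cases "j = lev r") auto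
        then have "c.Lv j T \<le> c.Lv (lev r) T" unfolding c.Lv_def by (intro nat_mono floor_mono mult_right_mono) auto
        then show ?thesis using e k by auto
      qed
      then show "proj j (x k) = proj j (y k)" by (simp add: proj_def vec_eq_iff)
    qed
  qed
  have pw: "of_int (m r) ^ c.Lv (lev r) T \<le> ?N ^ T" "?N ^ T \<le> of_int (m r) * of_int (m r) ^ c.Lv (lev r) T" for r T
    using power_bounds[of "c.Lv (lev r) T" r T] by (simp_all add: c.Lv_def)
  have mpos: "0 < real_of_int (m r) ^ k" for r k using m[of r] by simp
  have Npos: "0 < ?N ^ k" for k using vals_ge[of "s - 1"] s_pos by simp
  have "coding_geom (digits m) (language X) p s proj lam (coding_map m) ?N ?C (5 ^ CARD('n))"
  proof unfold_locales
    fix x y T assume x: "x \<in> sp.XL" and y: "y \<in> sp.XL" and e: "c.eqv T x y"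
    have "dist (coding_map m x) (coding_map m y) \<le> (\<Sum>r\<in>UNIV. 1 / of_int (m r) ^ c.Lv (lev r) T)"
      using e unfolding eqv by (intro dist_coding_map_le dig x y) auto
    also have "\<dots> \<le> (\<Sum>r\<in>UNIV. of_int (m r) * (1 / ?N ^ T))"
    proof (rule sum_mono)
      fix r
      show "1 / real_of_int (m r) ^ c.Lv (lev r) T \<le> of_int (m r) * (1 / ?N ^ T)"
        using pw(2)[of T r] mpos[of r "c.Lv (lev r) T"] Npos[of T] by (simp add: divide_le_eq le_divide_eq mult.commute)
    qed
    finally show "dist (coding_map m x) (coding_map m y) \<le> ?C * c.dl T"
      by (simp only: c.dl_def sum_distrib_right)
  next
    fix U :: "(real ^ 'n) set" and T assume U: "bounded U" "diameter U \<le> c.dl T"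
    define E where "E = {x \<in> sp.XL. coding_map m x \<in> U}"
    define f where "f x = (\<lambda>r. prefix_code (m r) (\<lambda>k. x k $ r) (c.Lv (lev r) T))" for x :: "nat \<Rightarrow> int ^ 'n"
    have "finite (f ` E) \<and> card (f ` E) \<le> 5 ^ CARD('n)"
    proof (cases "E = {}")
      case False
      then obtain z where z: "z \<in> E" by blast
      let ?V = "PiE UNIV (\<lambda>r. {f z r - 2..f z r + 2})"
      have "f ` E \<subseteq> ?V"
      proof (rule image_subsetI)
        fix x assume x: "x \<in> E"
        have "\<bar>f x r - f z r\<bar> \<le> 2" for r
          unfolding f_def
        proof (rule prefix_code_diff_le)
          show bx: "base_digits (m r) (\<lambda>k. x k $ r)" using x by (intro base_digits_coordinate dig) (simp add: E_def)
          show bz: "base_digits (m r) (\<lambda>k. z k $ r)" using z by (intro base_digits_coordinate dig) (simp add: E_def)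
          have "\<bar>expansion (m r) (\<lambda>k. x k $ r) - expansion (m r) (\<lambda>k. z k $ r)\<bar> = \<bar>(coding_map m x - coding_map m z) $ r\<bar>"
          proof -
            have "coding_map m x $ r = expansion (m r) (\<lambda>k. x k $ r)" using x by (intro coding_map_nth base_digits_coordinate dig) (simp add: E_def)
            moreover have "coding_map m z $ r = expansion (m r) (\<lambda>k. z k $ r)" using z by (intro coding_map_nth base_digits_coordinate dig) (simp add: E_def)
            ultimately show ?thesis by simp
          qed
          also have "\<dots> \<le> dist (coding_map m x) (coding_map m z)" unfolding dist_norm by (rule component_le_norm_cart)
          also have "\<dots> \<le> diameter U" using x z by (intro diameter_bounded_bound U) (auto simp: E_def)
          also have "\<dots> \<le> 1 / ?N ^ T" using U(2) unfolding c.dl_def .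
          also have "\<dots> \<le> 1 / of_int (m r) ^ c.Lv (lev r) T"
            using pw(1)[of r T] mpos[of r "c.Lv (lev r) T"] Npos[of T] by (intro divide_left_mono) auto
          finally show "real_of_int (m r) ^ c.Lv (lev r) T * \<bar>expansion (m r) (\<lambda>k. x k $ r) - expansion (m r) (\<lambda>k. z k $ r)\<bar> \<le> 1"
            using mpos[of r "c.Lv (lev r) T"] by (simp add: le_divide_eq mult.commute)
        qed
        then have "f z r - 2 \<le> f x r" "f x r \<le> f z r + 2" for r by (smt (verit))+
        then show "f x \<in> ?V" by (simp add: PiE_iff)
      qed
      moreover have "finite ?V" by (intro finite_PiE) auto
      moreover have "card ?V = 5 ^ CARD('n)" by (simp add: card_PiE)
      ultimately show ?thesis using card_mono[of ?V "f ` E"] finite_subset[of "f ` E" ?V] by simp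
    qed simp
    then obtain Y where Y: "Y \<subseteq> E" "finite Y" "card Y \<le> 5 ^ CARD('n)" "\<And>x. x \<in> E \<Longrightarrow> \<exists>y\<in>Y. f y = f x"
      using choose_representatives[of f E] by metis
    have "\<exists>y\<in>Y. c.eqv T x y" if x: "x \<in> E" for x
    proof -
      obtain y where y: "y \<in> Y" "f y = f x" using Y(4)[OF x] by blast
      have yE: "y \<in> E" by (rule subsetD[OF Y(1) y(1)])
      have "x k $ r = y k $ r" if "k < c.Lv (lev r) T" for k r
      proof (rule prefix_code_inj[of "m r" "\<lambda>k. x k $ r" "\<lambda>k. y k $ r", OF _ _ _ that])
        show "base_digits (m r) (\<lambda>k. x k $ r)" using x by (intro base_digits_coordinate dig) (simp add: E_def)
        show "base_digits (m r) (\<lambda>k. y k $ r)" using yE by (intro base_digits_coordinate dig) (simp add: E_def)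
        show "prefix_code (m r) (\<lambda>k. x k $ r) (c.Lv (lev r) T) = prefix_code (m r) (\<lambda>k. y k $ r) (c.Lv (lev r) T)"
          using fun_cong[OF y(2), of r] by (simp add: f_def)
      qed
      then show ?thesis using y(1) eqv by blast
    qed
    then show "\<exists>Y. finite Y \<and> card Y \<le> 5 ^ CARD('n) \<and> Y \<subseteq> {x \<in> sp.XL. coding_map m x \<in> U} \<and>
      (\<forall>x\<in>sp.XL. coding_map m x \<in> U \<longrightarrow> (\<exists>y\<in>Y. c.eqv T x y))"
      using Y(1-3) unfolding E_def by (intro exI[of _ Y] conjI ballI impI) auto
  qed
  then show ?thesis using that XL by blast
qed

end

theorem theorem1p1:
  fixes m :: "'n::{finite,linorder} \<Rightarrow> int"
    and X :: "(nat \<Rightarrow> int ^ 'n::{finite,linorder}) set"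
    and K :: "(real ^ 'n::{finite,linorder}) set"
    and \<gamma> :: real
  assumes "antimono m"
    and "\<forall>r. 2 \<le> m r"
    and "\<exists>r s. m r \<noteq> m s"
    and "subshift (digits m) X"
    and "weak_specification X"
    and "K = coding_map m ` X"
    and "\<gamma> = hausdorff_dim K"
  shows "(hausdorff_dim K = box_dim K \<longleftrightarrow> 0 < hausdorff_measure \<gamma> K \<and> hausdorff_measure \<gamma> K < \<infinity>) \<and>
         (hausdorff_dim K < box_dim K \<longleftrightarrow> hausdorff_measure \<gamma> K = \<infinity>) \<and>
         (hausdorff_dim K < box_dim K \<longrightarrow> \<not> hausdorff_sigma_finite_on \<gamma> K)"
proof -
  interpret diagonal m by unfold_locales (use assms(2) in blast)
  obtain p where p: "coding_geom (digits m) (language X) p s proj lam (coding_map m) (of_int (vals ! (s - 1)))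
      (\<Sum>r\<in>UNIV. of_int (m r)) (5 ^ CARD('n))" "spec_lang.XL (language X) = X"
    by (rule coding_geom_language[OF assms(4,5)])
  note dich = coding_geom.dichotomy[OF p(1), unfolded p(2), folded assms(6), folded assms(7)]
  have sig: "\<exists>S :: nat \<Rightarrow> (real ^ 'n::{finite,linorder}) set. (\<forall>i. hausdorff_measure \<gamma> (S i) < \<infinity>) \<and> K \<subseteq> (\<Union>i. S i)"
    if sf: "hausdorff_sigma_finite_on \<gamma> K"
  proof -
    from sf obtain S :: "nat \<Rightarrow> (real ^ 'n::{finite,linorder}) set" where
      "(\<forall>i. S i \<in> lambda_system UNIV UNIV (hausdorff_measure \<gamma>) \<and> hausdorff_measure \<gamma> (S i) < \<infinity>) \<and> K = (\<Union>i. S i)"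
      unfolding hausdorff_sigma_finite_on_def by (rule exE)
    then show ?thesis by (intro exI[of _ S]) simp
  qed
  \<comment> \<open>The two alternatives exclude each other, in the dimensions as well as in the
    measure, so the disjunction yields both equivalences.\<close>
  from dich show ?thesis
  proof (elim disjE conjE)
    assume "\<gamma> = box_dim K" "0 < hausdorff_measure \<gamma> K" "hausdorff_measure \<gamma> K < \<infinity>"
    then show ?thesis unfolding assms(7)[symmetric] by simp
  next
    assume lt: "\<gamma> < box_dim K" "hausdorff_measure \<gamma> K = \<infinity>"
      and n: "\<not> (\<exists>S :: nat \<Rightarrow> (real ^ 'n::{finite,linorder}) set. (\<forall>i. hausdorff_measure \<gamma> (S i) < \<infinity>) \<and> K \<subseteq> (\<Union>i. S i))"
    have "\<not> hausdorff_sigma_finite_on \<gamma> K" using n by (rule contrapos_nn) (rule sig)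
    then show ?thesis using lt unfolding assms(7)[symmetric] by simp
  qed
qed

end
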